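(* Let $p_X,p_{\hat X}$ be distributions on $\mathcal X$ and $\Delta$ a distortion measure, and let $R,R_c\ge 0$. (i) If $(p_X,p_{\hat X},\Delta)$ is uniformly integrable, then $$D(R,R_c|p_X,p_{\hat X})=\inf_{p_{XU\hat X}\in\Omega(p_X,p_{\hat X})}\mathbb E[\Delta(X,\hat X)]\quad\text{subject to}\quad I(X;U)\le R,\ \ I(\hat X;U)\le R+R_c .$$ (ii) If $\mathcal X=\mathbb R$, $\mathbb E[X^2]<\infty$, $\mathbb E[\hat X^2]<\infty$ (where $X\sim p_X$, $\hat X\sim p_{\hat X}$) and $\Delta(x,\hat x)=(x-\hat x)^2$, then $$D(R,R_c|p_X,p_{\hat X})=\inf_{p_{Y|X},\,p_{\hat Y|\hat X}}\Big(\mathbb E[(X-Y)^2]+\mathbb E[(\hat X-\hat Y)^2]+W_2^2(p_Y,p_{\hat Y})\Big)$$ where the infimum is over real-valued $Y$ jointly distributed with $X$ and real-valued $\hat Y$ jointly distributed with $\hat X$ subject to $\mathbb E[X|Y]=Y$ a.s., $\mathbb E[\hat X|\hat Y]=\hat Y$ a.s., $I(X;Y)\le R$, and $I(Y;\hat Y)\le R+R_c$ (here $p_Y$, $p_{\hat Y}$ denote the marginal laws of $Y$ and $\hat Y$).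
   Context: All logarithms are natural. Let $\mathcal X$ be an alphabet (a measurable space; $\mathcal X=\mathbb R$ in the squared-error case), $p_X$ a source distribution on $\mathcal X$, and $\Delta:\mathcal X\times\mathcal X\to[0,\infty)$ a measurable distortion measure. For a block length $n\ge1$, a code consists of finite sets $\mathcal J,\mathcal K$, a random seed $K$ uniform on $\mathcal K$ and independent of the source sequence $X^n=(X_1,\dots,X_n)$ (i.i.d. with marginal $p_X$), a stochastic encoder given by a conditional distribution $p_{J|X^nK}$ producing $J\in\mathcal J$, and a stochastic decoder given by a conditional distribution $p_{\hat X^n|JK}$ producing $\hat X^n=(\hat X_1,\dots,\hat X_n)\in\mathcal X^n$; the joint law is $p_{X^n}p_Kp_{J|X^nK}p_{\hat X^n|JK}$. For $R,R_c\ge0$ and a distribution $p_{\hat X}$ on $\mathcal X$, a distortion level $D$ is achievable with respect to $p_{\hat X}$ subject to rate constraints $(R,R_c)$ if for some $n$ there is such a code with $\frac1n\log|\mathcal J|\le R$, $\frac1n\log|\mathcal K|\le R_c$, $\frac1n\sum_{t=1}^n\mathbb E[\Delta(X_t,\hat X_t)]\le D$, and $\hat X_1,\dots,\hat X_n$ i.i.d. with marginal $p_{\hat X}$. $D(R,R_c|p_X,p_{\hat X})$ denotes the infimum of such achievable $D$. $(p_X,p_{\hat X},\Delta)$ is uniformly integrable if for every $\epsilon>0$ there is $\delta>0$ such that $\mathbb E[\Delta(X,\hat X)1_{\mathcal E}(X,\hat X)]\le\epsilon$ for every coupling $p_{X\hat X}$ of $p_X$ and $p_{\hat X}$ and every measurable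 event $\mathcal E$ with $\mathbb P\{(X,\hat X)\in\mathcal E\}\le\delta$. $\Omega(p_X,p_{\hat X})$ is the set of joint distributions $p_{XU\hat X}$ (with $U$ taking values in an arbitrary alphabet) whose $X$- and $\hat X$-marginals are $p_X$ and $p_{\hat X}$ and such that $X\leftrightarrow U\leftrightarrow\hat X$ is a Markov chain. $W_2^2(p,q):=\inf_{\pi\in\Pi(p,q)}\mathbb E_\pi[(A-B)^2]$, the squared quadratic Wasserstein distance, where $\Pi(p,q)$ is the set of couplings of $p$ and $q$ on $\mathbb R^2$.
   Formalization: In (ii) the constraint I(Y;Ŷ) ≤ R+R_c, undefined because Y and Ŷ have no joint law, is replaced by I(X̂;Ŷ) ≤ R+R_c; in (i) U takes values in measurable spaces on an arbitrary fixed infinite set, which loses nothing. *)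

theory Defs
  imports "HOL-Probability.Probability"
begin

(* Conventions.  The alphabet is a measurable space M on a type 'a; distributions on the
   alphabet are probability measures with the sigma-algebra of M.  Blocks x^n are functions
   nat => 'a living in PiM {..<n} (\<lambda>_. M).  A code has J = {..<m}, K = {..<kk}
   (any finite sets can be relabelled like this).  Expectations of nonnegative quantities are
   nonnegative Lebesgue integrals (values in ennreal, possibly infinite). *)

(* Stochastic encoder: e x k j = P(J = j | X^n = x, K = k) (measurable in x);
   stochastic decoder: dec j k = law of \<hat>X^n given J = j, K = k. *)
definition valid_code ::
  "'a measure \<Rightarrow> nat \<Rightarrow> nat \<Rightarrow> nat \<Rightarrow> ((nat \<Rightarrow> 'a) \<Rightarrow> nat \<Rightarrow> nat \<Rightarrow> real)
    \<Rightarrow> (nat \<Rightarrow> nat \<Rightarrow> (nat \<Rightarrow> 'a) measure) \<Rightarrow> bool" where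
  "valid_code M n m kk e dec \<longleftrightarrow>
     1 \<le> n \<and> 0 < kk \<and>
     (\<forall>k<kk. \<forall>j<m. (\<lambda>x. e x k j) \<in> borel_measurable (PiM {..<n} (\<lambda>_. M))) \<and>
     (\<forall>x\<in>space (PiM {..<n} (\<lambda>_. M)). \<forall>k<kk.
         (\<forall>j<m. 0 \<le> e x k j) \<and> (\<Sum>j<m. e x k j) = 1) \<and>
     (\<forall>j<m. \<forall>k<kk. prob_space (dec j k) \<and> sets (dec j k) = sets (PiM {..<n} (\<lambda>_. M)))"

(* E[\<Delta>(X_t, \<hat>X_t)] under the joint law p_{X^n} p_K p_{J|X^n K} p_{\<hat>X^n|JK} *)
definition code_distortion ::
  "'a measure \<Rightarrow> ('a \<Rightarrow> 'a \<Rightarrow> real) \<Rightarrow> nat \<Rightarrow> nat \<Rightarrow> nat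
    \<Rightarrow> ((nat \<Rightarrow> 'a) \<Rightarrow> nat \<Rightarrow> nat \<Rightarrow> real) \<Rightarrow> (nat \<Rightarrow> nat \<Rightarrow> (nat \<Rightarrow> 'a) measure) \<Rightarrow> nat \<Rightarrow> ennreal" where
  "code_distortion pX \<Delta> n m kk e dec t =
     (\<Sum>k<kk. \<integral>\<^sup>+ x. (\<Sum>j<m. ennreal (e x k j) *
                 (\<integral>\<^sup>+ y. ennreal (\<Delta> (x t) (y t)) \<partial>(dec j k))) \<partial>(PiM {..<n} (\<lambda>_. pX)))
       / of_nat kk"

definition code_output_prob ::
  "'a measure \<Rightarrow> nat \<Rightarrow> nat \<Rightarrow> nat \<Rightarrow> ((nat \<Rightarrow> 'a) \<Rightarrow> nat \<Rightarrow> nat \<Rightarrow> real)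
    \<Rightarrow> (nat \<Rightarrow> nat \<Rightarrow> (nat \<Rightarrow> 'a) measure) \<Rightarrow> (nat \<Rightarrow> 'a) set \<Rightarrow> ennreal" where
  "code_output_prob pX n m kk e dec A =
     (\<Sum>k<kk. \<Sum>j<m. (\<integral>\<^sup>+ x. ennreal (e x k j) \<partial>(PiM {..<n} (\<lambda>_. pX))) * emeasure (dec j k) A)
       / of_nat kk"

definition achievable ::
  "'a measure \<Rightarrow> 'a measure \<Rightarrow> 'a measure \<Rightarrow> ('a \<Rightarrow> 'a \<Rightarrow> real) \<Rightarrow> real \<Rightarrow> real \<Rightarrow> real \<Rightarrow> bool" where
  "achievable M pX pXh \<Delta> R Rc D \<longleftrightarrow>
     (\<exists>n m kk e dec. valid_code M n m kk e dec \<and>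
        ln (real m) / real n \<le> R \<and> ln (real kk) / real n \<le> Rc \<and>
        enn2ereal ((\<Sum>t<n. code_distortion pX \<Delta> n m kk e dec t) / of_nat n) \<le> ereal D \<and>
        (\<forall>A\<in>sets (PiM {..<n} (\<lambda>_. M)).
            code_output_prob pX n m kk e dec A = emeasure (PiM {..<n} (\<lambda>_. pXh)) A))"

(* D(R, R_c | p_X, p_Xhat) ; infimum of the empty set is \<infinity> *)
definition opt_distortion ::
  "'a measure \<Rightarrow> 'a measure \<Rightarrow> 'a measure \<Rightarrow> ('a \<Rightarrow> 'a \<Rightarrow> real) \<Rightarrow> real \<Rightarrow> real \<Rightarrow> ereal" where
  "opt_distortion M pX pXh \<Delta> R Rc = Inf (ereal ` {D. achievable M pX pXh \<Delta> R Rc D})"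

definition coupling :: "'a measure \<Rightarrow> 'a measure \<Rightarrow> 'b measure \<Rightarrow> 'b measure \<Rightarrow> ('a \<times> 'b) measure \<Rightarrow> bool" where
  "coupling S p T q \<pi> \<longleftrightarrow> prob_space \<pi> \<and> sets \<pi> = sets (S \<Otimes>\<^sub>M T) \<and>
     distr \<pi> S fst = p \<and> distr \<pi> T snd = q"

definition unif_integrable ::
  "'a measure \<Rightarrow> 'a measure \<Rightarrow> 'a measure \<Rightarrow> ('a \<Rightarrow> 'a \<Rightarrow> real) \<Rightarrow> bool" where
  "unif_integrable M pX pXh \<Delta> \<longleftrightarrow>
     (\<forall>\<epsilon>>0. \<exists>\<delta>>0. \<forall>\<pi> E. coupling M pX M pXh \<pi> \<and> E \<in> sets \<pi> \<and> measure \<pi> E \<le> \<delta> \<longrightarrow>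
        (\<integral>\<^sup>+ z. ennreal (indicator E z * \<Delta> (fst z) (snd z)) \<partial>\<pi>) \<le> ennreal \<epsilon>)"

definition KL_div :: "'a measure \<Rightarrow> 'a measure \<Rightarrow> ennreal" where
  "KL_div P Q =
     (if absolutely_continuous Q P \<and> integrable P (\<lambda>x. ln (enn2real (RN_deriv Q P x)))
      then ennreal (\<integral>x. ln (enn2real (RN_deriv Q P x)) \<partial>P) else \<infinity>)"

definition mutual_info :: "'a measure \<Rightarrow> 'b measure \<Rightarrow> ('a \<times> 'b) measure \<Rightarrow> ennreal" where
  "mutual_info S T P = KL_div P (distr P S fst \<Otimes>\<^sub>M distr P T snd)"

definition markov_chain :: "'a measure \<Rightarrow> 'u measure \<Rightarrow> 'a measure \<Rightarrow> ('a \<times> 'u \<times> 'a) measure \<Rightarrow> bool" where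
  "markov_chain M SU N P \<longleftrightarrow>
     (let F = vimage_algebra (space P) (\<lambda>z. fst (snd z)) SU in
      \<forall>A\<in>sets M. \<forall>B\<in>sets N. AE z in P.
        real_cond_exp P F (\<lambda>z. indicator A (fst z) * indicator B (snd (snd z))) z =
        real_cond_exp P F (\<lambda>z. indicator A (fst z)) z * real_cond_exp P F (\<lambda>z. indicator B (snd (snd z))) z)"

definition Omega :: "'a measure \<Rightarrow> 'u measure \<Rightarrow> 'a measure \<Rightarrow> 'a measure \<Rightarrow> ('a \<times> 'u \<times> 'a) measure set" where
  "Omega M SU pX pXh = {P. prob_space P \<and> sets P = sets (M \<Otimes>\<^sub>M (SU \<Otimes>\<^sub>M M)) \<and>
      distr P M fst = pX \<and> distr P M (\<lambda>z. snd (snd z)) = pXh \<and> markov_chain M SU M P}"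

definition W2sq :: "real measure \<Rightarrow> real measure \<Rightarrow> ennreal" where
  "W2sq p q = Inf {\<integral>\<^sup>+ z. ennreal ((fst z - snd z)\<^sup>2) \<partial>\<pi> | \<pi>. coupling borel p borel q \<pi>}"

definition cond_mean_eq :: "(real \<times> real) measure \<Rightarrow> bool" where
  "cond_mean_eq P \<longleftrightarrow> integrable P fst \<and>
     (AE z in P. real_cond_exp P (vimage_algebra (space P) snd borel) fst z = snd z)"

end

theory Submission
  imports Defs
begin

text \<open>Both parts reduce to one statement about densities. A Markov chain \<open>X - U - Y\<close> with finite
  mutual informations is described by the law \<open>\<nu>\<close> of \<open>U\<close> and densities \<open>f\<close>, \<open>g\<close> of \<open>(X, U)\<close> and
  \<open>(Y, U)\<close> with respect to the products of their marginals.

  Achievability is by random coding. If the codewords are drawn from \<open>\<nu>\<^sup>n\<close>, then by soft covering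
  the posterior of the index given \<open>X\<^sup>n\<close> and the seed is an encoder whose joint law is close in total
  variation to the ideal one, and the decoder \<open>g\<^sup>n\<close> has output close to \<open>q\<^sup>n\<close>. Moving the excess
  mass of the output makes it exactly \<open>q\<^sup>n\<close>; uniform integrability makes the cost of the correction
  vanish. Rates that are attained with equality are reached by replacing \<open>f\<close>, \<open>g\<close> with
  \<open>(1 - s) f + s\<close>, \<open>(1 - s) g + s\<close> and letting \<open>s\<close> tend to 0.

  Conversely, a code yields \<open>U = (J, K, T)\<close> with a uniform time index \<open>T\<close>, a finite alphabet and bounded
  densities, and the information bounds follow from \<open>ln x \<le> x - 1\<close>.

  For squared error, \<open>Y = E[X | U]\<close> and \<open>Y' = E[X' | U]\<close> split the distortion orthogonally; in the other
  direction \<open>U = (Y, Y')\<close> is a coupling of the two estimators.\<close>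

section \<open>Sample means\<close>

text \<open>The output must be exactly i.i.d., whereas soft covering only gives closeness. Moving
  even a small mass can be expensive under an unbounded \<open>\<Delta>\<close>, and uniform
  integrability speaks of couplings only. So the distortion is first truncated at a level
  \<open>N\<close> that serves all couplings at once; the code is built and corrected for the
  truncated cost, where misplaced mass costs at most \<open>N\<close> per unit; and once the output
  is exact, the pair of letters at each time is a coupling, to which the truncation bound applies.
  The two rates come from averaging over different parts of one codebook \<open>b (j, k)\<close>:
  over \<open>j\<close> with the seed fixed for the source, over all pairs for the output. In the
  converse the same split is the entropy of \<open>J\<close> given \<open>K\<close> against the
  joint entropy. Mixing with the density 1 makes the rates strict only for \<open>R > 0\<close>; at
  \<open>R = 0\<close> the source is independent of \<open>U\<close> and a trivial code suffices.
  The type of \<open>U\<close> is infinite since the alphabet \<open>(J, K, T)\<close> of a code can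
  have any finite size.\<close>

lemma nn_integral_PiM_component:
  assumes "prob_space \<nu>" "i \<in> I" "f \<in> borel_measurable \<nu>"
  shows "(\<integral>\<^sup>+c. f (c i) \<partial>PiM I (\<lambda>_. \<nu>)) = (\<integral>\<^sup>+v. f v \<partial>\<nu>)"
proof -
  have "(\<integral>\<^sup>+v. f v \<partial>\<nu>) = (\<integral>\<^sup>+v. f v \<partial>distr (PiM I (\<lambda>_. \<nu>)) \<nu> (\<lambda>c. c i))"
    using distr_PiM_component[of I "\<lambda>_. \<nu>" i] assms by simp
  then show ?thesis using assms by (simp add: nn_integral_distr)
qed

lemma integrable_PiM_component:
  fixes f :: "'v \<Rightarrow> real"
  assumes "prob_space \<nu>" "i \<in> I" "integrable \<nu> f"
  shows "integrable (PiM I (\<lambda>_. \<nu>)) (\<lambda>c. f (c i))"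
proof -
  have "integrable (distr (PiM I (\<lambda>_. \<nu>)) \<nu> (\<lambda>c. c i)) f"
    using distr_PiM_component[of I "\<lambda>_. \<nu>" i] assms by simp
  then show ?thesis
    using assms by (subst (asm) integrable_distr_eq) auto
qed

lemma integral_PiM_component:
  fixes f :: "'v \<Rightarrow> real"
  assumes "prob_space \<nu>" "i \<in> I" "f \<in> borel_measurable \<nu>"
  shows "(\<integral>c. f (c i) \<partial>PiM I (\<lambda>_. \<nu>)) = (\<integral>v. f v \<partial>\<nu>)"
proof -
  have "(\<integral>v. f v \<partial>\<nu>) = (\<integral>v. f v \<partial>distr (PiM I (\<lambda>_. \<nu>)) \<nu> (\<lambda>c. c i))"
    using distr_PiM_component[of I "\<lambda>_. \<nu>" i] assms by simp
  then show ?thesis using assms by (simp add: integral_distr)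
qed

lemma integral_PiM_two_components:
  fixes k :: "'v \<Rightarrow> real"
  assumes \<nu>: "prob_space \<nu>" and I: "finite I" "i \<in> I" "j \<in> I" "i \<noteq> j" and k: "integrable \<nu> k"
  shows "(\<integral>c. k (c i) * k (c j) \<partial>PiM I (\<lambda>_. \<nu>)) = (\<integral>v. k v \<partial>\<nu>)\<^sup>2"
proof -
  interpret prob_space \<nu> by fact
  interpret product_sigma_finite "\<lambda>_. \<nu>" by standard
  \<comment> \<open>The factor 1 at all other coordinates turns the two-point product into a product
    over \<open>I\<close>, where independence applies.\<close>
  define f where "f l = (if l = i \<or> l = j then k else (\<lambda>_. 1))" for l
  have "(\<integral>c. (\<Prod>l\<in>I. f l (c l)) \<partial>PiM I (\<lambda>_. \<nu>)) = (\<Prod>l\<in>I. \<integral>v. f l v \<partial>\<nu>)"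
    using I k by (intro product_integral_prod) (auto simp: f_def)
  moreover have "(\<Prod>l\<in>I. f l (c l)) = k (c i) * k (c j)" for c
  proof -
    have "(\<Prod>l\<in>I. f l (c l)) = (\<Prod>l\<in>{i,j}. f l (c l))"
      using I by (intro prod.mono_neutral_right) (auto simp: f_def)
    then show ?thesis using I by (simp add: f_def)
  qed
  moreover have "(\<Prod>l\<in>I. \<integral>v. f l v \<partial>\<nu>) = (\<Prod>l\<in>{i,j}. \<integral>v. f l v \<partial>\<nu>)"
    using I by (intro prod.mono_neutral_right) (auto simp: f_def prob_space)
  ultimately show ?thesis using I by (simp add: f_def power2_eq_square)
qed

text \<open>Centring makes the off-diagonal products integrate to zero; the \<open>card J\<close>
  diagonal terms are variances, hence at most second moments. \<open>J\<close> may be smaller than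
  \<open>I\<close> because later one column of a codebook is averaged under the law of the whole
  codebook.\<close>

lemma sample_mean_L2:
  fixes h :: "'v \<Rightarrow> real"
  assumes \<nu>: "prob_space \<nu>" and I: "finite I" "J \<subseteq> I"
    and h[measurable]: "h \<in> borel_measurable \<nu>" and B: "\<And>v. \<bar>h v\<bar> \<le> B"
  shows "(\<integral>c. (\<Sum>i\<in>J. h (c i) - (\<integral>v. h v \<partial>\<nu>))\<^sup>2 \<partial>PiM I (\<lambda>_. \<nu>)) \<le> card J * (\<integral>v. (h v)\<^sup>2 \<partial>\<nu>)"
proof -
  interpret prob_space \<nu> by fact
  interpret P: prob_space "PiM I (\<lambda>_. \<nu>)" by (intro prob_space_PiM \<nu>)
  define \<mu> where "\<mu> = (\<integral>v. h v \<partial>\<nu>)"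
  define k where "k v = h v - \<mu>" for v
  have k[measurable]: "k \<in> borel_measurable \<nu>" unfolding k_def by measurable
  have kB: "\<bar>k v\<bar> \<le> B + \<bar>\<mu>\<bar>" for v using B[of v] unfolding k_def by linarith
  have hi: "integrable \<nu> h" by (rule integrable_const_bound[of _ B]) (use B in auto)
  have h2i: "integrable \<nu> (\<lambda>v. (h v)\<^sup>2)"
    by (rule integrable_const_bound[of _ "B\<^sup>2"]) (use order.trans[OF B abs_ge_self] in \<open>auto simp: abs_le_square_iff[symmetric]\<close>)
  have ki: "integrable \<nu> k" unfolding k_def using hi by simp
  have k0: "(\<integral>v. k v \<partial>\<nu>) = 0" unfolding k_def using hi by (simp add: \<mu>_def prob_space)
  have k2: "(\<integral>v. (k v)\<^sup>2 \<partial>\<nu>) \<le> (\<integral>v. (h v)\<^sup>2 \<partial>\<nu>)"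
    using variance_eq[OF hi h2i] by (simp add: k_def \<mu>_def)
  have JI: "i \<in> I" if "i \<in> J" for i using that I by auto
  have kki: "integrable (PiM I (\<lambda>_. \<nu>)) (\<lambda>c. k (c i) * k (c j))" if "i \<in> J" "j \<in> J" for i j
  proof (rule P.integrable_const_bound[of _ "(B + \<bar>\<mu>\<bar>) * (B + \<bar>\<mu>\<bar>)"])
    show "AE c in PiM I (\<lambda>_. \<nu>). norm (k (c i) * k (c j)) \<le> (B + \<bar>\<mu>\<bar>) * (B + \<bar>\<mu>\<bar>)"
      using kB by (intro AE_I2) (simp add: abs_mult mult_mono' )
    show "(\<lambda>c. k (c i) * k (c j)) \<in> borel_measurable (PiM I (\<lambda>_. \<nu>))"
      using JI[OF that(1)] JI[OF that(2)] by measurable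
  qed
  have "(\<integral>c. (\<Sum>i\<in>J. k (c i))\<^sup>2 \<partial>PiM I (\<lambda>_. \<nu>)) = (\<Sum>i\<in>J. \<Sum>j\<in>J. \<integral>c. k (c i) * k (c j) \<partial>PiM I (\<lambda>_. \<nu>))"
    unfolding power2_eq_square sum_product using kki by (simp add: Bochner_Integration.integral_sum)
  also have "\<dots> = (\<Sum>i\<in>J. \<Sum>j\<in>J. if i = j then (\<integral>v. (k v)\<^sup>2 \<partial>\<nu>) else 0)"
  proof (intro sum.cong refl)
    fix i j assume "i \<in> J" "j \<in> J"
    then show "(\<integral>c. k (c i) * k (c j) \<partial>PiM I (\<lambda>_. \<nu>)) = (if i = j then (\<integral>v. (k v)\<^sup>2 \<partial>\<nu>) else 0)"
      using integral_PiM_two_components[OF \<nu> I(1) _ _ _ ki, of i j] I(2) k0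
        integral_PiM_component[OF \<nu>, of i I "\<lambda>v. (k v)\<^sup>2"]
      by (auto simp: power2_eq_square)
  qed
  also have "\<dots> = card J * (\<integral>v. (k v)\<^sup>2 \<partial>\<nu>)"
    using finite_subset[OF I(2,1)] by (simp add: sum.delta)
  also have "\<dots> \<le> card J * (\<integral>v. (h v)\<^sup>2 \<partial>\<nu>)" using k2 by (simp add: mult_left_mono)
  finally show ?thesis by (simp add: k_def \<mu>_def)
qed

text \<open>The variance of \<open>\<bar>X v\<bar>\<close> is nonnegative.\<close>

lemma (in prob_space) integral_abs_le_sqrt:
  fixes X :: "'a \<Rightarrow> real"
  assumes [measurable]: "X \<in> borel_measurable M" and B: "\<And>v. \<bar>X v\<bar> \<le> B"
  shows "(\<integral>v. \<bar>X v\<bar> \<partial>M) \<le> sqrt (\<integral>v. (X v)\<^sup>2 \<partial>M)"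
proof -
  have 1: "integrable M (\<lambda>v. \<bar>X v\<bar>)" by (rule integrable_const_bound[of _ B]) (use B in auto)
  have 2: "integrable M (\<lambda>v. \<bar>X v\<bar>\<^sup>2)"
    by (rule integrable_const_bound[of _ "B\<^sup>2"]) (use order.trans[OF B abs_ge_self] in \<open>auto simp: abs_le_square_iff[symmetric]\<close>)
  have "0 \<le> (\<integral>v. \<bar>X v\<bar>\<^sup>2 \<partial>M) - (\<integral>v. \<bar>X v\<bar> \<partial>M)\<^sup>2"
    using variance_positive[of "\<lambda>v. \<bar>X v\<bar>"] variance_eq[OF 1 2] by simp
  then show ?thesis by (intro real_le_rsqrt) simp
qed

text \<open>The bounded function \<open>h1\<close> stands in for \<open>h\<close>: its centred sum
  is controlled in mean square, while \<open>h - h1\<close> enters twice in mean, once through the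
  samples and once through the expectation.\<close>

lemma sample_mean_L1:
  fixes h h1 :: "'v \<Rightarrow> real" and I J :: "'i set"
  assumes \<nu>: "prob_space \<nu>" and I: "finite I" "J \<subseteq> I" "J \<noteq> {}"
    and h: "integrable \<nu> h" and h1[measurable]: "h1 \<in> borel_measurable \<nu>" and B: "\<And>v. \<bar>h1 v\<bar> \<le> B"
  shows "(\<integral>\<^sup>+c. ennreal \<bar>(\<Sum>i\<in>J. h (c i)) / card J - (\<integral>v. h v \<partial>\<nu>)\<bar> \<partial>PiM I (\<lambda>_. \<nu>))
    \<le> ennreal (sqrt ((\<integral>v. (h1 v)\<^sup>2 \<partial>\<nu>) / card J) + 2 * (\<integral>v. \<bar>h v - h1 v\<bar> \<partial>\<nu>))"
proof -
  interpret prob_space \<nu> by fact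
  interpret P: prob_space "PiM I (\<lambda>_. \<nu>)" by (intro prob_space_PiM \<nu>)
  let ?P = "PiM I (\<lambda>_. \<nu>)"
  have [measurable]: "h \<in> borel_measurable \<nu>" using h by simp
  have JI: "i \<in> I" if "i \<in> J" for i using that I by auto
  have J: "finite J" "card J > 0" using I finite_subset[OF I(2,1)] by (auto simp: card_gt_0_iff)
  define n where "n = real (card J)"
  have n: "n > 0" using J by (simp add: n_def)
  have h1i: "integrable \<nu> h1" by (rule integrable_const_bound[of _ B]) (use B in auto)
  define \<mu> \<mu>1 where "\<mu> = (\<integral>v. h v \<partial>\<nu>)" and "\<mu>1 = (\<integral>v. h1 v \<partial>\<nu>)"
  define d where "d = (\<integral>v. \<bar>h v - h1 v\<bar> \<partial>\<nu>)"
  have di: "integrable \<nu> (\<lambda>v. \<bar>h v - h1 v\<bar>)" using h h1i by simp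
  have \<mu>d: "\<bar>\<mu>1 - \<mu>\<bar> \<le> d"
    using integral_abs_bound[of \<nu> "\<lambda>v. h v - h1 v"] h h1i by (simp add: \<mu>_def \<mu>1_def d_def abs_minus_commute)
  define S where "S c = (\<Sum>i\<in>J. h1 (c i) - \<mu>1)" for c
  have S[measurable]: "S \<in> borel_measurable ?P" unfolding S_def using JI by measurable
  have SB: "\<bar>S c\<bar> \<le> n * (B + \<bar>\<mu>1\<bar>)" for c
  proof -
    have "\<bar>S c\<bar> \<le> (\<Sum>i\<in>J. \<bar>h1 (c i) - \<mu>1\<bar>)" unfolding S_def by (rule sum_abs)
    also have "\<dots> \<le> (\<Sum>i\<in>J. B + \<bar>\<mu>1\<bar>)"
    proof (rule sum_mono)
      fix i show "\<bar>h1 (c i) - \<mu>1\<bar> \<le> B + \<bar>\<mu>1\<bar>" using B[of "c i"] by linarith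
    qed
    finally show ?thesis by (simp add: n_def)
  qed
  have Si: "integrable ?P (\<lambda>c. \<bar>S c\<bar>)"
    by (rule P.integrable_const_bound[of _ "n * (B + \<bar>\<mu>1\<bar>)"]) (use SB in auto)
  have ES: "(\<integral>c. \<bar>S c\<bar> \<partial>?P) \<le> sqrt (n * (\<integral>v. (h1 v)\<^sup>2 \<partial>\<nu>))"
    using P.integral_abs_le_sqrt[OF S SB] sample_mean_L2[OF \<nu> I(1,2) h1 B]
    unfolding S_def n_def \<mu>1_def by (meson order_trans real_sqrt_le_mono)
  have ci: "integrable ?P (\<lambda>c. \<bar>h (c i) - h1 (c i)\<bar>)" if "i \<in> J" for i
    using integrable_PiM_component[OF \<nu> JI[OF that] di] by simp
  have cI: "(\<integral>c. \<bar>h (c i) - h1 (c i)\<bar> \<partial>?P) = d" if "i \<in> J" for i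
    using integral_PiM_component[OF \<nu> JI[OF that], of "\<lambda>v. \<bar>h v - h1 v\<bar>"] by (simp add: d_def)
  \<comment> \<open>Pointwise majorant: the fluctuation of \<open>h1\<close>, the sampled error of
    \<open>h - h1\<close>, and the constant \<open>d\<close> for the shift between the two
    means.\<close>
  define W where "W c = \<bar>S c\<bar> / n + (\<Sum>i\<in>J. \<bar>h (c i) - h1 (c i)\<bar>) / n + d" for c
  have Wi: "integrable ?P W" unfolding W_def
    by (intro Bochner_Integration.integrable_add integrable_divide Bochner_Integration.integrable_sum Si ci) auto
  have pt: "\<bar>(\<Sum>i\<in>J. h (c i)) / card J - \<mu>\<bar> \<le> W c" for c
  proof -
    have a: "(\<Sum>i\<in>J. h (c i)) / n - \<mu> = S c / n + (\<Sum>i\<in>J. h (c i) - h1 (c i)) / n + (\<mu>1 - \<mu>)"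
      using n by (simp add: S_def sum_subtractf n_def field_simps)
    have "\<bar>S c / n\<bar> = \<bar>S c\<bar> / n" "\<bar>(\<Sum>i\<in>J. h (c i) - h1 (c i)) / n\<bar> \<le> (\<Sum>i\<in>J. \<bar>h (c i) - h1 (c i)\<bar>) / n"
      using n sum_abs[of "\<lambda>i. h (c i) - h1 (c i)" J] by (auto simp: divide_right_mono)
    then show ?thesis using a \<mu>d unfolding W_def n_def[symmetric] by linarith
  qed
  have "(\<integral>\<^sup>+c. ennreal \<bar>(\<Sum>i\<in>J. h (c i)) / card J - \<mu>\<bar> \<partial>?P) \<le> (\<integral>\<^sup>+c. ennreal (W c) \<partial>?P)"
    by (intro nn_integral_mono ennreal_leI pt)
  also have "\<dots> = ennreal (\<integral>c. W c \<partial>?P)"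
    by (rule nn_integral_eq_integral[OF Wi]) (use pt in \<open>meson AE_I2 abs_ge_zero order_trans\<close>)
  also have "(\<integral>c. W c \<partial>?P) = (\<integral>c. \<bar>S c\<bar> \<partial>?P) / n + d + d"
    unfolding W_def using Si ci cI n
    by (simp add: Bochner_Integration.integral_sum P.prob_space) (simp add: n_def)
  also have "ennreal \<dots> \<le> ennreal (sqrt ((\<integral>v. (h1 v)\<^sup>2 \<partial>\<nu>) / n) + 2 * d)"
  proof (rule ennreal_leI)
    have "(\<integral>c. \<bar>S c\<bar> \<partial>?P) / n \<le> sqrt (n * (\<integral>v. (h1 v)\<^sup>2 \<partial>\<nu>)) / n"
      using ES n by (simp add: divide_right_mono)
    also have "\<dots> = sqrt ((\<integral>v. (h1 v)\<^sup>2 \<partial>\<nu>) / n)"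
      using n real_sqrt_mult_self[of n] by (auto simp: real_sqrt_mult real_sqrt_divide field_simps)
    finally show "(\<integral>c. \<bar>S c\<bar> \<partial>?P) / n + d + d \<le> sqrt ((\<integral>v. (h1 v)\<^sup>2 \<partial>\<nu>) / n) + 2 * d" by simp
  qed
  finally show ?thesis by (simp add: \<mu>_def d_def n_def)
qed


text \<open>The comparison function is \<open>h\<close> set to zero above \<open>\<tau>\<close>. As
  \<open>h\<close> has mean 1 and \<open>k\<^sup>2 \<le> \<tau> * h\<close>, its second moment is at
  most \<open>\<tau>\<close>, linear in the cut-off rather than quadratic; this is why a codebook
  much larger than \<open>\<tau>\<close> is good enough.\<close>

lemma sample_mean_nonneg_L1:
  fixes h :: "'v \<Rightarrow> real" and I J :: "'i set"
  assumes \<nu>: "prob_space \<nu>" and I: "finite I" "J \<subseteq> I" "J \<noteq> {}"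
    and h[measurable]: "h \<in> borel_measurable \<nu>" and h0: "\<And>v. 0 \<le> h v"
    and h1: "(\<integral>\<^sup>+v. ennreal (h v) \<partial>\<nu>) = 1" and \<tau>: "0 \<le> \<tau>"
  shows "(\<integral>\<^sup>+c. ennreal \<bar>1 - (\<Sum>i\<in>J. h (c i)) / card J\<bar> \<partial>PiM I (\<lambda>_. \<nu>))
    \<le> ennreal (sqrt (\<tau> / card J)) + 2 * (\<integral>\<^sup>+v. ennreal (h v * indicator {t. \<tau> < t} (h v)) \<partial>\<nu>)"
proof -
  interpret prob_space \<nu> by fact
  define k where "k v = (if h v \<le> \<tau> then h v else 0)" for v
  have k[measurable]: "k \<in> borel_measurable \<nu>" unfolding k_def by measurable
  have kB: "\<bar>k v\<bar> \<le> \<tau>" for v using h0 \<tau> by (simp add: k_def)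
  have hi: "integrable \<nu> h" using h1 h0 by (intro integrableI_nonneg) auto
  have hI: "(\<integral>v. h v \<partial>\<nu>) = 1" using h1 h0 by (simp add: integral_eq_nn_integral)
  have ki: "integrable \<nu> k" by (rule integrable_const_bound[of _ \<tau>]) (use kB in auto)
  have k2: "(\<integral>v. (k v)\<^sup>2 \<partial>\<nu>) \<le> \<tau>"
  proof -
    have "(\<integral>v. (k v)\<^sup>2 \<partial>\<nu>) \<le> (\<integral>v. \<tau> * h v \<partial>\<nu>)"
    proof (rule integral_mono')
      show "(k v)\<^sup>2 \<le> \<tau> * h v" for v using h0[of v] \<tau> by (auto simp: k_def power2_eq_square mult_right_mono)
    qed (use hi h0 \<tau> in auto)
    then show ?thesis using hI by simp
  qed
  have "(\<integral>\<^sup>+c. ennreal \<bar>(\<Sum>i\<in>J. h (c i)) / card J - 1\<bar> \<partial>PiM I (\<lambda>_. \<nu>))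
    \<le> ennreal (sqrt ((\<integral>v. (k v)\<^sup>2 \<partial>\<nu>) / card J) + 2 * (\<integral>v. \<bar>h v - k v\<bar> \<partial>\<nu>))"
    using sample_mean_L1[OF \<nu> I hi k kB] hI by simp
  also have "\<dots> \<le> ennreal (sqrt (\<tau> / card J) + 2 * (\<integral>v. \<bar>h v - k v\<bar> \<partial>\<nu>))"
    using k2 by (intro ennreal_leI add_right_mono real_sqrt_le_mono divide_right_mono) auto
  also have "\<dots> = ennreal (sqrt (\<tau> / card J)) + 2 * ennreal (\<integral>v. \<bar>h v - k v\<bar> \<partial>\<nu>)"
    using \<tau> by (simp add: ennreal_plus ennreal_mult)
  also have "ennreal (\<integral>v. \<bar>h v - k v\<bar> \<partial>\<nu>) = (\<integral>\<^sup>+v. ennreal \<bar>h v - k v\<bar> \<partial>\<nu>)"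
    by (rule nn_integral_eq_integral[symmetric]) (use hi ki in auto)
  also have "\<dots> = (\<integral>\<^sup>+v. ennreal (h v * indicator {t. \<tau> < t} (h v)) \<partial>\<nu>)"
    by (intro nn_integral_cong) (auto simp: k_def h0 indicator_def)
  finally show ?thesis by (simp add: abs_minus_commute)
qed

text \<open>The truncation level \<open>N\<close> is fixed first, so that \<open>h - k N\<close>
  costs at most \<open>\<epsilon> / 2\<close>; at this fixed level the mean-square part tends to
  zero with \<open>n\<close>.\<close>

lemma LLN_L1:
  fixes h :: "'v \<Rightarrow> real"
  assumes \<nu>: "prob_space \<nu>" and h: "integrable \<nu> h" and e: "0 < \<epsilon>"
  shows "\<forall>\<^sub>F n in sequentially. (\<integral>\<^sup>+c. ennreal \<bar>(\<Sum>i<n. h (c i)) / n - (\<integral>v. h v \<partial>\<nu>)\<bar> \<partial>PiM {..<n} (\<lambda>_. \<nu>)) \<le> ennreal \<epsilon>"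
proof -
  interpret prob_space \<nu> by fact
  have [measurable]: "h \<in> borel_measurable \<nu>" using h by simp
  define k where "k N v = (if \<bar>h v\<bar> \<le> real N then h v else 0)" for N v
  have k[measurable]: "k N \<in> borel_measurable \<nu>" for N unfolding k_def by measurable
  have kB: "\<bar>k N v\<bar> \<le> real N" for N v by (simp add: k_def)
  have "(\<lambda>N. \<integral>v. \<bar>h v - k N v\<bar> \<partial>\<nu>) \<longlonglongrightarrow> (\<integral>v. 0 \<partial>\<nu>)"
  proof (rule integral_dominated_convergence[where w="\<lambda>v. \<bar>h v\<bar>"])
    show "AE v in \<nu>. (\<lambda>N. \<bar>h v - k N v\<bar>) \<longlonglongrightarrow> 0"
    proof (rule AE_I2)
      fix v
      have "\<forall>\<^sub>F N in sequentially. \<bar>h v\<bar> \<le> real N"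
        by (rule eventually_sequentiallyI[of "nat \<lceil>\<bar>h v\<bar>\<rceil>"]) linarith
      then have "\<forall>\<^sub>F N in sequentially. \<bar>h v - k N v\<bar> = 0"
        by eventually_elim (simp add: k_def)
      then show "(\<lambda>N. \<bar>h v - k N v\<bar>) \<longlonglongrightarrow> 0" by (rule tendsto_eventually)
    qed
  qed (use h in \<open>auto simp: k_def\<close>)
  then have "\<forall>\<^sub>F N in sequentially. (\<integral>v. \<bar>h v - k N v\<bar> \<partial>\<nu>) < \<epsilon> / 4"
    using e by (intro order_tendstoD) auto
  then obtain N where N: "(\<integral>v. \<bar>h v - k N v\<bar> \<partial>\<nu>) < \<epsilon> / 4" by (auto simp: eventually_sequentially)
  define C where "C = (\<integral>v. (k N v)\<^sup>2 \<partial>\<nu>)"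
  have "(\<lambda>n. sqrt (C / real n)) \<longlonglongrightarrow> sqrt 0"
    by (intro tendsto_real_sqrt lim_const_over_n)
  then have "\<forall>\<^sub>F n in sequentially. sqrt (C / real n) < \<epsilon> / 2"
    using e by (intro order_tendstoD) auto
  then show ?thesis using eventually_gt_at_top[of 0]
  proof eventually_elim
    case (elim n)
    have "(\<integral>\<^sup>+c. ennreal \<bar>(\<Sum>i<n. h (c i)) / n - (\<integral>v. h v \<partial>\<nu>)\<bar> \<partial>PiM {..<n} (\<lambda>_. \<nu>))
      \<le> ennreal (sqrt (C / n) + 2 * (\<integral>v. \<bar>h v - k N v\<bar> \<partial>\<nu>))"
      using sample_mean_L1[OF \<nu> _ subset_refl _ h k kB, of "{..<n}" N] elim unfolding C_def by auto
    also have "\<dots> \<le> ennreal \<epsilon>" using elim N by (intro ennreal_leI) linarith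
    finally show ?case .
  qed
qed

section \<open>Soft covering with a random codebook\<close>

text \<open>The conditional law of a source letter given \<open>U = u\<close> is represented by its density \<open>f (_, u)\<close>
  with respect to the law of the letter; no regular conditional probabilities are needed, so the
  alphabets may be arbitrary measurable spaces.\<close>

definition channel :: "'a measure \<Rightarrow> 'u measure \<Rightarrow> ('a \<times> 'u \<Rightarrow> real) \<Rightarrow> bool" where
  "channel p \<nu> f \<longleftrightarrow> f \<in> borel_measurable (p \<Otimes>\<^sub>M \<nu>) \<and> (\<forall>z. 0 \<le> f z) \<and>
     (\<forall>u\<in>space \<nu>. (\<integral>\<^sup>+x. ennreal (f (x, u)) \<partial>p) = 1) \<and>
     (AE x in p. (\<integral>\<^sup>+u. ennreal (f (x, u)) \<partial>\<nu>) = 1)"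

lemma channelD:
  assumes "channel p \<nu> f"
  shows "f \<in> borel_measurable (p \<Otimes>\<^sub>M \<nu>)" "\<And>z. 0 \<le> f z"
    "\<And>u. u \<in> space \<nu> \<Longrightarrow> (\<integral>\<^sup>+x. ennreal (f (x, u)) \<partial>p) = 1"
    "AE x in p. (\<integral>\<^sup>+u. ennreal (f (x, u)) \<partial>\<nu>) = 1"
  using assms unfolding channel_def by auto

text \<open>\<open>F j k\<close> and \<open>G j k\<close> are the densities of source and output
  given the codeword \<open>(j, k)\<close>. \<open>A\<close> and \<open>B\<close> say how far a
  uniform index is from reproducing \<open>p\<close> for each seed and \<open>q\<close> overall. The
  encoder is the posterior of \<open>j\<close> under a uniform index; the decoder thins
  \<open>G\<close> where the output is too dense and puts the removed mass where output is missing.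
  \<open>N * A\<close> pays for the change of the joint law, \<open>N * (A + B)\<close> for the
  moved mass.\<close>

lemma fixed_codebook:
  fixes F :: "nat \<Rightarrow> nat \<Rightarrow> 'a \<Rightarrow> real" and G :: "nat \<Rightarrow> nat \<Rightarrow> 'b \<Rightarrow> real" and c :: "'a \<times> 'b \<Rightarrow> real"
  assumes p: "prob_space p" and q: "prob_space q" and m: "0 < m" and kk: "0 < kk"
    and F[measurable]: "\<And>j k. F j k \<in> borel_measurable p" and F0: "\<And>j k x. 0 \<le> F j k x"
    and F1: "\<And>j k. (\<integral>\<^sup>+x. ennreal (F j k x) \<partial>p) = 1"
    and G[measurable]: "\<And>j k. G j k \<in> borel_measurable q" and G0: "\<And>j k y. 0 \<le> G j k y"
    and G1: "\<And>j k. (\<integral>\<^sup>+y. ennreal (G j k y) \<partial>q) = 1"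
    and c[measurable]: "c \<in> borel_measurable (p \<Otimes>\<^sub>M q)" and c0: "\<And>z. 0 \<le> c z" and cN: "\<And>z. c z \<le> N"
  defines "A \<equiv> (\<Sum>k<kk. \<integral>x. \<bar>1 - (\<Sum>j<m. F j k x) / m\<bar> \<partial>p) / kk"
    and "B \<equiv> (\<integral>y. \<bar>1 - (\<Sum>k<kk. \<Sum>j<m. G j k y) / (real m * real kk)\<bar> \<partial>q)"
  shows "\<exists>e D. (\<forall>j k. (\<lambda>x. e x k j) \<in> borel_measurable p) \<and> (\<forall>x k j. 0 \<le> e x k j) \<and>
    (\<forall>x k. (\<Sum>j<m. e x k j) = 1) \<and>
    (\<forall>j k. D j k \<in> borel_measurable q) \<and> (\<forall>j k y. 0 \<le> D j k y) \<and>
    (\<forall>j k. (\<integral>\<^sup>+y. ennreal (D j k y) \<partial>q) = 1) \<and>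
    (AE y in q. (\<Sum>k<kk. \<Sum>j<m. (\<integral>x. e x k j \<partial>p) * D j k y) / kk = 1) \<and>
    (\<Sum>k<kk. \<integral>x. (\<Sum>j<m. e x k j * (\<integral>y. c (x, y) * D j k y \<partial>q)) \<partial>p) / kk
      \<le> (\<Sum>k<kk. \<Sum>j<m. \<integral>x. F j k x * (\<integral>y. c (x, y) * G j k y \<partial>q) \<partial>p) / (real m * real kk) + N * (2 * A + B)"
proof -
  interpret p: prob_space p by fact
  interpret q: prob_space q by fact
  have N: "0 \<le> N" using c0 cN order_trans by blast
  have Fi[simp]: "integrable p (F j k)" for j k
    using F1[of j k] F0 by (intro integrableI_nonneg) auto
  have FI[simp]: "(\<integral>x. F j k x \<partial>p) = 1" for j k
    using F1[of j k] F0 by (simp add: integral_eq_nn_integral)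
  have Gi[simp]: "integrable q (G j k)" for j k
    using G1[of j k] G0 by (intro integrableI_nonneg) auto
  have GI[simp]: "(\<integral>y. G j k y \<partial>q) = 1" for j k
    using G1[of j k] G0 by (simp add: integral_eq_nn_integral)
  define S where "S k x = (\<Sum>j<m. F j k x) / m" for k x
  have S[measurable]: "S k \<in> borel_measurable p" for k unfolding S_def by measurable
  have S0: "0 \<le> S k x" for k x unfolding S_def using F0 by (simp add: sum_nonneg)
  \<comment> \<open>Bayes posterior of \<open>j\<close> given \<open>x\<close> and \<open>k\<close>.
    Where all \<open>F j k x\<close> vanish, the uniform value keeps it a probability
    vector.\<close>
  define e where "e x k j = (if S k x = 0 then 1 / m else F j k x / (m * S k x))" for x k j
  have e[measurable]: "(\<lambda>x. e x k j) \<in> borel_measurable p" for k j unfolding e_def by measurable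
  have e0: "0 \<le> e x k j" for x k j unfolding e_def using F0 S0 by simp
  \<comment> \<open>The posterior and \<open>F / m\<close> are proportional in \<open>j\<close> with
    totals 1 and \<open>S k x\<close>, so their distance is exactly the difference of the totals; if
    \<open>S k x = 0\<close> then \<open>F\<close> vanishes and both sides are 1.\<close>
  have eF: "(\<Sum>j<m. \<bar>e x k j - F j k x / m\<bar>) = \<bar>1 - S k x\<bar>" and e1: "(\<Sum>j<m. e x k j) = 1" for x k
  proof -
    have *: "(\<Sum>j<m. F j k x) = m * S k x" using m by (simp add: S_def)
    show "(\<Sum>j<m. e x k j) = 1"
      using m * by (cases "S k x = 0") (simp_all add: e_def sum_divide_distrib[symmetric])
    show "(\<Sum>j<m. \<bar>e x k j - F j k x / m\<bar>) = \<bar>1 - S k x\<bar>"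
    proof (cases "S k x = 0")
      case True
      then have "F j k x = 0" if "j < m" for j
        using * F0 that by (auto simp: sum_nonneg_eq_0_iff)
      then show ?thesis using True m by (simp add: e_def)
    next
      case False
      then have "S k x > 0" using S0[of k x] by simp
      then have "\<bar>e x k j - F j k x / m\<bar> = F j k x * (\<bar>1 - S k x\<bar> / (m * S k x))" for j
      proof -
        have "e x k j - F j k x / m = F j k x * ((1 - S k x) / (m * S k x))"
          using False m by (simp add: e_def field_simps)
        then show ?thesis using F0[of j k x] \<open>S k x > 0\<close> m by (simp add: abs_mult)
      qed
      then have "(\<Sum>j<m. \<bar>e x k j - F j k x / m\<bar>) = m * S k x * (\<bar>1 - S k x\<bar> / (m * S k x))"
        using * by (simp only: sum_distrib_right[symmetric])
      then show ?thesis using \<open>S k x > 0\<close> m by simp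
    qed
  qed
  have ele: "e x k j \<le> 1" if "j < m" for x k j
    using member_le_sum[of j "{..<m}" "\<lambda>j. e x k j"] e0 e1[of x k] that by simp
  have ei[simp]: "integrable p (\<lambda>x. e x k j)" if "j < m" for k j
    by (rule p.integrable_const_bound[of _ 1]) (use ele that e0 in auto)
  define a where "a j k = (\<integral>x. e x k j \<partial>p)" for j k
  have a0: "0 \<le> a j k" for j k unfolding a_def using e0 by simp
  have a1: "(\<Sum>j<m. a j k) = 1" for k
  proof -
    have "(\<Sum>j<m. a j k) = (\<integral>x. (\<Sum>j<m. e x k j) \<partial>p)"
      unfolding a_def by (rule Bochner_Integration.integral_sum[symmetric]) simp
    then show ?thesis by (simp add: e1 p.prob_space)
  qed
  define w where "w j k = a j k / kk" for j k
  have w0: "0 \<le> w j k" for j k unfolding w_def using a0 by simp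
  have w1: "(\<Sum>k<kk. \<Sum>j<m. w j k) = 1"
    unfolding w_def using kk by (simp add: a1 sum_divide_distrib[symmetric])
  \<comment> \<open>Output density of the decoders \<open>G\<close> when the index follows its true
    law \<open>w\<close> instead of the uniform one.\<close>
  define h where "h y = (\<Sum>k<kk. \<Sum>j<m. w j k * G j k y)" for y
  have h[measurable]: "h \<in> borel_measurable q" unfolding h_def by measurable
  have h0: "0 \<le> h y" for y unfolding h_def using w0 G0 by (intro sum_nonneg mult_nonneg_nonneg) auto
  have hi[simp]: "integrable q h" unfolding h_def by simp
  have hI: "(\<integral>y. h y \<partial>q) = 1" unfolding h_def by (simp add: Bochner_Integration.integral_sum w1)
  \<comment> \<open>Thinning factor with \<open>h * \<theta> = min h 1\<close>, so that no point
    receives more than the target density 1. At \<open>h y = 0\<close> the division gives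
    \<open>\<theta> y = 0\<close>, and the product is still right.\<close>
  define \<theta> where "\<theta> y = min 1 (1 / h y)" for y
  have \<theta>[measurable]: "\<theta> \<in> borel_measurable q" unfolding \<theta>_def by measurable
  have \<theta>0: "0 \<le> \<theta> y" and \<theta>1: "\<theta> y \<le> 1" for y unfolding \<theta>_def using h0 by auto
  have h\<theta>: "h y * \<theta> y = min (h y) 1" for y
    using h0[of y] by (cases "h y = 0") (auto simp: \<theta>_def min_def field_simps)
  have G\<theta>i[simp]: "integrable q (\<lambda>y. G j k y * \<theta> y)" for j k
    by (rule Bochner_Integration.integrable_bound[OF Gi[of j k]])
      (use G0 \<theta>0 \<theta>1 in \<open>auto intro!: mult_left_le\<close>)
  define c' where "c' j k = (\<integral>y. G j k y * (1 - \<theta> y) \<partial>q)" for j k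
  have c'0: "0 \<le> c' j k" for j k unfolding c'_def using G0 \<theta>1 by simp
  have c'1: "c' j k = 1 - (\<integral>y. G j k y * \<theta> y \<partial>q)" for j k
    unfolding c'_def by (simp add: right_diff_distrib)
  \<comment> \<open>\<open>h\<close> and 1 have the same integral, so the mass thinned away equals
    the mass missing below 1; \<open>wc\<close> confirms this.\<close>
  define \<delta> where "\<delta> = (\<integral>y. max 0 (1 - h y) \<partial>q)"
  have mxi[simp]: "integrable q (\<lambda>y. max 0 (1 - h y))" by simp
  have \<delta>0: "0 \<le> \<delta>" unfolding \<delta>_def by simp
  have wc: "(\<Sum>k<kk. \<Sum>j<m. w j k * c' j k) = \<delta>"
  proof -
    have "(\<Sum>k<kk. \<Sum>j<m. w j k * c' j k) = 1 - (\<Sum>k<kk. \<Sum>j<m. w j k * (\<integral>y. G j k y * \<theta> y \<partial>q))"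
      by (simp add: c'1 right_diff_distrib sum_subtractf w1)
    also have "(\<Sum>k<kk. \<Sum>j<m. w j k * (\<integral>y. G j k y * \<theta> y \<partial>q)) = (\<integral>y. h y * \<theta> y \<partial>q)"
      unfolding h_def by (simp add: Bochner_Integration.integral_sum sum_distrib_right mult.assoc)
    also have "\<dots> = (\<integral>y. 1 - max 0 (1 - h y) \<partial>q)"
      by (intro Bochner_Integration.integral_cong) (auto simp: h\<theta>)
    also have "\<dots> = 1 - \<delta>" by (simp add: \<delta>_def q.prob_space)
    finally show ?thesis by simp
  qed
  \<comment> \<open>Density of the refill: the normalised deficit. If \<open>\<delta> = 0\<close>
    nothing is moved, and 1 is chosen merely as some probability density.\<close>
  define r where "r y = (if \<delta> = 0 then 1 else max 0 (1 - h y) / \<delta>)" for y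
  have r[measurable]: "r \<in> borel_measurable q" unfolding r_def by measurable
  have r0: "0 \<le> r y" for y unfolding r_def using \<delta>0 by simp
  have ri[simp]: "integrable q r" unfolding r_def by (cases "\<delta> = 0") simp_all
  have rI: "(\<integral>y. r y \<partial>q) = 1"
  proof (cases "\<delta> = 0")
    case False
    then have "(\<integral>y. r y \<partial>q) = (\<integral>y. max 0 (1 - h y) \<partial>q) / \<delta>" by (simp add: r_def)
    then show ?thesis using False by (simp add: \<delta>_def)
  qed (simp add: r_def q.prob_space)
  define D where "D j k y = G j k y * \<theta> y + c' j k * r y" for j k y
  have D[measurable]: "D j k \<in> borel_measurable q" for j k unfolding D_def by measurable
  have D0: "0 \<le> D j k y" for j k y unfolding D_def using G0 \<theta>0 c'0 r0 by simp
  have Di[simp]: "integrable q (D j k)" for j k unfolding D_def by simp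
  have DI: "(\<integral>y. D j k y \<partial>q) = 1" for j k unfolding D_def by (simp add: rI c'1)
  have D1: "(\<integral>\<^sup>+y. ennreal (D j k y) \<partial>q) = 1" for j k
    using nn_integral_eq_integral[OF Di[of j k]] D0 DI by simp
  have out: "AE y in q. (\<Sum>k<kk. \<Sum>j<m. a j k * D j k y) / kk = 1"
  proof -
    have *: "(\<Sum>k<kk. \<Sum>j<m. a j k * D j k y) / kk = min (h y) 1 + \<delta> * r y" for y
    proof -
      have "(\<Sum>k<kk. \<Sum>j<m. a j k * D j k y) / kk = (\<Sum>k<kk. \<Sum>j<m. w j k * D j k y)"
        by (simp add: w_def sum_divide_distrib)
      also have "\<dots> = h y * \<theta> y + (\<Sum>k<kk. \<Sum>j<m. w j k * c' j k) * r y"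
        by (simp add: D_def h_def distrib_left sum.distrib sum_distrib_right mult.assoc)
      finally show ?thesis by (simp add: h\<theta> wc)
    qed
    show ?thesis
    proof (cases "\<delta> = 0")
      case True
      have "AE y in q. max 0 (1 - h y) = 0"
        using integral_nonneg_eq_0_iff_AE[OF mxi] True by (simp add: \<delta>_def)
      then show ?thesis by eventually_elim (use True * in \<open>auto simp: min_def max_def split: if_splits\<close>)
    next
      case False
      then show ?thesis by (intro AE_I2) (auto simp: * r_def)
    qed
  qed
  have Si[simp]: "integrable p (\<lambda>x. \<bar>1 - S k x\<bar>)" for k unfolding S_def by simp
  have A: "A = (\<Sum>k<kk. \<integral>x. \<bar>1 - S k x\<bar> \<partial>p) / kk" by (simp add: A_def S_def)
  have eFi[simp]: "integrable p (\<lambda>x. \<bar>e x k j - F j k x / m\<bar>)" if "j < m" for k j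
    using that by simp
  \<comment> \<open>The true index law is the \<open>p\<close>-mean of the posterior, so its
    distance from the uniform law is at most the mean distance given by \<open>eF\<close>.\<close>
  have wA: "(\<Sum>k<kk. \<Sum>j<m. \<bar>w j k - 1 / (real m * real kk)\<bar>) \<le> A"
  proof -
    have "\<bar>w j k - 1 / (real m * real kk)\<bar> \<le> (\<integral>x. \<bar>e x k j - F j k x / m\<bar> \<partial>p) / kk" if "j < m" for j k
    proof -
      have "w j k - 1 / (real m * real kk) = (\<integral>x. e x k j - F j k x / m \<partial>p) / kk"
        using that by (simp add: w_def a_def diff_divide_distrib)
      then show ?thesis
        using integral_abs_bound[of p "\<lambda>x. e x k j - F j k x / m"] by (simp add: divide_right_mono)
    qed
    then have "(\<Sum>k<kk. \<Sum>j<m. \<bar>w j k - 1 / (real m * real kk)\<bar>)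
      \<le> (\<Sum>k<kk. \<Sum>j<m. (\<integral>x. \<bar>e x k j - F j k x / m\<bar> \<partial>p) / kk)"
      by (intro sum_mono) auto
    also have "\<dots> = (\<Sum>k<kk. \<Sum>j<m. (\<integral>x. \<bar>e x k j - F j k x / m\<bar> \<partial>p)) / kk"
      by (simp add: sum_divide_distrib)
    also have "\<dots> = (\<Sum>k<kk. (\<integral>x. (\<Sum>j<m. \<bar>e x k j - F j k x / m\<bar>) \<partial>p)) / kk"
      by (intro arg_cong2[where f="(/)"] sum.cong refl Bochner_Integration.integral_sum[symmetric] eFi) auto
    finally show ?thesis by (simp add: eF A)
  qed
  \<comment> \<open>\<open>H\<close> is the output density under a uniform index, at distance
    \<open>B\<close> from 1; passing to \<open>w\<close> adds at most \<open>A\<close> because every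
    \<open>G j k\<close> has integral 1.\<close>
  have \<delta>AB: "\<delta> \<le> A + B"
  proof -
    define H where "H y = (\<Sum>k<kk. \<Sum>j<m. G j k y) / (real m * real kk)" for y
    have Hi: "integrable q H" unfolding H_def by simp
    have "max 0 (1 - h y) \<le> \<bar>1 - H y\<bar> + (\<Sum>k<kk. \<Sum>j<m. \<bar>w j k - 1 / (real m * real kk)\<bar> * G j k y)" for y
    proof -
      have "H y - h y = (\<Sum>k<kk. \<Sum>j<m. (1 / (real m * real kk) - w j k) * G j k y)"
        by (simp add: H_def h_def left_diff_distrib sum_subtractf sum_divide_distrib)
      also have "\<dots> \<le> (\<Sum>k<kk. \<Sum>j<m. \<bar>w j k - 1 / (real m * real kk)\<bar> * G j k y)"
        by (intro sum_mono mult_right_mono G0) (subst abs_minus_commute, rule abs_ge_self)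
      finally have "H y - h y \<le> (\<Sum>k<kk. \<Sum>j<m. \<bar>w j k - 1 / (real m * real kk)\<bar> * G j k y)" .
      moreover have "0 \<le> (\<Sum>k<kk. \<Sum>j<m. \<bar>w j k - 1 / (real m * real kk)\<bar> * G j k y)"
        by (intro sum_nonneg mult_nonneg_nonneg G0) auto
      ultimately show ?thesis by linarith
    qed
    then have "\<delta> \<le> (\<integral>y. \<bar>1 - H y\<bar> + (\<Sum>k<kk. \<Sum>j<m. \<bar>w j k - 1 / (real m * real kk)\<bar> * G j k y) \<partial>q)"
      unfolding \<delta>_def using Hi by (intro integral_mono) auto
    also have "\<dots> = B + (\<Sum>k<kk. \<Sum>j<m. \<bar>w j k - 1 / (real m * real kk)\<bar>)"
      using Hi by (subst Bochner_Integration.integral_add) (auto simp: Bochner_Integration.integral_sum B_def H_def)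
    finally show ?thesis using wA by simp
  qed
  have cD[simp]: "integrable q (\<lambda>y. c (x, y) * d y)" if "x \<in> space p" "integrable q d" for d x
  proof (rule Bochner_Integration.integrable_bound[of q "\<lambda>y. N * d y"])
    have [measurable]: "d \<in> borel_measurable q" using that by simp
    show "(\<lambda>y. c (x, y) * d y) \<in> borel_measurable q" using that(1) by measurable
    show "AE y in q. norm (c (x, y) * d y) \<le> norm (N * d y)"
      using c0 cN N by (intro AE_I2) (simp add: abs_mult mult_right_mono)
  qed (use that in simp)
  define g where "g j k x = (\<integral>y. c (x, y) * G j k y \<partial>q)" for j k x
  define l where "l j k x = (\<integral>y. c (x, y) * D j k y \<partial>q)" for j k x
  have g[measurable]: "g j k \<in> borel_measurable p" for j k unfolding g_def by measurable
  have l[measurable]: "l j k \<in> borel_measurable p" for j k unfolding l_def by measurable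
  have g0: "0 \<le> g j k x" for j k x unfolding g_def using c0 G0 by simp
  have l0: "0 \<le> l j k x" for j k x unfolding l_def using c0 D0 by simp
  have gN: "g j k x \<le> N" if "x \<in> space p" for j k x
  proof -
    have "g j k x \<le> (\<integral>y. N * G j k y \<partial>q)" unfolding g_def
      using that cN G0 by (intro integral_mono cD mult_right_mono) auto
    then show ?thesis by simp
  qed
  \<comment> \<open>Thinning only lowers the cost, and the refilled mass \<open>c' j k\<close> costs
    at most \<open>N\<close> per unit.\<close>
  have lg: "l j k x \<le> g j k x + N * c' j k" if "x \<in> space p" for j k x
  proof -
    have "l j k x \<le> (\<integral>y. c (x, y) * G j k y + N * (c' j k * r y) \<partial>q)" unfolding l_def
    proof (rule integral_mono)
      fix y
      have "c (x, y) * (G j k y * \<theta> y) \<le> c (x, y) * G j k y"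
        using c0 G0 \<theta>1 \<theta>0 by (intro mult_left_mono mult_left_le) auto
      moreover have "c (x, y) * (c' j k * r y) \<le> N * (c' j k * r y)"
        using cN c'0 r0 by (intro mult_right_mono) auto
      ultimately show "c (x, y) * D j k y \<le> c (x, y) * G j k y + N * (c' j k * r y)"
        unfolding D_def by (simp add: distrib_left)
    qed (use that in auto)
    also have "\<dots> = g j k x + N * c' j k" using that by (simp add: g_def rI)
    finally show ?thesis .
  qed
  have Fgi: "integrable p (\<lambda>x. F j k x * g j k x)" for j k
    by (rule Bochner_Integration.integrable_bound[of p "\<lambda>x. F j k x * N"])
      (use F0 g0 gN N in \<open>auto simp: abs_mult intro!: mult_left_mono\<close>)
  have li: "integrable p (\<lambda>x. e x k j * l j k x)" if "j < m" for j k
  proof (rule p.integrable_const_bound[of _ "1 * (N + N * c' j k)"])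
    have "e x k j * l j k x \<le> 1 * (N + N * c' j k)" if "x \<in> space p" for x
      using lg[OF that, of j k] gN[OF that, of j k] l0 ele[OF \<open>j < m\<close>] by (intro mult_mono) auto
    then show "AE x in p. norm (e x k j * l j k x) \<le> 1 * (N + N * c' j k)"
      using e0 l0 by (intro AE_I2) auto
  qed measurable
  \<comment> \<open>Two exchanges: \<open>e\<close> for \<open>F / m\<close>, at a price of
    \<open>N * \<bar>1 - S k x\<bar>\<close> by \<open>eF\<close>, and the decoder \<open>D\<close>
    for \<open>G\<close>, at a price of \<open>N * c' j k\<close> weighted with the true index
    law.\<close>
  have k_bound: "(\<integral>x. (\<Sum>j<m. e x k j * l j k x) \<partial>p)
    \<le> (\<Sum>j<m. \<integral>x. F j k x * g j k x \<partial>p) / m + N * (\<integral>x. \<bar>1 - S k x\<bar> \<partial>p) + N * (\<Sum>j<m. a j k * c' j k)" for k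
  proof -
    have "(\<integral>x. (\<Sum>j<m. e x k j * l j k x) \<partial>p)
      \<le> (\<integral>x. (\<Sum>j<m. F j k x * g j k x / m) + N * \<bar>1 - S k x\<bar> + (\<Sum>j<m. N * c' j k * e x k j) \<partial>p)"
    proof (rule integral_mono)
      fix x assume x: "x \<in> space p"
      have "e x k j * l j k x \<le> F j k x * g j k x / m + N * \<bar>e x k j - F j k x / m\<bar> + N * c' j k * e x k j" for j
      proof -
        have "e x k j * l j k x \<le> e x k j * (g j k x + N * c' j k)"
          by (intro mult_left_mono lg x e0)
        also have "\<dots> = F j k x / m * g j k x + (e x k j - F j k x / m) * g j k x + N * c' j k * e x k j"
          by (simp add: algebra_simps)
        also have "(e x k j - F j k x / m) * g j k x \<le> \<bar>e x k j - F j k x / m\<bar> * N"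
          using g0 gN[OF x] by (intro mult_mono) auto
        finally show ?thesis by (simp add: mult.commute)
      qed
      then have "(\<Sum>j<m. e x k j * l j k x)
        \<le> (\<Sum>j<m. F j k x * g j k x / m + N * \<bar>e x k j - F j k x / m\<bar> + N * c' j k * e x k j)"
        by (intro sum_mono) auto
      also have "\<dots> = (\<Sum>j<m. F j k x * g j k x / m) + N * \<bar>1 - S k x\<bar> + (\<Sum>j<m. N * c' j k * e x k j)"
        by (simp only: sum.distrib sum_distrib_left[symmetric] eF)
      finally show "(\<Sum>j<m. e x k j * l j k x) \<le> \<dots>" .
    next
      show "integrable p (\<lambda>x. \<Sum>j<m. e x k j * l j k x)" by (intro Bochner_Integration.integrable_sum li) auto
      show "integrable p (\<lambda>x. (\<Sum>j<m. F j k x * g j k x / m) + N * \<bar>1 - S k x\<bar> + (\<Sum>j<m. N * c' j k * e x k j))"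
        by (intro Bochner_Integration.integrable_add Bochner_Integration.integrable_sum integrable_divide
            integrable_mult_right Fgi Si ei) auto
    qed
    also have "\<dots> = (\<Sum>j<m. \<integral>x. F j k x * g j k x \<partial>p) / m + N * (\<integral>x. \<bar>1 - S k x\<bar> \<partial>p) + N * (\<Sum>j<m. a j k * c' j k)"
    proof -
      have i1: "integrable p (\<lambda>x. \<Sum>j<m. F j k x * g j k x / m)" using Fgi by simp
      have i2: "integrable p (\<lambda>x. N * \<bar>1 - S k x\<bar>)" by simp
      have i3: "integrable p (\<lambda>x. \<Sum>j<m. N * c' j k * e x k j)"
        by (intro Bochner_Integration.integrable_sum integrable_mult_right ei) auto
      have "(\<integral>x. (\<Sum>j<m. N * c' j k * e x k j) \<partial>p) = (\<Sum>j<m. \<integral>x. N * c' j k * e x k j \<partial>p)"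
        by (intro Bochner_Integration.integral_sum integrable_mult_right ei) auto
      also have "\<dots> = N * (\<Sum>j<m. a j k * c' j k)"
        by (simp add: a_def sum_distrib_left mult_ac)
      finally have s3: "(\<integral>x. (\<Sum>j<m. N * c' j k * e x k j) \<partial>p) = N * (\<Sum>j<m. a j k * c' j k)" .
      have s1: "(\<integral>x. (\<Sum>j<m. F j k x * g j k x / m) \<partial>p) = (\<Sum>j<m. \<integral>x. F j k x * g j k x \<partial>p) / m"
        using Fgi by (simp add: Bochner_Integration.integral_sum sum_divide_distrib)
      show ?thesis
        unfolding Bochner_Integration.integral_add[OF Bochner_Integration.integrable_add[OF i1 i2] i3]
          Bochner_Integration.integral_add[OF i1 i2] s1 s3 by simp
    qed
    finally show ?thesis .
  qed
  have "(\<Sum>k<kk. \<integral>x. (\<Sum>j<m. e x k j * l j k x) \<partial>p) / kk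
    \<le> (\<Sum>k<kk. (\<Sum>j<m. \<integral>x. F j k x * g j k x \<partial>p) / m + N * (\<integral>x. \<bar>1 - S k x\<bar> \<partial>p) + N * (\<Sum>j<m. a j k * c' j k)) / kk"
    by (intro divide_right_mono sum_mono k_bound) auto
  also have "\<dots> = (\<Sum>k<kk. \<Sum>j<m. \<integral>x. F j k x * g j k x \<partial>p) / (real m * real kk) + N * A + N * (\<Sum>k<kk. \<Sum>j<m. w j k * c' j k)"
    by (simp add: A w_def sum.distrib add_divide_distrib sum_distrib_left[symmetric] sum_divide_distrib[symmetric])
  also have "\<dots> \<le> (\<Sum>k<kk. \<Sum>j<m. \<integral>x. F j k x * g j k x \<partial>p) / (real m * real kk) + N * (2 * A + B)"
    using mult_left_mono[OF \<delta>AB N] unfolding wc by (simp add: algebra_simps)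
  finally have cost: "(\<Sum>k<kk. \<integral>x. (\<Sum>j<m. e x k j * l j k x) \<partial>p) / kk \<le> \<dots>" .
  show ?thesis
    by (rule exI[of _ e], rule exI[of _ D])
      (use e e0 e1 D D0 D1 out cost in \<open>simp add: a_def g_def l_def\<close>)
qed


text \<open>After the integrals are exchanged, \<open>x\<close> is fixed and the values
  \<open>f (x, b i)\<close> are i.i.d. with mean 1 under the random codebook, so the sample mean
  bound applies at almost every \<open>x\<close>. The remaining tail integral is the probability,
  under the joint law, that the density exceeds \<open>\<tau>\<close>.\<close>

lemma expected_soft_covering:
  fixes p :: "'a measure" and \<nu> :: "'u measure" and I J :: "'i set"
  assumes p: "prob_space p" and \<nu>: "prob_space \<nu>" and f: "channel p \<nu> f"
    and I: "finite I" "J \<subseteq> I" "J \<noteq> {}" and \<tau>: "0 \<le> \<tau>"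
  shows "(\<integral>\<^sup>+b. \<integral>\<^sup>+x. ennreal \<bar>1 - (\<Sum>i\<in>J. f (x, b i)) / card J\<bar> \<partial>p \<partial>PiM I (\<lambda>_. \<nu>))
    \<le> ennreal (sqrt (\<tau> / card J)) + 2 * (\<integral>\<^sup>+z. ennreal (f z * indicator {t. \<tau> < t} (f z)) \<partial>(p \<Otimes>\<^sub>M \<nu>))"
proof -
  interpret p: prob_space p by fact
  interpret \<nu>: prob_space \<nu> by fact
  interpret P: prob_space "PiM I (\<lambda>_. \<nu>)" by (intro prob_space_PiM \<nu>)
  interpret pair_sigma_finite p "PiM I (\<lambda>_. \<nu>)" by standard
  note [measurable] = channelD(1)[OF f]
  have c[measurable]: "(\<lambda>b. b i) \<in> measurable (PiM I (\<lambda>_. \<nu>)) \<nu>" if "i \<in> J" for i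
    using I that by (intro measurable_component_singleton) auto
  have "(\<integral>\<^sup>+b. \<integral>\<^sup>+x. ennreal \<bar>1 - (\<Sum>i\<in>J. f (x, b i)) / card J\<bar> \<partial>p \<partial>PiM I (\<lambda>_. \<nu>))
    = (\<integral>\<^sup>+x. \<integral>\<^sup>+b. ennreal \<bar>1 - (\<Sum>i\<in>J. f (x, b i)) / card J\<bar> \<partial>PiM I (\<lambda>_. \<nu>) \<partial>p)"
    by (rule Fubini') measurable
  also have "\<dots> \<le> (\<integral>\<^sup>+x. ennreal (sqrt (\<tau> / card J)) + 2 * (\<integral>\<^sup>+u. ennreal (f (x, u) * indicator {t. \<tau> < t} (f (x, u))) \<partial>\<nu>) \<partial>p)"
  proof (rule nn_integral_mono_AE)
    show "AE x in p. (\<integral>\<^sup>+b. ennreal \<bar>1 - (\<Sum>i\<in>J. f (x, b i)) / card J\<bar> \<partial>PiM I (\<lambda>_. \<nu>))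
      \<le> ennreal (sqrt (\<tau> / card J)) + 2 * (\<integral>\<^sup>+u. ennreal (f (x, u) * indicator {t. \<tau> < t} (f (x, u))) \<partial>\<nu>)"
      using channelD(4)[OF f] AE_space
    proof eventually_elim
      case (elim x)
      then show ?case
        by (intro sample_mean_nonneg_L1[OF \<nu> I, of "\<lambda>u. f (x, u)"] channelD(2)[OF f] \<tau>) auto
    qed
  qed
  also have "\<dots> = ennreal (sqrt (\<tau> / card J)) + 2 * (\<integral>\<^sup>+x. \<integral>\<^sup>+u. ennreal (f (x, u) * indicator {t. \<tau> < t} (f (x, u))) \<partial>\<nu> \<partial>p)"
    by (subst nn_integral_add) (auto simp: nn_integral_cmult p.emeasure_space_1)
  also have "(\<integral>\<^sup>+x. \<integral>\<^sup>+u. ennreal (f (x, u) * indicator {t. \<tau> < t} (f (x, u))) \<partial>\<nu> \<partial>p)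
    = (\<integral>\<^sup>+z. ennreal (f z * indicator {t. \<tau> < t} (f z)) \<partial>(p \<Otimes>\<^sub>M \<nu>))"
    by (subst \<nu>.nn_integral_fst[symmetric]) auto
  finally show ?thesis .
qed

text \<open>First moment method: distortion, source error and output error are added into one random
  variable before a codebook is chosen, so a single codebook is good for the sum. The source error
  averages \<open>m\<close> codewords for each seed, the output error all \<open>m * kk\<close> of
  them.\<close>

lemma random_codebook:
  fixes p :: "'a measure" and q :: "'b measure" and \<nu> :: "'u measure" and c :: "'a \<times> 'b \<Rightarrow> real"
  assumes p: "prob_space p" and q: "prob_space q" and \<nu>: "prob_space \<nu>"
    and f: "channel p \<nu> f" and g: "channel q \<nu> g" and m: "0 < m" and kk: "0 < kk"
    and c[measurable]: "c \<in> borel_measurable (p \<Otimes>\<^sub>M q)" and c0: "\<And>z. 0 \<le> c z" and cN: "\<And>z. c z \<le> N"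
    and \<tau>: "0 \<le> \<tau>1" "0 \<le> \<tau>2" and \<eta>: "0 \<le> \<eta>1" "0 \<le> \<eta>2" and \<epsilon>: "0 < \<epsilon>" and L: "0 \<le> L"
    and \<eta>1: "(\<integral>\<^sup>+z. ennreal (f z * indicator {t. \<tau>1 < t} (f z)) \<partial>(p \<Otimes>\<^sub>M \<nu>)) \<le> ennreal \<eta>1"
    and \<eta>2: "(\<integral>\<^sup>+z. ennreal (g z * indicator {t. \<tau>2 < t} (g z)) \<partial>(q \<Otimes>\<^sub>M \<nu>)) \<le> ennreal \<eta>2"
    and avg: "(\<integral>\<^sup>+u. \<integral>\<^sup>+x. \<integral>\<^sup>+y. ennreal (f (x, u)) * (ennreal (c (x, y)) * ennreal (g (y, u))) \<partial>q \<partial>p \<partial>\<nu>) \<le> ennreal L"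
  shows "\<exists>b. (\<forall>j<m. \<forall>k<kk. b (j, k) \<in> space \<nu>) \<and>
    (\<Sum>k<kk. \<Sum>j<m. \<integral>x. f (x, b (j, k)) * (\<integral>y. c (x, y) * g (y, b (j, k)) \<partial>q) \<partial>p) / (real m * real kk)
     + N * (2 * ((\<Sum>k<kk. \<integral>x. \<bar>1 - (\<Sum>j<m. f (x, b (j, k))) / m\<bar> \<partial>p) / kk)
            + (\<integral>y. \<bar>1 - (\<Sum>k<kk. \<Sum>j<m. g (y, b (j, k))) / (real m * real kk)\<bar> \<partial>q))
    \<le> L + N * (2 * (sqrt (\<tau>1 / m) + 2 * \<eta>1) + (sqrt (\<tau>2 / (real m * real kk)) + 2 * \<eta>2)) + \<epsilon>"
proof -
  interpret p: prob_space p by fact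
  interpret q: prob_space q by fact
  interpret \<nu>: prob_space \<nu> by fact
  have N: "0 \<le> N" using c0 cN order_trans by blast
  define I :: "(nat \<times> nat) set" where "I = {..<m} \<times> {..<kk}"
  define CB where "CB = PiM I (\<lambda>_. \<nu>)"
  interpret P: prob_space CB unfolding CB_def by (intro prob_space_PiM \<nu>)
  note fm[measurable] = channelD(1)[OF f] and gm[measurable] = channelD(1)[OF g]
  note f0 = channelD(2)[OF f] and g0 = channelD(2)[OF g]
  have cm[measurable]: "(\<lambda>b. b (j, k)) \<in> measurable CB \<nu>" if "j < m" "k < kk" for j k
    unfolding CB_def using that by (intro measurable_component_singleton) (auto simp: I_def)
  have bsp: "b (j, k) \<in> space \<nu>" if "b \<in> space CB" "j < m" "k < kk" for b j k
    using measurable_space[OF cm[OF that(2,3)] that(1)] .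
  define Ak where "Ak k b = (\<integral>\<^sup>+x. ennreal \<bar>1 - (\<Sum>j<m. f (x, b (j, k))) / m\<bar> \<partial>p)" for k :: nat and b
  define B where "B b = (\<integral>\<^sup>+y. ennreal \<bar>1 - (\<Sum>k<kk. \<Sum>j<m. g (y, b (j, k))) / (real m * real kk)\<bar> \<partial>q)" for b
  define \<psi> where "\<psi> u = (\<integral>\<^sup>+x. \<integral>\<^sup>+y. ennreal (f (x, u)) * (ennreal (c (x, y)) * ennreal (g (y, u))) \<partial>q \<partial>p)" for u
  have \<psi>[measurable]: "\<psi> \<in> borel_measurable \<nu>" unfolding \<psi>_def by measurable
  have fz: "(\<lambda>z. f (snd z, fst z (j, k))) \<in> borel_measurable (CB \<Otimes>\<^sub>M p)" if "j < m" "k < kk" for j k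
    by (rule measurable_compose[OF measurable_Pair[OF measurable_snd measurable_compose[OF measurable_fst cm[OF that]]] fm])
  have gz: "(\<lambda>z. g (snd z, fst z (j, k))) \<in> borel_measurable (CB \<Otimes>\<^sub>M q)" if "j < m" "k < kk" for j k
    by (rule measurable_compose[OF measurable_Pair[OF measurable_snd measurable_compose[OF measurable_fst cm[OF that]]] gm])
  have Ak[measurable]: "Ak k \<in> borel_measurable CB" if "k < kk" for k
    unfolding Ak_def
  proof (rule p.borel_measurable_nn_integral)
    have "(\<lambda>z. \<Sum>j<m. f (snd z, fst z (j, k))) \<in> borel_measurable (CB \<Otimes>\<^sub>M p)"
      using that by (intro borel_measurable_sum fz) auto
    then show "(\<lambda>(b, x). ennreal \<bar>1 - (\<Sum>j<m. f (x, b (j, k))) / real m\<bar>) \<in> borel_measurable (CB \<Otimes>\<^sub>M p)"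
      by (simp add: split_beta')
  qed
  have B[measurable]: "B \<in> borel_measurable CB"
    unfolding B_def
  proof (rule q.borel_measurable_nn_integral)
    have "(\<lambda>z. \<Sum>k<kk. \<Sum>j<m. g (snd z, fst z (j, k))) \<in> borel_measurable (CB \<Otimes>\<^sub>M q)"
      by (intro borel_measurable_sum gz) auto
    then show "(\<lambda>(b, y). ennreal \<bar>1 - (\<Sum>k<kk. \<Sum>j<m. g (y, b (j, k))) / (real m * real kk)\<bar>) \<in> borel_measurable (CB \<Otimes>\<^sub>M q)"
      by (simp add: split_beta')
  qed
  \<comment> \<open>The quantity to be bounded, in extended nonnegative form; it becomes a sum of
    real integrals only after \<open>b\<close> has been selected.\<close>
  define W where "W b = ennreal (1 / (real m * real kk)) * (\<Sum>k<kk. \<Sum>j<m. \<psi> (b (j, k)))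
    + ennreal N * (2 * (ennreal (1 / kk) * (\<Sum>k<kk. Ak k b)) + B b)" for b
  define \<alpha> where "\<alpha> = sqrt (\<tau>1 / m) + 2 * \<eta>1"
  define \<beta> where "\<beta> = sqrt (\<tau>2 / (real m * real kk)) + 2 * \<eta>2"
  have \<alpha>\<beta>: "0 \<le> \<alpha>" "0 \<le> \<beta>" using \<tau> \<eta> by (auto simp: \<alpha>_def \<beta>_def)
  have EA: "(\<integral>\<^sup>+b. Ak k b \<partial>CB) \<le> ennreal \<alpha>" if "k < kk" for k
  proof -
    let ?J = "{..<m} \<times> {k}"
    have J: "finite I" "?J \<subseteq> I" "?J \<noteq> {}" using that m by (auto simp: I_def)
    have s: "(\<Sum>i\<in>?J. f (x, b i)) = (\<Sum>j<m. f (x, b (j, k)))" for x b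
      by (simp add: sum.cartesian_product' card_cartesian_product)
    have crd: "card ?J = m" by (simp add: card_cartesian_product)
    have "(\<integral>\<^sup>+b. Ak k b \<partial>CB) \<le> ennreal (sqrt (\<tau>1 / card ?J))
      + 2 * (\<integral>\<^sup>+z. ennreal (f z * indicator {t. \<tau>1 < t} (f z)) \<partial>(p \<Otimes>\<^sub>M \<nu>))"
      using expected_soft_covering[OF p \<nu> f J \<tau>(1)] unfolding Ak_def CB_def s crd .
    also have "\<dots> \<le> ennreal (sqrt (\<tau>1 / card ?J)) + 2 * ennreal \<eta>1"
      by (intro add_left_mono mult_left_mono \<eta>1) auto
    also have "\<dots> = ennreal \<alpha>" using \<tau> \<eta> by (simp add: \<alpha>_def ennreal_plus ennreal_mult card_cartesian_product)
    finally show ?thesis .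
  qed
  have EB: "(\<integral>\<^sup>+b. B b \<partial>CB) \<le> ennreal \<beta>"
  proof -
    have J: "finite I" "I \<subseteq> I" "I \<noteq> {}" using kk m by (auto simp: I_def)
    have s: "(\<Sum>i\<in>I. g (x, b i)) = (\<Sum>k<kk. \<Sum>j<m. g (x, b (j, k)))" for x b
      unfolding I_def by (subst sum.swap) (simp add: sum.cartesian_product')
    have crd: "real (card I) = real m * real kk" by (simp add: I_def card_cartesian_product)
    have "(\<integral>\<^sup>+b. B b \<partial>CB) \<le> ennreal (sqrt (\<tau>2 / card I))
      + 2 * (\<integral>\<^sup>+z. ennreal (g z * indicator {t. \<tau>2 < t} (g z)) \<partial>(q \<Otimes>\<^sub>M \<nu>))"
      using expected_soft_covering[OF q \<nu> g J \<tau>(2)] unfolding B_def CB_def s crd .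
    also have "\<dots> \<le> ennreal (sqrt (\<tau>2 / card I)) + 2 * ennreal \<eta>2"
      by (intro add_left_mono mult_left_mono \<eta>2) auto
    also have "\<dots> = ennreal \<beta>" using \<tau> \<eta> by (simp add: \<beta>_def I_def ennreal_plus ennreal_mult card_cartesian_product)
    finally show ?thesis .
  qed
  have E\<psi>: "(\<integral>\<^sup>+b. \<psi> (b (j, k)) \<partial>CB) \<le> ennreal L" if "j < m" "k < kk" for j k
    using nn_integral_PiM_component[OF \<nu>, of "(j, k)" I \<psi>] that avg by (simp add: I_def CB_def \<psi>_def)
  let ?X = "L + N * (2 * \<alpha> + \<beta>)"
  have EW: "(\<integral>\<^sup>+b. W b \<partial>CB) \<le> ennreal ?X"
  proof -
    have "(\<integral>\<^sup>+b. W b \<partial>CB) = ennreal (1 / (real m * real kk)) * (\<Sum>k<kk. \<Sum>j<m. \<integral>\<^sup>+b. \<psi> (b (j, k)) \<partial>CB)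
      + ennreal N * (2 * (ennreal (1 / kk) * (\<Sum>k<kk. \<integral>\<^sup>+b. Ak k b \<partial>CB)) + (\<integral>\<^sup>+b. B b \<partial>CB))"
    proof -
      have \<psi>m: "(\<lambda>b. \<psi> (b (j, k))) \<in> borel_measurable CB" if "j < m" "k < kk" for j k
        using measurable_compose[OF cm[OF that] \<psi>] .
      have "(\<integral>\<^sup>+b. (\<Sum>k<kk. \<Sum>j<m. \<psi> (b (j, k))) \<partial>CB) = (\<Sum>k<kk. \<integral>\<^sup>+b. (\<Sum>j<m. \<psi> (b (j, k))) \<partial>CB)"
        by (intro nn_integral_sum borel_measurable_sum \<psi>m) auto
      also have "\<dots> = (\<Sum>k<kk. \<Sum>j<m. \<integral>\<^sup>+b. \<psi> (b (j, k)) \<partial>CB)"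
        by (intro sum.cong refl nn_integral_sum \<psi>m) auto
      finally have "(\<integral>\<^sup>+b. (\<Sum>k<kk. \<Sum>j<m. \<psi> (b (j, k))) \<partial>CB) = (\<Sum>k<kk. \<Sum>j<m. \<integral>\<^sup>+b. \<psi> (b (j, k)) \<partial>CB)" .
      moreover have "(\<integral>\<^sup>+b. (\<Sum>k<kk. Ak k b) \<partial>CB) = (\<Sum>k<kk. \<integral>\<^sup>+b. Ak k b \<partial>CB)"
        by (subst nn_integral_sum) simp_all
      moreover have "(\<lambda>b. \<Sum>k<kk. \<Sum>j<m. \<psi> (b (j, k))) \<in> borel_measurable CB"
        "(\<lambda>b. \<Sum>k<kk. Ak k b) \<in> borel_measurable CB"
        by (intro borel_measurable_sum \<psi>m Ak; simp)+
      ultimately show ?thesis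
        unfolding W_def by (simp add: nn_integral_add nn_integral_cmult)
    qed
    also have "\<dots> \<le> ennreal (1 / (real m * real kk)) * (\<Sum>k<kk. \<Sum>j<m. ennreal L)
      + ennreal N * (2 * (ennreal (1 / kk) * (\<Sum>k<kk. ennreal \<alpha>)) + ennreal \<beta>)"
      using EA EB E\<psi> by (intro add_mono mult_left_mono sum_mono) auto
    also have "ennreal (1 / (real m * real kk)) * (\<Sum>k<kk. \<Sum>j<m. ennreal L) = ennreal L"
      using m kk L by (simp add: ennreal_of_nat_eq_real_of_nat ennreal_mult[symmetric])
    also have "ennreal (1 / kk) * (\<Sum>k<kk. ennreal \<alpha>) = ennreal \<alpha>"
      using kk \<alpha>\<beta> by (simp add: ennreal_of_nat_eq_real_of_nat ennreal_mult[symmetric])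
    also have "ennreal L + ennreal N * (2 * ennreal \<alpha> + ennreal \<beta>) = ennreal ?X"
      using L N \<alpha>\<beta> by (simp add: ennreal_plus ennreal_mult)
    finally show ?thesis .
  qed
  \<comment> \<open>If \<open>W\<close> were above \<open>?X + \<epsilon>\<close> everywhere, so
    would its expectation be, against \<open>EW\<close>.\<close>
  have "\<exists>b\<in>space CB. W b \<le> ennreal (?X + \<epsilon>)"
  proof (rule ccontr)
    assume "\<not> (\<exists>b\<in>space CB. W b \<le> ennreal (?X + \<epsilon>))"
    then have "(\<integral>\<^sup>+b. ennreal (?X + \<epsilon>) \<partial>CB) \<le> (\<integral>\<^sup>+b. W b \<partial>CB)"
      by (intro nn_integral_mono) (auto simp: not_le less_imp_le)
    then have "ennreal (?X + \<epsilon>) \<le> ennreal ?X" using EW by (simp add: P.emeasure_space_1)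
    then show False using \<epsilon> L N \<alpha>\<beta> by (subst (asm) ennreal_le_iff) auto
  qed
  then obtain b where b: "b \<in> space CB" and Wb: "W b \<le> ennreal (?X + \<epsilon>)" by auto
  note bs = bsp[OF b]
  have fi: "integrable p (\<lambda>x. f (x, b (j, k)))" if "j < m" "k < kk" for j k
    using channelD(3)[OF f bs[OF that]] f0 bs[OF that] by (intro integrableI_nonneg) auto
  have gi: "integrable q (\<lambda>x. g (x, b (j, k)))" if "j < m" "k < kk" for j k
    using channelD(3)[OF g bs[OF that]] g0 bs[OF that] by (intro integrableI_nonneg) auto
  have Ab: "Ak k b = ennreal (\<integral>x. \<bar>1 - (\<Sum>j<m. f (x, b (j, k))) / m\<bar> \<partial>p)" if "k < kk" for k
    unfolding Ak_def using that
    by (intro nn_integral_eq_integral integrable_abs Bochner_Integration.integrable_diff integrable_divide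
        Bochner_Integration.integrable_sum fi) auto
  have Bb: "B b = ennreal (\<integral>y. \<bar>1 - (\<Sum>k<kk. \<Sum>j<m. g (y, b (j, k))) / (real m * real kk)\<bar> \<partial>q)"
    unfolding B_def
    by (intro nn_integral_eq_integral integrable_abs Bochner_Integration.integrable_diff integrable_divide
        Bochner_Integration.integrable_sum gi) auto
  have \<psi>b: "\<psi> u = ennreal (\<integral>x. f (x, u) * (\<integral>y. c (x, y) * g (y, u) \<partial>q) \<partial>p)"
    if u: "u \<in> space \<nu>" for u
  proof -
    have gu: "integrable q (\<lambda>y. g (y, u))" and fu: "integrable p (\<lambda>x. f (x, u))"
      using channelD(3)[OF g u] channelD(3)[OF f u] g0 f0 u by (auto intro!: integrableI_nonneg)
    have gI: "(\<integral>y. g (y, u) \<partial>q) = 1"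
      using channelD(3)[OF g u] g0 u by (subst integral_eq_nn_integral) auto
    have ci: "integrable q (\<lambda>y. c (x, y) * g (y, u))" if "x \<in> space p" for x
      by (rule Bochner_Integration.integrable_bound[of q "\<lambda>y. N * g (y, u)"])
        (use that u c0 cN N g0 gu in \<open>auto simp: abs_mult intro!: mult_right_mono\<close>)
    have in1: "(\<integral>\<^sup>+y. ennreal (c (x, y)) * ennreal (g (y, u)) \<partial>q) = ennreal (\<integral>y. c (x, y) * g (y, u) \<partial>q)"
      if "x \<in> space p" for x
      using ci[OF that] c0 g0 by (subst nn_integral_eq_integral[symmetric]) (auto simp: ennreal_mult)
    have cl: "0 \<le> (\<integral>y. c (x, y) * g (y, u) \<partial>q)" for x using c0 g0 by simp
    have cle: "(\<integral>y. c (x, y) * g (y, u) \<partial>q) \<le> N" if "x \<in> space p" for x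
    proof -
      have "(\<integral>y. c (x, y) * g (y, u) \<partial>q) \<le> (\<integral>y. N * g (y, u) \<partial>q)"
        using ci[OF that] gu cN g0 by (intro integral_mono mult_right_mono) auto
      then show ?thesis by (simp add: gI)
    qed
    have xi: "integrable p (\<lambda>x. f (x, u) * (\<integral>y. c (x, y) * g (y, u) \<partial>q))"
      by (rule Bochner_Integration.integrable_bound[of p "\<lambda>x. f (x, u) * N"])
        (use u f0 cl cle N fu in \<open>auto simp: abs_mult intro!: mult_left_mono\<close>)
    have "\<psi> u = (\<integral>\<^sup>+x. ennreal (f (x, u)) * (\<integral>\<^sup>+y. ennreal (c (x, y)) * ennreal (g (y, u)) \<partial>q) \<partial>p)"
      unfolding \<psi>_def using u by (intro nn_integral_cong nn_integral_cmult) auto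
    also have "\<dots> = (\<integral>\<^sup>+x. ennreal (f (x, u) * (\<integral>y. c (x, y) * g (y, u) \<partial>q)) \<partial>p)"
      using f0 cl by (intro nn_integral_cong) (simp add: in1 ennreal_mult)
    also have "\<dots> = ennreal (\<integral>x. f (x, u) * (\<integral>y. c (x, y) * g (y, u) \<partial>q) \<partial>p)"
      using xi f0 cl by (intro nn_integral_eq_integral) auto
    finally show ?thesis .
  qed
  define Cr where "Cr = (\<Sum>k<kk. \<Sum>j<m. \<integral>x. f (x, b (j, k)) * (\<integral>y. c (x, y) * g (y, b (j, k)) \<partial>q) \<partial>p)"
  define Ar where "Ar = (\<Sum>k<kk. \<integral>x. \<bar>1 - (\<Sum>j<m. f (x, b (j, k))) / m\<bar> \<partial>p)"
  define Br where "Br = (\<integral>y. \<bar>1 - (\<Sum>k<kk. \<Sum>j<m. g (y, b (j, k))) / (real m * real kk)\<bar> \<partial>q)"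
  have nn: "0 \<le> Cr" "0 \<le> Ar" "0 \<le> Br"
    unfolding Cr_def Ar_def Br_def using f0 g0 c0
    by (auto intro!: sum_nonneg integral_nonneg mult_nonneg_nonneg)
  have "(\<Sum>k<kk. \<Sum>j<m. \<psi> (b (j, k))) = ennreal Cr"
    unfolding Cr_def using f0 g0 c0 bs
    by (simp add: \<psi>b sum_ennreal sum_nonneg integral_nonneg)
  moreover have "(\<Sum>k<kk. Ak k b) = ennreal Ar"
    unfolding Ar_def by (simp add: Ab sum_ennreal)
  ultimately have "W b = ennreal (Cr / (real m * real kk) + N * (2 * (Ar / kk) + Br))"
    unfolding W_def Bb Br_def[symmetric] using nn N
    by (simp add: ennreal_mult[symmetric] ennreal_plus[symmetric] del: ennreal_plus ennreal_numeral add: ennreal_numeral[symmetric])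
  then have "ennreal (Cr / (real m * real kk) + N * (2 * (Ar / kk) + Br)) \<le> ennreal (?X + \<epsilon>)"
    using Wb by simp
  moreover have "0 \<le> ?X + \<epsilon>" using \<epsilon> L N \<alpha>\<beta> by simp
  ultimately have "Cr / (real m * real kk) + N * (2 * (Ar / kk) + Br) \<le> ?X + \<epsilon>"
    by (simp only: ennreal_le_iff)
  then show ?thesis using bs unfolding Cr_def Ar_def Br_def \<alpha>_def \<beta>_def by blast
qed

section \<open>Memoryless channels on blocks\<close>

text \<open>Transposes a pair of sequences into a sequence of pairs, so that a memoryless block can
  be treated as i.i.d. pairs. The two laws agree on boxes, which determine a product
  measure.\<close>

lemma nn_integral_PiM_pair:
  fixes p :: "'a measure" and \<nu> :: "'u measure"
  assumes p: "prob_space p" and \<nu>: "prob_space \<nu>" and I: "finite I"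
    and H: "H \<in> borel_measurable (PiM I (\<lambda>_. p \<Otimes>\<^sub>M \<nu>))"
  shows "(\<integral>\<^sup>+z. H (\<lambda>t\<in>I. (fst z t, snd z t)) \<partial>(PiM I (\<lambda>_. p) \<Otimes>\<^sub>M PiM I (\<lambda>_. \<nu>)))
    = (\<integral>\<^sup>+z. H z \<partial>PiM I (\<lambda>_. p \<Otimes>\<^sub>M \<nu>))"
proof -
  interpret p: prob_space p by fact
  interpret \<nu>: prob_space \<nu> by fact
  interpret p\<nu>: pair_prob_space p \<nu> by standard
  interpret pp: product_sigma_finite "\<lambda>_. p" by standard
  interpret pn: product_sigma_finite "\<lambda>_. \<nu>" by standard
  interpret pq: product_sigma_finite "\<lambda>_. p \<Otimes>\<^sub>M \<nu>" by standard
  interpret P: prob_space "PiM I (\<lambda>_. p)" by (intro prob_space_PiM p)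
  interpret V: prob_space "PiM I (\<lambda>_. \<nu>)" by (intro prob_space_PiM \<nu>)
  let ?X = "PiM I (\<lambda>_. p)" and ?V = "PiM I (\<lambda>_. \<nu>)" and ?Q = "PiM I (\<lambda>_. p \<Otimes>\<^sub>M \<nu>)"
  let ?T = "\<lambda>z. (\<lambda>t\<in>I. (fst z t, snd z t))"
  have T[measurable]: "?T \<in> measurable (?X \<Otimes>\<^sub>M ?V) ?Q"
    by (intro measurable_restrict) auto
  have "distr (?X \<Otimes>\<^sub>M ?V) ?Q ?T = ?Q"
  proof (rule pq.PiM_eqI[OF I])
    fix A assume A: "\<And>i. i \<in> I \<Longrightarrow> A i \<in> sets (p \<Otimes>\<^sub>M \<nu>)"
    note [measurable] = A
    have "emeasure (distr (?X \<Otimes>\<^sub>M ?V) ?Q ?T) (Pi\<^sub>E I A) = (\<integral>\<^sup>+z. indicator (Pi\<^sub>E I A) (?T z) \<partial>(?X \<Otimes>\<^sub>M ?V))"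
      using A I by (subst nn_integral_distr[OF T, symmetric]) (auto intro!: sets_PiM_I_finite)
    also have "\<dots> = (\<integral>\<^sup>+z. (\<Prod>t\<in>I. indicator (A t) (fst z t, snd z t)) \<partial>(?X \<Otimes>\<^sub>M ?V))"
    proof (rule nn_integral_cong)
      fix z
      show "indicator (Pi\<^sub>E I A) (?T z) = (\<Prod>t\<in>I. indicator (A t) (fst z t, snd z t) :: ennreal)"
        using I by (auto simp: indicator_def PiE_iff prod.neutral_const split: if_splits)
    qed
    also have "\<dots> = (\<integral>\<^sup>+x. \<integral>\<^sup>+u. (\<Prod>t\<in>I. indicator (A t) (x t, u t)) \<partial>?V \<partial>?X)"
      by (subst V.nn_integral_fst[symmetric]) (auto intro!: borel_measurable_prod)
    also have "\<dots> = (\<integral>\<^sup>+x. (\<Prod>t\<in>I. \<integral>\<^sup>+u. indicator (A t) (x t, u) \<partial>\<nu>) \<partial>?X)"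
    proof (rule nn_integral_cong)
      fix x assume x: "x \<in> space ?X"
      show "(\<integral>\<^sup>+u. (\<Prod>t\<in>I. indicator (A t) (x t, u t)) \<partial>?V) = (\<Prod>t\<in>I. \<integral>\<^sup>+u. indicator (A t) (x t, u) \<partial>\<nu>)"
      proof (rule pn.product_nn_integral_prod[OF I])
        fix i assume i: "i \<in> I"
        have "x i \<in> space p" using x i by (auto simp: space_PiM PiE_iff)
        then show "(\<lambda>u. indicator (A i) (x i, u)) \<in> borel_measurable \<nu>" using A[OF i] by measurable
      qed
    qed
    also have "\<dots> = (\<Prod>t\<in>I. \<integral>\<^sup>+x. \<integral>\<^sup>+u. indicator (A t) (x, u) \<partial>\<nu> \<partial>p)"
      by (rule pp.product_nn_integral_prod[OF I]) measurable
    also have "\<dots> = (\<Prod>t\<in>I. emeasure (p \<Otimes>\<^sub>M \<nu>) (A t))"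
      by (intro prod.cong refl) (subst \<nu>.nn_integral_fst, auto)
    finally show "emeasure (distr (?X \<Otimes>\<^sub>M ?V) ?Q ?T) (Pi\<^sub>E I A) = (\<Prod>t\<in>I. emeasure (p \<Otimes>\<^sub>M \<nu>) (A t))" .
  qed simp
  then have "(\<integral>\<^sup>+z. H z \<partial>?Q) = (\<integral>\<^sup>+z. H z \<partial>distr (?X \<Otimes>\<^sub>M ?V) ?Q ?T)" by simp
  then show ?thesis using H by (simp add: nn_integral_distr)
qed

text \<open>The change of measure behind the law of large numbers: i.i.d. letters weighted with the
  product of \<open>f\<close> are again i.i.d. It is checked on boxes.\<close>

lemma density_PiM:
  assumes Q: "prob_space Q" and I: "finite I" and f[measurable]: "f \<in> borel_measurable Q"
    and f1: "(\<integral>\<^sup>+z. f z \<partial>Q) = 1"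
  shows "density (PiM I (\<lambda>_. Q)) (\<lambda>z. \<Prod>t\<in>I. f (z t)) = PiM I (\<lambda>_. density Q f)"
proof -
  interpret Q: prob_space Q by fact
  interpret R: prob_space "density Q f"
    by standard (use f1 in \<open>simp add: emeasure_density\<close>)
  interpret pQ: product_sigma_finite "\<lambda>_. Q" by standard
  interpret pR: product_sigma_finite "\<lambda>_. density Q f" by standard
  have m[measurable]: "(\<lambda>z. \<Prod>t\<in>I. f (z t)) \<in> borel_measurable (PiM I (\<lambda>_. Q))"
    by (intro borel_measurable_prod_ennreal measurable_compose[OF _ f] measurable_component_singleton) auto
  show ?thesis
  proof (rule pR.PiM_eqI[OF I])
    show "sets (density (PiM I (\<lambda>_. Q)) (\<lambda>z. \<Prod>t\<in>I. f (z t))) = sets (PiM I (\<lambda>_. density Q f))"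
      by (simp cong: sets_PiM_cong)
    fix A assume A: "\<And>i. i \<in> I \<Longrightarrow> A i \<in> sets (density Q f)"
    then have A': "\<And>i. i \<in> I \<Longrightarrow> A i \<in> sets Q" by simp
    have "emeasure (density (PiM I (\<lambda>_. Q)) (\<lambda>z. \<Prod>t\<in>I. f (z t))) (Pi\<^sub>E I A)
      = (\<integral>\<^sup>+z. (\<Prod>t\<in>I. f (z t)) * indicator (Pi\<^sub>E I A) z \<partial>PiM I (\<lambda>_. Q))"
      using A' I by (subst emeasure_density) (auto intro!: sets_PiM_I_finite)
    also have "\<dots> = (\<integral>\<^sup>+z. (\<Prod>t\<in>I. f (z t) * indicator (A t) (z t)) \<partial>PiM I (\<lambda>_. Q))"
    proof (rule nn_integral_cong)
      fix z assume z: "z \<in> space (PiM I (\<lambda>_. Q))"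
      have "indicator (Pi\<^sub>E I A) z = (\<Prod>t\<in>I. indicator (A t) (z t) :: ennreal)"
        using I z by (auto simp: indicator_def PiE_iff space_PiM split: if_splits)
      then show "(\<Prod>t\<in>I. f (z t)) * indicator (Pi\<^sub>E I A) z = (\<Prod>t\<in>I. f (z t) * indicator (A t) (z t))"
        by (simp add: prod.distrib)
    qed
    also have "\<dots> = (\<Prod>t\<in>I. \<integral>\<^sup>+z. f z * indicator (A t) z \<partial>Q)"
      using A' by (intro pQ.product_nn_integral_prod[OF I]) auto
    also have "\<dots> = (\<Prod>t\<in>I. emeasure (density Q f) (A t))"
      using A' by (intro prod.cong refl) (simp add: emeasure_density)
    finally show "emeasure (density (PiM I (\<lambda>_. Q)) (\<lambda>z. \<Prod>t\<in>I. f (z t))) (Pi\<^sub>E I A) = (\<Prod>t\<in>I. emeasure (density Q f) (A t))" .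
  qed
qed

text \<open>Takes a pair of sequences rather than a sequence of pairs, so that
  \<open>channel\<close> and the one-shot results apply to blocks as they stand.\<close>

definition block :: "nat \<Rightarrow> ('a \<times> 'u \<Rightarrow> real) \<Rightarrow> (nat \<Rightarrow> 'a) \<times> (nat \<Rightarrow> 'u) \<Rightarrow> real" where
  "block n f z = (\<Prod>t<n. f (fst z t, snd z t))"

lemma borel_measurable_block[measurable]:
  assumes [measurable]: "f \<in> borel_measurable (p \<Otimes>\<^sub>M \<nu>)"
  shows "block n f \<in> borel_measurable (PiM {..<n} (\<lambda>_. p) \<Otimes>\<^sub>M PiM {..<n} (\<lambda>_. \<nu>))"
  unfolding block_def
proof (intro borel_measurable_prod)
  fix i assume "i \<in> {..<n}"
  then have [measurable]: "(\<lambda>x. x i) \<in> measurable (PiM {..<n} (\<lambda>_. p)) p"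
    "(\<lambda>x. x i) \<in> measurable (PiM {..<n} (\<lambda>_. \<nu>)) \<nu>"
    by (auto intro: measurable_component_singleton)
  show "(\<lambda>z. f (fst z i, snd z i)) \<in> borel_measurable (PiM {..<n} (\<lambda>_. p) \<Otimes>\<^sub>M PiM {..<n} (\<lambda>_. \<nu>))"
    by measurable
qed

text \<open>All factors except the one at \<open>t\<close> integrate to 1.\<close>

lemma nn_integral_block_weight:
  assumes p: "prob_space p" and f: "channel p \<nu> f"
    and u: "u \<in> space (PiM {..<n} (\<lambda>_. \<nu>))" and t: "t < n" and \<kappa>[measurable]: "\<kappa> \<in> borel_measurable p"
  shows "(\<integral>\<^sup>+x. ennreal (block n f (x, u)) * \<kappa> (x t) \<partial>PiM {..<n} (\<lambda>_. p)) = (\<integral>\<^sup>+x. ennreal (f (x, u t)) * \<kappa> x \<partial>p)"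
proof -
  interpret p: prob_space p by fact
  interpret pp: product_sigma_finite "\<lambda>_. p" by standard
  note [measurable] = channelD(1)[OF f]
  have us: "u s \<in> space \<nu>" if "s < n" for s using u that by (auto simp: space_PiM PiE_iff)
  define k where "k s x = ennreal (f (x, u s)) * (if s = t then \<kappa> x else 1)" for s x
  have "(\<integral>\<^sup>+x. ennreal (block n f (x, u)) * \<kappa> (x t) \<partial>PiM {..<n} (\<lambda>_. p)) = (\<integral>\<^sup>+x. (\<Prod>s<n. k s (x s)) \<partial>PiM {..<n} (\<lambda>_. p))"
    using t channelD(2)[OF f]
    by (simp add: block_def k_def prod.distrib prod.delta prod_ennreal)
  also have "\<dots> = (\<Prod>s<n. \<integral>\<^sup>+x. k s x \<partial>p)"
    using us unfolding k_def by (intro pp.product_nn_integral_prod) auto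
  also have "\<dots> = (\<Prod>s<n. if s = t then (\<integral>\<^sup>+x. ennreal (f (x, u t)) * \<kappa> x \<partial>p) else 1)"
    using channelD(3)[OF f us] by (intro prod.cong refl) (auto simp: k_def)
  also have "\<dots> = (\<integral>\<^sup>+x. ennreal (f (x, u t)) * \<kappa> x \<partial>p)" using t by (simp add: prod.delta)
  finally show ?thesis .
qed

text \<open>The almost sure condition holds at each of finitely many coordinates, hence at all of
  them simultaneously.\<close>

lemma channel_block:
  assumes p: "prob_space p" and \<nu>: "prob_space \<nu>" and f: "channel p \<nu> f"
  shows "channel (PiM {..<n} (\<lambda>_. p)) (PiM {..<n} (\<lambda>_. \<nu>)) (block n f)"
  unfolding channel_def
proof (intro conjI ballI allI)
  interpret p: prob_space p by fact
  interpret \<nu>: prob_space \<nu> by fact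
  interpret pp: product_sigma_finite "\<lambda>_. p" by standard
  interpret pn: product_sigma_finite "\<lambda>_. \<nu>" by standard
  note fm[measurable] = channelD(1)[OF f]
  note f0 = channelD(2)[OF f]
  show "block n f \<in> borel_measurable (PiM {..<n} (\<lambda>_. p) \<Otimes>\<^sub>M PiM {..<n} (\<lambda>_. \<nu>))" by measurable
  show "0 \<le> block n f z" for z unfolding block_def using f0 by (intro prod_nonneg) auto
  show "(\<integral>\<^sup>+x. ennreal (block n f (x, u)) \<partial>PiM {..<n} (\<lambda>_. p)) = 1" if "u \<in> space (PiM {..<n} (\<lambda>_. \<nu>))" for u
  proof -
    have us: "u s \<in> space \<nu>" if "s < n" for s using \<open>u \<in> _\<close> that by (auto simp: space_PiM PiE_iff)
    have "(\<integral>\<^sup>+x. ennreal (block n f (x, u)) \<partial>PiM {..<n} (\<lambda>_. p)) = (\<Prod>s<n. \<integral>\<^sup>+x. ennreal (f (x, u s)) \<partial>p)"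
      unfolding block_def using us by (subst pp.product_nn_integral_prod[symmetric]) (auto simp: prod_ennreal f0)
    then show ?thesis using channelD(3)[OF f us] by simp
  qed
  have "AE x in PiM {..<n} (\<lambda>_. p). \<forall>t\<in>{..<n}. (\<integral>\<^sup>+u. ennreal (f (x t, u)) \<partial>\<nu>) = 1"
    by (rule AE_finite_allI) (auto intro!: AE_PiM_component[where M="\<lambda>_. p" and P="\<lambda>x. (\<integral>\<^sup>+u. ennreal (f (x, u)) \<partial>\<nu>) = 1"] p channelD(4)[OF f])
  then show "AE x in PiM {..<n} (\<lambda>_. p). (\<integral>\<^sup>+u. ennreal (block n f (x, u)) \<partial>PiM {..<n} (\<lambda>_. \<nu>)) = 1"
    using AE_space
  proof eventually_elim
    case (elim x)
    have xs: "x s \<in> space p" if "s < n" for s using elim(2) that by (auto simp: space_PiM PiE_iff)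
    have "(\<integral>\<^sup>+u. ennreal (block n f (x, u)) \<partial>PiM {..<n} (\<lambda>_. \<nu>)) = (\<Prod>s<n. \<integral>\<^sup>+u. ennreal (f (x s, u)) \<partial>\<nu>)"
      unfolding block_def using xs by (subst pn.product_nn_integral_prod[symmetric]) (auto simp: prod_ennreal f0)
    then show ?case using elim(1) by simp
  qed
qed

text \<open>Given the sequence \<open>u\<close> the letters are independent, so only position
  \<open>t\<close> contributes, and \<open>u t\<close> has law \<open>\<nu>\<close>. The expected
  cost of every letter is therefore the single-letter one.\<close>

lemma block_average:
  assumes p: "prob_space p" and q: "prob_space q" and \<nu>: "prob_space \<nu>"
    and f: "channel p \<nu> f" and g: "channel q \<nu> g" and t: "t < n"
    and \<phi>[measurable]: "\<phi> \<in> borel_measurable (p \<Otimes>\<^sub>M q)"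
  shows "(\<integral>\<^sup>+u. \<integral>\<^sup>+x. \<integral>\<^sup>+y. ennreal (block n f (x, u)) * (\<phi> (x t, y t) * ennreal (block n g (y, u)))
      \<partial>PiM {..<n} (\<lambda>_. q) \<partial>PiM {..<n} (\<lambda>_. p) \<partial>PiM {..<n} (\<lambda>_. \<nu>))
    = (\<integral>\<^sup>+u. \<integral>\<^sup>+x. \<integral>\<^sup>+y. ennreal (f (x, u)) * (\<phi> (x, y) * ennreal (g (y, u))) \<partial>q \<partial>p \<partial>\<nu>)"
proof -
  interpret p: prob_space p by fact
  interpret q: prob_space q by fact
  interpret \<nu>: prob_space \<nu> by fact
  note fm[measurable] = channelD(1)[OF f] and gm[measurable] = channelD(1)[OF g]
  let ?P = "PiM {..<n} (\<lambda>_. p)" and ?Q = "PiM {..<n} (\<lambda>_. q)" and ?V = "PiM {..<n} (\<lambda>_. \<nu>)"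
  have [measurable]: "(\<lambda>x. x t) \<in> measurable ?P p" "(\<lambda>x. x t) \<in> measurable ?Q q" "(\<lambda>x. x t) \<in> measurable ?V \<nu>"
    using t by (auto intro: measurable_component_singleton)
  define \<kappa> where "\<kappa> v x = (\<integral>\<^sup>+y. ennreal (g (y, v)) * \<phi> (x, y) \<partial>q)" for v x
  have [measurable]: "\<kappa> v \<in> borel_measurable p" if "v \<in> space \<nu>" for v unfolding \<kappa>_def using that by measurable
  have "(\<integral>\<^sup>+x. \<integral>\<^sup>+y. ennreal (block n f (x, u)) * (\<phi> (x t, y t) * ennreal (block n g (y, u))) \<partial>?Q \<partial>?P)
    = (\<integral>\<^sup>+x. \<integral>\<^sup>+y. ennreal (f (x, u t)) * (\<phi> (x, y) * ennreal (g (y, u t))) \<partial>q \<partial>p)" if u: "u \<in> space ?V" for u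
  proof -
    have ut: "u t \<in> space \<nu>" using u t by (auto simp: space_PiM PiE_iff)
    have "(\<integral>\<^sup>+x. \<integral>\<^sup>+y. ennreal (block n f (x, u)) * (\<phi> (x t, y t) * ennreal (block n g (y, u))) \<partial>?Q \<partial>?P)
      = (\<integral>\<^sup>+x. ennreal (block n f (x, u)) * (\<integral>\<^sup>+y. ennreal (block n g (y, u)) * \<phi> (x t, y t) \<partial>?Q) \<partial>?P)"
      using u t by (intro nn_integral_cong) (subst nn_integral_cmult[symmetric], auto simp: mult.commute)
    also have "\<dots> = (\<integral>\<^sup>+x. ennreal (block n f (x, u)) * \<kappa> (u t) (x t) \<partial>?P)"
    proof (intro nn_integral_cong arg_cong2[where f="(*)"] refl)
      fix x assume "x \<in> space ?P"
      then have "x t \<in> space p" using t by (auto simp: space_PiM PiE_iff)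
      then show "(\<integral>\<^sup>+y. ennreal (block n g (y, u)) * \<phi> (x t, y t) \<partial>?Q) = \<kappa> (u t) (x t)"
        unfolding \<kappa>_def by (intro nn_integral_block_weight[OF q g u t, of "\<lambda>y. \<phi> (x t, y)"]) auto
    qed
    also have "\<dots> = (\<integral>\<^sup>+x. ennreal (f (x, u t)) * \<kappa> (u t) x \<partial>p)"
      using ut by (intro nn_integral_block_weight[OF p f u t]) auto
    also have "\<dots> = (\<integral>\<^sup>+x. \<integral>\<^sup>+y. ennreal (f (x, u t)) * (\<phi> (x, y) * ennreal (g (y, u t))) \<partial>q \<partial>p)"
      unfolding \<kappa>_def using ut by (intro nn_integral_cong) (subst nn_integral_cmult[symmetric], auto simp: mult.commute)
    finally show ?thesis .
  qed
  then have "(\<integral>\<^sup>+u. \<integral>\<^sup>+x. \<integral>\<^sup>+y. ennreal (block n f (x, u)) * (\<phi> (x t, y t) * ennreal (block n g (y, u))) \<partial>?Q \<partial>?P \<partial>?V)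
    = (\<integral>\<^sup>+u. \<integral>\<^sup>+x. \<integral>\<^sup>+y. ennreal (f (x, u t)) * (\<phi> (x, y) * ennreal (g (y, u t))) \<partial>q \<partial>p \<partial>?V)"
    by (rule nn_integral_cong)
  also have "\<dots> = (\<integral>\<^sup>+u. \<integral>\<^sup>+x. \<integral>\<^sup>+y. ennreal (f (x, u)) * (\<phi> (x, y) * ennreal (g (y, u))) \<partial>q \<partial>p \<partial>\<nu>)"
    using t by (intro nn_integral_PiM_component[OF \<nu>, of t "{..<n}" "\<lambda>v. \<integral>\<^sup>+x. \<integral>\<^sup>+y. ennreal (f (x, v)) * (\<phi> (x, y) * ennreal (g (y, v))) \<partial>q \<partial>p"]) auto
  finally show ?thesis .
qed

text \<open>Information density: under the joint law, \<open>ln (block n f)\<close> is a sum of i.i.d. terms with mean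
  the mutual information, so it rarely exceeds \<open>n * r\<close> for \<open>r\<close> above the mutual information.\<close>

lemma block_tail:
  fixes r \<epsilon> :: real
  assumes p: "prob_space p" and \<nu>: "prob_space \<nu>" and f: "channel p \<nu> f"
    and int: "integrable (p \<Otimes>\<^sub>M \<nu>) (\<lambda>z. f z * ln (f z))"
    and r: "(\<integral>z. f z * ln (f z) \<partial>(p \<Otimes>\<^sub>M \<nu>)) < r" and \<epsilon>: "0 < \<epsilon>"
  shows "\<forall>\<^sub>F n in sequentially. (\<integral>\<^sup>+z. ennreal (block n f z * indicator {t. exp (n * r) < t} (block n f z))
    \<partial>(PiM {..<n} (\<lambda>_. p) \<Otimes>\<^sub>M PiM {..<n} (\<lambda>_. \<nu>))) \<le> ennreal \<epsilon>"
proof -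
  interpret p: prob_space p by fact
  interpret \<nu>: prob_space \<nu> by fact
  interpret Q: pair_prob_space p \<nu> by standard
  note fm[measurable] = channelD(1)[OF f]
  note f0 = channelD(2)[OF f]
  define Q where "Q = p \<Otimes>\<^sub>M \<nu>"
  have Qp: "prob_space Q" unfolding Q_def by unfold_locales
  have fQ[measurable]: "f \<in> borel_measurable Q" unfolding Q_def by measurable
  have f1: "(\<integral>\<^sup>+z. ennreal (f z) \<partial>Q) = 1"
    unfolding Q_def using channelD(3)[OF f]
    by (subst Q.nn_integral_snd[symmetric]) (auto simp: \<nu>.emeasure_space_1 cong: nn_integral_cong)
  \<comment> \<open>Joint law of one pair: integrals weighted with \<open>f\<close> become
    expectations under \<open>R\<close>, and \<open>ln f\<close> has the mutual information as its
    mean there.\<close>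
  define R where "R = density Q (\<lambda>z. ennreal (f z))"
  have Rp: "prob_space R" unfolding R_def by standard (use f1 in \<open>simp add: emeasure_density\<close>)
  define \<mu> where "\<mu> = (\<integral>z. f z * ln (f z) \<partial>Q)"
  have R1: "integrable R (\<lambda>z. ln (f z))" unfolding R_def
    using int f0 by (subst integrable_density) (auto simp: Q_def)
  have R2: "(\<integral>z. ln (f z) \<partial>R) = \<mu>" unfolding R_def \<mu>_def
    using f0 by (subst integral_density) auto
  have r': "\<mu> < r" using r by (simp add: \<mu>_def Q_def)
  \<comment> \<open>Chosen for Markov's inequality: the mean deviation \<open>\<eta>\<close> divided
    by the gap \<open>r - \<mu>\<close> is \<open>\<epsilon>\<close>.\<close>
  define \<eta> where "\<eta> = \<epsilon> * (r - \<mu>)"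
  have \<eta>: "\<eta> > 0" using \<epsilon> r' by (simp add: \<eta>_def)
  show ?thesis
    using LLN_L1[OF Rp R1 \<eta>] eventually_gt_at_top[of 0]
  proof eventually_elim
    case (elim n)
    let ?I = "{..<n}"
    define H where "H z = ennreal ((\<Prod>t<n. f (z t)) * indicator {t. exp (n * r) < t} (\<Prod>t<n. f (z t)))" for z :: "nat \<Rightarrow> 'a \<times> 'b"
    have pm: "(\<lambda>z. \<Prod>t<n. f (z t)) \<in> borel_measurable (PiM ?I (\<lambda>_. Q))"
      by (intro borel_measurable_prod measurable_compose[OF _ fQ] measurable_component_singleton) auto
    have pe: "(\<lambda>z. ennreal (\<Prod>t<n. f (z t))) = (\<lambda>z. \<Prod>t<n. ennreal (f (z t)))"
      using f0 by (simp add: prod_ennreal)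
    have Hm: "H \<in> borel_measurable (PiM ?I (\<lambda>_. Q))" unfolding H_def using pm by measurable
    have "(\<integral>\<^sup>+z. ennreal (block n f z * indicator {t. exp (n * r) < t} (block n f z)) \<partial>(PiM ?I (\<lambda>_. p) \<Otimes>\<^sub>M PiM ?I (\<lambda>_. \<nu>)))
      = (\<integral>\<^sup>+z. H z \<partial>PiM ?I (\<lambda>_. Q))"
      using nn_integral_PiM_pair[OF p \<nu>, of ?I H] Hm by (simp add: H_def block_def Q_def)
    also have "\<dots> = (\<integral>\<^sup>+z. ennreal (\<Prod>t<n. f (z t)) * indicator {t. exp (n * r) < t} (\<Prod>t<n. f (z t)) \<partial>PiM ?I (\<lambda>_. Q))"
      unfolding H_def by (intro nn_integral_cong) (auto simp: indicator_def)
    also have "\<dots> = (\<integral>\<^sup>+z. indicator {t. exp (n * r) < t} (\<Prod>t<n. f (z t)) \<partial>density (PiM ?I (\<lambda>_. Q)) (\<lambda>z. ennreal (\<Prod>t<n. f (z t))))"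
      using pm by (subst nn_integral_density) auto
    also have "\<dots> = (\<integral>\<^sup>+z. indicator {t. exp (n * r) < t} (\<Prod>t<n. f (z t)) \<partial>PiM ?I (\<lambda>_. R))"
      unfolding pe R_def using density_PiM[OF Qp, of ?I "\<lambda>z. ennreal (f z)"] f1 by simp
    also have "\<dots> \<le> (\<integral>\<^sup>+z. ennreal (1 / (r - \<mu>)) * ennreal \<bar>(\<Sum>i<n. ln (f (z i))) / n - \<mu>\<bar> \<partial>PiM ?I (\<lambda>_. R))"
    proof (rule nn_integral_mono)
      fix z :: "nat \<Rightarrow> 'a \<times> 'b"
      show "indicator {t. exp (n * r) < t} (\<Prod>t<n. f (z t)) \<le> ennreal (1 / (r - \<mu>)) * ennreal \<bar>(\<Sum>i<n. ln (f (z i))) / n - \<mu>\<bar>"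
      proof (cases "exp (n * r) < (\<Prod>t<n. f (z t))")
        case True
        \<comment> \<open>On the tail event the product is positive, so its logarithm splits into a
          sum, and the sample mean exceeds \<open>\<mu>\<close> by more than the gap
          \<open>r - \<mu>\<close>.\<close>
        then have "(\<Prod>t<n. f (z t)) \<noteq> 0" by (metis exp_gt_zero less_asym)
        then have pos: "f (z t) > 0" if "t < n" for t using f0[of "z t"] that by (auto simp: less_le)
        have "n * r = ln (exp (n * r))" by simp
        also have "\<dots> < ln (\<Prod>t<n. f (z t))" using True by (intro ln_less_cancel_iff[THEN iffD2]) (auto intro: less_trans[OF exp_gt_zero])
        also have "\<dots> = (\<Sum>i<n. ln (f (z i)))" using pos by (intro ln_prod) (auto simp: less_le)
        finally have "r < (\<Sum>i<n. ln (f (z i))) / n" using elim(2) by (simp add: field_simps)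
        then have "1 \<le> 1 / (r - \<mu>) * \<bar>(\<Sum>i<n. ln (f (z i))) / n - \<mu>\<bar>"
          using r' by (simp add: field_simps)
        then have "ennreal 1 \<le> ennreal (1 / (r - \<mu>) * \<bar>(\<Sum>i<n. ln (f (z i))) / n - \<mu>\<bar>)" by (rule ennreal_leI)
        also have "\<dots> = ennreal (1 / (r - \<mu>)) * ennreal \<bar>(\<Sum>i<n. ln (f (z i))) / n - \<mu>\<bar>"
          using r' by (intro ennreal_mult) auto
        finally show ?thesis using True by simp
      qed simp
    qed
    also have "\<dots> = ennreal (1 / (r - \<mu>)) * (\<integral>\<^sup>+z. ennreal \<bar>(\<Sum>i<n. ln (f (z i))) / n - \<mu>\<bar> \<partial>PiM ?I (\<lambda>_. R))"
    proof (rule nn_integral_cmult)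
      have [measurable]: "(\<lambda>v. ln (f v)) \<in> borel_measurable R" using R1 by simp
      have "(\<lambda>z. \<Sum>i<n. ln (f (z i))) \<in> borel_measurable (PiM ?I (\<lambda>_. R))"
        by (intro borel_measurable_sum) measurable
      then show "(\<lambda>z. ennreal \<bar>(\<Sum>i<n. ln (f (z i))) / n - \<mu>\<bar>) \<in> borel_measurable (PiM ?I (\<lambda>_. R))" by measurable
    qed
    also have "\<dots> \<le> ennreal (1 / (r - \<mu>)) * ennreal \<eta>"
      using elim(1) R2 by (intro mult_left_mono) auto
    also have "\<dots> = ennreal \<epsilon>" using r' \<epsilon> by (simp add: \<eta>_def ennreal_mult[symmetric])
    finally show ?case .
  qed
qed

section \<open>Uniformly integrable distortion\<close>

lemma distr_fst_pair:
  assumes "prob_space p" "prob_space q" "sets p' = sets p"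
  shows "distr (p \<Otimes>\<^sub>M q) p' fst = p"
proof (rule measure_eqI)
  interpret p: prob_space p by fact
  interpret q: prob_space q by fact
  have fm: "fst \<in> measurable (p \<Otimes>\<^sub>M q) p'" using assms(3) by (simp cong: measurable_cong_sets)
  fix A assume "A \<in> sets (distr (p \<Otimes>\<^sub>M q) p' fst)"
  then have A: "A \<in> sets p" using assms(3) by simp
  have "fst -` A \<inter> space (p \<Otimes>\<^sub>M q) = A \<times> space q"
    using sets.sets_into_space[OF A] by (auto simp: space_pair_measure)
  then show "emeasure (distr (p \<Otimes>\<^sub>M q) p' fst) A = emeasure p A"
    using A fm assms(3) by (simp add: emeasure_distr q.emeasure_pair_measure_Times q.emeasure_space_1)
qed (use assms in simp)

lemma distr_snd_pair:
  assumes "prob_space p" "prob_space q" "sets q' = sets q"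
  shows "distr (p \<Otimes>\<^sub>M q) q' snd = q"
proof (rule measure_eqI)
  interpret p: prob_space p by fact
  interpret q: prob_space q by fact
  have fm: "snd \<in> measurable (p \<Otimes>\<^sub>M q) q'" using assms(3) by (simp cong: measurable_cong_sets)
  fix A assume "A \<in> sets (distr (p \<Otimes>\<^sub>M q) q' snd)"
  then have A: "A \<in> sets q" using assms(3) by simp
  have "snd -` A \<inter> space (p \<Otimes>\<^sub>M q) = space p \<times> A"
    using sets.sets_into_space[OF A] by (auto simp: space_pair_measure)
  then show "emeasure (distr (p \<Otimes>\<^sub>M q) q' snd) A = emeasure q A"
    using A fm assms(3) by (simp add: emeasure_distr q.emeasure_pair_measure_Times p.emeasure_space_1)
qed (use assms in simp)

lemma couplingD:
  assumes "coupling S p T q \<pi>"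
  shows "prob_space \<pi>" "sets \<pi> = sets (S \<Otimes>\<^sub>M T)" "distr \<pi> S fst = p" "distr \<pi> T snd = q"
  using assms unfolding coupling_def by blast+

lemma coupling_product:
  assumes "prob_space p" "prob_space q" "sets S = sets p" "sets T = sets q"
  shows "coupling S p T q (p \<Otimes>\<^sub>M q)"
proof -
  interpret p: prob_space p by fact
  interpret q: prob_space q by fact
  interpret pair_prob_space p q by standard
  show ?thesis using assms distr_fst_pair[of p q S] distr_snd_pair[of p q T]
    by (auto simp: coupling_def intro: sets_pair_measure_cong) (unfold_locales)
qed

text \<open>The mixture is a Bernoulli choice followed by one of the two couplings; it keeps the
  marginals because the two couplings share them.\<close>

lemma coupling_mixture:
  assumes \<pi>: "coupling S p T q \<pi>" and \<pi>0: "coupling S p T q \<pi>0" and l: "0 \<le> l" "l \<le> 1"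
  shows "\<exists>\<pi>'. coupling S p T q \<pi>' \<and> (\<forall>h\<in>borel_measurable (S \<Otimes>\<^sub>M T).
    (\<integral>\<^sup>+z. h z \<partial>\<pi>') = ennreal l * (\<integral>\<^sup>+z. h z \<partial>\<pi>) + ennreal (1 - l) * (\<integral>\<^sup>+z. h z \<partial>\<pi>0))"
proof -
  note s[measurable_cong] = couplingD(2)[OF \<pi>] couplingD(2)[OF \<pi>0]
  note pr = couplingD(1)[OF \<pi>] couplingD(1)[OF \<pi>0]
  define K where "K b = (if b then \<pi> else \<pi>0)" for b
  have Ks: "sets (K b) = sets (S \<Otimes>\<^sub>M T)" for b by (simp add: K_def s)
  have Km: "K \<in> measurable (measure_pmf (bernoulli_pmf l)) (subprob_algebra (S \<Otimes>\<^sub>M T))"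
  proof (rule measurableI)
    fix b
    have "prob_space (K b)" using pr by (simp add: K_def)
    then show "K b \<in> space (subprob_algebra (S \<Otimes>\<^sub>M T))"
      using Ks by (simp add: space_subprob_algebra prob_space_imp_subprob_space)
  qed simp
  define \<pi>' where "\<pi>' = measure_pmf (bernoulli_pmf l) \<bind> K"
  have s': "sets \<pi>' = sets (S \<Otimes>\<^sub>M T)" unfolding \<pi>'_def by (rule sets_bind[OF Ks]) simp
  have nn: "(\<integral>\<^sup>+z. h z \<partial>\<pi>') = ennreal l * (\<integral>\<^sup>+z. h z \<partial>\<pi>) + ennreal (1 - l) * (\<integral>\<^sup>+z. h z \<partial>\<pi>0)"
    if "h \<in> borel_measurable (S \<Otimes>\<^sub>M T)" for h
    unfolding \<pi>'_def using l by (subst nn_integral_bind[OF that Km]) (simp add: K_def mult.commute)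
  have mix: "ennreal l * x + ennreal (1 - l) * x = x" for x
    using l by (simp add: distrib_right[symmetric] ennreal_plus[symmetric] del: ennreal_plus)
  have d1: "distr \<pi>' S fst = p"
  proof (rule measure_eqI)
    show "sets (distr \<pi>' S fst) = sets p" using couplingD(3)[OF \<pi>] by force
    fix A assume "A \<in> sets (distr \<pi>' S fst)"
    then have A[measurable]: "A \<in> sets S" by simp
    note [measurable_cong] = s'
    have "emeasure (distr \<pi>' S fst) A = (\<integral>\<^sup>+z. indicator A (fst z) \<partial>\<pi>')"
      by (subst nn_integral_distr[symmetric, of fst \<pi>' S]) auto
    also have "\<dots> = ennreal l * (\<integral>\<^sup>+z. indicator A (fst z) \<partial>\<pi>) + ennreal (1 - l) * (\<integral>\<^sup>+z. indicator A (fst z) \<partial>\<pi>0)"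
      by (rule nn) measurable
    also have "(\<integral>\<^sup>+z. indicator A (fst z) \<partial>\<pi>) = emeasure (distr \<pi> S fst) A"
      by (subst nn_integral_distr[symmetric, of fst \<pi> S]) auto
    also have "(\<integral>\<^sup>+z. indicator A (fst z) \<partial>\<pi>0) = emeasure (distr \<pi>0 S fst) A"
      by (subst nn_integral_distr[symmetric, of fst \<pi>0 S]) auto
    finally show "emeasure (distr \<pi>' S fst) A = emeasure p A"
      unfolding couplingD(3)[OF \<pi>] couplingD(3)[OF \<pi>0] mix .
  qed
  have d2: "distr \<pi>' T snd = q"
  proof (rule measure_eqI)
    show "sets (distr \<pi>' T snd) = sets q" using couplingD(4)[OF \<pi>] by force
    fix A assume "A \<in> sets (distr \<pi>' T snd)"
    then have A[measurable]: "A \<in> sets T" by simp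
    note [measurable_cong] = s'
    have "emeasure (distr \<pi>' T snd) A = (\<integral>\<^sup>+z. indicator A (snd z) \<partial>\<pi>')"
      by (subst nn_integral_distr[symmetric, of snd \<pi>' T]) auto
    also have "\<dots> = ennreal l * (\<integral>\<^sup>+z. indicator A (snd z) \<partial>\<pi>) + ennreal (1 - l) * (\<integral>\<^sup>+z. indicator A (snd z) \<partial>\<pi>0)"
      by (rule nn) measurable
    also have "(\<integral>\<^sup>+z. indicator A (snd z) \<partial>\<pi>) = emeasure (distr \<pi> T snd) A"
      by (subst nn_integral_distr[symmetric, of snd \<pi> T]) auto
    also have "(\<integral>\<^sup>+z. indicator A (snd z) \<partial>\<pi>0) = emeasure (distr \<pi>0 T snd) A"
      by (subst nn_integral_distr[symmetric, of snd \<pi>0 T]) auto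
    finally show "emeasure (distr \<pi>' T snd) A = emeasure q A"
      unfolding couplingD(4)[OF \<pi>] couplingD(4)[OF \<pi>0] mix .
  qed
  have "prob_space \<pi>'"
    unfolding \<pi>'_def using pr by (intro measure_pmf.prob_space_bind[OF _ Km]) (auto simp: K_def)
  then show ?thesis using s' d1 d2 nn by (intro exI[of _ \<pi>']) (auto simp: coupling_def)
qed

text \<open>Mixing an arbitrary coupling with the product coupling makes every tail event small without
  splitting atoms; this turns the hypothesis into a bound that is uniform over all couplings.\<close>

lemma unif_integrable_truncate:
  fixes \<Delta> :: "'a \<Rightarrow> 'a \<Rightarrow> real"
  assumes p: "prob_space p" and q: "prob_space q" and sM: "sets p = sets M" "sets q = sets M"
    and \<Delta>0: "\<And>x y. 0 \<le> \<Delta> x y" and \<Delta>m: "(\<lambda>(x, y). \<Delta> x y) \<in> borel_measurable (M \<Otimes>\<^sub>M M)"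
    and UI: "unif_integrable M p q \<Delta>" and \<epsilon>: "0 < \<epsilon>"
  shows "\<exists>N>0. \<forall>\<pi>. coupling M p M q \<pi> \<longrightarrow>
    (\<integral>\<^sup>+z. ennreal (\<Delta> (fst z) (snd z)) \<partial>\<pi>) \<le> (\<integral>\<^sup>+z. ennreal (min (\<Delta> (fst z) (snd z)) N) \<partial>\<pi>) + ennreal \<epsilon>"
proof -
  define d where "d z = \<Delta> (fst z) (snd z)" for z
  have dm[measurable]: "d \<in> borel_measurable (M \<Otimes>\<^sub>M M)" using \<Delta>m unfolding d_def by (simp add: split_beta')
  have d0: "0 \<le> d z" for z unfolding d_def using \<Delta>0 .
  have UI': "\<exists>\<delta>>0. \<forall>\<pi> E. coupling M p M q \<pi> \<longrightarrow> E \<in> sets (M \<Otimes>\<^sub>M M) \<longrightarrow> emeasure \<pi> E \<le> ennreal \<delta> \<longrightarrow>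
     (\<integral>\<^sup>+z. ennreal (d z) * indicator E z \<partial>\<pi>) \<le> ennreal e" if "0 < e" for e
  proof -
    have "\<exists>\<delta>>0. \<forall>\<pi> E. coupling M p M q \<pi> \<and> E \<in> sets \<pi> \<and> measure \<pi> E \<le> \<delta> \<longrightarrow>
        (\<integral>\<^sup>+ z. ennreal (indicator E z * \<Delta> (fst z) (snd z)) \<partial>\<pi>) \<le> ennreal e"
      using UI that unfolding unif_integrable_def by simp
    then obtain \<delta> where \<delta>: "\<delta> > 0" "\<And>\<pi> E. coupling M p M q \<pi> \<Longrightarrow> E \<in> sets \<pi> \<Longrightarrow> measure \<pi> E \<le> \<delta> \<Longrightarrow>
        (\<integral>\<^sup>+ z. ennreal (indicator E z * \<Delta> (fst z) (snd z)) \<partial>\<pi>) \<le> ennreal e"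
      by blast
    show ?thesis
    proof (intro exI[of _ \<delta>] conjI allI impI \<delta>(1))
      fix \<pi> E assume \<pi>: "coupling M p M q \<pi>" and E: "E \<in> sets (M \<Otimes>\<^sub>M M)" "emeasure \<pi> E \<le> ennreal \<delta>"
      interpret prob_space \<pi> by (rule couplingD(1)[OF \<pi>])
      have "measure \<pi> E \<le> \<delta>" using E(2) \<delta>(1) by (simp add: emeasure_eq_measure)
      moreover have "E \<in> sets \<pi>" using couplingD(2)[OF \<pi>] E by simp
      ultimately have "(\<integral>\<^sup>+ z. ennreal (indicator E z * \<Delta> (fst z) (snd z)) \<partial>\<pi>) \<le> ennreal e"
        using \<delta>(2)[OF \<pi>] by simp
      moreover have "ennreal (d z) * indicator E z = ennreal (indicator E z * \<Delta> (fst z) (snd z))" for z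
        by (simp add: d_def indicator_def)
      ultimately show "(\<integral>\<^sup>+z. ennreal (d z) * indicator E z \<partial>\<pi>) \<le> ennreal e" by simp
    qed
  qed
  define T where "T N = {z \<in> space (M \<Otimes>\<^sub>M M). real N < d z}" for N :: nat
  have T[measurable]: "T N \<in> sets (M \<Otimes>\<^sub>M M)" for N unfolding T_def by measurable
  let ?\<pi>0 = "p \<Otimes>\<^sub>M q"
  have \<pi>0: "coupling M p M q ?\<pi>0" using coupling_product[OF p q] sM by simp
  interpret P0: prob_space ?\<pi>0 by (rule couplingD(1)[OF \<pi>0])
  note s0 = couplingD(2)[OF \<pi>0]
  obtain \<delta>1 where \<delta>1: "\<delta>1 > 0" "\<And>\<pi> E. coupling M p M q \<pi> \<Longrightarrow> E \<in> sets (M \<Otimes>\<^sub>M M) \<Longrightarrow> emeasure \<pi> E \<le> ennreal \<delta>1 \<Longrightarrow>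
     (\<integral>\<^sup>+z. ennreal (d z) * indicator E z \<partial>\<pi>) \<le> ennreal 1" using UI'[of 1] by auto
  \<comment> \<open>Weight of the arbitrary coupling in the mixture. An event of product measure at
    most \<open>l\<close> then has mixed measure at most \<open>l + l \<le> \<delta>1\<close>,
    whatever mass the arbitrary coupling gives it.\<close>
  define l where "l = min \<delta>1 1 / 2"
  have l: "0 < l" "l \<le> 1" "2 * l \<le> \<delta>1" using \<delta>1(1) by (auto simp: l_def)
  have "(\<lambda>N. measure ?\<pi>0 (T N)) \<longlonglongrightarrow> measure ?\<pi>0 (\<Inter>N. T N)"
    by (rule P0.finite_Lim_measure_decseq) (auto simp: s0 decseq_def T_def)
  moreover have "(\<Inter>N. T N) = {}"
  proof -
    have False if "z \<in> (\<Inter>N. T N)" for z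
      using that reals_Archimedean2[of "d z"] by (auto simp: T_def) (metis less_asym)
    then show ?thesis by auto
  qed
  ultimately have "(\<lambda>N. measure ?\<pi>0 (T N)) \<longlonglongrightarrow> 0" by simp
  then have "\<forall>\<^sub>F N in sequentially. measure ?\<pi>0 (T N) < l" using l by (intro order_tendstoD) auto
  then obtain N0 where N0: "\<And>N. N \<ge> N0 \<Longrightarrow> measure ?\<pi>0 (T N) < l" by (auto simp: eventually_sequentially)
  \<comment> \<open>The mixture puts distortion at most 1 on the tail event, and
    \<open>\<pi>\<close> is a fraction \<open>l\<close> of it. Hence \<open>\<pi>\<close> puts at
    most \<open>1 / l\<close> there, uniformly over all couplings, and Markov's inequality bounds
    the tail probability.\<close>
  have tail: "ennreal (real N) * emeasure \<pi> (T N) \<le> ennreal (1 / l)"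
    if \<pi>: "coupling M p M q \<pi>" and N: "N \<ge> N0" for \<pi> N
  proof -
    interpret prob_space \<pi> by (rule couplingD(1)[OF \<pi>])
    note s\<pi> = couplingD(2)[OF \<pi>]
    obtain \<pi>' where \<pi>': "coupling M p M q \<pi>'" "\<And>h. h \<in> borel_measurable (M \<Otimes>\<^sub>M M) \<Longrightarrow>
      (\<integral>\<^sup>+z. h z \<partial>\<pi>') = ennreal l * (\<integral>\<^sup>+z. h z \<partial>\<pi>) + ennreal (1 - l) * (\<integral>\<^sup>+z. h z \<partial>?\<pi>0)"
      using coupling_mixture[OF \<pi> \<pi>0, of l] l by auto
    note s\<pi>' = couplingD(2)[OF \<pi>'(1)]
    have "emeasure \<pi>' (T N) = ennreal l * emeasure \<pi> (T N) + ennreal (1 - l) * emeasure ?\<pi>0 (T N)"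
      using \<pi>'(2)[of "indicator (T N)"] T s\<pi> s\<pi>' s0 by simp
    also have "\<dots> \<le> ennreal l * 1 + 1 * ennreal l"
      using l N0[OF N] by (intro add_mono mult_mono measure_le_1) (auto simp: P0.emeasure_eq_measure intro!: ennreal_leI)
    also have "\<dots> = ennreal (2 * l)" using l by (simp add: ennreal_plus[symmetric] del: ennreal_plus)
    also have "\<dots> \<le> ennreal \<delta>1" using l by (intro ennreal_leI)
    finally have "(\<integral>\<^sup>+z. ennreal (d z) * indicator (T N) z \<partial>\<pi>') \<le> ennreal 1" using \<delta>1(2)[OF \<pi>'(1) T] by simp
    then have "ennreal l * (\<integral>\<^sup>+z. ennreal (d z) * indicator (T N) z \<partial>\<pi>) \<le> 1"
      by (subst (asm) \<pi>'(2)) (auto elim: order_trans[rotated])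
    moreover have "ennreal (real N) * emeasure \<pi> (T N) \<le> (\<integral>\<^sup>+z. ennreal (d z) * indicator (T N) z \<partial>\<pi>)"
      using T s\<pi> by (subst nn_integral_cmult_indicator[symmetric]) (auto intro!: nn_integral_mono ennreal_leI simp: T_def indicator_def)
    ultimately have "ennreal l * (ennreal (real N) * emeasure \<pi> (T N)) \<le> 1"
      by (meson mult_left_mono order_trans zero_le)
    then have "ennreal (1 / l) * (ennreal l * (ennreal (real N) * emeasure \<pi> (T N))) \<le> ennreal (1 / l) * 1"
      by (intro mult_left_mono) auto
    moreover have "ennreal (1 / l) * ennreal l = 1" using l by (simp add: ennreal_mult[symmetric])
    ultimately show ?thesis by (simp add: mult.assoc[symmetric])
  qed
  obtain \<delta>2 where \<delta>2: "\<delta>2 > 0" "\<And>\<pi> E. coupling M p M q \<pi> \<Longrightarrow> E \<in> sets (M \<Otimes>\<^sub>M M) \<Longrightarrow> emeasure \<pi> E \<le> ennreal \<delta>2 \<Longrightarrow>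
     (\<integral>\<^sup>+z. ennreal (d z) * indicator E z \<partial>\<pi>) \<le> ennreal \<epsilon>" using UI'[OF \<epsilon>] by auto
  \<comment> \<open>\<open>N1\<close> brings the uniform tail probability \<open>1 / (l * N)\<close>
    below \<open>\<delta>2\<close>; then the hypothesis applies to \<open>\<pi>\<close> itself, with
    the small bound \<open>\<epsilon>\<close>.\<close>
  obtain N1 :: nat where N1: "1 / l / \<delta>2 < real N1" using reals_Archimedean2 by blast
  define N where "N = max (max N0 N1) 1"
  have N: "N \<ge> N0" "real N > 0" "1 / l \<le> real N * \<delta>2"
  proof -
    have "1 / l / \<delta>2 \<le> real N" using N1 by (simp add: N_def)
    then show "1 / l \<le> real N * \<delta>2" using \<delta>2(1) by (simp only: pos_divide_le_eq)
  qed (auto simp: N_def)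
  show ?thesis
  proof (intro exI[of _ "real N"] conjI allI impI N(2))
    fix \<pi> assume \<pi>: "coupling M p M q \<pi>"
    note s\<pi>[measurable_cong] = couplingD(2)[OF \<pi>]
    have "ennreal (1 / real N) * (ennreal (real N) * emeasure \<pi> (T N)) \<le> ennreal (1 / real N) * ennreal (1 / l)"
      by (intro mult_left_mono tail \<pi> N) auto
    moreover have "ennreal (1 / real N) * ennreal (real N) = 1" using N by (simp add: ennreal_mult[symmetric])
    moreover have "ennreal (1 / real N) * ennreal (1 / l) \<le> ennreal \<delta>2"
      using N l by (simp add: ennreal_mult[symmetric]) (intro ennreal_leI, simp add: field_simps)
    ultimately have "emeasure \<pi> (T N) \<le> ennreal \<delta>2" by (simp add: mult.assoc[symmetric])
    then have 1: "(\<integral>\<^sup>+z. ennreal (d z) * indicator (T N) z \<partial>\<pi>) \<le> ennreal \<epsilon>" using \<delta>2(2)[OF \<pi> T] by simp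
    have "(\<integral>\<^sup>+z. ennreal (d z) \<partial>\<pi>) \<le> (\<integral>\<^sup>+z. ennreal (min (d z) N) + ennreal (d z) * indicator (T N) z \<partial>\<pi>)"
    proof (rule nn_integral_mono)
      fix z assume "z \<in> space \<pi>"
      then have "z \<in> space (M \<Otimes>\<^sub>M M)" using sets_eq_imp_space_eq[OF s\<pi>] by simp
      then show "ennreal (d z) \<le> ennreal (min (d z) N) + ennreal (d z) * indicator (T N) z"
        by (cases "real N < d z") (auto simp: T_def min_def)
    qed
    also have "\<dots> = (\<integral>\<^sup>+z. ennreal (min (d z) N) \<partial>\<pi>) + (\<integral>\<^sup>+z. ennreal (d z) * indicator (T N) z \<partial>\<pi>)"
      by (rule nn_integral_add) measurable
    also have "\<dots> \<le> (\<integral>\<^sup>+z. ennreal (min (d z) N) \<partial>\<pi>) + ennreal \<epsilon>" by (intro add_left_mono 1)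
    finally show "(\<integral>\<^sup>+z. ennreal (\<Delta> (fst z) (snd z)) \<partial>\<pi>) \<le> (\<integral>\<^sup>+z. ennreal (min (\<Delta> (fst z) (snd z)) N) \<partial>\<pi>) + ennreal \<epsilon>"
      by (simp add: d_def)
  qed
qed

section \<open>The joint law of source and output of a code\<close>

definition code_joint :: "'a measure \<Rightarrow> 'b measure \<Rightarrow> nat \<Rightarrow> nat \<Rightarrow> ('a \<Rightarrow> nat \<Rightarrow> nat \<Rightarrow> real)
    \<Rightarrow> (nat \<Rightarrow> nat \<Rightarrow> 'b \<Rightarrow> real) \<Rightarrow> ('a \<times> 'b) measure" where
  "code_joint P Q m kk e D = density (P \<Otimes>\<^sub>M Q)
     (\<lambda>z. (\<Sum>k<kk. \<Sum>j<m. ennreal (e (fst z) k j) * ennreal (D j k (snd z))) / of_nat kk)"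

text \<open>Matches integrals under the joint density with the sums over messages and seeds that
  define the distortion of a code.\<close>

lemma nn_integral_code_joint:
  assumes P: "prob_space P" and Q: "prob_space Q" and kk: "0 < kk"
    and e[measurable]: "\<And>j k. (\<lambda>x. e x k j) \<in> borel_measurable P"
    and D[measurable]: "\<And>j k. D j k \<in> borel_measurable Q"
    and \<phi>[measurable]: "\<phi> \<in> borel_measurable (P \<Otimes>\<^sub>M Q)"
  shows "(\<integral>\<^sup>+z. \<phi> z \<partial>code_joint P Q m kk e D) =
    (\<Sum>k<kk. \<integral>\<^sup>+x. (\<Sum>j<m. ennreal (e x k j) * (\<integral>\<^sup>+y. \<phi> (x, y) \<partial>density Q (\<lambda>y. ennreal (D j k y)))) \<partial>P) / of_nat kk"
proof -
  interpret P: prob_space P by fact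
  interpret Q: prob_space Q by fact
  have "(\<integral>\<^sup>+z. \<phi> z \<partial>code_joint P Q m kk e D)
    = (\<integral>\<^sup>+z. (\<Sum>k<kk. \<Sum>j<m. ennreal (e (fst z) k j) * (ennreal (D j k (snd z)) * \<phi> z)) / of_nat kk \<partial>(P \<Otimes>\<^sub>M Q))"
    unfolding code_joint_def
    by (subst nn_integral_density) (auto simp: divide_ennreal_def sum_distrib_right sum_distrib_left mult_ac intro!: nn_integral_cong)
  also have "\<dots> = (\<integral>\<^sup>+z. (\<Sum>k<kk. \<Sum>j<m. ennreal (e (fst z) k j) * (ennreal (D j k (snd z)) * \<phi> z)) \<partial>(P \<Otimes>\<^sub>M Q)) / of_nat kk"
    by (rule nn_integral_divide) measurable
  also have "(\<integral>\<^sup>+z. (\<Sum>k<kk. \<Sum>j<m. ennreal (e (fst z) k j) * (ennreal (D j k (snd z)) * \<phi> z)) \<partial>(P \<Otimes>\<^sub>M Q))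
    = (\<Sum>k<kk. \<Sum>j<m. \<integral>\<^sup>+z. ennreal (e (fst z) k j) * (ennreal (D j k (snd z)) * \<phi> z) \<partial>(P \<Otimes>\<^sub>M Q))"
    by (simp add: nn_integral_sum)
  also have "\<dots> = (\<Sum>k<kk. \<Sum>j<m. \<integral>\<^sup>+x. ennreal (e x k j) * (\<integral>\<^sup>+y. \<phi> (x, y) \<partial>density Q (\<lambda>y. ennreal (D j k y))) \<partial>P)"
  proof (intro sum.cong refl)
    fix k j
    have "(\<integral>\<^sup>+z. ennreal (e (fst z) k j) * (ennreal (D j k (snd z)) * \<phi> z) \<partial>(P \<Otimes>\<^sub>M Q))
      = (\<integral>\<^sup>+x. \<integral>\<^sup>+y. ennreal (e x k j) * (ennreal (D j k y) * \<phi> (x, y)) \<partial>Q \<partial>P)"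
      by (subst Q.nn_integral_fst[symmetric]) auto
    also have "\<dots> = (\<integral>\<^sup>+x. ennreal (e x k j) * (\<integral>\<^sup>+y. \<phi> (x, y) \<partial>density Q (\<lambda>y. ennreal (D j k y))) \<partial>P)"
      by (intro nn_integral_cong) (simp add: nn_integral_cmult nn_integral_density)
    finally show "(\<integral>\<^sup>+z. ennreal (e (fst z) k j) * (ennreal (D j k (snd z)) * \<phi> z) \<partial>(P \<Otimes>\<^sub>M Q)) = \<dots>" .
  qed
  also have "\<dots> = (\<Sum>k<kk. \<integral>\<^sup>+x. (\<Sum>j<m. ennreal (e x k j) * (\<integral>\<^sup>+y. \<phi> (x, y) \<partial>density Q (\<lambda>y. ennreal (D j k y)))) \<partial>P)"
  proof (intro sum.cong refl nn_integral_sum[symmetric])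
    fix k j
    show "(\<lambda>x. ennreal (e x k j) * (\<integral>\<^sup>+y. \<phi> (x, y) \<partial>density Q (\<lambda>y. ennreal (D j k y)))) \<in> borel_measurable P"
    proof (rule measurable_cong[THEN iffD2])
      show "ennreal (e x k j) * (\<integral>\<^sup>+y. \<phi> (x, y) \<partial>density Q (\<lambda>y. ennreal (D j k y)))
        = ennreal (e x k j) * (\<integral>\<^sup>+y. ennreal (D j k y) * \<phi> (x, y) \<partial>Q)" if "x \<in> space P" for x
        using that by (subst nn_integral_density) auto
    qed measurable
  qed
  finally show ?thesis .
qed

section \<open>Achievability\<close>

lemma enn2ereal_le_ereal_iff: "0 \<le> b \<Longrightarrow> enn2ereal x \<le> ereal b \<longleftrightarrow> x \<le> ennreal b"
  unfolding less_eq_ennreal.rep_eq by (simp only: enn2ereal_ennreal)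

lemma ennreal_of_nat_mult_divide: "0 < n \<Longrightarrow> of_nat n * (x::ennreal) / of_nat n = x"
  by (subst mult.commute) (simp add: mult_divide_eq_ennreal)

text \<open>Turns the almost everywhere identity between densities into the identity between laws
  that \<open>achievable\<close> asks for.\<close>

lemma code_output:
  fixes e :: "'a \<Rightarrow> nat \<Rightarrow> nat \<Rightarrow> real" and D :: "nat \<Rightarrow> nat \<Rightarrow> 'b \<Rightarrow> real"
  assumes P: "prob_space P" and Q: "prob_space Q"
    and e[measurable]: "\<And>j k. (\<lambda>x. e x k j) \<in> borel_measurable P" and e0: "\<And>x k j. 0 \<le> e x k j"
    and e1: "\<And>x k. (\<Sum>j<m. e x k j) = 1"
    and D[measurable]: "\<And>j k. D j k \<in> borel_measurable Q" and D0: "\<And>j k y. 0 \<le> D j k y"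
    and out: "AE y in Q. (\<Sum>k<kk. \<Sum>j<m. (\<integral>x. e x k j \<partial>P) * D j k y) / kk = 1"
    and kk: "0 < kk" and A[measurable]: "A \<in> sets Q"
  shows "(\<Sum>k<kk. \<Sum>j<m. (\<integral>\<^sup>+x. ennreal (e x k j) \<partial>P) * emeasure (density Q (\<lambda>y. ennreal (D j k y))) A) / of_nat kk = emeasure Q A"
proof -
  interpret P: prob_space P by fact
  interpret Q: prob_space Q by fact
  have ele: "e x k j \<le> 1" if "j < m" for x k j
  proof -
    have "e x k j \<le> (\<Sum>j<m. e x k j)" using that e0 by (intro member_le_sum) auto
    then show ?thesis by (simp add: e1)
  qed
  have ei: "integrable P (\<lambda>x. e x k j)" if "j < m" for k j
    by (rule P.integrable_const_bound[of _ 1]) (use ele that e0 in auto)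
  have "(\<Sum>k<kk. \<Sum>j<m. (\<integral>\<^sup>+x. ennreal (e x k j) \<partial>P) * emeasure (density Q (\<lambda>y. ennreal (D j k y))) A)
    = (\<Sum>k<kk. \<Sum>j<m. \<integral>\<^sup>+y. ennreal ((\<integral>x. e x k j \<partial>P) * D j k y) * indicator A y \<partial>Q)"
  proof (intro sum.cong refl)
    fix k j assume "j \<in> {..<m}"
    then have "(\<integral>\<^sup>+x. ennreal (e x k j) \<partial>P) = ennreal (\<integral>x. e x k j \<partial>P)"
      using e0 by (intro nn_integral_eq_integral ei) auto
    then show "(\<integral>\<^sup>+x. ennreal (e x k j) \<partial>P) * emeasure (density Q (\<lambda>y. ennreal (D j k y))) A
      = (\<integral>\<^sup>+y. ennreal ((\<integral>x. e x k j \<partial>P) * D j k y) * indicator A y \<partial>Q)"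
      using e0 D0 by (simp add: emeasure_density nn_integral_cmult[symmetric] ennreal_mult mult.assoc)
  qed
  also have "\<dots> = (\<integral>\<^sup>+y. (\<Sum>k<kk. \<Sum>j<m. ennreal ((\<integral>x. e x k j \<partial>P) * D j k y) * indicator A y) \<partial>Q)"
  proof -
    have "(\<integral>\<^sup>+y. (\<Sum>k<kk. \<Sum>j<m. ennreal ((\<integral>x. e x k j \<partial>P) * D j k y) * indicator A y) \<partial>Q)
      = (\<Sum>k<kk. \<integral>\<^sup>+y. (\<Sum>j<m. ennreal ((\<integral>x. e x k j \<partial>P) * D j k y) * indicator A y) \<partial>Q)"
      by (rule nn_integral_sum) measurable
    also have "\<dots> = (\<Sum>k<kk. \<Sum>j<m. \<integral>\<^sup>+y. ennreal ((\<integral>x. e x k j \<partial>P) * D j k y) * indicator A y \<partial>Q)"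
      by (intro sum.cong refl nn_integral_sum) measurable
    finally show ?thesis ..
  qed
  also have "\<dots> = (\<integral>\<^sup>+y. of_nat kk * indicator A y \<partial>Q)"
  proof (rule nn_integral_cong_AE)
    show "AE y in Q. (\<Sum>k<kk. \<Sum>j<m. ennreal ((\<integral>x. e x k j \<partial>P) * D j k y) * indicator A y) = of_nat kk * indicator A y"
      using out
    proof eventually_elim
      case (elim y)
      have "(\<Sum>k<kk. \<Sum>j<m. ennreal ((\<integral>x. e x k j \<partial>P) * D j k y)) = ennreal (\<Sum>k<kk. \<Sum>j<m. (\<integral>x. e x k j \<partial>P) * D j k y)"
        using e0 D0 by (simp add: sum_ennreal sum_nonneg)
      also have "\<dots> = of_nat kk"
        using elim kk by (simp add: field_simps ennreal_of_nat_eq_real_of_nat)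
      finally show ?case by (simp add: sum_distrib_right[symmetric])
    qed
  qed
  also have "\<dots> = of_nat kk * emeasure Q A" by (simp add: nn_integral_cmult)
  finally show ?thesis using kk by (simp add: ennreal_of_nat_mult_divide)
qed

text \<open>The first marginal is \<open>P\<close> because the encoder sums to 1, the second is
  \<open>Q\<close> because the output is exact. This makes uniform integrability, a property of
  couplings, applicable to a code.\<close>

lemma code_joint_coupling:
  assumes P: "prob_space P" and Q: "prob_space Q"
    and e[measurable]: "\<And>j k. (\<lambda>x. e x k j) \<in> borel_measurable P" and e0: "\<And>x k j. 0 \<le> e x k j"
    and e1: "\<And>x k. (\<Sum>j<m. e x k j) = 1"
    and D[measurable]: "\<And>j k. D j k \<in> borel_measurable Q" and D0: "\<And>j k y. 0 \<le> D j k y"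
    and D1: "\<And>j k. (\<integral>\<^sup>+y. ennreal (D j k y) \<partial>Q) = 1"
    and out: "AE y in Q. (\<Sum>k<kk. \<Sum>j<m. (\<integral>x. e x k j \<partial>P) * D j k y) / kk = 1"
    and kk: "0 < kk"
  shows "coupling P P Q Q (code_joint P Q m kk e D)"
proof -
  interpret P: prob_space P by fact
  interpret Q: prob_space Q by fact
  let ?J = "code_joint P Q m kk e D"
  have s[measurable_cong]: "sets ?J = sets (P \<Otimes>\<^sub>M Q)" by (simp add: code_joint_def)
  have e1': "(\<Sum>j<m. ennreal (e x k j)) = 1" for x k using e0 e1 by (simp add: sum_ennreal)
  have DQ: "emeasure (density Q (\<lambda>y. ennreal (D j k y))) (space Q) = 1" for j k
    using D1 by (simp add: emeasure_density)
  have f: "distr ?J P fst = P"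
  proof (rule measure_eqI)
    fix A assume "A \<in> sets (distr ?J P fst)"
    then have A[measurable]: "A \<in> sets P" by simp
    have "emeasure (distr ?J P fst) A = (\<integral>\<^sup>+z. indicator A (fst z) \<partial>?J)"
      by (subst nn_integral_distr[symmetric, of fst ?J P]) auto
    also have "\<dots> = (\<Sum>k<kk. \<integral>\<^sup>+x. (\<Sum>j<m. ennreal (e x k j) * (\<integral>\<^sup>+y. indicator A (fst (x, y)) \<partial>density Q (\<lambda>y. ennreal (D j k y)))) \<partial>P) / of_nat kk"
      by (rule nn_integral_code_joint[OF P Q kk e D]) measurable
    also have "\<dots> = (\<Sum>k<kk. emeasure P A) / of_nat kk"
      using DQ by (simp add: sum_distrib_right[symmetric] e1')
    also have "\<dots> = emeasure P A"
      using kk by (simp add: ennreal_of_nat_mult_divide)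
    finally show "emeasure (distr ?J P fst) A = emeasure P A" .
  qed simp
  have g: "distr ?J Q snd = Q"
  proof (rule measure_eqI)
    fix A assume "A \<in> sets (distr ?J Q snd)"
    then have A[measurable]: "A \<in> sets Q" by simp
    have "emeasure (distr ?J Q snd) A = (\<integral>\<^sup>+z. indicator A (snd z) \<partial>?J)"
      by (subst nn_integral_distr[symmetric, of snd ?J Q]) auto
    also have "\<dots> = (\<Sum>k<kk. \<integral>\<^sup>+x. (\<Sum>j<m. ennreal (e x k j) * (\<integral>\<^sup>+y. indicator A (snd (x, y)) \<partial>density Q (\<lambda>y. ennreal (D j k y)))) \<partial>P) / of_nat kk"
      by (rule nn_integral_code_joint[OF P Q kk e D]) measurable
    also have "\<dots> = (\<Sum>k<kk. \<Sum>j<m. (\<integral>\<^sup>+x. ennreal (e x k j) \<partial>P) * emeasure (density Q (\<lambda>y. ennreal (D j k y))) A) / of_nat kk"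
      by (simp add: nn_integral_sum nn_integral_multc)
    also have "\<dots> = emeasure Q A"
      by (rule code_output[OF P Q e e0 e1 D D0 out kk A])
    finally show "emeasure (distr ?J Q snd) A = emeasure Q A" .
  qed simp
  have "prob_space (distr ?J P fst)" unfolding f by fact
  then have "prob_space ?J" by (rule prob_space_distrD[rotated]) measurable
  then show ?thesis using s f g by (simp add: coupling_def)
qed

text \<open>Joins the selected codebook to the code built from it and restates the cost as an
  integral under the joint law of the code.\<close>

lemma one_shot:
  fixes p :: "'a measure" and q :: "'b measure" and \<nu> :: "'u measure" and c :: "'a \<times> 'b \<Rightarrow> real"
  assumes p: "prob_space p" and q: "prob_space q" and \<nu>: "prob_space \<nu>"
    and f: "channel p \<nu> f" and g: "channel q \<nu> g" and m: "0 < m" and kk: "0 < kk"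
    and c[measurable]: "c \<in> borel_measurable (p \<Otimes>\<^sub>M q)" and c0: "\<And>z. 0 \<le> c z" and cN: "\<And>z. c z \<le> N"
    and \<tau>: "0 \<le> \<tau>1" "0 \<le> \<tau>2" and \<eta>: "0 \<le> \<eta>1" "0 \<le> \<eta>2" and \<epsilon>: "0 < \<epsilon>" and L: "0 \<le> L"
    and \<eta>1: "(\<integral>\<^sup>+z. ennreal (f z * indicator {t. \<tau>1 < t} (f z)) \<partial>(p \<Otimes>\<^sub>M \<nu>)) \<le> ennreal \<eta>1"
    and \<eta>2: "(\<integral>\<^sup>+z. ennreal (g z * indicator {t. \<tau>2 < t} (g z)) \<partial>(q \<Otimes>\<^sub>M \<nu>)) \<le> ennreal \<eta>2"
    and avg: "(\<integral>\<^sup>+u. \<integral>\<^sup>+x. \<integral>\<^sup>+y. ennreal (f (x, u)) * (ennreal (c (x, y)) * ennreal (g (y, u))) \<partial>q \<partial>p \<partial>\<nu>) \<le> ennreal L"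
  shows "\<exists>e D. (\<forall>j k. (\<lambda>x. e x k j) \<in> borel_measurable p) \<and> (\<forall>x k j. 0 \<le> e x k j) \<and>
    (\<forall>x k. (\<Sum>j<m. e x k j) = 1) \<and>
    (\<forall>j k. D j k \<in> borel_measurable q) \<and> (\<forall>j k y. 0 \<le> D j k y) \<and>
    (\<forall>j k. (\<integral>\<^sup>+y. ennreal (D j k y) \<partial>q) = 1) \<and>
    (AE y in q. (\<Sum>k<kk. \<Sum>j<m. (\<integral>x. e x k j \<partial>p) * D j k y) / kk = 1) \<and>
    (\<integral>\<^sup>+z. ennreal (c z) \<partial>code_joint p q m kk e D)
      \<le> ennreal (L + N * (2 * (sqrt (\<tau>1 / m) + 2 * \<eta>1) + (sqrt (\<tau>2 / (real m * real kk)) + 2 * \<eta>2)) + \<epsilon>)"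
proof -
  interpret p: prob_space p by fact
  interpret q: prob_space q by fact
  note fm[measurable] = channelD(1)[OF f] and gm[measurable] = channelD(1)[OF g]
  let ?X = "L + N * (2 * (sqrt (\<tau>1 / m) + 2 * \<eta>1) + (sqrt (\<tau>2 / (real m * real kk)) + 2 * \<eta>2)) + \<epsilon>"
  obtain b where b: "\<And>j k. j < m \<Longrightarrow> k < kk \<Longrightarrow> b (j, k) \<in> space \<nu>" and bb:
    "(\<Sum>k<kk. \<Sum>j<m. \<integral>x. f (x, b (j, k)) * (\<integral>y. c (x, y) * g (y, b (j, k)) \<partial>q) \<partial>p) / (real m * real kk)
     + N * (2 * ((\<Sum>k<kk. \<integral>x. \<bar>1 - (\<Sum>j<m. f (x, b (j, k))) / m\<bar> \<partial>p) / kk)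
            + (\<integral>y. \<bar>1 - (\<Sum>k<kk. \<Sum>j<m. g (y, b (j, k))) / (real m * real kk)\<bar> \<partial>q)) \<le> ?X"
    using random_codebook[OF p q \<nu> f g m kk c c0 cN \<tau> \<eta> \<epsilon> L \<eta>1 \<eta>2 avg] by blast
  \<comment> \<open>\<open>fixed_codebook\<close> expects densities at all indices; outside the
    codebook the constant 1 serves.\<close>
  define F where "F j k x = (if j < m \<and> k < kk then f (x, b (j, k)) else 1)" for j k x
  define G where "G j k y = (if j < m \<and> k < kk then g (y, b (j, k)) else 1)" for j k y
  have F: "F j k \<in> borel_measurable p" for j k
    unfolding F_def using b[of j k] by (cases "j < m \<and> k < kk") auto
  have F0: "0 \<le> F j k x" for j k x unfolding F_def using channelD(2)[OF f] by simp
  have F1: "(\<integral>\<^sup>+x. ennreal (F j k x) \<partial>p) = 1" for j k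
    unfolding F_def using channelD(3)[OF f b[of j k]] by (cases "j < m \<and> k < kk") (auto simp: p.emeasure_space_1)
  have G: "G j k \<in> borel_measurable q" for j k
    unfolding G_def using b[of j k] by (cases "j < m \<and> k < kk") auto
  have G0: "0 \<le> G j k x" for j k x unfolding G_def using channelD(2)[OF g] by simp
  have G1: "(\<integral>\<^sup>+x. ennreal (G j k x) \<partial>q) = 1" for j k
    unfolding G_def using channelD(3)[OF g b[of j k]] by (cases "j < m \<and> k < kk") (auto simp: q.emeasure_space_1)
  have bb': "(\<Sum>k<kk. \<Sum>j<m. \<integral>x. F j k x * (\<integral>y. c (x, y) * G j k y \<partial>q) \<partial>p) / (real m * real kk)
     + N * (2 * ((\<Sum>k<kk. \<integral>x. \<bar>1 - (\<Sum>j<m. F j k x) / m\<bar> \<partial>p) / kk)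
            + (\<integral>y. \<bar>1 - (\<Sum>k<kk. \<Sum>j<m. G j k y) / (real m * real kk)\<bar> \<partial>q)) \<le> ?X"
    using bb unfolding F_def G_def by (simp cong: sum.cong_simp)
  obtain e D where e[measurable]: "\<And>j k. (\<lambda>x. e x k j) \<in> borel_measurable p" and e0: "\<And>x k j. 0 \<le> e x k j"
    and e1: "\<And>x k. (\<Sum>j<m. e x k j) = 1"
    and D[measurable]: "\<And>j k. D j k \<in> borel_measurable q" and D0: "\<And>j k y. 0 \<le> D j k y"
    and D1: "\<And>j k. (\<integral>\<^sup>+y. ennreal (D j k y) \<partial>q) = 1"
    and out: "AE y in q. (\<Sum>k<kk. \<Sum>j<m. (\<integral>x. e x k j \<partial>p) * D j k y) / kk = 1"
    and cost: "(\<Sum>k<kk. \<integral>x. (\<Sum>j<m. e x k j * (\<integral>y. c (x, y) * D j k y \<partial>q)) \<partial>p) / kk \<le> ?X"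
    using fixed_codebook[of p q m kk F G c N, OF p q m kk F F0 F1 G G0 G1 c c0 cN] bb' order_trans by blast
  have Di: "integrable q (D j k)" for j k
    using D1[of j k] D0 by (intro integrableI_nonneg) auto
  have DI: "(\<integral>y. D j k y \<partial>q) = 1" for j k using D1[of j k] D0 by (simp add: integral_eq_nn_integral)
  have N: "0 \<le> N" using c0 cN order_trans by blast
  have cD: "integrable q (\<lambda>y. c (x, y) * D j k y)" if "x \<in> space p" for x j k
    by (rule Bochner_Integration.integrable_bound[of q "\<lambda>y. N * D j k y"])
      (use that c0 cN N D0 Di in \<open>auto simp: abs_mult intro!: mult_right_mono\<close>)
  define l where "l j k x = (\<integral>y. c (x, y) * D j k y \<partial>q)" for j k x
  have l[measurable]: "l j k \<in> borel_measurable p" for j k unfolding l_def by measurable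
  have l0: "0 \<le> l j k x" for j k x unfolding l_def using c0 D0 by simp
  have lN: "l j k x \<le> N" if "x \<in> space p" for j k x
  proof -
    have "l j k x \<le> (\<integral>y. N * D j k y \<partial>q)" unfolding l_def
      using that cN D0 by (intro integral_mono cD mult_right_mono integrable_mult_right Di) auto
    then show ?thesis by (simp add: DI)
  qed
  have lnn: "(\<integral>\<^sup>+y. ennreal (c (x, y)) \<partial>density q (\<lambda>y. ennreal (D j k y))) = ennreal (l j k x)" if "x \<in> space p" for j k x
  proof -
    have "(\<integral>\<^sup>+y. ennreal (c (x, y)) \<partial>density q (\<lambda>y. ennreal (D j k y))) = (\<integral>\<^sup>+y. ennreal (c (x, y) * D j k y) \<partial>q)"
      using that c0 D0 by (subst nn_integral_density) (auto simp: ennreal_mult mult.commute intro!: nn_integral_cong)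
    also have "\<dots> = ennreal (l j k x)"
      unfolding l_def using c0 D0 by (intro nn_integral_eq_integral cD that) auto
    finally show ?thesis .
  qed
  have li: "integrable p (\<lambda>x. e x k j * l j k x)" if "j < m" for j k
  proof (rule p.integrable_const_bound[of _ "1 * N"])
    have ele: "e x k j \<le> 1" for x
    proof -
      have "e x k j \<le> (\<Sum>j<m. e x k j)" using \<open>j < m\<close> e0 by (intro member_le_sum) auto
      then show ?thesis by (simp add: e1)
    qed
    show "AE x in p. norm (e x k j * l j k x) \<le> 1 * N"
    proof (rule AE_I2)
      fix x assume "x \<in> space p"
      then have "e x k j * l j k x \<le> 1 * N" using e0 l0 lN ele by (intro mult_mono) auto
      then show "norm (e x k j * l j k x) \<le> 1 * N" using e0 l0 by simp
    qed
  qed measurable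
  have "(\<integral>\<^sup>+z. ennreal (c z) \<partial>code_joint p q m kk e D) =
    (\<Sum>k<kk. \<integral>\<^sup>+x. (\<Sum>j<m. ennreal (e x k j) * (\<integral>\<^sup>+y. ennreal (c (x, y)) \<partial>density q (\<lambda>y. ennreal (D j k y)))) \<partial>p) / of_nat kk"
    by (rule nn_integral_code_joint[OF p q kk e D]) measurable
  also have "\<dots> = (\<Sum>k<kk. \<integral>\<^sup>+x. ennreal (\<Sum>j<m. e x k j * l j k x) \<partial>p) / of_nat kk"
    using e0 l0 by (intro arg_cong2[where f="(/)"] sum.cong refl nn_integral_cong) (simp add: lnn ennreal_mult[symmetric] sum_ennreal)
  also have "\<dots> = (\<Sum>k<kk. ennreal (\<integral>x. (\<Sum>j<m. e x k j * l j k x) \<partial>p)) / of_nat kk"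
    using e0 l0 by (intro arg_cong2[where f="(/)"] sum.cong refl nn_integral_eq_integral Bochner_Integration.integrable_sum li)
      (auto intro!: sum_nonneg)
  also have "\<dots> = ennreal ((\<Sum>k<kk. \<integral>x. (\<Sum>j<m. e x k j * l j k x) \<partial>p) / kk)"
    using e0 l0 kk by (simp add: sum_ennreal integral_nonneg sum_nonneg ennreal_of_nat_eq_real_of_nat divide_ennreal)
  also have "\<dots> \<le> ennreal ?X" using cost by (intro ennreal_leI) (simp add: l_def)
  finally have C: "(\<integral>\<^sup>+z. ennreal (c z) \<partial>code_joint p q m kk e D) \<le> ennreal ?X" .
  show ?thesis
    by (rule exI[of _ e], rule exI[of _ D]) (use e e0 e1 D D0 D1 out C in simp)
qed

lemma nn_integral_triple:
  assumes "prob_space P" "prob_space Q" and H[measurable]: "H \<in> borel_measurable (V \<Otimes>\<^sub>M (P \<Otimes>\<^sub>M Q))"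
  shows "(\<integral>\<^sup>+u. \<integral>\<^sup>+x. \<integral>\<^sup>+y. H (u, x, y) \<partial>Q \<partial>P \<partial>V) = (\<integral>\<^sup>+z. H z \<partial>(V \<Otimes>\<^sub>M (P \<Otimes>\<^sub>M Q)))"
proof -
  interpret P: prob_space P by fact
  interpret Q: prob_space Q by fact
  interpret PQ: pair_prob_space P Q by standard
  have "(\<integral>\<^sup>+z. H z \<partial>(V \<Otimes>\<^sub>M (P \<Otimes>\<^sub>M Q))) = (\<integral>\<^sup>+u. \<integral>\<^sup>+w. H (u, w) \<partial>(P \<Otimes>\<^sub>M Q) \<partial>V)"
    by (rule PQ.nn_integral_fst[symmetric]) measurable
  also have "\<dots> = (\<integral>\<^sup>+u. \<integral>\<^sup>+x. \<integral>\<^sup>+y. H (u, x, y) \<partial>Q \<partial>P \<partial>V)"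
    by (intro nn_integral_cong Q.nn_integral_fst[symmetric]) measurable
  finally show ?thesis ..
qed

text \<open>Rounding down keeps the rate constraint exact and loses at most a factor 2 in
  size.\<close>

lemma floor_exp_size:
  assumes "0 \<le> R" "0 < n"
  defines "m \<equiv> nat \<lfloor>exp (real n * R)\<rfloor>"
  shows "0 < m" "ln (real m) / real n \<le> R" "exp (real n * R) / 2 \<le> real m"
proof -
  have 1: "1 \<le> exp (real n * R)" using assms by simp
  then have f: "1 \<le> \<lfloor>exp (real n * R)\<rfloor>" by simp
  then show m: "0 < m" by (simp add: m_def)
  have rm: "real m = of_int \<lfloor>exp (real n * R)\<rfloor>" using f by (simp add: m_def)
  have "real m \<le> exp (real n * R)" unfolding rm by simp
  then have "ln (real m) \<le> ln (exp (real n * R))" using m by (subst ln_le_cancel_iff) auto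
  then have "ln (real m) \<le> real n * R" by simp
  then show "ln (real m) / real n \<le> R" using assms by (simp add: field_simps)
  have "exp (real n * R) < real m + 1" unfolding rm by linarith
  moreover have "1 \<le> real m" using m by simp
  ultimately show "exp (real n * R) / 2 \<le> real m" by linarith
qed

text \<open>The constant 4 absorbs the two roundings, one for the messages and one for the
  seeds.\<close>

lemma eventually_sqrt_exp_small:
  fixes s \<eta> :: real
  assumes "0 < s" "0 < \<eta>"
  shows "\<forall>\<^sub>F n in sequentially. sqrt (4 * exp (- (real n * s))) \<le> \<eta>"
proof -
  have "(\<lambda>n. sqrt (4 * exp (- s) ^ n)) \<longlonglongrightarrow> sqrt (4 * 0)"
    using assms by (intro tendsto_intros LIMSEQ_power_zero) simp
  then have "\<forall>\<^sub>F n in sequentially. sqrt (4 * exp (- s) ^ n) < \<eta>"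
    using assms by (intro order_tendstoD) auto
  then show ?thesis
    by eventually_elim (simp add: exp_of_nat_mult[symmetric])
qed

text \<open>The constants are fixed in the order \<open>N\<close>, \<open>\<eta>\<close>,
  \<open>n\<close>. The truncation level does not depend on the block length, so \<open>n\<close>
  can be taken large enough for errors that are multiplied by \<open>N\<close>. Half of
  \<open>\<epsilon>\<close> goes to the truncation, a quarter to the covering errors and a quarter
  to the choice of the codebook.\<close>

lemma achievability_strict:
  fixes \<Delta> :: "'a \<Rightarrow> 'a \<Rightarrow> real" and \<nu> :: "'u measure"
  assumes p: "prob_space p" and q: "prob_space q" and qp: "sets q = sets p" and \<nu>: "prob_space \<nu>"
    and \<Delta>0: "\<And>x y. 0 \<le> \<Delta> x y" and \<Delta>m: "(\<lambda>(x, y). \<Delta> x y) \<in> borel_measurable (p \<Otimes>\<^sub>M p)"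
    and UI: "unif_integrable p p q \<Delta>"
    and f: "channel p \<nu> f" and g: "channel q \<nu> g"
    and fi: "integrable (p \<Otimes>\<^sub>M \<nu>) (\<lambda>z. f z * ln (f z))" and gi: "integrable (q \<Otimes>\<^sub>M \<nu>) (\<lambda>z. g z * ln (g z))"
    and fR: "(\<integral>z. f z * ln (f z) \<partial>(p \<Otimes>\<^sub>M \<nu>)) < R" and gR: "(\<integral>z. g z * ln (g z) \<partial>(q \<Otimes>\<^sub>M \<nu>)) < R + Rc"
    and R: "0 \<le> R" "0 \<le> Rc" and \<epsilon>: "0 < \<epsilon>" and L: "0 \<le> L"
    and avg: "(\<integral>\<^sup>+u. \<integral>\<^sup>+x. \<integral>\<^sup>+y. ennreal (f (x, u)) * (ennreal (\<Delta> x y) * ennreal (g (y, u))) \<partial>q \<partial>p \<partial>\<nu>) \<le> ennreal L"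
  shows "achievable p p q \<Delta> R Rc (L + \<epsilon>)"
proof -
  note fm[measurable] = channelD(1)[OF f] and gm[measurable] = channelD(1)[OF g]
  note [measurable_cong] = qp
  have \<Delta>m'[measurable]: "(\<lambda>(x, y). \<Delta> x y) \<in> borel_measurable (p \<Otimes>\<^sub>M q)"
    using \<Delta>m by (simp cong: measurable_cong_sets sets_pair_measure_cong)
  obtain N where N: "N > 0" and UIN: "\<And>\<pi>. coupling p p p q \<pi> \<Longrightarrow>
    (\<integral>\<^sup>+z. ennreal (\<Delta> (fst z) (snd z)) \<partial>\<pi>) \<le> (\<integral>\<^sup>+z. ennreal (min (\<Delta> (fst z) (snd z)) N) \<partial>\<pi>) + ennreal (\<epsilon> / 2)"
    using unif_integrable_truncate[OF p q refl qp \<Delta>0 \<Delta>m UI, of "\<epsilon> / 2"] \<epsilon> by auto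
  obtain r1 where r1: "(\<integral>z. f z * ln (f z) \<partial>(p \<Otimes>\<^sub>M \<nu>)) < r1" "r1 < R" using dense[OF fR] by blast
  obtain r2 where r2: "(\<integral>z. g z * ln (g z) \<partial>(q \<Otimes>\<^sub>M \<nu>)) < r2" "r2 < R + Rc" using dense[OF gR] by blast
  \<comment> \<open>Each of the two covering errors is at most \<open>3 * \<eta>\<close>; the source
    error counts twice and the output error once, which gives \<open>9 * (N * \<eta>)\<close>, a
    quarter of \<open>\<epsilon>\<close>.\<close>
  define \<eta> where "\<eta> = \<epsilon> / (36 * N)"
  have \<eta>: "0 < \<eta>" "9 * (N * \<eta>) = \<epsilon> / 4" using \<epsilon> N by (auto simp: \<eta>_def)
  have "\<forall>\<^sub>F n in sequentially. 0 < n \<and>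
      (\<integral>\<^sup>+z. ennreal (block n f z * indicator {t. exp (n * r1) < t} (block n f z)) \<partial>(PiM {..<n} (\<lambda>_. p) \<Otimes>\<^sub>M PiM {..<n} (\<lambda>_. \<nu>))) \<le> ennreal \<eta> \<and>
      (\<integral>\<^sup>+z. ennreal (block n g z * indicator {t. exp (n * r2) < t} (block n g z)) \<partial>(PiM {..<n} (\<lambda>_. q) \<Otimes>\<^sub>M PiM {..<n} (\<lambda>_. \<nu>))) \<le> ennreal \<eta> \<and>
      sqrt (4 * exp (- (real n * (R - r1)))) \<le> \<eta> \<and> sqrt (4 * exp (- (real n * (R + Rc - r2)))) \<le> \<eta>"
    using r1 r2 \<eta>(1)
    by (intro eventually_conj eventually_gt_at_top block_tail[OF p \<nu> f fi] block_tail[OF q \<nu> g gi] eventually_sqrt_exp_small) auto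
  then obtain n where n: "0 < n" and
    t1: "(\<integral>\<^sup>+z. ennreal (block n f z * indicator {t. exp (n * r1) < t} (block n f z)) \<partial>(PiM {..<n} (\<lambda>_. p) \<Otimes>\<^sub>M PiM {..<n} (\<lambda>_. \<nu>))) \<le> ennreal \<eta>" and
    t2: "(\<integral>\<^sup>+z. ennreal (block n g z * indicator {t. exp (n * r2) < t} (block n g z)) \<partial>(PiM {..<n} (\<lambda>_. q) \<Otimes>\<^sub>M PiM {..<n} (\<lambda>_. \<nu>))) \<le> ennreal \<eta>" and
    x1: "sqrt (4 * exp (- (real n * (R - r1)))) \<le> \<eta>" and x2: "sqrt (4 * exp (- (real n * (R + Rc - r2)))) \<le> \<eta>"
    by (auto simp: eventually_sequentially)
  define m where "m = nat \<lfloor>exp (real n * R)\<rfloor>"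
  define kk where "kk = nat \<lfloor>exp (real n * Rc)\<rfloor>"
  note m = floor_exp_size[OF R(1) n, folded m_def]
  note kk = floor_exp_size[OF R(2) n, folded kk_def]
  have s1: "sqrt (exp (n * r1) / m) \<le> \<eta>"
  proof -
    have "exp (n * r1) / m \<le> exp (n * r1) / (exp (real n * R) / 2)"
      using m by (intro divide_left_mono) auto
    also have "\<dots> = 2 * exp (- (real n * (R - r1)))"
    proof -
      have "- (real n * (R - r1)) = n * r1 - real n * R" by (simp add: algebra_simps)
      then show ?thesis by (simp add: exp_diff)
    qed
    also have "\<dots> \<le> 4 * exp (- (real n * (R - r1)))" by simp
    finally have "sqrt (exp (n * r1) / m) \<le> sqrt (4 * exp (- (real n * (R - r1))))" by (rule real_sqrt_le_mono)
    then show ?thesis using x1 by linarith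
  qed
  have s2: "sqrt (exp (n * r2) / (real m * real kk)) \<le> \<eta>"
  proof -
    have "(exp (real n * R) / 2) * (exp (real n * Rc) / 2) \<le> real m * real kk" using m kk by (intro mult_mono) auto
    then have "exp (n * r2) / (real m * real kk) \<le> exp (n * r2) / ((exp (real n * R) / 2) * (exp (real n * Rc) / 2))"
      using m kk by (intro divide_left_mono) auto
    also have "\<dots> = 4 * exp (- (real n * (R + Rc - r2)))"
    proof -
      have "- (real n * (R + Rc - r2)) = n * r2 - (real n * R + real n * Rc)" by (simp add: algebra_simps)
      then show ?thesis by (simp add: exp_diff exp_add)
    qed
    finally have "sqrt (exp (n * r2) / (real m * real kk)) \<le> sqrt (4 * exp (- (real n * (R + Rc - r2))))" by (rule real_sqrt_le_mono)
    then show ?thesis using x2 by linarith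
  qed
  let ?P = "PiM {..<n} (\<lambda>_. p)" and ?Q = "PiM {..<n} (\<lambda>_. q)" and ?V = "PiM {..<n} (\<lambda>_. \<nu>)"
  have P: "prob_space ?P" and Q: "prob_space ?Q" and V: "prob_space ?V"
    by (intro prob_space_PiM p q \<nu>)+
  have QP: "sets ?Q = sets ?P" using qp by (intro sets_PiM_cong) auto
  have cm[measurable]: "(\<lambda>x. x t) \<in> measurable ?P p" "(\<lambda>x. x t) \<in> measurable ?Q q" if "t < n" for t
    using that by (auto intro: measurable_component_singleton)
  have \<Delta>t: "(\<lambda>z. \<Delta> (fst z t) (snd z t)) \<in> borel_measurable (?P \<Otimes>\<^sub>M ?Q)" if "t < n" for t
    using measurable_compose[OF measurable_Pair[OF measurable_compose[OF measurable_fst cm(1)[OF that]] measurable_compose[OF measurable_snd cm(2)[OF that]]] \<Delta>m']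
    by simp
  \<comment> \<open>The cost is truncated letter by letter, not after averaging, because the
    truncation bound will be applied to the coupling of the two letters at each time.\<close>
  define c where "c z = (\<Sum>t<n. min (\<Delta> (fst z t) (snd z t)) N) / n" for z
  have c: "c \<in> borel_measurable (?P \<Otimes>\<^sub>M ?Q)"
    unfolding c_def by (intro borel_measurable_divide borel_measurable_sum borel_measurable_min \<Delta>t) auto
  have c0: "0 \<le> c z" for z unfolding c_def using \<Delta>0 N by (intro divide_nonneg_nonneg sum_nonneg) auto
  have cN: "c z \<le> N" for z
  proof -
    have "(\<Sum>t<n. min (\<Delta> (fst z t) (snd z t)) N) \<le> (\<Sum>t<n. N)" by (intro sum_mono) auto
    then show ?thesis using n by (simp add: c_def field_simps)
  qed
  have cs: "ennreal (c z) = (\<Sum>t<n. ennreal (1 / n) * ennreal (min (\<Delta> (fst z t) (snd z t)) N))" for z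
    unfolding c_def using \<Delta>0 N by (simp add: sum_ennreal ennreal_mult[symmetric] sum_divide_distrib)
  define \<phi> where "\<phi> = (\<lambda>(x, y). ennreal (min (\<Delta> x y) N))"
  have \<phi>[measurable]: "\<phi> \<in> borel_measurable (p \<Otimes>\<^sub>M q)" unfolding \<phi>_def using \<Delta>m' by (simp add: split_beta')
  have cavg: "(\<integral>\<^sup>+u. \<integral>\<^sup>+x. \<integral>\<^sup>+y. ennreal (block n f (x, u)) * (ennreal (c (x, y)) * ennreal (block n g (y, u))) \<partial>?Q \<partial>?P \<partial>?V) \<le> ennreal L"
  proof -
    define H where "H t z = ennreal (block n f (fst (snd z), fst z)) * (\<phi> (fst (snd z) t, snd (snd z) t) * ennreal (block n g (snd (snd z), fst z)))" for t z
    have Hm: "H t \<in> borel_measurable (?V \<Otimes>\<^sub>M (?P \<Otimes>\<^sub>M ?Q))" if "t < n" for t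
    proof -
      note [measurable] = cm[OF that]
      show ?thesis unfolding H_def by measurable
    qed
    have "(\<integral>\<^sup>+u. \<integral>\<^sup>+x. \<integral>\<^sup>+y. ennreal (block n f (x, u)) * (ennreal (c (x, y)) * ennreal (block n g (y, u))) \<partial>?Q \<partial>?P \<partial>?V)
      = (\<integral>\<^sup>+u. \<integral>\<^sup>+x. \<integral>\<^sup>+y. (\<Sum>t<n. ennreal (1 / n) * H t (u, x, y)) \<partial>?Q \<partial>?P \<partial>?V)"
      unfolding cs by (simp add: H_def \<phi>_def sum_distrib_left sum_distrib_right mult_ac)
    also have "\<dots> = (\<integral>\<^sup>+z. (\<Sum>t<n. ennreal (1 / n) * H t z) \<partial>(?V \<Otimes>\<^sub>M (?P \<Otimes>\<^sub>M ?Q)))"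
      by (rule nn_integral_triple[OF P Q]) (intro borel_measurable_sum borel_measurable_times_ennreal borel_measurable_const Hm, simp)
    also have "\<dots> = (\<Sum>t<n. ennreal (1 / n) * (\<integral>\<^sup>+z. H t z \<partial>(?V \<Otimes>\<^sub>M (?P \<Otimes>\<^sub>M ?Q))))"
      using Hm by (subst nn_integral_sum) (auto simp: nn_integral_cmult)
    also have "\<dots> = (\<Sum>t<n. ennreal (1 / n) * (\<integral>\<^sup>+u. \<integral>\<^sup>+x. \<integral>\<^sup>+y. ennreal (f (x, u)) * (\<phi> (x, y) * ennreal (g (y, u))) \<partial>q \<partial>p \<partial>\<nu>))"
    proof (intro sum.cong refl arg_cong2[where f="(*)"])
      fix t assume "t \<in> {..<n}"
      then have t: "t < n" by simp
      show "(\<integral>\<^sup>+z. H t z \<partial>(?V \<Otimes>\<^sub>M (?P \<Otimes>\<^sub>M ?Q))) = (\<integral>\<^sup>+u. \<integral>\<^sup>+x. \<integral>\<^sup>+y. ennreal (f (x, u)) * (\<phi> (x, y) * ennreal (g (y, u))) \<partial>q \<partial>p \<partial>\<nu>)"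
        using nn_integral_triple[OF P Q Hm[OF t]] block_average[OF p q \<nu> f g t \<phi>] by (simp add: H_def)
    qed
    also have "\<dots> = (\<integral>\<^sup>+u. \<integral>\<^sup>+x. \<integral>\<^sup>+y. ennreal (f (x, u)) * (\<phi> (x, y) * ennreal (g (y, u))) \<partial>q \<partial>p \<partial>\<nu>)"
      using n by (simp add: mult.assoc[symmetric] ennreal_of_nat_eq_real_of_nat ennreal_mult[symmetric])
    also have "\<dots> \<le> (\<integral>\<^sup>+u. \<integral>\<^sup>+x. \<integral>\<^sup>+y. ennreal (f (x, u)) * (ennreal (\<Delta> x y) * ennreal (g (y, u))) \<partial>q \<partial>p \<partial>\<nu>)"
      by (intro nn_integral_mono mult_left_mono mult_right_mono) (auto simp: \<phi>_def intro!: ennreal_leI)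
    finally show ?thesis using avg by (rule order_trans)
  qed
  have "\<exists>e D. (\<forall>j k. (\<lambda>x. e x k j) \<in> borel_measurable ?P) \<and> (\<forall>x k j. 0 \<le> e x k j) \<and>
    (\<forall>x k. (\<Sum>j<m. e x k j) = 1) \<and>
    (\<forall>j k. D j k \<in> borel_measurable ?Q) \<and> (\<forall>j k y. 0 \<le> D j k y) \<and>
    (\<forall>j k. (\<integral>\<^sup>+y. ennreal (D j k y) \<partial>?Q) = 1) \<and>
    (AE y in ?Q. (\<Sum>k<kk. \<Sum>j<m. (\<integral>x. e x k j \<partial>?P) * D j k y) / kk = 1) \<and>
    (\<integral>\<^sup>+z. ennreal (c z) \<partial>code_joint ?P ?Q m kk e D)
      \<le> ennreal (L + N * (2 * (sqrt (exp (n * r1) / m) + 2 * \<eta>) + (sqrt (exp (n * r2) / (real m * real kk)) + 2 * \<eta>)) + \<epsilon> / 4)"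
    using \<eta> \<epsilon> by (intro one_shot[OF P Q V channel_block[OF p \<nu> f] channel_block[OF q \<nu> g] m(1) kk(1) c c0 cN _ _ _ _ _ L t1 t2 cavg]) auto
  then obtain e D where e: "\<And>j k. (\<lambda>x. e x k j) \<in> borel_measurable ?P" and e0: "\<And>x k j. 0 \<le> e x k j"
    and e1: "\<And>x k. (\<Sum>j<m. e x k j) = 1"
    and D: "\<And>j k. D j k \<in> borel_measurable ?Q" and D0: "\<And>j k y. 0 \<le> D j k y"
    and D1: "\<And>j k. (\<integral>\<^sup>+y. ennreal (D j k y) \<partial>?Q) = 1"
    and out: "AE y in ?Q. (\<Sum>k<kk. \<Sum>j<m. (\<integral>x. e x k j \<partial>?P) * D j k y) / kk = 1"
    and cost: "(\<integral>\<^sup>+z. ennreal (c z) \<partial>code_joint ?P ?Q m kk e D)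
      \<le> ennreal (L + N * (2 * (sqrt (exp (n * r1) / m) + 2 * \<eta>) + (sqrt (exp (n * r2) / (real m * real kk)) + 2 * \<eta>)) + \<epsilon> / 4)"
    by (elim exE conjE) (rule that; blast)
  define dec where "dec j k = density ?Q (\<lambda>y. ennreal (D j k y))" for j k
  define J where "J = code_joint ?P ?Q m kk e D"
  have J: "coupling ?P ?P ?Q ?Q J"
    unfolding J_def by (rule code_joint_coupling[OF P Q e e0 e1 D D0 D1 out kk(1)])
  note Js[measurable_cong] = couplingD(2)[OF J]
  have cost': "(\<integral>\<^sup>+z. ennreal (c z) \<partial>J) \<le> ennreal (L + \<epsilon> / 2)"
  proof -
    have "N * (2 * (sqrt (exp (n * r1) / m) + 2 * \<eta>) + (sqrt (exp (n * r2) / (real m * real kk)) + 2 * \<eta>)) \<le> N * (9 * \<eta>)"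
      using s1 s2 N by (intro mult_left_mono) auto
    then have "L + N * (2 * (sqrt (exp (n * r1) / m) + 2 * \<eta>) + (sqrt (exp (n * r2) / (real m * real kk)) + 2 * \<eta>)) + \<epsilon> / 4 \<le> L + \<epsilon> / 2"
      using \<eta>(2) by simp
    then show ?thesis using cost unfolding J_def by (meson ennreal_leI order_trans)
  qed
  have dist: "code_distortion p \<Delta> n m kk e dec t = (\<integral>\<^sup>+z. ennreal (\<Delta> (fst z t) (snd z t)) \<partial>J)" if "t < n" for t
    unfolding code_distortion_def J_def dec_def
    using nn_integral_code_joint[OF P Q kk(1) e D, of "\<lambda>z. ennreal (\<Delta> (fst z t) (snd z t))"] \<Delta>t[OF that] by simp
  have dist_le: "code_distortion p \<Delta> n m kk e dec t \<le> (\<integral>\<^sup>+z. ennreal (min (\<Delta> (fst z t) (snd z t)) N) \<partial>J) + ennreal (\<epsilon> / 2)" if t: "t < n" for t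
  proof -
    note [measurable] = cm[OF t]
    \<comment> \<open>Law of the pair of letters at time \<open>t\<close>. Its second marginal is
      \<open>q\<close> itself because the block output is exactly i.i.d.\<close>
    define T where "T = (\<lambda>z :: (nat \<Rightarrow> 'a) \<times> (nat \<Rightarrow> 'a). (fst z t, snd z t))"
    have T: "T \<in> measurable J (p \<Otimes>\<^sub>M p)" unfolding T_def by measurable
    define \<pi> where "\<pi> = distr J (p \<Otimes>\<^sub>M p) T"
    have Jp: "prob_space J" by (rule couplingD(1)[OF J])
    have "coupling p p p q \<pi>"
      unfolding coupling_def
    proof (intro conjI)
      show "prob_space \<pi>" unfolding \<pi>_def by (rule prob_space.prob_space_distr[OF Jp T])
      show "sets \<pi> = sets (p \<Otimes>\<^sub>M p)" by (simp add: \<pi>_def)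
      have "distr \<pi> p fst = distr J p (\<lambda>z. fst z t)"
        unfolding \<pi>_def using T by (subst distr_distr) (auto simp: T_def comp_def)
      also have "\<dots> = distr (distr J ?P fst) p (\<lambda>x. x t)"
        by (subst distr_distr) (auto simp: comp_def)
      also have "\<dots> = p" unfolding couplingD(3)[OF J] using t by (intro distr_PiM_component p) auto
      finally show "distr \<pi> p fst = p" .
      have "distr \<pi> p snd = distr J q (\<lambda>z. snd z t)"
        unfolding \<pi>_def using T by (subst distr_distr) (auto simp: T_def comp_def qp intro!: distr_cong)
      also have "\<dots> = distr (distr J ?Q snd) q (\<lambda>x. x t)"
        by (subst distr_distr) (auto simp: comp_def)
      also have "\<dots> = q" unfolding couplingD(4)[OF J] using t by (intro distr_PiM_component q) auto
      finally show "distr \<pi> p snd = q" .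
    qed
    from UIN[OF this] show ?thesis
      unfolding dist[OF t] \<pi>_def using T \<Delta>m
      by (subst (asm) (1 2) nn_integral_distr) (auto simp: T_def split_beta')
  qed
  have "(\<Sum>t<n. code_distortion p \<Delta> n m kk e dec t) \<le> (\<Sum>t<n. (\<integral>\<^sup>+z. ennreal (min (\<Delta> (fst z t) (snd z t)) N) \<partial>J) + ennreal (\<epsilon> / 2))"
    by (intro sum_mono dist_le) auto
  also have "\<dots> = of_nat n * (\<integral>\<^sup>+z. ennreal (c z) \<partial>J) + of_nat n * ennreal (\<epsilon> / 2)"
  proof -
    have 1: "(\<lambda>z. ennreal (min (\<Delta> (fst z t) (snd z t)) N)) \<in> borel_measurable J" if "t < n" for t
      using \<Delta>t[OF that] by measurable
    have "(\<integral>\<^sup>+z. ennreal (c z) \<partial>J) = (\<Sum>t<n. ennreal (1 / n) * (\<integral>\<^sup>+z. ennreal (min (\<Delta> (fst z t) (snd z t)) N) \<partial>J))"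
      unfolding cs using 1 by (subst nn_integral_sum) (auto simp: nn_integral_cmult)
    then have "of_nat n * (\<integral>\<^sup>+z. ennreal (c z) \<partial>J) = (\<Sum>t<n. (\<integral>\<^sup>+z. ennreal (min (\<Delta> (fst z t) (snd z t)) N) \<partial>J))"
      using n by (simp add: sum_distrib_left[symmetric] mult.assoc[symmetric] ennreal_of_nat_eq_real_of_nat ennreal_mult[symmetric])
    then show ?thesis by (simp add: sum.distrib)
  qed
  also have "\<dots> \<le> of_nat n * ennreal (L + \<epsilon> / 2) + of_nat n * ennreal (\<epsilon> / 2)"
    by (intro add_right_mono mult_left_mono cost') auto
  also have "\<dots> = of_nat n * ennreal (L + \<epsilon>)"
    using L \<epsilon> by (simp add: distrib_left[symmetric] ennreal_plus[symmetric] add.commute del: ennreal_plus)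
  finally have "(\<Sum>t<n. code_distortion p \<Delta> n m kk e dec t) / of_nat n \<le> of_nat n * ennreal (L + \<epsilon>) / of_nat n"
    by (rule divide_right_mono_ennreal)
  also have "\<dots> = ennreal (L + \<epsilon>)" using n by (simp add: ennreal_of_nat_mult_divide)
  finally have final: "(\<Sum>t<n. code_distortion p \<Delta> n m kk e dec t) / of_nat n \<le> ennreal (L + \<epsilon>)" .
  have decp: "prob_space (dec j k)" "sets (dec j k) = sets ?P" for j k
    unfolding dec_def using D1 D QP by (auto intro!: prob_spaceI simp: emeasure_density)
  have "valid_code p n m kk e dec"
    unfolding valid_code_def using n kk(1) e e0 e1 decp by auto
  moreover have "enn2ereal ((\<Sum>t<n. code_distortion p \<Delta> n m kk e dec t) / of_nat n) \<le> ereal (L + \<epsilon>)"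
    using final L \<epsilon> by (subst enn2ereal_le_ereal_iff) auto
  moreover have "code_output_prob p n m kk e dec A = emeasure ?Q A" if "A \<in> sets ?P" for A
    unfolding code_output_prob_def dec_def
    using that QP by (intro code_output[OF P Q e e0 e1 D D0 out kk(1)]) auto
  ultimately show ?thesis
    unfolding achievable_def using m(2) kk(2) by blast
qed

section \<open>Rates attained with equality, and rate zero\<close>

lemma diff_le_xlnx: "0 \<le> t \<Longrightarrow> t - 1 \<le> t * ln (t::real)"
proof (cases "t = 0")
  case False
  assume "0 \<le> t"
  with False have t: "0 < t" by simp
  then have "ln (1 / t) \<le> 1 / t - 1" by (intro ln_le_minus_one) simp
  then have "t * ln (1 / t) \<le> t * (1 / t - 1)" using t by (intro mult_left_mono) auto
  then show ?thesis using t by (simp add: ln_div algebra_simps)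
qed simp

text \<open>Convexity of \<open>t * ln t\<close> on the segment from \<open>t\<close> to 1, where
  the function vanishes. It is obtained from \<open>ln x \<le> x - 1\<close> at
  \<open>x = w / t\<close> and at \<open>x = w\<close>.\<close>

lemma xlnx_mix_one:
  fixes s t :: real
  assumes s: "0 < s" "s < 1" and t: "0 \<le> t"
  shows "((1 - s) * t + s) * ln ((1 - s) * t + s) \<le> (1 - s) * (t * ln t)"
proof -
  define w where "w = (1 - s) * t + s"
  have "0 \<le> (1 - s) * t" using s t by simp
  then have w: "0 < w" using s by (simp add: w_def)
  have 1: "t * ln w \<le> t * ln t + (w - t)"
  proof (cases "t = 0")
    case False
    then have "0 < t" using t by simp
    then have "ln (w / t) \<le> w / t - 1" using w by (intro ln_le_minus_one) simp
    then have "t * ln (w / t) \<le> t * (w / t - 1)" using t by (rule mult_left_mono)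
    then show ?thesis using \<open>0 < t\<close> w by (simp add: ln_div algebra_simps)
  qed (use w in simp)
  have 2: "ln w \<le> w - 1" using w by (rule ln_le_minus_one)
  have "w * ln w = (1 - s) * (t * ln w) + s * ln w" by (simp add: w_def algebra_simps)
  also have "\<dots> \<le> (1 - s) * (t * ln t + (w - t)) + s * (w - 1)"
    using s by (intro add_mono mult_left_mono 1 2) auto
  also have "\<dots> = (1 - s) * (t * ln t)" by (simp add: w_def algebra_simps)
  finally show ?thesis by (simp add: w_def)
qed

text \<open>Averaging the conditional laws over \<open>u\<close> gives back \<open>p\<close>; this
  is the normalisation over \<open>u\<close>, which holds for almost all \<open>x\<close>.\<close>

lemma nn_integral_channel:
  assumes p: "prob_space p" and \<nu>: "prob_space \<nu>" and f: "channel p \<nu> f" and K[measurable]: "K \<in> borel_measurable p"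
  shows "(\<integral>\<^sup>+u. \<integral>\<^sup>+x. ennreal (f (x, u)) * K x \<partial>p \<partial>\<nu>) = (\<integral>\<^sup>+x. K x \<partial>p)"
proof -
  interpret p: prob_space p by fact
  interpret \<nu>: prob_space \<nu> by fact
  interpret pair_sigma_finite p \<nu> by standard
  note [measurable] = channelD(1)[OF f]
  have "(\<integral>\<^sup>+u. \<integral>\<^sup>+x. ennreal (f (x, u)) * K x \<partial>p \<partial>\<nu>) = (\<integral>\<^sup>+x. \<integral>\<^sup>+u. ennreal (f (x, u)) * K x \<partial>\<nu> \<partial>p)"
    by (rule Fubini') measurable
  also have "\<dots> = (\<integral>\<^sup>+x. (\<integral>\<^sup>+u. ennreal (f (x, u)) \<partial>\<nu>) * K x \<partial>p)"
    by (intro nn_integral_cong nn_integral_multc) measurable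
  also have "\<dots> = (\<integral>\<^sup>+x. K x \<partial>p)"
    using channelD(4)[OF f] by (intro nn_integral_cong_AE) auto
  finally show ?thesis .
qed

lemma integral_channel_eq_one:
  assumes "prob_space p" "prob_space \<nu>" "channel p \<nu> f"
  shows "(\<integral>\<^sup>+z. ennreal (f z) \<partial>(p \<Otimes>\<^sub>M \<nu>)) = 1"
proof -
  interpret p: prob_space p by fact
  interpret \<nu>: prob_space \<nu> by fact
  interpret pair_prob_space p \<nu> by standard
  show ?thesis using channelD(1,3)[OF assms(3)]
    by (subst nn_integral_snd[symmetric]) (auto simp: \<nu>.emeasure_space_1 cong: nn_integral_cong)
qed

text \<open>The density 1 belongs to an independent pair and carries no information, so convexity
  shrinks the information by the factor \<open>1 - s\<close>. A positive rate met with equality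
  thereby becomes strict.\<close>

lemma channel_mix:
  assumes p: "prob_space p" and \<nu>: "prob_space \<nu>" and f: "channel p \<nu> f" and s: "0 < s" "s < 1"
    and fi: "integrable (p \<Otimes>\<^sub>M \<nu>) (\<lambda>z. f z * ln (f z))"
    and fs_def: "fs = (\<lambda>z. (1 - s) * f z + s)"
  shows "channel p \<nu> fs" "integrable (p \<Otimes>\<^sub>M \<nu>) (\<lambda>z. fs z * ln (fs z))"
    "(\<integral>z. fs z * ln (fs z) \<partial>(p \<Otimes>\<^sub>M \<nu>)) \<le> (1 - s) * (\<integral>z. f z * ln (f z) \<partial>(p \<Otimes>\<^sub>M \<nu>))"
proof -
  interpret p: prob_space p by fact
  interpret \<nu>: prob_space \<nu> by fact
  interpret pair_prob_space p \<nu> by standard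
  note fm[measurable] = channelD(1)[OF f] and f0 = channelD(2)[OF f]
  have fs[measurable]: "fs \<in> borel_measurable (p \<Otimes>\<^sub>M \<nu>)" unfolding fs_def by measurable
  have fs0: "0 \<le> fs z" for z unfolding fs_def using f0 s by simp
  have e: "ennreal (fs z) = ennreal (1 - s) * ennreal (f z) + ennreal s" for z
    unfolding fs_def using s f0 by (simp add: ennreal_plus ennreal_mult)
  have ss: "ennreal (1 - s) + ennreal s = 1" using s by (simp add: ennreal_plus[symmetric] del: ennreal_plus)
  show "channel p \<nu> fs"
    unfolding channel_def
  proof (intro conjI allI ballI fs fs0)
    fix u assume u[measurable]: "u \<in> space \<nu>"
    have "(\<integral>\<^sup>+x. ennreal (fs (x, u)) \<partial>p) = ennreal (1 - s) * (\<integral>\<^sup>+x. ennreal (f (x, u)) \<partial>p) + ennreal s"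
      unfolding e by (simp add: nn_integral_add nn_integral_cmult p.emeasure_space_1)
    then show "(\<integral>\<^sup>+x. ennreal (fs (x, u)) \<partial>p) = 1" using channelD(3)[OF f u] ss by simp
  next
    show "AE x in p. (\<integral>\<^sup>+u. ennreal (fs (x, u)) \<partial>\<nu>) = 1"
      using channelD(4)[OF f] AE_space
    proof eventually_elim
      case (elim x)
      note [measurable] = elim(2)
      have "(\<integral>\<^sup>+u. ennreal (fs (x, u)) \<partial>\<nu>) = ennreal (1 - s) * (\<integral>\<^sup>+u. ennreal (f (x, u)) \<partial>\<nu>) + ennreal s"
        unfolding e by (simp add: nn_integral_add nn_integral_cmult \<nu>.emeasure_space_1)
      then show ?case using elim ss by simp
    qed
  qed
  have le: "fs z * ln (fs z) \<le> (1 - s) * (f z * ln (f z))" for z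
    unfolding fs_def using s f0 by (intro xlnx_mix_one) auto
  have ge: "- 1 \<le> fs z * ln (fs z)" for z using diff_le_xlnx[OF fs0[of z]] fs0[of z] by linarith
  show i: "integrable (p \<Otimes>\<^sub>M \<nu>) (\<lambda>z. fs z * ln (fs z))"
  proof (rule Bochner_Integration.integrable_bound[of _ "\<lambda>z. 1 + \<bar>(1 - s) * (f z * ln (f z))\<bar>"])
    show "integrable (p \<Otimes>\<^sub>M \<nu>) (\<lambda>z. 1 + \<bar>(1 - s) * (f z * ln (f z))\<bar>)" using fi by simp
    show "AE z in p \<Otimes>\<^sub>M \<nu>. norm (fs z * ln (fs z)) \<le> norm (1 + \<bar>(1 - s) * (f z * ln (f z))\<bar>)"
    proof (rule AE_I2)
      fix z show "norm (fs z * ln (fs z)) \<le> norm (1 + \<bar>(1 - s) * (f z * ln (f z))\<bar>)"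
        unfolding real_norm_def using le[of z] ge[of z] by linarith
    qed
  qed measurable
  have "(\<integral>z. fs z * ln (fs z) \<partial>(p \<Otimes>\<^sub>M \<nu>)) \<le> (\<integral>z. (1 - s) * (f z * ln (f z)) \<partial>(p \<Otimes>\<^sub>M \<nu>))"
    using i fi le by (intro integral_mono) auto
  then show "(\<integral>z. fs z * ln (fs z) \<partial>(p \<Otimes>\<^sub>M \<nu>)) \<le> (1 - s) * (\<integral>z. f z * ln (f z) \<partial>(p \<Otimes>\<^sub>M \<nu>))" by simp
qed

text \<open>\<open>t * ln t - (t - 1)\<close> is nonnegative for \<open>t \<ge> 0\<close> and
  vanishes only at \<open>t = 1\<close>; its integral is the information, because \<open>f\<close>
  has mean 1.\<close>

lemma channel_zero_info:
  assumes p: "prob_space p" and \<nu>: "prob_space \<nu>" and f: "channel p \<nu> f"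
    and fi: "integrable (p \<Otimes>\<^sub>M \<nu>) (\<lambda>z. f z * ln (f z))"
    and le: "(\<integral>z. f z * ln (f z) \<partial>(p \<Otimes>\<^sub>M \<nu>)) \<le> 0"
  shows "AE z in p \<Otimes>\<^sub>M \<nu>. f z = 1"
proof -
  interpret p: prob_space p by fact
  interpret \<nu>: prob_space \<nu> by fact
  interpret pair_prob_space p \<nu> by standard
  note fm[measurable] = channelD(1)[OF f] and f0 = channelD(2)[OF f]
  note one = integral_channel_eq_one[OF p \<nu> f]
  have i: "integrable (p \<Otimes>\<^sub>M \<nu>) f" using one f0 by (intro integrableI_nonneg) auto
  have I: "(\<integral>z. f z \<partial>(p \<Otimes>\<^sub>M \<nu>)) = 1" using one f0 by (simp add: integral_eq_nn_integral)
  define h where "h z = f z * ln (f z) - (f z - 1)" for z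
  have h0: "0 \<le> h z" for z unfolding h_def using diff_le_xlnx[OF f0[of z]] by simp
  have hi: "integrable (p \<Otimes>\<^sub>M \<nu>) h" unfolding h_def using fi i by simp
  have "(\<integral>z. h z \<partial>(p \<Otimes>\<^sub>M \<nu>)) = (\<integral>z. f z * ln (f z) \<partial>(p \<Otimes>\<^sub>M \<nu>))"
    unfolding h_def using fi i I by (simp add: prob_space)
  then have "(\<integral>z. h z \<partial>(p \<Otimes>\<^sub>M \<nu>)) = 0"
  proof -
    have "0 \<le> (\<integral>z. h z \<partial>(p \<Otimes>\<^sub>M \<nu>))" using h0 by simp
    then show ?thesis using le \<open>(\<integral>z. h z \<partial>(p \<Otimes>\<^sub>M \<nu>)) = _\<close> by linarith
  qed
  then have "AE z in p \<Otimes>\<^sub>M \<nu>. h z = 0"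
    using integral_nonneg_eq_0_iff_AE[OF hi] h0 by simp
  then show ?thesis
  proof eventually_elim
    case (elim z)
    show ?case
    proof (cases "f z = 0")
      case False
      then have pos: "0 < f z" using f0[of z] by (simp add: less_le)
      have "ln (1 / f z) = 1 / f z - 1" using elim pos by (simp add: h_def ln_div field_simps)
      then have "1 / f z = 1" using pos by (intro ln_eq_minus_one) auto
      then show ?thesis using pos by simp
    qed (use elim in \<open>simp add: h_def\<close>)
  qed
qed

lemma opt_distortion_le: "achievable M p q \<Delta> R Rc D \<Longrightarrow> opt_distortion M p q \<Delta> R Rc \<le> ereal D"
  unfolding opt_distortion_def by (rule Inf_lower) simp

text \<open>Block length 1, one message and one seed: the decoder draws from \<open>q\<close>
  without looking at the source.\<close>

lemma achievable_product:
  fixes \<Delta> :: "'a \<Rightarrow> 'a \<Rightarrow> real"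
  assumes p: "prob_space p" and q: "prob_space q" and qp: "sets q = sets p"
    and \<Delta>m: "(\<lambda>(x, y). \<Delta> x y) \<in> borel_measurable (p \<Otimes>\<^sub>M p)"
    and R: "0 \<le> R" "0 \<le> Rc" and L: "0 \<le> L"
    and avg: "(\<integral>\<^sup>+x. \<integral>\<^sup>+y. ennreal (\<Delta> x y) \<partial>q \<partial>p) \<le> ennreal L"
  shows "achievable p p q \<Delta> R Rc L"
proof -
  interpret p: prob_space p by fact
  interpret q: prob_space q by fact
  let ?I = "{..<Suc 0}"
  have P: "prob_space (PiM ?I (\<lambda>_. p))" and Q: "prob_space (PiM ?I (\<lambda>_. q))" by (intro prob_space_PiM p q)+
  interpret P: prob_space "PiM ?I (\<lambda>_. p)" by fact
  have \<Delta>m'[measurable]: "(\<lambda>(x, y). \<Delta> x y) \<in> borel_measurable (p \<Otimes>\<^sub>M q)"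
    using \<Delta>m qp by (simp cong: measurable_cong_sets sets_pair_measure_cong)
  have QP: "sets (PiM ?I (\<lambda>_. q)) = sets (PiM ?I (\<lambda>_. p))" using qp by (intro sets_PiM_cong) auto
  define e where "e = (\<lambda>(x::nat \<Rightarrow> 'a) (k::nat) (j::nat). 1 :: real)"
  define dec where "dec = (\<lambda>(j::nat) (k::nat). PiM ?I (\<lambda>_. q))"
  have "code_distortion p \<Delta> 1 1 1 e dec 0 = (\<integral>\<^sup>+x. \<integral>\<^sup>+y. ennreal (\<Delta> (x 0) (y 0)) \<partial>PiM ?I (\<lambda>_. q) \<partial>PiM ?I (\<lambda>_. p))"
    by (simp add: code_distortion_def e_def dec_def divide_ennreal_def)
  also have "\<dots> = (\<integral>\<^sup>+x. \<integral>\<^sup>+y. ennreal (\<Delta> (x 0) y) \<partial>q \<partial>PiM ?I (\<lambda>_. p))"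
  proof (rule nn_integral_cong)
    fix x assume "x \<in> space (PiM ?I (\<lambda>_. p))"
    then have "x 0 \<in> space p" by (auto simp: space_PiM PiE_iff)
    then show "(\<integral>\<^sup>+y. ennreal (\<Delta> (x 0) (y 0)) \<partial>PiM ?I (\<lambda>_. q)) = (\<integral>\<^sup>+y. ennreal (\<Delta> (x 0) y) \<partial>q)"
      by (intro nn_integral_PiM_component[OF q, of 0 ?I "\<lambda>y. ennreal (\<Delta> (x 0) y)"]) auto
  qed
  also have "\<dots> = (\<integral>\<^sup>+x. \<integral>\<^sup>+y. ennreal (\<Delta> x y) \<partial>q \<partial>p)"
    by (rule nn_integral_PiM_component[OF p, of 0 ?I "\<lambda>x. \<integral>\<^sup>+y. ennreal (\<Delta> x y) \<partial>q"]) auto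
  finally have d: "code_distortion p \<Delta> 1 1 1 e dec 0 \<le> ennreal L" using avg by simp
  have "valid_code p 1 1 1 e dec" using Q QP by (auto simp: valid_code_def e_def dec_def)
  moreover have "code_output_prob p 1 1 1 e dec A = emeasure (PiM {..<1} (\<lambda>_. q)) A" for A
    by (simp add: code_output_prob_def e_def dec_def P.emeasure_space_1 divide_ennreal_def)
  ultimately show ?thesis
    unfolding achievable_def using R d L
    by (intro exI[of _ "1::nat"] exI[of _ e] exI[of _ dec]) (auto simp: enn2ereal_le_ereal_iff divide_ennreal_def)
qed

abbreviation avg_distortion :: "'a measure \<Rightarrow> 'a measure \<Rightarrow> 'u measure \<Rightarrow> ('a \<times> 'u \<Rightarrow> real) \<Rightarrow> ('a \<times> 'u \<Rightarrow> real)
    \<Rightarrow> ('a \<Rightarrow> 'a \<Rightarrow> real) \<Rightarrow> ennreal" where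
  "avg_distortion p q \<nu> f g \<Delta> \<equiv>
    (\<integral>\<^sup>+u. \<integral>\<^sup>+x. \<integral>\<^sup>+y. ennreal (f (x, u)) * (ennreal (\<Delta> x y) * ennreal (g (y, u))) \<partial>q \<partial>p \<partial>\<nu>)"

text \<open>Mixing both densities with 1 adds at most \<open>3 * s * A0\<close> to the distortion,
  where \<open>A0\<close> is that of an independent pair. Uniform integrability makes
  \<open>A0\<close> finite, so the addition vanishes with \<open>s\<close>.\<close>

lemma achievability:
  fixes \<Delta> :: "'a \<Rightarrow> 'a \<Rightarrow> real" and \<nu> :: "'u measure"
  assumes p: "prob_space p" and q: "prob_space q" and qp: "sets q = sets p" and \<nu>: "prob_space \<nu>"
    and \<Delta>0: "\<And>x y. 0 \<le> \<Delta> x y" and \<Delta>m: "(\<lambda>(x, y). \<Delta> x y) \<in> borel_measurable (p \<Otimes>\<^sub>M p)"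
    and UI: "unif_integrable p p q \<Delta>"
    and f: "channel p \<nu> f" and g: "channel q \<nu> g"
    and fi: "integrable (p \<Otimes>\<^sub>M \<nu>) (\<lambda>z. f z * ln (f z))" and gi: "integrable (q \<Otimes>\<^sub>M \<nu>) (\<lambda>z. g z * ln (g z))"
    and fR: "(\<integral>z. f z * ln (f z) \<partial>(p \<Otimes>\<^sub>M \<nu>)) \<le> R" and gR: "(\<integral>z. g z * ln (g z) \<partial>(q \<Otimes>\<^sub>M \<nu>)) \<le> R + Rc"
    and R: "0 \<le> R" "0 \<le> Rc"
  shows "opt_distortion p p q \<Delta> R Rc \<le> enn2ereal (avg_distortion p q \<nu> f g \<Delta>)"
proof (cases "avg_distortion p q \<nu> f g \<Delta> = \<infinity>")
  case False
  interpret p: prob_space p by fact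
  interpret q: prob_space q by fact
  interpret \<nu>: prob_space \<nu> by fact
  interpret pq: pair_sigma_finite p q by standard
  interpret pn: pair_sigma_finite p \<nu> by standard
  note fm[measurable] = channelD(1)[OF f] and gm[measurable] = channelD(1)[OF g]
  note f0 = channelD(2)[OF f] and g0 = channelD(2)[OF g]
  have \<Delta>m'[measurable]: "(\<lambda>(x, y). \<Delta> x y) \<in> borel_measurable (p \<Otimes>\<^sub>M q)"
    using \<Delta>m qp by (simp cong: measurable_cong_sets sets_pair_measure_cong)
  define L where "L = enn2real (avg_distortion p q \<nu> f g \<Delta>)"
  have L: "avg_distortion p q \<nu> f g \<Delta> = ennreal L" "0 \<le> L" using False by (auto simp: L_def less_top)
  define A0 where "A0 = (\<integral>\<^sup>+x. \<integral>\<^sup>+y. ennreal (\<Delta> x y) \<partial>q \<partial>p)"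
  have f_avg: "(\<integral>\<^sup>+u. \<integral>\<^sup>+x. \<integral>\<^sup>+y. ennreal (f (x, u)) * ennreal (\<Delta> x y) \<partial>q \<partial>p \<partial>\<nu>) = A0"
  proof -
    have "(\<integral>\<^sup>+u. \<integral>\<^sup>+x. \<integral>\<^sup>+y. ennreal (f (x, u)) * ennreal (\<Delta> x y) \<partial>q \<partial>p \<partial>\<nu>)
      = (\<integral>\<^sup>+u. \<integral>\<^sup>+x. ennreal (f (x, u)) * (\<integral>\<^sup>+y. ennreal (\<Delta> x y) \<partial>q) \<partial>p \<partial>\<nu>)"
      by (intro nn_integral_cong nn_integral_cmult) measurable
    also have "\<dots> = A0" unfolding A0_def by (rule nn_integral_channel[OF p \<nu> f]) measurable
    finally show ?thesis .
  qed
  have g_avg: "(\<integral>\<^sup>+u. \<integral>\<^sup>+x. \<integral>\<^sup>+y. ennreal (\<Delta> x y) * ennreal (g (y, u)) \<partial>q \<partial>p \<partial>\<nu>) = A0"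
  proof -
    have "(\<integral>\<^sup>+u. \<integral>\<^sup>+x. \<integral>\<^sup>+y. ennreal (\<Delta> x y) * ennreal (g (y, u)) \<partial>q \<partial>p \<partial>\<nu>)
      = (\<integral>\<^sup>+u. \<integral>\<^sup>+y. \<integral>\<^sup>+x. ennreal (\<Delta> x y) * ennreal (g (y, u)) \<partial>p \<partial>q \<partial>\<nu>)"
      by (intro nn_integral_cong pq.Fubini'[symmetric]) measurable
    also have "\<dots> = (\<integral>\<^sup>+u. \<integral>\<^sup>+y. ennreal (g (y, u)) * (\<integral>\<^sup>+x. ennreal (\<Delta> x y) \<partial>p) \<partial>q \<partial>\<nu>)"
      by (intro nn_integral_cong) (subst nn_integral_multc, auto simp: mult.commute)
    also have "\<dots> = (\<integral>\<^sup>+y. \<integral>\<^sup>+x. ennreal (\<Delta> x y) \<partial>p \<partial>q)" by (rule nn_integral_channel[OF q \<nu> g]) measurable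
    also have "\<dots> = A0" unfolding A0_def by (rule pq.Fubini') measurable
    finally show ?thesis .
  qed
  show ?thesis
  proof (cases "R = 0")
    case True
    \<comment> \<open>Zero information cannot be made strictly smaller. It forces
      \<open>f = 1\<close> almost everywhere, so the distortion is \<open>A0\<close> whatever
      \<open>g\<close> is, and the product code attains it.\<close>
    have one: "AE z in p \<Otimes>\<^sub>M \<nu>. f z = 1" using channel_zero_info[OF p \<nu> f fi] fR True by simp
    define K where "K z = (\<integral>\<^sup>+y. ennreal (\<Delta> (fst z) y) * ennreal (g (y, snd z)) \<partial>q)" for z
    have K[measurable]: "K \<in> borel_measurable (p \<Otimes>\<^sub>M \<nu>)" unfolding K_def by measurable
    have "avg_distortion p q \<nu> f g \<Delta> = (\<integral>\<^sup>+u. \<integral>\<^sup>+x. ennreal (f (x, u)) * K (x, u) \<partial>p \<partial>\<nu>)"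
      unfolding K_def fst_conv snd_conv by (intro nn_integral_cong nn_integral_cmult) measurable
    also have "\<dots> = (\<integral>\<^sup>+z. ennreal (f z) * K z \<partial>(p \<Otimes>\<^sub>M \<nu>))" by (rule pn.nn_integral_snd) measurable
    also have "\<dots> = (\<integral>\<^sup>+z. K z \<partial>(p \<Otimes>\<^sub>M \<nu>))" using one by (intro nn_integral_cong_AE) auto
    also have "\<dots> = (\<integral>\<^sup>+u. \<integral>\<^sup>+x. K (x, u) \<partial>p \<partial>\<nu>)" by (rule pn.nn_integral_snd[symmetric]) measurable
    also have "\<dots> = A0" using g_avg by (simp add: K_def)
    finally have "achievable p p q \<Delta> R Rc L"
      using L by (intro achievable_product p q qp \<Delta>m R) (auto simp: A0_def)
    then show ?thesis using opt_distortion_le L by (simp add: enn2ereal_ennreal)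
  next
    case False
    then have Rpos: "0 < R" "0 < R + Rc" using R by auto
    \<comment> \<open>Truncation with error 1, applied to the product coupling, gives
      \<open>A0 \<le> N + 1\<close>.\<close>
    obtain N where N: "N > 0" and UIN: "\<And>\<pi>. coupling p p p q \<pi> \<Longrightarrow>
      (\<integral>\<^sup>+z. ennreal (\<Delta> (fst z) (snd z)) \<partial>\<pi>) \<le> (\<integral>\<^sup>+z. ennreal (min (\<Delta> (fst z) (snd z)) N) \<partial>\<pi>) + ennreal 1"
      using unif_integrable_truncate[OF p q refl qp \<Delta>0 \<Delta>m UI, of 1] by auto
    have cpl: "coupling p p p q (p \<Otimes>\<^sub>M q)" using coupling_product[OF p q] qp by simp
    interpret PQ: prob_space "p \<Otimes>\<^sub>M q" by (rule couplingD(1)[OF cpl])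
    have "A0 = (\<integral>\<^sup>+z. ennreal (\<Delta> (fst z) (snd z)) \<partial>(p \<Otimes>\<^sub>M q))"
      unfolding A0_def by (subst q.nn_integral_fst[symmetric]) (use \<Delta>m' in \<open>auto simp: split_beta'\<close>)
    also have "\<dots> \<le> (\<integral>\<^sup>+z. ennreal (min (\<Delta> (fst z) (snd z)) N) \<partial>(p \<Otimes>\<^sub>M q)) + ennreal 1" by (rule UIN[OF cpl])
    also have "\<dots> \<le> (\<integral>\<^sup>+z. ennreal N \<partial>(p \<Otimes>\<^sub>M q)) + ennreal 1"
      by (intro add_right_mono nn_integral_mono ennreal_leI) auto
    also have "\<dots> = ennreal (N + 1)" using N by (simp add: PQ.emeasure_space_1 ennreal_plus)
    finally have A0: "A0 \<le> ennreal (N + 1)" .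
    have ach: "achievable p p q \<Delta> R Rc (L + \<epsilon>)" if \<epsilon>: "0 < \<epsilon>" for \<epsilon>
    proof -
      \<comment> \<open>Makes the added distortion \<open>3 * s * (N + 1)\<close> at most
        \<open>\<epsilon> / 2\<close>; the other half is left to
        \<open>achievability_strict\<close>. The cap \<open>1 / 2\<close> keeps \<open>s\<close>
        below 1.\<close>
      define s where "s = min (1 / 2) (\<epsilon> / (6 * (N + 1)))"
      have s: "0 < s" "s < 1" using \<epsilon> N by (auto simp: s_def)
      have sN: "3 * (s * (N + 1)) \<le> \<epsilon> / 2"
      proof -
        have "s * (N + 1) \<le> \<epsilon> / (6 * (N + 1)) * (N + 1)" using N by (intro mult_right_mono) (auto simp: s_def)
        also have "\<dots> = \<epsilon> / 6" using N by (simp add: field_simps)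
        finally show ?thesis by linarith
      qed
      define fs gs where "fs = (\<lambda>z. (1 - s) * f z + s)" and "gs = (\<lambda>z. (1 - s) * g z + s)"
      note F = channel_mix[OF p \<nu> f s fi fs_def] and G = channel_mix[OF q \<nu> g s gi gs_def]
      have FR: "(\<integral>z. fs z * ln (fs z) \<partial>(p \<Otimes>\<^sub>M \<nu>)) < R"
      proof -
        have "(\<integral>z. fs z * ln (fs z) \<partial>(p \<Otimes>\<^sub>M \<nu>)) \<le> (1 - s) * R"
          by (rule order_trans[OF F(3) mult_left_mono[OF fR]]) (use s in simp)
        also have "\<dots> < R" using s Rpos by simp
        finally show ?thesis .
      qed
      have GR: "(\<integral>z. gs z * ln (gs z) \<partial>(q \<Otimes>\<^sub>M \<nu>)) < R + Rc"
      proof -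
        have "(\<integral>z. gs z * ln (gs z) \<partial>(q \<Otimes>\<^sub>M \<nu>)) \<le> (1 - s) * (R + Rc)"
          by (rule order_trans[OF G(3) mult_left_mono[OF gR]]) (use s in simp)
        also have "\<dots> < R + Rc" using s Rpos by simp
        finally show ?thesis .
      qed
      \<comment> \<open>Majorant from expanding the product of the two mixtures, with
        \<open>1 - s\<close> and one factor \<open>s\<close> of the last term replaced by 1.\<close>
      define H where "H u x y = ennreal (f (x, u)) * (ennreal (\<Delta> x y) * ennreal (g (y, u)))
        + ennreal s * (ennreal (f (x, u)) * ennreal (\<Delta> x y)) + ennreal s * (ennreal (\<Delta> x y) * ennreal (g (y, u)))
        + ennreal s * ennreal (\<Delta> x y)" for u x y
      have pt: "ennreal (fs (x, u)) * (ennreal (\<Delta> x y) * ennreal (gs (y, u))) \<le> H u x y" for u x y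
      proof -
        have a: "fs (x, u) * gs (y, u) \<le> f (x, u) * g (y, u) + s * f (x, u) + s * g (y, u) + s"
        proof -
          have "fs (x, u) * gs (y, u) = (1 - s) * (1 - s) * (f (x, u) * g (y, u)) + (1 - s) * (s * f (x, u)) + (1 - s) * (s * g (y, u)) + s * s"
            by (simp add: fs_def gs_def algebra_simps)
          also have "\<dots> \<le> 1 * (f (x, u) * g (y, u)) + 1 * (s * f (x, u)) + 1 * (s * g (y, u)) + s * 1"
            using s f0 g0 by (intro add_mono mult_right_mono mult_left_mono) (auto simp: mult_le_one)
          finally show ?thesis by simp
        qed
        have "ennreal (fs (x, u)) * (ennreal (\<Delta> x y) * ennreal (gs (y, u))) = ennreal (\<Delta> x y * (fs (x, u) * gs (y, u)))"
          using \<Delta>0 channelD(2)[OF F(1)] channelD(2)[OF G(1)] by (simp add: ennreal_mult mult_ac)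
        also have "\<dots> \<le> ennreal (\<Delta> x y * (f (x, u) * g (y, u) + s * f (x, u) + s * g (y, u) + s))"
          using \<Delta>0 a by (intro ennreal_leI mult_left_mono) auto
        also have "\<dots> = H u x y"
          unfolding H_def using \<Delta>0 f0 g0 s
          by (simp add: ennreal_mult[symmetric] ennreal_plus[symmetric] del: ennreal_plus) (simp add: algebra_simps)
        finally show ?thesis .
      qed
      have "avg_distortion p q \<nu> fs gs \<Delta> \<le> (\<integral>\<^sup>+u. \<integral>\<^sup>+x. \<integral>\<^sup>+y. H u x y \<partial>q \<partial>p \<partial>\<nu>)"
        by (intro nn_integral_mono pt)
      also have "\<dots> = avg_distortion p q \<nu> f g \<Delta> + ennreal s * A0 + ennreal s * A0 + ennreal s * A0"
      proof -
        define h1 where "h1 = (\<lambda>z. ennreal (f (fst (snd z), fst z)) * (ennreal (\<Delta> (fst (snd z)) (snd (snd z))) * ennreal (g (snd (snd z), fst z))))"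
        define h2 where "h2 = (\<lambda>z. ennreal (f (fst (snd z), fst z)) * ennreal (\<Delta> (fst (snd z)) (snd (snd z))))"
        define h3 where "h3 = (\<lambda>z. ennreal (\<Delta> (fst (snd z)) (snd (snd z))) * ennreal (g (snd (snd z), fst z)))"
        define h4 where "h4 = (\<lambda>z :: 'u \<times> 'a \<times> 'a. ennreal (\<Delta> (fst (snd z)) (snd (snd z))))"
        have \<Delta>': "(\<lambda>z. ennreal (\<Delta> (fst z) (snd z))) \<in> borel_measurable (p \<Otimes>\<^sub>M q)" using \<Delta>m' by (simp add: split_beta')
        have [measurable]: "(\<lambda>z. ennreal (\<Delta> (fst (snd z)) (snd (snd z)))) \<in> borel_measurable (\<nu> \<Otimes>\<^sub>M (p \<Otimes>\<^sub>M q))"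
          using measurable_compose[OF measurable_snd \<Delta>'] .
        have m: "h1 \<in> borel_measurable (\<nu> \<Otimes>\<^sub>M (p \<Otimes>\<^sub>M q))" "h2 \<in> borel_measurable (\<nu> \<Otimes>\<^sub>M (p \<Otimes>\<^sub>M q))"
          "h3 \<in> borel_measurable (\<nu> \<Otimes>\<^sub>M (p \<Otimes>\<^sub>M q))" "h4 \<in> borel_measurable (\<nu> \<Otimes>\<^sub>M (p \<Otimes>\<^sub>M q))"
          unfolding h1_def h2_def h3_def h4_def by measurable
        note [measurable] = m
        have "(\<integral>\<^sup>+u. \<integral>\<^sup>+x. \<integral>\<^sup>+y. H u x y \<partial>q \<partial>p \<partial>\<nu>) = (\<integral>\<^sup>+u. \<integral>\<^sup>+x. \<integral>\<^sup>+y. (\<lambda>z. h1 z + ennreal s * h2 z + ennreal s * h3 z + ennreal s * h4 z) (u, x, y) \<partial>q \<partial>p \<partial>\<nu>)"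
          by (simp add: H_def h1_def h2_def h3_def h4_def)
        also have "\<dots> = (\<integral>\<^sup>+z. h1 z + ennreal s * h2 z + ennreal s * h3 z + ennreal s * h4 z \<partial>(\<nu> \<Otimes>\<^sub>M (p \<Otimes>\<^sub>M q)))"
          by (rule nn_integral_triple[OF p q]) measurable
        also have "\<dots> = integral\<^sup>N (\<nu> \<Otimes>\<^sub>M (p \<Otimes>\<^sub>M q)) h1 + ennreal s * integral\<^sup>N (\<nu> \<Otimes>\<^sub>M (p \<Otimes>\<^sub>M q)) h2
            + ennreal s * integral\<^sup>N (\<nu> \<Otimes>\<^sub>M (p \<Otimes>\<^sub>M q)) h3 + ennreal s * integral\<^sup>N (\<nu> \<Otimes>\<^sub>M (p \<Otimes>\<^sub>M q)) h4"
          by (simp add: nn_integral_add nn_integral_cmult)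
        also have "integral\<^sup>N (\<nu> \<Otimes>\<^sub>M (p \<Otimes>\<^sub>M q)) h1 = avg_distortion p q \<nu> f g \<Delta>"
          using nn_integral_triple[OF p q m(1)] by (simp add: h1_def)
        also have "integral\<^sup>N (\<nu> \<Otimes>\<^sub>M (p \<Otimes>\<^sub>M q)) h2 = A0"
          using nn_integral_triple[OF p q m(2)] f_avg by (simp add: h2_def)
        also have "integral\<^sup>N (\<nu> \<Otimes>\<^sub>M (p \<Otimes>\<^sub>M q)) h3 = A0"
          using nn_integral_triple[OF p q m(3)] g_avg by (simp add: h3_def)
        also have "integral\<^sup>N (\<nu> \<Otimes>\<^sub>M (p \<Otimes>\<^sub>M q)) h4 = A0"
          using nn_integral_triple[OF p q m(4)] by (simp add: h4_def A0_def \<nu>.emeasure_space_1)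
        finally show ?thesis .
      qed
      also have "\<dots> \<le> ennreal L + ennreal s * ennreal (N + 1) + ennreal s * ennreal (N + 1) + ennreal s * ennreal (N + 1)"
        using L(1) A0 by (intro add_mono mult_left_mono) auto
      also have "\<dots> = ennreal (L + 3 * (s * (N + 1)))"
        using L(2) s N by (simp add: ennreal_mult[symmetric] ennreal_plus[symmetric] del: ennreal_plus)
      also have "\<dots> \<le> ennreal (L + \<epsilon> / 2)" using sN by (intro ennreal_leI) simp
      finally have avg: "avg_distortion p q \<nu> fs gs \<Delta> \<le> ennreal (L + \<epsilon> / 2)" .
      have "achievable p p q \<Delta> R Rc (L + \<epsilon> / 2 + \<epsilon> / 2)"
        using L(2) \<epsilon> by (intro achievability_strict[OF p q qp \<nu> \<Delta>0 \<Delta>m UI F(1) G(1) F(2) G(2) FR GR R _ _ avg]) auto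
      then show ?thesis by (simp add: add.commute)
    qed
    have "opt_distortion p p q \<Delta> R Rc \<le> ereal L + ereal \<epsilon>" if "0 < \<epsilon>" for \<epsilon>
      using opt_distortion_le[OF ach[OF that]] by simp
    then have "opt_distortion p p q \<Delta> R Rc \<le> ereal L" by (rule ereal_le_epsilon2[rule_format])
    then show ?thesis unfolding L(1) using L(2) by (simp add: enn2ereal_ennreal)
  qed
qed simp

section \<open>Mutual information and conditional expectation\<close>

text \<open>The Radon-Nikodym derivative agrees with \<open>f\<close> only almost everywhere under
  \<open>Q\<close>; absolute continuity carries this over to the measure under which the logarithm
  is integrated.\<close>

lemma KL_div_density:
  assumes Q: "prob_space Q" and f[measurable]: "f \<in> borel_measurable Q" and f0: "\<And>z. 0 \<le> f z"
    and f1: "(\<integral>\<^sup>+z. ennreal (f z) \<partial>Q) = 1"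
    and fi: "integrable Q (\<lambda>z. f z * ln (f z))"
  shows "KL_div (density Q (\<lambda>z. ennreal (f z))) Q = ennreal (\<integral>z. f z * ln (f z) \<partial>Q)"
proof -
  interpret Q: prob_space Q by fact
  let ?P = "density Q (\<lambda>z. ennreal (f z))"
  have ac: "absolutely_continuous Q ?P" by (rule absolutely_continuousI_density) measurable
  have "AE z in Q. ennreal (f z) = RN_deriv Q ?P z" by (rule Q.RN_deriv_unique) auto
  then have "AE z in Q. ln (enn2real (RN_deriv Q ?P z)) = ln (f z)"
    by eventually_elim (use f0 in \<open>metis enn2real_ennreal\<close>)
  then have ae: "AE z in ?P. ln (enn2real (RN_deriv Q ?P z)) = ln (f z)"
    by (intro absolutely_continuous_AE[OF _ ac]) auto
  have m: "(\<lambda>z. ln (enn2real (RN_deriv Q ?P z))) \<in> borel_measurable ?P" by measurable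
  have i: "integrable ?P (\<lambda>z. ln (f z))" using fi f0 by (subst integrable_density) auto
  have "integrable ?P (\<lambda>z. ln (enn2real (RN_deriv Q ?P z)))"
    using i ae m by (subst integrable_cong_AE[where g="\<lambda>z. ln (f z)"]) auto
  moreover have "(\<integral>z. ln (enn2real (RN_deriv Q ?P z)) \<partial>?P) = (\<integral>z. ln (f z) \<partial>?P)"
    using ae m by (intro integral_cong_AE) auto
  moreover have "(\<integral>z. ln (f z) \<partial>?P) = (\<integral>z. f z * ln (f z) \<partial>Q)"
    using f0 by (subst integral_density) auto
  ultimately show ?thesis using ac by (simp add: KL_div_def)
qed

text \<open>The two normalisations of a channel are exactly the two marginal conditions.\<close>

lemma channel_marginals:
  assumes p: "prob_space p" and \<nu>: "prob_space \<nu>" and f: "channel p \<nu> f"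
    and S: "sets S = sets p" and T: "sets T = sets \<nu>"
  shows "prob_space (density (p \<Otimes>\<^sub>M \<nu>) (\<lambda>z. ennreal (f z)))"
    "distr (density (p \<Otimes>\<^sub>M \<nu>) (\<lambda>z. ennreal (f z))) S fst = p"
    "distr (density (p \<Otimes>\<^sub>M \<nu>) (\<lambda>z. ennreal (f z))) T snd = \<nu>"
proof -
  interpret p: prob_space p by fact
  interpret \<nu>: prob_space \<nu> by fact
  interpret pair_prob_space p \<nu> by standard
  note fm[measurable] = channelD(1)[OF f]
  note [measurable_cong] = S T
  let ?P = "density (p \<Otimes>\<^sub>M \<nu>) (\<lambda>z. ennreal (f z))"
  show "prob_space ?P"
    by standard (use integral_channel_eq_one[OF p \<nu> f] in \<open>simp add: emeasure_density\<close>)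
  show "distr ?P S fst = p"
  proof (rule measure_eqI)
    fix A assume "A \<in> sets (distr ?P S fst)"
    then have A[measurable]: "A \<in> sets p" using S by simp
    have "emeasure (distr ?P S fst) A = (\<integral>\<^sup>+z. indicator A (fst z) \<partial>?P)"
      using S by (subst nn_integral_distr[symmetric, of fst ?P S]) auto
    also have "\<dots> = (\<integral>\<^sup>+z. ennreal (f z) * indicator A (fst z) \<partial>(p \<Otimes>\<^sub>M \<nu>))"
      by (rule nn_integral_density) measurable
    also have "\<dots> = (\<integral>\<^sup>+u. \<integral>\<^sup>+x. ennreal (f (x, u)) * indicator A (fst (x, u)) \<partial>p \<partial>\<nu>)"
      by (rule nn_integral_snd[symmetric]) measurable
    also have "\<dots> = emeasure p A"
      using nn_integral_channel[OF p \<nu> f, of "indicator A"] by simp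
    finally show "emeasure (distr ?P S fst) A = emeasure p A" .
  qed (use S in simp)
  show "distr ?P T snd = \<nu>"
  proof (rule measure_eqI)
    fix A assume "A \<in> sets (distr ?P T snd)"
    then have A[measurable]: "A \<in> sets \<nu>" using T by simp
    have "emeasure (distr ?P T snd) A = (\<integral>\<^sup>+z. indicator A (snd z) \<partial>?P)"
      using T by (subst nn_integral_distr[symmetric, of snd ?P T]) auto
    also have "\<dots> = (\<integral>\<^sup>+z. ennreal (f z) * indicator A (snd z) \<partial>(p \<Otimes>\<^sub>M \<nu>))"
      by (rule nn_integral_density) measurable
    also have "\<dots> = (\<integral>\<^sup>+u. \<integral>\<^sup>+x. ennreal (f (x, u)) * indicator A (snd (x, u)) \<partial>p \<partial>\<nu>)"
      by (rule nn_integral_snd[symmetric]) measurable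
    also have "\<dots> = (\<integral>\<^sup>+u. indicator A u \<partial>\<nu>)"
      using channelD(3)[OF f] by (intro nn_integral_cong) (simp add: nn_integral_multc)
    also have "\<dots> = emeasure \<nu> A" by simp
    finally show "emeasure (distr ?P T snd) A = emeasure \<nu> A" .
  qed (use T in simp)
qed

lemma mutual_info_channel:
  assumes p: "prob_space p" and \<nu>: "prob_space \<nu>" and f: "channel p \<nu> f"
    and S: "sets S = sets p" and T: "sets T = sets \<nu>"
    and fi: "integrable (p \<Otimes>\<^sub>M \<nu>) (\<lambda>z. f z * ln (f z))"
  shows "mutual_info S T (density (p \<Otimes>\<^sub>M \<nu>) (\<lambda>z. ennreal (f z))) = ennreal (\<integral>z. f z * ln (f z) \<partial>(p \<Otimes>\<^sub>M \<nu>))"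
  unfolding mutual_info_def channel_marginals[OF p \<nu> f S T]
  using fi by (intro KL_div_density prob_space_pair p \<nu> channelD[OF f] integral_channel_eq_one[OF p \<nu> f])

text \<open>A finite divergence yields absolute continuity, hence a density \<open>f1\<close>. That
  \<open>P\<close> has the marginals \<open>p\<close> and \<open>\<nu>\<close> means that
  \<open>f1\<close> integrates to 1 in each variable, almost everywhere in the other.\<close>

lemma mutual_info_finite_channel:
  assumes P: "prob_space P" and s: "sets P = sets (S \<Otimes>\<^sub>M T)"
    and I: "mutual_info S T P \<le> ennreal R" and R: "0 \<le> R"
  defines "p \<equiv> distr P S fst" and "\<nu> \<equiv> distr P T snd"
  shows "\<exists>f. channel p \<nu> f \<and> P = density (p \<Otimes>\<^sub>M \<nu>) (\<lambda>z. ennreal (f z)) \<and>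
    integrable (p \<Otimes>\<^sub>M \<nu>) (\<lambda>z. f z * ln (f z)) \<and> (\<integral>z. f z * ln (f z) \<partial>(p \<Otimes>\<^sub>M \<nu>)) \<le> R"
proof -
  interpret P: prob_space P by fact
  note [measurable_cong] = s
  have fm: "fst \<in> measurable P S" and sm: "snd \<in> measurable P T" by measurable
  have p: "prob_space p" unfolding p_def by (rule P.prob_space_distr[OF fm])
  have \<nu>: "prob_space \<nu>" unfolding \<nu>_def by (rule P.prob_space_distr[OF sm])
  interpret p: prob_space p by fact
  interpret \<nu>: prob_space \<nu> by fact
  interpret Q: pair_prob_space p \<nu> by standard
  define Q where "Q = p \<Otimes>\<^sub>M \<nu>"
  have Qp: "prob_space Q" unfolding Q_def by unfold_locales
  interpret QQ: prob_space Q by fact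
  have sp: "sets p = sets S" "sets \<nu> = sets T" by (simp_all add: p_def \<nu>_def)
  have sQ: "sets P = sets Q" unfolding Q_def s using sp by (intro sets_pair_measure_cong) auto
  note [measurable_cong] = sp
  have KL: "KL_div P Q \<le> ennreal R" using I by (simp add: mutual_info_def Q_def p_def \<nu>_def)
  then have "KL_div P Q \<noteq> \<infinity>" by (auto simp: top_unique)
  then have ac: "absolutely_continuous Q P" and li: "integrable P (\<lambda>z. ln (enn2real (RN_deriv Q P z)))"
    by (auto simp: KL_div_def split: if_splits)
  have lR: "(\<integral>z. ln (enn2real (RN_deriv Q P z)) \<partial>P) \<le> R"
    using KL ac li R by (simp add: KL_div_def)
  have dP: "density Q (RN_deriv Q P) = P" using ac sQ by (rule QQ.density_RN_deriv)
  have fin: "AE z in Q. RN_deriv Q P z \<noteq> \<infinity>"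
    by (rule QQ.RN_deriv_finite[OF _ ac sQ]) unfold_locales
  define f1 where "f1 z = enn2real (RN_deriv Q P z)" for z
  have f1[measurable]: "f1 \<in> borel_measurable (p \<Otimes>\<^sub>M \<nu>)" unfolding f1_def Q_def by measurable
  have f1': "f1 \<in> borel_measurable Q" unfolding Q_def by measurable
  have f10: "0 \<le> f1 z" for z by (simp add: f1_def)
  have eqf: "AE z in Q. RN_deriv Q P z = ennreal (f1 z)"
    using fin by eventually_elim (simp add: f1_def less_top)
  have dP1: "density Q (\<lambda>z. ennreal (f1 z)) = P"
  proof -
    have "density Q (RN_deriv Q P) = density Q (\<lambda>z. ennreal (f1 z))"
      using eqf f1' by (intro density_cong) auto
    then show ?thesis using dP by simp
  qed
  define g where "g u = (\<integral>\<^sup>+x. ennreal (f1 (x, u)) \<partial>p)" for u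
  have g[measurable]: "g \<in> borel_measurable \<nu>" unfolding g_def by measurable
  have g1: "AE u in \<nu>. g u = 1"
  proof -
    have "density \<nu> g = density \<nu> (\<lambda>_. 1)"
    proof (rule measure_eqI)
      fix C assume "C \<in> sets (density \<nu> g)"
      then have C[measurable]: "C \<in> sets \<nu>" by simp
      have "emeasure \<nu> C = (\<integral>\<^sup>+z. indicator C (snd z) \<partial>P)"
        unfolding \<nu>_def using C sp by (subst nn_integral_distr[symmetric, of snd P T]) auto
      also have "\<dots> = (\<integral>\<^sup>+z. ennreal (f1 z) * indicator C (snd z) \<partial>(p \<Otimes>\<^sub>M \<nu>))"
        unfolding dP1[symmetric] Q_def by (rule nn_integral_density) measurable
      also have "\<dots> = (\<integral>\<^sup>+u. \<integral>\<^sup>+x. ennreal (f1 (x, u)) * indicator C (snd (x, u)) \<partial>p \<partial>\<nu>)"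
        by (rule Q.nn_integral_snd[symmetric]) measurable
      also have "\<dots> = (\<integral>\<^sup>+u. g u * indicator C u \<partial>\<nu>)"
        unfolding g_def by (intro nn_integral_cong) (simp add: nn_integral_multc)
      finally show "emeasure (density \<nu> g) C = emeasure (density \<nu> (\<lambda>_. 1)) C"
        by (simp add: emeasure_density)
    qed simp
    then show ?thesis by (subst (asm) \<nu>.density_unique_iff) auto
  qed
  have h1: "AE x in p. (\<integral>\<^sup>+u. ennreal (f1 (x, u)) \<partial>\<nu>) = 1"
  proof -
    define h where "h x = (\<integral>\<^sup>+u. ennreal (f1 (x, u)) \<partial>\<nu>)" for x
    have h[measurable]: "h \<in> borel_measurable p" unfolding h_def by measurable
    have "density p h = density p (\<lambda>_. 1)"
    proof (rule measure_eqI)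
      fix C assume "C \<in> sets (density p h)"
      then have C[measurable]: "C \<in> sets p" by simp
      have "emeasure p C = (\<integral>\<^sup>+z. indicator C (fst z) \<partial>P)"
        unfolding p_def using C sp by (subst nn_integral_distr[symmetric, of fst P S]) auto
      also have "\<dots> = (\<integral>\<^sup>+z. ennreal (f1 z) * indicator C (fst z) \<partial>(p \<Otimes>\<^sub>M \<nu>))"
        unfolding dP1[symmetric] Q_def by (rule nn_integral_density) measurable
      also have "\<dots> = (\<integral>\<^sup>+x. \<integral>\<^sup>+u. ennreal (f1 (x, u)) * indicator C (fst (x, u)) \<partial>\<nu> \<partial>p)"
        by (rule \<nu>.nn_integral_fst[symmetric]) measurable
      also have "\<dots> = (\<integral>\<^sup>+x. h x * indicator C x \<partial>p)"
        unfolding h_def by (intro nn_integral_cong) (simp add: nn_integral_multc)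
      finally show "emeasure (density p h) C = emeasure (density p (\<lambda>_. 1)) C"
        by (simp add: emeasure_density)
    qed simp
    then show ?thesis unfolding h_def[symmetric] by (subst (asm) p.density_unique_iff) auto
  qed
  \<comment> \<open>\<open>channel\<close> asks for normalisation at every \<open>u\<close>, since a
    codebook consists of individual points. On the null set where it fails the density is reset to
    1, which changes neither the joint law nor the information.\<close>
  define f where "f z = (if g (snd z) = 1 then f1 z else 1)" for z
  have f[measurable]: "f \<in> borel_measurable (p \<Otimes>\<^sub>M \<nu>)" unfolding f_def by measurable
  have f0: "0 \<le> f z" for z unfolding f_def using f10 by simp
  have aeQ: "AE z in p \<Otimes>\<^sub>M \<nu>. f z = f1 z"
  proof -
    have "AE u in distr (p \<Otimes>\<^sub>M \<nu>) \<nu> snd. g u = 1" unfolding distr_snd_pair[OF p \<nu> refl] by (rule g1)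
    then have "AE z in p \<Otimes>\<^sub>M \<nu>. g (snd z) = 1" by (rule AE_distrD[OF measurable_snd])
    then show ?thesis by eventually_elim (simp add: f_def)
  qed
  have ch: "channel p \<nu> f"
    unfolding channel_def
  proof (intro conjI allI ballI f f0)
    fix u assume "u \<in> space \<nu>"
    then show "(\<integral>\<^sup>+x. ennreal (f (x, u)) \<partial>p) = 1"
      by (cases "g u = 1") (auto simp: f_def p.emeasure_space_1, simp add: g_def)
  next
    have "AE x in p. AE u in \<nu>. f (x, u) = f1 (x, u)" using Q.AE_pair[OF aeQ] by simp
    then show "AE x in p. (\<integral>\<^sup>+u. ennreal (f (x, u)) \<partial>\<nu>) = 1"
      using h1
    proof eventually_elim
      case (elim x)
      then have "(\<integral>\<^sup>+u. ennreal (f (x, u)) \<partial>\<nu>) = (\<integral>\<^sup>+u. ennreal (f1 (x, u)) \<partial>\<nu>)"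
        by (intro nn_integral_cong_AE) auto
      then show ?case using elim by simp
    qed
  qed
  have dPf: "P = density (p \<Otimes>\<^sub>M \<nu>) (\<lambda>z. ennreal (f z))"
    unfolding dP1[symmetric] Q_def using aeQ by (intro density_cong) auto
  have i1: "integrable (p \<Otimes>\<^sub>M \<nu>) (\<lambda>z. f1 z * ln (f1 z))"
    and I1: "(\<integral>z. f1 z * ln (f1 z) \<partial>(p \<Otimes>\<^sub>M \<nu>)) \<le> R"
  proof -
    have "integrable P (\<lambda>z. ln (f1 z))" using li by (simp add: f1_def)
    then show "integrable (p \<Otimes>\<^sub>M \<nu>) (\<lambda>z. f1 z * ln (f1 z))"
      using f10 unfolding dP1[symmetric] Q_def by (subst (asm) integrable_density) auto
    have "(\<integral>z. f1 z * ln (f1 z) \<partial>(p \<Otimes>\<^sub>M \<nu>)) = (\<integral>z. ln (f1 z) \<partial>P)"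
      using f10 unfolding dP1[symmetric] Q_def by (subst integral_density) auto
    then show "(\<integral>z. f1 z * ln (f1 z) \<partial>(p \<Otimes>\<^sub>M \<nu>)) \<le> R" using lR by (simp add: f1_def)
  qed
  have i2: "integrable (p \<Otimes>\<^sub>M \<nu>) (\<lambda>z. f z * ln (f z))"
    using aeQ i1 by (subst integrable_cong_AE[where g="\<lambda>z. f1 z * ln (f1 z)"]) auto
  have "(\<integral>z. f z * ln (f z) \<partial>(p \<Otimes>\<^sub>M \<nu>)) = (\<integral>z. f1 z * ln (f1 z) \<partial>(p \<Otimes>\<^sub>M \<nu>))"
    using aeQ by (intro integral_cong_AE) auto
  then show ?thesis using ch dPf i2 I1 by (intro exI[of _ f]) auto
qed

text \<open>The sets of the algebra generated by \<open>T\<close> are the preimages of the sets of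
  \<open>SU\<close>, so testing against \<open>indicator C (T z)\<close> characterises the
  conditional expectation.\<close>

lemma real_cond_exp_vimage:
  fixes h :: "'z \<Rightarrow> real" and \<phi> :: "'u \<Rightarrow> real"
  assumes P: "prob_space P" and T[measurable]: "T \<in> measurable P SU"
    and h: "integrable P h" and \<phi>: "integrable P (\<lambda>z. \<phi> (T z))" and \<phi>m[measurable]: "\<phi> \<in> borel_measurable SU"
    and eq: "\<And>C. C \<in> sets SU \<Longrightarrow> (\<integral>z. indicator C (T z) * h z \<partial>P) = (\<integral>z. indicator C (T z) * \<phi> (T z) \<partial>P)"
  shows "AE z in P. real_cond_exp P (vimage_algebra (space P) T SU) h z = \<phi> (T z)"
proof -
  interpret P: prob_space P by fact
  let ?F = "vimage_algebra (space P) T SU"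
  have TS: "T \<in> space P \<rightarrow> space SU" using measurable_space[OF T] by auto
  have sF: "sets ?F = {T -` A \<inter> space P | A. A \<in> sets SU}" using TS by (rule sets_vimage_algebra2)
  have sub: "subalgebra P ?F"
    unfolding subalgebra_def using sF measurable_sets[OF T] by auto
  interpret finite_measure_subalgebra P ?F by standard (rule sub)
  interpret sigma_finite_subalgebra P ?F
    by (rule finite_measure_subalgebra_is_sigma_finite) unfold_locales
  show ?thesis
  proof (rule real_cond_exp_charact)
    fix A assume "A \<in> sets ?F"
    then obtain C where C: "C \<in> sets SU" "A = T -` C \<inter> space P" using sF by auto
    have i: "indicator A z = (indicator C (T z) :: real)" if "z \<in> space P" for z
      using that by (auto simp: C indicator_def)
    have "(\<integral>z\<in>A. h z \<partial>P) = (\<integral>z. indicator C (T z) * h z \<partial>P)"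
      unfolding set_lebesgue_integral_def by (intro Bochner_Integration.integral_cong) (auto simp: i)
    moreover have "(\<integral>z\<in>A. \<phi> (T z) \<partial>P) = (\<integral>z. indicator C (T z) * \<phi> (T z) \<partial>P)"
      unfolding set_lebesgue_integral_def by (intro Bochner_Integration.integral_cong) (auto simp: i)
    ultimately show "(\<integral>z\<in>A. h z \<partial>P) = (\<integral>z\<in>A. \<phi> (T z) \<partial>P)" using eq[OF C(1)] by simp
  next
    have "T \<in> measurable ?F SU" using TS by (rule measurable_vimage_algebra1)
    then show "(\<lambda>z. \<phi> (T z)) \<in> borel_measurable ?F" by measurable
  qed (use h \<phi> in auto)
qed

section \<open>Converse\<close>

text \<open>The law conditioned on an event of probability \<open>a\<close> is dominated in this
  way. Bounded densities make all the expressions \<open>f * ln f\<close> of the converse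
  integrable.\<close>

lemma dominated_density:
  assumes p: "prob_space p" and \<mu>: "prob_space \<mu>" and s: "sets \<mu> = sets p" and a: "0 < a"
    and dom: "\<And>A. A \<in> sets p \<Longrightarrow> ennreal a * emeasure \<mu> A \<le> emeasure p A"
  shows "\<exists>\<phi>\<in>borel_measurable p. (\<forall>x. 0 \<le> \<phi> x \<and> \<phi> x \<le> 1 / a) \<and> \<mu> = density p (\<lambda>x. ennreal (\<phi> x))"
proof -
  interpret p: prob_space p by fact
  interpret \<mu>: prob_space \<mu> by fact
  have ac: "absolutely_continuous p \<mu>"
    unfolding absolutely_continuous_def
  proof
    fix A assume A: "A \<in> null_sets p"
    have "ennreal a * emeasure \<mu> A \<le> 0" using dom[OF null_setsD2[OF A]] null_setsD1[OF A] by simp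
    then have "emeasure \<mu> A = 0" using a by simp
    then show "A \<in> null_sets \<mu>" using null_setsD2[OF A] s by (simp add: null_sets_def)
  qed
  define f where "f = RN_deriv p \<mu>"
  have f[measurable]: "f \<in> borel_measurable p" unfolding f_def by measurable
  have df: "density p f = \<mu>" unfolding f_def by (rule p.density_RN_deriv[OF ac s])
  have le: "AE x in p. ennreal a * f x \<le> 1"
  proof -
    \<comment> \<open>On the set where \<open>a * f\<close> exceeds 1 the excess \<open>h\<close>
      has integral zero, because the domination is applied to this very set.\<close>
    define A where "A = {x \<in> space p. 1 < ennreal a * f x}"
    have A[measurable]: "A \<in> sets p" unfolding A_def by measurable
    define h where "h x = (ennreal a * f x - 1) * indicator A x" for x
    have h[measurable]: "h \<in> borel_measurable p" unfolding h_def by measurable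
    have "emeasure p A + (\<integral>\<^sup>+x. h x \<partial>p) = (\<integral>\<^sup>+x. indicator A x + h x \<partial>p)"
      by (simp add: nn_integral_add)
    also have "\<dots> = (\<integral>\<^sup>+x. ennreal a * (f x * indicator A x) \<partial>p)"
      by (intro nn_integral_cong) (auto simp: h_def A_def indicator_def less_imp_le)
    also have "\<dots> = ennreal a * emeasure \<mu> A" unfolding df[symmetric] by (simp add: nn_integral_cmult emeasure_density)
    also have "\<dots> \<le> emeasure p A" by (rule dom) measurable
    finally have "emeasure p A + (\<integral>\<^sup>+x. h x \<partial>p) \<le> emeasure p A + 0" by simp
    then have "(\<integral>\<^sup>+x. h x \<partial>p) = 0"
      by (subst (asm) ennreal_add_left_cancel_le) (auto simp: p.emeasure_finite)
    then have "AE x in p. h x = 0" by (subst (asm) nn_integral_0_iff_AE) auto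
    then show ?thesis using AE_space
    proof eventually_elim
      case (elim x)
      show ?case
      proof (rule ccontr)
        assume "\<not> ?case"
        then have "x \<in> A" using elim by (simp add: A_def not_le)
        then have "ennreal a * f x - 1 = 0" using elim by (simp add: h_def)
        then show False using \<open>\<not> ?case\<close> by (simp add: diff_eq_0_iff_ennreal)
      qed
    qed
  qed
  \<comment> \<open>A version of the derivative; the minimum makes the bound hold at every point
    instead of almost everywhere.\<close>
  define \<phi> where "\<phi> x = min (enn2real (f x)) (1 / a)" for x
  have \<phi>[measurable]: "\<phi> \<in> borel_measurable p" unfolding \<phi>_def by measurable
  have "AE x in p. f x = ennreal (\<phi> x)"
    using le
  proof eventually_elim
    case (elim x)
    have "f x \<noteq> top"
    proof
      assume "f x = top"
      then show False using elim a by (simp add: ennreal_mult_top top_unique)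
    qed
    then obtain r where r: "f x = ennreal r" "0 \<le> r" by (cases "f x") auto
    then have "ennreal (a * r) \<le> ennreal 1" using elim a by (simp add: ennreal_mult)
    then have "a * r \<le> 1" by (subst (asm) ennreal_le_iff) auto
    then have "r \<le> 1 / a" using a by (simp add: field_simps)
    then show ?case using r by (simp add: \<phi>_def)
  qed
  then have "\<mu> = density p (\<lambda>x. ennreal (\<phi> x))"
    unfolding df[symmetric] by (intro density_cong) auto
  then show ?thesis using a by (intro bexI[of _ \<phi>]) (auto simp: \<phi>_def)
qed

lemma dominated_nn_integral:
  assumes p: "prob_space p" and \<mu>: "prob_space \<mu>" and s: "sets \<mu> = sets p" and a: "0 < a"
    and dom: "\<And>A. A \<in> sets p \<Longrightarrow> ennreal a * emeasure \<mu> A \<le> emeasure p A"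
    and h[measurable]: "h \<in> borel_measurable p"
  shows "ennreal a * (\<integral>\<^sup>+x. h x \<partial>\<mu>) \<le> (\<integral>\<^sup>+x. h x \<partial>p)"
proof -
  obtain \<phi> where \<phi>[measurable]: "\<phi> \<in> borel_measurable p" and b: "\<And>x. 0 \<le> \<phi> x \<and> \<phi> x \<le> 1 / a"
    and d: "\<mu> = density p (\<lambda>x. ennreal (\<phi> x))"
    using dominated_density[OF p \<mu> s a dom] by blast
  have "ennreal a * (\<integral>\<^sup>+x. h x \<partial>\<mu>) = (\<integral>\<^sup>+x. ennreal (a * \<phi> x) * h x \<partial>p)"
    unfolding d using a b by (simp add: nn_integral_density nn_integral_cmult[symmetric] ennreal_mult mult.assoc)
  also have "\<dots> \<le> (\<integral>\<^sup>+x. ennreal 1 * h x \<partial>p)"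
  proof (intro nn_integral_mono mult_right_mono ennreal_leI)
    fix x show "a * \<phi> x \<le> 1" using a b[of x] by (simp add: field_simps)
  qed simp
  finally show ?thesis by simp
qed

text \<open>The lower bound -1 is the tangent inequality at 1, the upper bound comes from
  \<open>ln t \<le> t\<close>.\<close>

lemma xlnx_bounded:
  assumes "0 \<le> t" "t \<le> C"
  shows "\<bar>t * ln t\<bar> \<le> 1 + C * (C::real)"
proof -
  have "t * ln t \<le> t * t"
  proof (cases "t = 0")
    case False
    then have "ln t \<le> t" using assms ln_le_minus_one[of t] by simp
    then show ?thesis using assms by (intro mult_left_mono) auto
  qed simp
  also have "\<dots> \<le> C * C" using assms by (intro mult_mono) auto
  finally have 1: "t * ln t \<le> C * C" .
  have 2: "- 1 \<le> t * ln t" using diff_le_xlnx[of t] assms by simp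
  have "0 \<le> C * C" by simp
  then show ?thesis using 1 2 by linarith
qed

lemma (in prob_space) integrable_xlnx:
  fixes f :: "'a \<Rightarrow> real"
  assumes [measurable]: "f \<in> borel_measurable M" and "\<And>z. 0 \<le> f z" "\<And>z. f z \<le> C"
  shows "integrable M (\<lambda>z. f z * ln (f z))"
  by (rule integrable_const_bound[of _ "1 + C * C"]) (use xlnx_bounded assms(2,3) in auto)

text \<open>Single-letterisation. With \<open>G = (\<Prod>t. \<phi> t (x t))\<close>, the sum is the \<open>\<mu>\<close>-mean of
  \<open>ln G \<le> a * G - 1 - ln a\<close>, and the mean of \<open>a * G\<close> is at most one because \<open>a \<mu> \<le> p\<^sup>n\<close>.\<close>

lemma letter_information:
  fixes p :: "'a measure" and \<phi> :: "nat \<Rightarrow> 'a \<Rightarrow> real"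
  assumes p: "prob_space p" and \<mu>: "prob_space \<mu>" and s: "sets \<mu> = sets (PiM {..<n} (\<lambda>_. p))" and a: "0 < a"
    and dom: "\<And>A. A \<in> sets (PiM {..<n} (\<lambda>_. p)) \<Longrightarrow> ennreal a * emeasure \<mu> A \<le> emeasure (PiM {..<n} (\<lambda>_. p)) A"
    and \<phi>[measurable]: "\<And>t. \<phi> t \<in> borel_measurable p" and \<phi>0: "\<And>t x. 0 \<le> \<phi> t x" and \<phi>C: "\<And>t x. \<phi> t x \<le> C"
    and d: "\<And>t. t < n \<Longrightarrow> distr \<mu> p (\<lambda>x. x t) = density p (\<lambda>x. ennreal (\<phi> t x))"
  shows "(\<Sum>t<n. \<integral>x. \<phi> t x * ln (\<phi> t x) \<partial>p) \<le> - ln a"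
proof -
  let ?P = "PiM {..<n} (\<lambda>_. p)"
  interpret p: prob_space p by fact
  interpret \<mu>: prob_space \<mu> by fact
  interpret pp: product_sigma_finite "\<lambda>_. p" by standard
  have P: "prob_space ?P" by (intro prob_space_PiM p)
  have C0: "0 \<le> C" using \<phi>0 \<phi>C order_trans by blast
  have cm: "(\<lambda>x. x t) \<in> measurable \<mu> p" if "t < n" for t
    using that s by (simp cong: measurable_cong_sets)
  have i1: "integrable (density p (\<lambda>x. ennreal (\<phi> t x))) (\<lambda>x. ln (\<phi> t x))" for t
    using p.integrable_xlnx[OF \<phi> \<phi>0 \<phi>C, of t] \<phi>0 by (subst integrable_density) auto
  have I1: "(\<integral>x. \<phi> t x * ln (\<phi> t x) \<partial>p) = (\<integral>x. ln (\<phi> t x) \<partial>density p (\<lambda>x. ennreal (\<phi> t x)))" for t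
    using \<phi>0 by (subst integral_density) auto
  have i2: "integrable \<mu> (\<lambda>x. ln (\<phi> t (x t)))" if "t < n" for t
    using i1[of t] unfolding d[OF that, symmetric] by (subst (asm) integrable_distr_eq[OF cm[OF that]]) auto
  have I2: "(\<integral>x. \<phi> t x * ln (\<phi> t x) \<partial>p) = (\<integral>x. ln (\<phi> t (x t)) \<partial>\<mu>)" if "t < n" for t
    unfolding I1 d[OF that, symmetric] by (subst integral_distr[OF cm[OF that]]) auto
  have \<phi>1: "(\<integral>\<^sup>+x. ennreal (\<phi> t x) \<partial>p) = 1" if "t < n" for t
  proof -
    have "prob_space (density p (\<lambda>x. ennreal (\<phi> t x)))"
      unfolding d[OF that, symmetric] by (rule \<mu>.prob_space_distr[OF cm[OF that]])
    then show ?thesis using prob_space.emeasure_space_1 by (fastforce simp: emeasure_density)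
  qed
  define G where "G x = (\<Prod>t<n. \<phi> t (x t))" for x
  have GP: "G \<in> borel_measurable ?P"
    unfolding G_def by (intro borel_measurable_prod measurable_compose[OF _ \<phi>] measurable_component_singleton) auto
  have G\<mu>: "G \<in> borel_measurable \<mu>" using GP s by (simp cong: measurable_cong_sets)
  have G0: "0 \<le> G x" for x unfolding G_def using \<phi>0 by (intro prod_nonneg) auto
  have GC: "G x \<le> C ^ n" for x
  proof -
    have "G x \<le> (\<Prod>t<n. C)" unfolding G_def using \<phi>0 \<phi>C by (intro prod_mono) auto
    then show ?thesis by simp
  qed
  have Gi: "integrable \<mu> G"
    by (rule \<mu>.integrable_const_bound[of _ "C ^ n"]) (use G0 GC G\<mu> in auto)
  \<comment> \<open>\<open>\<mu>\<close> gives no mass to points where one of its own letter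
    densities vanishes, so the logarithm of the product splits.\<close>
  have "AE x in \<mu>. \<forall>t\<in>{..<n}. 0 < \<phi> t (x t)"
  proof (rule AE_finite_allI)
    fix t assume "t \<in> {..<n}"
    then have t: "t < n" by simp
    have "AE x in distr \<mu> p (\<lambda>x. x t). 0 < \<phi> t x"
      unfolding d[OF t] by (subst AE_density) auto
    then show "AE x in \<mu>. 0 < \<phi> t (x t)" by (rule AE_distrD[OF cm[OF t]])
  qed simp
  then have "AE x in \<mu>. (\<Sum>t<n. ln (\<phi> t (x t))) \<le> a * G x - 1 - ln a"
  proof eventually_elim
    case (elim x)
    then have pos: "0 < G x" unfolding G_def by (intro prod_pos) auto
    have "(\<Sum>t<n. ln (\<phi> t (x t))) = ln (G x)"
      unfolding G_def using elim by (intro ln_prod[symmetric]) (auto simp: less_le)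
    moreover have "ln (a * G x) \<le> a * G x - 1" using a pos by (intro ln_le_minus_one) simp
    moreover have "ln (a * G x) = ln a + ln (G x)" using a pos by (simp add: ln_mult)
    ultimately show ?case by linarith
  qed
  then have "(\<integral>x. (\<Sum>t<n. ln (\<phi> t (x t))) \<partial>\<mu>) \<le> (\<integral>x. a * G x - 1 - ln a \<partial>\<mu>)"
    using i2 Gi by (intro integral_mono_AE Bochner_Integration.integrable_sum) auto
  also have "\<dots> = a * (\<integral>x. G x \<partial>\<mu>) - 1 - ln a" using Gi by (simp add: \<mu>.prob_space)
  \<comment> \<open>Under the product law the factors of \<open>G\<close> are independent with mean
    1 each; the domination transfers the bound to \<open>\<mu>\<close>.\<close>
  also have "a * (\<integral>x. G x \<partial>\<mu>) \<le> 1"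
  proof -
    have "ennreal (a * (\<integral>x. G x \<partial>\<mu>)) = ennreal a * (\<integral>\<^sup>+x. ennreal (G x) \<partial>\<mu>)"
      using a G0 Gi by (simp add: ennreal_mult nn_integral_eq_integral)
    also have "\<dots> \<le> (\<integral>\<^sup>+x. ennreal (G x) \<partial>?P)"
      using GP by (intro dominated_nn_integral[OF P \<mu> s a dom]) auto
    also have "\<dots> = (\<Prod>t<n. \<integral>\<^sup>+x. ennreal (\<phi> t x) \<partial>p)"
      unfolding G_def using \<phi>0 by (subst pp.product_nn_integral_prod[symmetric]) (auto simp: prod_ennreal)
    also have "\<dots> = 1" using \<phi>1 by simp
    finally show ?thesis by simp
  qed
  finally have "(\<integral>x. (\<Sum>t<n. ln (\<phi> t (x t))) \<partial>\<mu>) \<le> - ln a" by simp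
  moreover have "(\<integral>x. (\<Sum>t<n. ln (\<phi> t (x t))) \<partial>\<mu>) = (\<Sum>t<n. \<integral>x. \<phi> t x * ln (\<phi> t x) \<partial>p)"
    using i2 I2 by (subst Bochner_Integration.integral_sum) auto
  ultimately show ?thesis by simp
qed

text \<open>An abstract mixture is used so that one statement serves both ends of the code: for the
  source \<open>a i\<close> is the probability of the message given the seed, for the output it is
  the weight \<open>w i\<close> itself. A uniform time turns the weights into
  \<open>w i / n\<close>, and the letter laws average to \<open>p\<close> because every coordinate
  of the block law is \<open>p\<close>.\<close>

lemma letter_channels:
  fixes p :: "'a measure" and \<mu> :: "'i \<Rightarrow> (nat \<Rightarrow> 'a) measure" and w a :: "'i \<Rightarrow> real"
  assumes p: "prob_space p" and n: "0 < n" and I: "finite I" and w0: "\<And>i. i \<in> I \<Longrightarrow> 0 \<le> w i" and w1: "(\<Sum>i\<in>I. w i) = 1"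
    and \<mu>: "\<And>i. i \<in> I \<Longrightarrow> 0 < w i \<Longrightarrow> prob_space (\<mu> i)"
    and s: "\<And>i. i \<in> I \<Longrightarrow> 0 < w i \<Longrightarrow> sets (\<mu> i) = sets (PiM {..<n} (\<lambda>_. p))"
    and mix: "\<And>A. A \<in> sets (PiM {..<n} (\<lambda>_. p)) \<Longrightarrow>
      (\<Sum>i\<in>I. ennreal (w i) * emeasure (\<mu> i) A) = emeasure (PiM {..<n} (\<lambda>_. p)) A"
    and a: "\<And>i. i \<in> I \<Longrightarrow> 0 < w i \<Longrightarrow> 0 < a i"
    and dom: "\<And>i A. i \<in> I \<Longrightarrow> 0 < w i \<Longrightarrow> A \<in> sets (PiM {..<n} (\<lambda>_. p)) \<Longrightarrow>
      ennreal (a i) * emeasure (\<mu> i) A \<le> emeasure (PiM {..<n} (\<lambda>_. p)) A"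
  shows "\<exists>\<phi> C. (\<forall>i t. \<phi> i t \<in> borel_measurable p) \<and> (\<forall>i t x. 0 \<le> \<phi> i t x) \<and> (\<forall>i t x. \<phi> i t x \<le> C) \<and>
    (\<forall>i t. (\<integral>\<^sup>+x. ennreal (\<phi> i t x) \<partial>p) = 1) \<and>
    (\<forall>i\<in>I. \<forall>t<n. 0 < w i \<longrightarrow> distr (\<mu> i) p (\<lambda>x. x t) = density p (\<lambda>x. ennreal (\<phi> i t x))) \<and>
    (AE x in p. (\<Sum>i\<in>I. \<Sum>t<n. ennreal (w i / n) * ennreal (\<phi> i t x)) = 1) \<and>
    (\<Sum>i\<in>I. \<Sum>t<n. w i / n * (\<integral>x. \<phi> i t x * ln (\<phi> i t x) \<partial>p)) \<le> (\<Sum>i\<in>I. w i * (- ln (a i))) / n"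
proof -
  let ?P = "PiM {..<n} (\<lambda>_. p)"
  interpret p: prob_space p by fact
  have P: "prob_space ?P" by (intro prob_space_PiM p)
  have cm: "(\<lambda>x. x t) \<in> measurable (\<mu> i) p" if "t < n" "i \<in> I" "0 < w i" for t i
    using that s[OF that(2,3)] by (simp cong: measurable_cong_sets)
  have cP: "(\<lambda>x. x t) \<in> measurable ?P p" if "t < n" for t
    using that by (auto intro: measurable_component_singleton)
  have PA: "(\<lambda>x. x t) -` A \<inter> space ?P \<in> sets ?P" "emeasure ?P ((\<lambda>x. x t) -` A \<inter> space ?P) = emeasure p A"
    if "t < n" "A \<in> sets p" for t A
  proof -
    show "(\<lambda>x. x t) -` A \<inter> space ?P \<in> sets ?P" using measurable_sets[OF cP[OF that(1)] that(2)] .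
    have "emeasure ?P ((\<lambda>x. x t) -` A \<inter> space ?P) = emeasure (distr ?P p (\<lambda>x. x t)) A"
      using that by (simp add: emeasure_distr[OF cP[OF that(1)]])
    then show "emeasure ?P ((\<lambda>x. x t) -` A \<inter> space ?P) = emeasure p A"
      using distr_PiM_component[of "{..<n}" "\<lambda>_. p" t] p that by simp
  qed
  have dA: "emeasure (distr (\<mu> i) p (\<lambda>x. x t)) A = emeasure (\<mu> i) ((\<lambda>x. x t) -` A \<inter> space ?P)"
    if "t < n" "i \<in> I" "0 < w i" "A \<in> sets p" for t i A
    using that by (simp add: emeasure_distr[OF cm] sets_eq_imp_space_eq[OF s])
  \<comment> \<open>Indices of weight zero have no conditional law. There, and outside the index
    ranges, \<open>\<phi>\<close> is the constant 1, which satisfies the pointwise conditions and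
    leaves the weighted sums unchanged.\<close>
  define good where "good i t \<longleftrightarrow> i \<in> I \<and> t < n \<and> 0 < w i" for i t
  have "\<exists>\<phi>\<in>borel_measurable p. (\<forall>x. 0 \<le> \<phi> x \<and> \<phi> x \<le> 1 / a i) \<and> distr (\<mu> i) p (\<lambda>x. x t) = density p (\<lambda>x. ennreal (\<phi> x))"
    if "good i t" for i t
  proof -
    have g: "t < n" "i \<in> I" "0 < w i" using that by (auto simp: good_def)
    show ?thesis
    proof (rule dominated_density[OF p _ _ a[OF g(2,3)]])
      show "prob_space (distr (\<mu> i) p (\<lambda>x. x t))" by (rule prob_space.prob_space_distr[OF \<mu>[OF g(2,3)] cm[OF g]])
      fix A assume A: "A \<in> sets p"
      show "ennreal (a i) * emeasure (distr (\<mu> i) p (\<lambda>x. x t)) A \<le> emeasure p A"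
        unfolding dA[OF g A] using dom[OF g(2,3) PA(1)[OF g(1) A]] PA(2)[OF g(1) A] by simp
    qed simp
  qed
  then obtain \<psi> where \<psi>: "\<And>i t. good i t \<Longrightarrow> \<psi> i t \<in> borel_measurable p" "\<And>i t x. good i t \<Longrightarrow> 0 \<le> \<psi> i t x"
    "\<And>i t x. good i t \<Longrightarrow> \<psi> i t x \<le> 1 / a i"
    "\<And>i t. good i t \<Longrightarrow> distr (\<mu> i) p (\<lambda>x. x t) = density p (\<lambda>x. ennreal (\<psi> i t x))"
    by metis
  define \<phi> where "\<phi> i t = (if good i t then \<psi> i t else (\<lambda>_. 1))" for i t
  \<comment> \<open>One bound for all indices: the sum dominates each \<open>1 / a i\<close>, and
    the summand 1 covers the default density.\<close>
  define C where "C = 1 + (\<Sum>i\<in>{i\<in>I. 0 < w i}. 1 / a i)"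
  have \<phi>m[measurable]: "\<phi> i t \<in> borel_measurable p" for i t using \<psi>(1) by (simp add: \<phi>_def)
  have \<phi>0: "0 \<le> \<phi> i t x" for i t x using \<psi>(2) by (simp add: \<phi>_def)
  have Cle: "0 \<le> (\<Sum>i\<in>{i\<in>I. 0 < w i}. 1 / a i)" using a by (intro sum_nonneg) (auto simp: less_imp_le)
  have \<phi>C: "\<phi> i t x \<le> C" for i t x
  proof (cases "good i t")
    case True
    then have "1 / a i \<le> (\<Sum>i\<in>{i\<in>I. 0 < w i}. 1 / a i)"
      using a I by (intro member_le_sum) (auto simp: good_def less_imp_le)
    then show ?thesis using \<psi>(3)[OF True, of x] True by (simp add: C_def \<phi>_def)
  next
    case False
    then show ?thesis using Cle by (simp add: \<phi>_def C_def)
  qed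
  have \<phi>d: "distr (\<mu> i) p (\<lambda>x. x t) = density p (\<lambda>x. ennreal (\<phi> i t x))" if "good i t" for i t
    using \<psi>(4)[OF that] that by (simp add: \<phi>_def)
  have \<phi>1: "(\<integral>\<^sup>+x. ennreal (\<phi> i t x) \<partial>p) = 1" for i t
  proof (cases "good i t")
    case True
    then have "prob_space (density p (\<lambda>x. ennreal (\<phi> i t x)))"
      unfolding \<phi>d[OF True, symmetric] using \<mu> cm by (intro prob_space.prob_space_distr) (auto simp: good_def)
    then show ?thesis using prob_space.emeasure_space_1 by (fastforce simp: emeasure_density)
  qed (simp add: \<phi>_def p.emeasure_space_1)
  have ae: "AE x in p. (\<Sum>i\<in>I. \<Sum>t<n. ennreal (w i / n) * ennreal (\<phi> i t x)) = 1"
  proof -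
    define h where "h x = (\<Sum>i\<in>I. \<Sum>t<n. ennreal (w i / n) * ennreal (\<phi> i t x))" for x
    have h[measurable]: "h \<in> borel_measurable p" unfolding h_def by measurable
    have "density p h = density p (\<lambda>_. 1)"
    proof (rule measure_eqI)
      fix A assume "A \<in> sets (density p h)"
      then have A[measurable]: "A \<in> sets p" by simp
      have "emeasure (density p h) A = (\<integral>\<^sup>+x. (\<Sum>i\<in>I. \<Sum>t<n. ennreal (w i / n) * (ennreal (\<phi> i t x) * indicator A x)) \<partial>p)"
        by (simp add: emeasure_density h_def sum_distrib_right mult.assoc)
      also have "\<dots> = (\<Sum>i\<in>I. \<Sum>t<n. ennreal (w i / n) * (\<integral>\<^sup>+x. ennreal (\<phi> i t x) * indicator A x \<partial>p))"
        by (subst nn_integral_sum, simp, intro sum.cong refl, subst nn_integral_sum) (simp_all add: nn_integral_cmult)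
      also have "\<dots> = (\<Sum>i\<in>I. \<Sum>t<n. ennreal (1 / n) * (ennreal (w i) * emeasure (\<mu> i) ((\<lambda>x. x t) -` A \<inter> space ?P)))"
      proof (intro sum.cong refl)
        fix i t assume i: "i \<in> I" and "t \<in> {..<n}"
        then have t: "t < n" by simp
        show "ennreal (w i / n) * (\<integral>\<^sup>+x. ennreal (\<phi> i t x) * indicator A x \<partial>p)
          = ennreal (1 / n) * (ennreal (w i) * emeasure (\<mu> i) ((\<lambda>x. x t) -` A \<inter> space ?P))"
        proof (cases "0 < w i")
          case True
          then have g: "good i t" using i t by (simp add: good_def)
          have "(\<integral>\<^sup>+x. ennreal (\<phi> i t x) * indicator A x \<partial>p) = emeasure (distr (\<mu> i) p (\<lambda>x. x t)) A"
            unfolding \<phi>d[OF g] by (simp add: emeasure_density)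
          also have "\<dots> = emeasure (\<mu> i) ((\<lambda>x. x t) -` A \<inter> space ?P)" by (rule dA[OF t i True A])
          finally show ?thesis using True n by (simp add: mult.assoc[symmetric] ennreal_mult[symmetric])
        next
          case False
          then show ?thesis using w0[OF i] by simp
        qed
      qed
      also have "\<dots> = (\<Sum>t<n. ennreal (1 / n) * (\<Sum>i\<in>I. ennreal (w i) * emeasure (\<mu> i) ((\<lambda>x. x t) -` A \<inter> space ?P)))"
        by (subst sum.swap) (simp add: sum_distrib_left)
      also have "\<dots> = (\<Sum>t<n. ennreal (1 / n) * emeasure p A)"
        by (intro sum.cong refl) (simp add: mix PA)
      also have "\<dots> = emeasure p A"
        using n by (simp add: mult.assoc[symmetric] ennreal_of_nat_eq_real_of_nat ennreal_mult[symmetric])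
      finally show "emeasure (density p h) A = emeasure (density p (\<lambda>_. 1)) A"
        by (simp add: emeasure_density)
    qed simp
    then have "AE x in p. h x = 1" by (subst (asm) p.density_unique_iff) auto
    then show ?thesis by (simp add: h_def)
  qed
  have info: "(\<Sum>i\<in>I. \<Sum>t<n. w i / n * (\<integral>x. \<phi> i t x * ln (\<phi> i t x) \<partial>p)) \<le> (\<Sum>i\<in>I. w i * (- ln (a i))) / n"
  proof -
    have "(\<Sum>i\<in>I. \<Sum>t<n. w i / n * (\<integral>x. \<phi> i t x * ln (\<phi> i t x) \<partial>p))
      = (\<Sum>i\<in>I. w i * (\<Sum>t<n. \<integral>x. \<phi> i t x * ln (\<phi> i t x) \<partial>p)) / n"
      by (simp add: sum_distrib_left sum_divide_distrib)
    also have "\<dots> \<le> (\<Sum>i\<in>I. w i * (- ln (a i))) / n"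
    proof (intro divide_right_mono sum_mono)
      fix i assume i: "i \<in> I"
      show "w i * (\<Sum>t<n. \<integral>x. \<phi> i t x * ln (\<phi> i t x) \<partial>p) \<le> w i * (- ln (a i))"
      proof (cases "0 < w i")
        case True
        have "(\<Sum>t<n. \<integral>x. \<phi> i t x * ln (\<phi> i t x) \<partial>p) \<le> - ln (a i)"
          by (rule letter_information[OF p \<mu>[OF i True] s[OF i True] a[OF i True] dom[OF i True] \<phi>m \<phi>0 \<phi>C \<phi>d])
            (use i True in \<open>auto simp: good_def\<close>)
        then show ?thesis using True by (intro mult_left_mono) auto
      next
        case False
        then show ?thesis using w0[OF i] by simp
      qed
    qed simp
    finally show ?thesis .
  qed
  show ?thesis
    by (rule exI[of _ \<phi>], rule exI[of _ C]) (use \<phi>m \<phi>0 \<phi>C \<phi>1 \<phi>d ae info in \<open>auto simp: good_def\<close>)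
qed

text \<open>Gibbs' inequality against the uniform law, termwise from \<open>ln x \<le> x - 1\<close>
  at \<open>x = 1 / (w i * N)\<close>.\<close>

lemma entropy_le_ln_card:
  fixes w :: "'i \<Rightarrow> real"
  assumes "finite I" "I \<noteq> {}" and w0: "\<And>i. i \<in> I \<Longrightarrow> 0 \<le> w i" and w1: "(\<Sum>i\<in>I. w i) = 1"
  shows "(\<Sum>i\<in>I. w i * (- ln (w i))) \<le> ln (card I)"
proof -
  define N where "N = real (card I)"
  have N: "0 < N" using assms by (simp add: N_def card_gt_0_iff)
  have "w i * (- ln (w i)) \<le> w i * ln N + (1 / N - w i)" if "i \<in> I" for i
  proof (cases "w i = 0")
    case False
    then have pos: "0 < w i" using w0[OF that] by simp
    have "ln (1 / (w i * N)) \<le> 1 / (w i * N) - 1" using pos N by (intro ln_le_minus_one) simp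
    then have "w i * ln (1 / (w i * N)) \<le> w i * (1 / (w i * N) - 1)" using pos by (intro mult_left_mono) auto
    then show ?thesis using pos N by (simp add: ln_div ln_mult algebra_simps)
  qed (use N in simp)
  then have "(\<Sum>i\<in>I. w i * (- ln (w i))) \<le> (\<Sum>i\<in>I. w i * ln N + (1 / N - w i))" by (rule sum_mono)
  also have "\<dots> = (\<Sum>i\<in>I. w i) * ln N + (card I / N - (\<Sum>i\<in>I. w i))"
    by (simp add: sum.distrib sum_subtractf sum_distrib_right)
  also have "\<dots> = ln N" using N by (simp add: w1 N_def)
  finally show ?thesis by (simp add: N_def)
qed

text \<open>The seed is independent of the source, so the source law given \<open>(j, k)\<close> is
  at most \<open>1 / a j k\<close> times the block law, with \<open>a j k\<close> the probability of
  \<open>j\<close> given \<open>k\<close>; the mean of \<open>- ln (a j k)\<close> is the entropy of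
  \<open>J\<close> given \<open>K\<close>, at most \<open>ln m\<close>. For the output law given
  \<open>(j, k)\<close> the domination comes from the joint weight \<open>a j k / kk\<close>, and
  the joint entropy is at most \<open>ln m + ln kk\<close>.\<close>

lemma code_converse:
  fixes \<Delta> :: "'a \<Rightarrow> 'a \<Rightarrow> real"
  assumes inf: "infinite (UNIV :: 'u set)" and p: "prob_space p" and q: "prob_space q" and qp: "sets q = sets p"
    and \<Delta>m: "(\<lambda>(x, y). \<Delta> x y) \<in> borel_measurable (p \<Otimes>\<^sub>M p)"
    and ach: "achievable p p q \<Delta> R Rc d"
  shows "\<exists>(\<nu> :: 'u measure) f g C. prob_space \<nu> \<and> channel p \<nu> f \<and> channel q \<nu> g \<and> (\<forall>z. f z \<le> C) \<and> (\<forall>z. g z \<le> C) \<and>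
    (\<integral>z. f z * ln (f z) \<partial>(p \<Otimes>\<^sub>M \<nu>)) \<le> R \<and> (\<integral>z. g z * ln (g z) \<partial>(q \<Otimes>\<^sub>M \<nu>)) \<le> R + Rc \<and>
    enn2ereal (avg_distortion p q \<nu> f g \<Delta>) \<le> ereal d"
proof -
  interpret p: prob_space p by fact
  interpret q: prob_space q by fact
  have \<Delta>m': "(\<lambda>(x, y). \<Delta> x y) \<in> borel_measurable (p \<Otimes>\<^sub>M q)"
    using \<Delta>m qp by (simp cong: measurable_cong_sets sets_pair_measure_cong)
  obtain n m kk e dec where code: "valid_code p n m kk e dec"
    and mR: "ln (real m) / real n \<le> R" and kR: "ln (real kk) / real n \<le> Rc"
    and dist: "enn2ereal ((\<Sum>t<n. code_distortion p \<Delta> n m kk e dec t) / of_nat n) \<le> ereal d"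
    and out: "\<And>A. A \<in> sets (PiM {..<n} (\<lambda>_. p)) \<Longrightarrow> code_output_prob p n m kk e dec A = emeasure (PiM {..<n} (\<lambda>_. q)) A"
    using ach unfolding achievable_def by blast
  let ?P = "PiM {..<n} (\<lambda>_. p)" and ?Q = "PiM {..<n} (\<lambda>_. q)"
  have P: "prob_space ?P" and Q: "prob_space ?Q" by (intro prob_space_PiM p q)+
  interpret P: prob_space ?P by fact
  have QP: "sets ?Q = sets ?P" using qp by (intro sets_PiM_cong) auto
  have n: "0 < n" and kk: "0 < kk"
    and em: "\<And>j k. j < m \<Longrightarrow> k < kk \<Longrightarrow> (\<lambda>x. e x k j) \<in> borel_measurable ?P"
    and e0: "\<And>x j k. x \<in> space ?P \<Longrightarrow> j < m \<Longrightarrow> k < kk \<Longrightarrow> 0 \<le> e x k j"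
    and e1: "\<And>x k. x \<in> space ?P \<Longrightarrow> k < kk \<Longrightarrow> (\<Sum>j<m. e x k j) = 1"
    and decp: "\<And>j k. j < m \<Longrightarrow> k < kk \<Longrightarrow> prob_space (dec j k)"
    and decs: "\<And>j k. j < m \<Longrightarrow> k < kk \<Longrightarrow> sets (dec j k) = sets ?P"
    using code unfolding valid_code_def by auto
  \<comment> \<open>The encoder probabilities sum to 1, which is impossible over an empty message
    set.\<close>
  have m: "0 < m"
  proof (rule ccontr)
    assume "\<not> 0 < m"
    moreover obtain x where "x \<in> space ?P" using P.not_empty by blast
    ultimately show False using e1[of x 0] kk by simp
  qed
  have ele: "e x k j \<le> 1" if "x \<in> space ?P" "j < m" "k < kk" for x j k
  proof -
    have "e x k j \<le> (\<Sum>j<m. e x k j)" using that e0 by (intro member_le_sum) auto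
    then show ?thesis using e1 that by simp
  qed
  have ei: "integrable ?P (\<lambda>x. e x k j)" if "j < m" "k < kk" for j k
    using that e0 ele em by (intro P.integrable_const_bound[of _ 1]) auto
  define a where "a j k = (\<integral>x. e x k j \<partial>?P)" for j k
  have a0: "0 \<le> a j k" if "j < m" "k < kk" for j k
    unfolding a_def using e0 that by (intro Bochner_Integration.integral_nonneg) auto
  have a_nn: "(\<integral>\<^sup>+x. ennreal (e x k j) \<partial>?P) = ennreal (a j k)" if "j < m" "k < kk" for j k
    unfolding a_def using e0 that by (intro nn_integral_eq_integral ei) auto
  have a1: "(\<Sum>j<m. a j k) = 1" if "k < kk" for k
  proof -
    have "(\<Sum>j<m. a j k) = (\<integral>x. (\<Sum>j<m. e x k j) \<partial>?P)"
      unfolding a_def using that by (intro Bochner_Integration.integral_sum[symmetric] ei) auto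
    also have "\<dots> = (\<integral>x. 1 \<partial>?P)" using e1 that by (intro Bochner_Integration.integral_cong) auto
    finally show ?thesis by (simp add: P.prob_space)
  qed
  define I :: "(nat \<times> nat) set" where "I = {..<m} \<times> {..<kk}"
  have I: "finite I" "I \<noteq> {}" using m kk by (auto simp: I_def)
  have sumI: "(\<Sum>i\<in>I. F i) = (\<Sum>k<kk. \<Sum>j<m. F (j, k))" for F :: "nat \<times> nat \<Rightarrow> 'z :: comm_monoid_add"
    unfolding I_def by (subst sum.swap) (simp add: sum.cartesian_product')
  define aI where "aI i = a (fst i) (snd i)" for i
  define w where "w i = aI i / kk" for i
  have aI0: "0 \<le> aI i" if "i \<in> I" for i using that a0 by (auto simp: aI_def I_def)
  have w0: "0 \<le> w i" if "i \<in> I" for i using aI0[OF that] by (simp add: w_def)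
  have wpos: "0 < w i \<longleftrightarrow> 0 < aI i" for i using kk by (simp add: w_def zero_less_divide_iff)
  have w1: "(\<Sum>i\<in>I. w i) = 1"
    unfolding sumI using kk by (simp add: w_def aI_def a1 sum_divide_distrib[symmetric])
  \<comment> \<open>Law of the source block given message and seed. For \<open>aI i = 0\<close> the
    division by zero makes it the zero measure; such indices have weight 0.\<close>
  define \<mu>X where "\<mu>X i = density ?P (\<lambda>x. ennreal (e x (snd i) (fst i) / aI i))" for i
  define \<mu>Y where "\<mu>Y i = dec (fst i) (snd i)" for i
  have emI: "(\<lambda>x. e x (snd i) (fst i)) \<in> borel_measurable ?P" if "i \<in> I" for i using that em by (auto simp: I_def)
  have e0I: "0 \<le> e x (snd i) (fst i)" if "x \<in> space ?P" "i \<in> I" for i x using that e0 by (auto simp: I_def)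
  have a_nnI: "(\<integral>\<^sup>+x. ennreal (e x (snd i) (fst i)) \<partial>?P) = ennreal (aI i)" if "i \<in> I" for i
    using that a_nn by (auto simp: I_def aI_def)
  have \<mu>X_int: "ennreal (aI i) * (\<integral>\<^sup>+x. h x \<partial>\<mu>X i) = (\<integral>\<^sup>+x. ennreal (e x (snd i) (fst i)) * h x \<partial>?P)"
    if i: "i \<in> I" and pos: "0 < aI i" and h: "h \<in> borel_measurable ?P" for i h
  proof -
    note [measurable] = emI[OF i] h
    have "ennreal (aI i) * (\<integral>\<^sup>+x. h x \<partial>\<mu>X i) = (\<integral>\<^sup>+x. ennreal (aI i) * (ennreal (e x (snd i) (fst i) / aI i) * h x) \<partial>?P)"
      unfolding \<mu>X_def by (simp add: nn_integral_density nn_integral_cmult)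
    also have "\<dots> = (\<integral>\<^sup>+x. ennreal (e x (snd i) (fst i)) * h x \<partial>?P)"
      using pos e0I[OF _ i] by (intro nn_integral_cong) (simp add: mult.assoc[symmetric] ennreal_mult[symmetric])
    finally show ?thesis .
  qed
  have zero_int: "(\<integral>\<^sup>+x. ennreal (e x (snd i) (fst i)) * h x \<partial>?P) = 0"
    if i: "i \<in> I" and z: "\<not> 0 < aI i" for i h
  proof -
    note [measurable] = emI[OF i]
    have "(\<integral>\<^sup>+x. ennreal (e x (snd i) (fst i)) \<partial>?P) = 0" using a_nnI[OF i] z by (simp add: not_less ennreal_neg)
    then have "AE x in ?P. ennreal (e x (snd i) (fst i)) = 0" by (subst (asm) nn_integral_0_iff_AE) auto
    then have "(\<integral>\<^sup>+x. ennreal (e x (snd i) (fst i)) * h x \<partial>?P) = (\<integral>\<^sup>+x. 0 \<partial>?P)"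
      by (intro nn_integral_cong_AE) auto
    then show ?thesis by simp
  qed
  have \<mu>Xs: "sets (\<mu>X i) = sets ?P" for i by (simp add: \<mu>X_def)
  have \<mu>X_em: "ennreal (aI i) * emeasure (\<mu>X i) A = (\<integral>\<^sup>+x. ennreal (e x (snd i) (fst i)) * indicator A x \<partial>?P)"
    if "i \<in> I" "0 < aI i" "A \<in> sets ?P" for i A
    using \<mu>X_int[OF that(1,2), of "indicator A"] that(3) by (simp add: \<mu>Xs)
  have \<mu>Xp: "prob_space (\<mu>X i)" if "i \<in> I" "0 < aI i" for i
  proof (rule prob_spaceI)
    have "ennreal (aI i) * emeasure (\<mu>X i) (space ?P) = ennreal (aI i)"
      using \<mu>X_em[OF that sets.top] a_nnI[OF that(1)] by (simp cong: nn_integral_cong)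
    then have "ennreal (1 / aI i) * (ennreal (aI i) * emeasure (\<mu>X i) (space ?P)) = ennreal (1 / aI i) * ennreal (aI i)" by simp
    then show "emeasure (\<mu>X i) (space (\<mu>X i)) = 1"
      using that by (simp add: mult.assoc[symmetric] ennreal_mult[symmetric] \<mu>X_def)
  qed
  have sum_e: "(\<Sum>j<m. ennreal (e x k j)) = 1" if "x \<in> space ?P" "k < kk" for x k
    using e0 e1 that by (subst sum_ennreal) auto
  have mixX: "(\<Sum>i\<in>I. ennreal (w i) * emeasure (\<mu>X i) A) = emeasure ?P A" if A: "A \<in> sets ?P" for A
  proof -
    have "(\<Sum>i\<in>I. ennreal (w i) * emeasure (\<mu>X i) A)
      = (\<Sum>i\<in>I. ennreal (1 / kk) * (\<integral>\<^sup>+x. ennreal (e x (snd i) (fst i)) * indicator A x \<partial>?P))"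
    proof (intro sum.cong refl)
      fix i assume i: "i \<in> I"
      show "ennreal (w i) * emeasure (\<mu>X i) A = ennreal (1 / kk) * (\<integral>\<^sup>+x. ennreal (e x (snd i) (fst i)) * indicator A x \<partial>?P)"
      proof (cases "0 < aI i")
        case True
        have "ennreal (w i) = ennreal (1 / kk) * ennreal (aI i)" using True by (simp add: w_def ennreal_mult[symmetric])
        then show ?thesis using \<mu>X_em[OF i True A] by (simp add: mult.assoc)
      next
        case False
        then show ?thesis using zero_int[OF i False] w0[OF i] wpos[of i] by simp
      qed
    qed
    also have "\<dots> = ennreal (1 / kk) * (\<Sum>k<kk. \<Sum>j<m. \<integral>\<^sup>+x. ennreal (e x k j) * indicator A x \<partial>?P)"
      by (simp add: sumI sum_distrib_left)
    also have "(\<Sum>k<kk. \<Sum>j<m. \<integral>\<^sup>+x. ennreal (e x k j) * indicator A x \<partial>?P) = (\<Sum>k<kk. emeasure ?P A)"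
    proof (intro sum.cong refl)
      fix k assume "k \<in> {..<kk}"
      then have k: "k < kk" by simp
      have "(\<Sum>j<m. \<integral>\<^sup>+x. ennreal (e x k j) * indicator A x \<partial>?P) = (\<integral>\<^sup>+x. (\<Sum>j<m. ennreal (e x k j) * indicator A x) \<partial>?P)"
        using em k A by (intro nn_integral_sum[symmetric]) auto
      also have "\<dots> = (\<integral>\<^sup>+x. indicator A x \<partial>?P)"
        using sum_e k by (intro nn_integral_cong) (simp add: sum_distrib_right[symmetric])
      finally show "(\<Sum>j<m. \<integral>\<^sup>+x. ennreal (e x k j) * indicator A x \<partial>?P) = emeasure ?P A" using A by simp
    qed
    also have "ennreal (1 / kk) * (\<Sum>k<kk. emeasure ?P A) = emeasure ?P A"
      using kk by (simp add: mult.assoc[symmetric] ennreal_of_nat_eq_real_of_nat ennreal_mult[symmetric])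
    finally show ?thesis .
  qed
  \<comment> \<open>An encoder probability is at most 1, so conditioning on \<open>(j, k)\<close>
    multiplies the block law by at most \<open>1 / aI i\<close>.\<close>
  have domX: "ennreal (aI i) * emeasure (\<mu>X i) A \<le> emeasure ?P A" if "i \<in> I" "0 < w i" "A \<in> sets ?P" for i A
  proof -
    have "ennreal (aI i) * emeasure (\<mu>X i) A = (\<integral>\<^sup>+x. ennreal (e x (snd i) (fst i)) * indicator A x \<partial>?P)"
      using that wpos by (intro \<mu>X_em) auto
    also have "\<dots> \<le> (\<integral>\<^sup>+x. 1 * indicator A x \<partial>?P)"
      using ele that by (intro nn_integral_mono mult_right_mono) (auto simp: I_def)
    finally show ?thesis using that by simp
  qed
  have mixY: "(\<Sum>i\<in>I. ennreal (w i) * emeasure (\<mu>Y i) A) = emeasure ?Q A" if A: "A \<in> sets ?Q" for A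
  proof -
    have "emeasure ?Q A = code_output_prob p n m kk e dec A" using out A QP by simp
    also have "\<dots> = (\<Sum>k<kk. \<Sum>j<m. ennreal (a j k) * emeasure (dec j k) A) / of_nat kk"
      unfolding code_output_prob_def using a_nn by simp
    also have "\<dots> = (\<Sum>k<kk. \<Sum>j<m. ennreal (a j k / kk) * emeasure (dec j k) A)"
    proof -
      have "ennreal (a j k / kk) * emeasure (dec j k) A = ennreal (1 / kk) * (ennreal (a j k) * emeasure (dec j k) A)" if "j < m" "k < kk" for j k
        using a0[OF that] by (simp add: mult.assoc[symmetric] ennreal_mult[symmetric])
      moreover have "x / of_nat kk = ennreal (1 / kk) * x" for x
        using kk by (simp add: divide_ennreal_def ennreal_of_nat_eq_real_of_nat inverse_ennreal mult.commute inverse_eq_divide)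
      ultimately show ?thesis by (simp add: sum_distrib_left)
    qed
    finally show ?thesis by (simp add: sumI w_def aI_def \<mu>Y_def)
  qed
  \<comment> \<open>A single term of the mixture that makes up the output law; the exactness of the
    output enters through \<open>mixY\<close>.\<close>
  have domY: "ennreal (w i) * emeasure (\<mu>Y i) A \<le> emeasure ?Q A" if "i \<in> I" "A \<in> sets ?Q" for i A
    unfolding mixY[OF that(2), symmetric] using that I by (intro member_le_sum) auto
  have \<mu>Yp: "prob_space (\<mu>Y i)" and \<mu>Ys: "sets (\<mu>Y i) = sets ?Q" if "i \<in> I" for i
    using that decp decs QP by (auto simp: \<mu>Y_def I_def)
  have exX: "\<exists>\<phi> C. (\<forall>i t. \<phi> i t \<in> borel_measurable p) \<and> (\<forall>i t x. 0 \<le> \<phi> i t x) \<and> (\<forall>i t x. \<phi> i t x \<le> C) \<and>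
    (\<forall>i t. (\<integral>\<^sup>+x. ennreal (\<phi> i t x) \<partial>p) = 1) \<and>
    (\<forall>i\<in>I. \<forall>t<n. 0 < w i \<longrightarrow> distr (\<mu>X i) p (\<lambda>x. x t) = density p (\<lambda>x. ennreal (\<phi> i t x))) \<and>
    (AE x in p. (\<Sum>i\<in>I. \<Sum>t<n. ennreal (w i / n) * ennreal (\<phi> i t x)) = 1) \<and>
    (\<Sum>i\<in>I. \<Sum>t<n. w i / n * (\<integral>x. \<phi> i t x * ln (\<phi> i t x) \<partial>p)) \<le> (\<Sum>i\<in>I. w i * (- ln (aI i))) / n"
    using wpos by (intro letter_channels[OF p n I(1) w0 w1 \<mu>Xp \<mu>Xs mixX _ domX]) auto
  obtain \<phi> C1 where \<phi>m: "\<And>i t. \<phi> i t \<in> borel_measurable p" and \<phi>0: "\<And>i t x. 0 \<le> \<phi> i t x" and \<phi>C: "\<And>i t x. \<phi> i t x \<le> C1"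
    and \<phi>1: "\<And>i t. (\<integral>\<^sup>+x. ennreal (\<phi> i t x) \<partial>p) = 1"
    and \<phi>d: "\<And>i t. i \<in> I \<Longrightarrow> t < n \<Longrightarrow> 0 < w i \<Longrightarrow> distr (\<mu>X i) p (\<lambda>x. x t) = density p (\<lambda>x. ennreal (\<phi> i t x))"
    and \<phi>ae: "AE x in p. (\<Sum>i\<in>I. \<Sum>t<n. ennreal (w i / n) * ennreal (\<phi> i t x)) = 1"
    and \<phi>I: "(\<Sum>i\<in>I. \<Sum>t<n. w i / n * (\<integral>x. \<phi> i t x * ln (\<phi> i t x) \<partial>p)) \<le> (\<Sum>i\<in>I. w i * (- ln (aI i))) / n"
    using exX
  proof (elim exE conjE, goal_cases)
    case (1 \<phi> C)
    show ?thesis by (rule that[of \<phi> C]) (use 1(2-) in blast)+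
  qed
  have exY: "\<exists>\<phi> C. (\<forall>i t. \<phi> i t \<in> borel_measurable q) \<and> (\<forall>i t x. 0 \<le> \<phi> i t x) \<and> (\<forall>i t x. \<phi> i t x \<le> C) \<and>
    (\<forall>i t. (\<integral>\<^sup>+x. ennreal (\<phi> i t x) \<partial>q) = 1) \<and>
    (\<forall>i\<in>I. \<forall>t<n. 0 < w i \<longrightarrow> distr (\<mu>Y i) q (\<lambda>x. x t) = density q (\<lambda>x. ennreal (\<phi> i t x))) \<and>
    (AE x in q. (\<Sum>i\<in>I. \<Sum>t<n. ennreal (w i / n) * ennreal (\<phi> i t x)) = 1) \<and>
    (\<Sum>i\<in>I. \<Sum>t<n. w i / n * (\<integral>x. \<phi> i t x * ln (\<phi> i t x) \<partial>q)) \<le> (\<Sum>i\<in>I. w i * (- ln (w i))) / n"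
    by (intro letter_channels[OF q n I(1) w0 w1 \<mu>Yp \<mu>Ys mixY _ domY]) auto
  obtain \<psi> C2 where \<psi>m: "\<And>i t. \<psi> i t \<in> borel_measurable q" and \<psi>0: "\<And>i t x. 0 \<le> \<psi> i t x" and \<psi>C: "\<And>i t x. \<psi> i t x \<le> C2"
    and \<psi>1: "\<And>i t. (\<integral>\<^sup>+x. ennreal (\<psi> i t x) \<partial>q) = 1"
    and \<psi>d: "\<And>i t. i \<in> I \<Longrightarrow> t < n \<Longrightarrow> 0 < w i \<Longrightarrow> distr (\<mu>Y i) q (\<lambda>x. x t) = density q (\<lambda>x. ennreal (\<psi> i t x))"
    and \<psi>ae: "AE x in q. (\<Sum>i\<in>I. \<Sum>t<n. ennreal (w i / n) * ennreal (\<psi> i t x)) = 1"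
    and \<psi>I: "(\<Sum>i\<in>I. \<Sum>t<n. w i / n * (\<integral>x. \<psi> i t x * ln (\<psi> i t x) \<partial>q)) \<le> (\<Sum>i\<in>I. w i * (- ln (w i))) / n"
    using exY
  proof (elim exE conjE, goal_cases)
    case (1 \<phi> C)
    show ?thesis by (rule that[of \<phi> C]) (use 1(2-) in blast)+
  qed
  \<comment> \<open>For each seed this is an entropy over \<open>m\<close> messages; the uniform
    seed averages these entropies.\<close>
  have rateX: "(\<Sum>i\<in>I. w i * (- ln (aI i))) / n \<le> R"
  proof -
    have "(\<Sum>i\<in>I. w i * (- ln (aI i))) = (\<Sum>k<kk. (\<Sum>j<m. a j k * (- ln (a j k))) / kk)"
      by (simp add: sumI w_def aI_def sum_divide_distrib)
    also have "\<dots> \<le> (\<Sum>k<kk. ln (real m) / kk)"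
    proof (intro sum_mono divide_right_mono)
      fix k assume "k \<in> {..<kk}"
      then show "(\<Sum>j<m. a j k * (- ln (a j k))) \<le> ln (real m)"
        using entropy_le_ln_card[of "{..<m}" "\<lambda>j. a j k"] m a0 a1 by auto
    qed simp
    also have "\<dots> = ln (real m)" using kk by simp
    finally show ?thesis using mR n by (meson divide_right_mono of_nat_0_le_iff order_trans)
  qed
  have rateY: "(\<Sum>i\<in>I. w i * (- ln (w i))) / n \<le> R + Rc"
  proof -
    have "(\<Sum>i\<in>I. w i * (- ln (w i))) \<le> ln (card I)" by (rule entropy_le_ln_card[OF I w0 w1])
    also have "\<dots> = ln (real m) + ln (real kk)" using m kk by (simp add: I_def card_cartesian_product ln_mult)
    finally have "(\<Sum>i\<in>I. w i * (- ln (w i))) / n \<le> (ln (real m) + ln (real kk)) / n" by (rule divide_right_mono) simp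
    then show ?thesis using mR kR by (simp add: add_divide_distrib)
  qed
  have Wf: "finite (I \<times> {..<n})" using I by simp
  \<comment> \<open>A copy of the finite alphabet \<open>I \<times> {..<n}\<close> inside the given
    type; \<open>b\<close> translates back.\<close>
  obtain B :: "'u set" where B: "finite B" "card B = card (I \<times> {..<n})"
    using infinite_arbitrarily_large[OF inf] by blast
  obtain b where b: "bij_betw b B (I \<times> {..<n})"
    using finite_same_card_bij[OF B(1) Wf B(2)] by blast
  have bI: "fst (b u) \<in> I" "snd (b u) < n" if "u \<in> B" for u
    using bij_betwE[OF b] that by (auto simp: mem_Times_iff)
  \<comment> \<open>Message and seed with their true law, together with an independent uniform
    time.\<close>
  define \<nu> where "\<nu> = point_measure B (\<lambda>u. ennreal (w (fst (b u)) / n))"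
  have \<nu>s: "sets \<nu> = Pow B" "space \<nu> = B" by (simp_all add: \<nu>_def sets_point_measure space_point_measure)
  have \<nu>sc: "sets \<nu> = sets (count_space B)" by (simp add: \<nu>s)
  have nu_nn: "(\<integral>\<^sup>+u. H (b u) \<partial>\<nu>) = (\<Sum>i\<in>I. \<Sum>t<n. ennreal (w i / n) * H (i, t))" for H
  proof -
    have "(\<integral>\<^sup>+u. H (b u) \<partial>\<nu>) = (\<Sum>u\<in>B. ennreal (w (fst (b u)) / n) * H (b u))"
      unfolding \<nu>_def by (rule nn_integral_point_measure_finite[OF B(1)])
    also have "\<dots> = (\<Sum>z\<in>I \<times> {..<n}. ennreal (w (fst z) / n) * H z)"
      by (rule sum.reindex_bij_betw[OF b])
    finally show ?thesis by (simp add: sum.cartesian_product')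
  qed
  have nu_int: "(\<integral>u. H (b u) \<partial>\<nu>) = (\<Sum>i\<in>I. \<Sum>t<n. w i / n * H (i, t))" for H :: "(nat \<times> nat) \<times> nat \<Rightarrow> real"
  proof -
    have "(\<integral>u. H (b u) \<partial>\<nu>) = (\<Sum>u\<in>B. (w (fst (b u)) / n) *\<^sub>R H (b u))"
      unfolding \<nu>_def using w0 bI by (intro lebesgue_integral_point_measure_finite[OF B(1)]) auto
    also have "\<dots> = (\<Sum>z\<in>I \<times> {..<n}. (w (fst z) / n) *\<^sub>R H z)"
      by (rule sum.reindex_bij_betw[OF b])
    finally show ?thesis by (simp add: sum.cartesian_product')
  qed
  have \<nu>: "prob_space \<nu>"
  proof (rule prob_spaceI)
    have "emeasure \<nu> (space \<nu>) = (\<integral>\<^sup>+u. 1 \<partial>\<nu>)" by simp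
    also have "\<dots> = (\<Sum>i\<in>I. \<Sum>t<n. ennreal (w i / n))" using nu_nn[of "\<lambda>_. 1"] by simp
    also have "\<dots> = ennreal (\<Sum>i\<in>I. \<Sum>t<n. w i / n)" using w0 by (simp add: sum_ennreal sum_nonneg del: sum_constant)
    also have "(\<Sum>i\<in>I. \<Sum>t<n. w i / n) = 1" using w1 n by simp
    finally show "emeasure \<nu> (space \<nu>) = 1" by simp
  qed
  interpret \<nu>: prob_space \<nu> by fact
  define f where "f z = \<phi> (fst (b (snd z))) (snd (b (snd z))) (fst z)" for z
  define g where "g z = \<psi> (fst (b (snd z))) (snd (b (snd z))) (fst z)" for z
  \<comment> \<open>The second coordinate ranges over a finite discrete space, so measurability in
    the first coordinate for each fixed index is enough.\<close>
  have fgen: "(\<lambda>z. \<xi> (fst (b (snd z))) (snd (b (snd z))) (fst z)) \<in> borel_measurable (r \<Otimes>\<^sub>M \<nu>)"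
    if "\<And>i t. \<xi> i t \<in> borel_measurable r" for \<xi> :: "nat \<times> nat \<Rightarrow> nat \<Rightarrow> 'a \<Rightarrow> real" and r
  proof -
    have 1: "(\<lambda>z. \<xi> (fst (b (fst z))) (snd (b (fst z))) (snd z)) \<in> borel_measurable (count_space B \<Otimes>\<^sub>M r)"
      using that B(1) by (intro measurable_pair_measure_countable1) (auto intro: countable_finite)
    have 2: "(\<lambda>z. (snd z, fst z)) \<in> measurable (r \<Otimes>\<^sub>M count_space B) (count_space B \<Otimes>\<^sub>M r)" by measurable
    have "(\<lambda>z. \<xi> (fst (b (snd z))) (snd (b (snd z))) (fst z)) \<in> borel_measurable (r \<Otimes>\<^sub>M count_space B)"
      using measurable_compose[OF 2 1] by simp
    moreover have "sets (r \<Otimes>\<^sub>M \<nu>) = sets (r \<Otimes>\<^sub>M count_space B)" by (intro sets_pair_measure_cong \<nu>sc refl)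
    ultimately show ?thesis by (simp cong: measurable_cong_sets)
  qed
  have fm: "f \<in> borel_measurable (p \<Otimes>\<^sub>M \<nu>)" unfolding f_def by (rule fgen[OF \<phi>m])
  have gm: "g \<in> borel_measurable (q \<Otimes>\<^sub>M \<nu>)" unfolding g_def by (rule fgen[OF \<psi>m])
  have fch: "channel p \<nu> f"
    unfolding channel_def
  proof (intro conjI allI ballI fm)
    show "0 \<le> f z" for z by (simp add: f_def \<phi>0)
    show "(\<integral>\<^sup>+x. ennreal (f (x, u)) \<partial>p) = 1" for u by (simp add: f_def \<phi>1)
    show "AE x in p. (\<integral>\<^sup>+u. ennreal (f (x, u)) \<partial>\<nu>) = 1"
      using \<phi>ae by eventually_elim (use nu_nn[of "\<lambda>z. ennreal (\<phi> (fst z) (snd z) _)"] in \<open>simp add: f_def\<close>)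
  qed
  have gch: "channel q \<nu> g"
    unfolding channel_def
  proof (intro conjI allI ballI gm)
    show "0 \<le> g z" for z by (simp add: g_def \<psi>0)
    show "(\<integral>\<^sup>+x. ennreal (g (x, u)) \<partial>q) = 1" for u by (simp add: g_def \<psi>1)
    show "AE x in q. (\<integral>\<^sup>+u. ennreal (g (x, u)) \<partial>\<nu>) = 1"
      using \<psi>ae by eventually_elim (use nu_nn[of "\<lambda>z. ennreal (\<psi> (fst z) (snd z) _)"] in \<open>simp add: g_def\<close>)
  qed
  have fC: "f z \<le> max C1 C2" for z by (simp add: f_def le_max_iff_disj \<phi>C)
  have gC: "g z \<le> max C1 C2" for z by (simp add: g_def le_max_iff_disj \<psi>C)
  have fR: "(\<integral>z. f z * ln (f z) \<partial>(p \<Otimes>\<^sub>M \<nu>)) \<le> R"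
  proof -
    interpret pn: pair_prob_space p \<nu> by standard
    have "(\<integral>z. f z * ln (f z) \<partial>(p \<Otimes>\<^sub>M \<nu>)) = (\<integral>u. (\<integral>x. f (x, u) * ln (f (x, u)) \<partial>p) \<partial>\<nu>)"
      using pn.integral_snd[of "\<lambda>x u. f (x, u) * ln (f (x, u))"] pn.integrable_xlnx[OF fm channelD(2)[OF fch] fC]
      by (simp add: split_beta')
    also have "\<dots> = (\<Sum>i\<in>I. \<Sum>t<n. w i / n * (\<integral>x. \<phi> i t x * ln (\<phi> i t x) \<partial>p))"
      using nu_int[of "\<lambda>z. \<integral>x. \<phi> (fst z) (snd z) x * ln (\<phi> (fst z) (snd z) x) \<partial>p"] by (simp add: f_def)
    finally show ?thesis using \<phi>I rateX by linarith
  qed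
  have gR: "(\<integral>z. g z * ln (g z) \<partial>(q \<Otimes>\<^sub>M \<nu>)) \<le> R + Rc"
  proof -
    interpret qn: pair_prob_space q \<nu> by standard
    have "(\<integral>z. g z * ln (g z) \<partial>(q \<Otimes>\<^sub>M \<nu>)) = (\<integral>u. (\<integral>x. g (x, u) * ln (g (x, u)) \<partial>q) \<partial>\<nu>)"
      using qn.integral_snd[of "\<lambda>x u. g (x, u) * ln (g (x, u))"] qn.integrable_xlnx[OF gm channelD(2)[OF gch] gC]
      by (simp add: split_beta')
    also have "\<dots> = (\<Sum>i\<in>I. \<Sum>t<n. w i / n * (\<integral>x. \<psi> i t x * ln (\<psi> i t x) \<partial>q))"
      using nu_int[of "\<lambda>z. \<integral>x. \<psi> (fst z) (snd z) x * ln (\<psi> (fst z) (snd z) x) \<partial>q"] by (simp add: g_def)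
    finally show ?thesis using \<psi>I rateY by linarith
  qed
  define L where "L t i x = (\<integral>\<^sup>+y. ennreal (\<Delta> (x t) (y t)) \<partial>\<mu>Y i)" for t i x
  have cP: "(\<lambda>x. x t) \<in> measurable ?P p" if "t < n" for t
    using that by (auto intro: measurable_component_singleton)
  have cY: "(\<lambda>x. x t) \<in> measurable (\<mu>Y i) q" if "t < n" "i \<in> I" for t i
    using that \<mu>Ys[OF that(2)] by (simp cong: measurable_cong_sets)
  have cX: "(\<lambda>x. x t) \<in> measurable (\<mu>X i) p" if "t < n" for t i
    using that \<mu>Xs[of i] by (simp cong: measurable_cong_sets)
  define L1 where "L1 t i x = (\<integral>\<^sup>+y. ennreal (\<Delta> x (y t)) \<partial>\<mu>Y i)" for t i x
  have L1m: "L1 t i \<in> borel_measurable p" if t: "t < n" and i: "i \<in> I" for t i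
  proof -
    interpret Y: prob_space "\<mu>Y i" by (rule \<mu>Yp[OF i])
    have "(\<lambda>z. (fst z, snd z t)) \<in> measurable (p \<Otimes>\<^sub>M \<mu>Y i) (p \<Otimes>\<^sub>M q)"
      by (intro measurable_Pair measurable_fst measurable_compose[OF measurable_snd cY[OF t i]])
    from measurable_compose[OF this \<Delta>m'] have "(\<lambda>(x, y). ennreal (\<Delta> x (y t))) \<in> borel_measurable (p \<Otimes>\<^sub>M \<mu>Y i)"
      by (simp add: split_beta')
    then show ?thesis unfolding L1_def by (rule Y.borel_measurable_nn_integral)
  qed
  have LL1: "L t i x = L1 t i (x t)" for t i x by (simp add: L_def L1_def)
  have Lm: "L t i \<in> borel_measurable ?P" if "t < n" "i \<in> I" for t i
    unfolding LL1 by (rule measurable_compose[OF cP[OF that(1)] L1m[OF that]])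
  \<comment> \<open>Given \<open>(j, k)\<close> the decoder output is independent of the source, so
    the two letters have the product of their conditional laws and the double integral is the cost
    incurred with this index. For weight zero both sides vanish.\<close>
  have key: "ennreal (w i / n) * (\<integral>\<^sup>+x. \<integral>\<^sup>+y. ennreal (\<phi> i t x) * (ennreal (\<Delta> x y) * ennreal (\<psi> i t y)) \<partial>q \<partial>p)
    = ennreal (1 / (n * kk)) * (\<integral>\<^sup>+x. ennreal (e x (snd i) (fst i)) * L t i x \<partial>?P)" if i: "i \<in> I" and t: "t < n" for i t
  proof (cases "0 < w i")
    case True
    note [measurable] = \<phi>m \<psi>m \<Delta>m'
    have inner: "(\<integral>\<^sup>+y. ennreal (\<Delta> x y) * ennreal (\<psi> i t y) \<partial>q) = L1 t i x" if x: "x \<in> space p" for x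
    proof -
      have [measurable]: "(\<lambda>y. ennreal (\<Delta> x y)) \<in> borel_measurable q" using x by measurable
      have "(\<integral>\<^sup>+y. ennreal (\<Delta> x y) * ennreal (\<psi> i t y) \<partial>q) = (\<integral>\<^sup>+y. ennreal (\<Delta> x y) \<partial>density q (\<lambda>y. ennreal (\<psi> i t y)))"
        by (subst nn_integral_density) (auto simp: mult.commute)
      also have "\<dots> = L1 t i x"
        unfolding \<psi>d[OF i t True, symmetric] L1_def by (rule nn_integral_distr[OF cY[OF t i]]) measurable
      finally show ?thesis .
    qed
    have "(\<integral>\<^sup>+x. \<integral>\<^sup>+y. ennreal (\<phi> i t x) * (ennreal (\<Delta> x y) * ennreal (\<psi> i t y)) \<partial>q \<partial>p)
      = (\<integral>\<^sup>+x. ennreal (\<phi> i t x) * L1 t i x \<partial>p)"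
    proof (rule nn_integral_cong)
      fix x assume x: "x \<in> space p"
      then have [measurable]: "(\<lambda>y. ennreal (\<Delta> x y)) \<in> borel_measurable q" by measurable
      show "(\<integral>\<^sup>+y. ennreal (\<phi> i t x) * (ennreal (\<Delta> x y) * ennreal (\<psi> i t y)) \<partial>q) = ennreal (\<phi> i t x) * L1 t i x"
        unfolding inner[OF x, symmetric] by (rule nn_integral_cmult) measurable
    qed
    also have "\<dots> = (\<integral>\<^sup>+x. L1 t i x \<partial>density p (\<lambda>x. ennreal (\<phi> i t x)))"
      using L1m[OF t i] by (subst nn_integral_density) auto
    also have "\<dots> = (\<integral>\<^sup>+x. L t i x \<partial>\<mu>X i)"
      unfolding \<phi>d[OF i t True, symmetric] LL1 by (rule nn_integral_distr[OF cX[OF t]]) (use L1m[OF t i] in simp)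
    finally have K: "(\<integral>\<^sup>+x. \<integral>\<^sup>+y. ennreal (\<phi> i t x) * (ennreal (\<Delta> x y) * ennreal (\<psi> i t y)) \<partial>q \<partial>p)
      = (\<integral>\<^sup>+x. L t i x \<partial>\<mu>X i)" .
    have W: "ennreal (w i / n) = ennreal (1 / (n * kk)) * ennreal (aI i)"
      using aI0[OF i] by (simp add: w_def ennreal_mult[symmetric] mult.commute)
    show ?thesis
      unfolding K W mult.assoc using \<mu>X_int[OF i _ Lm[OF t i]] True wpos by simp
  next
    case False
    then have "w i = 0" using w0[OF i] by simp
    moreover have "\<not> 0 < aI i" using False wpos by simp
    ultimately show ?thesis using zero_int[OF i] by simp
  qed
  have "avg_distortion p q \<nu> f g \<Delta> = (\<Sum>i\<in>I. \<Sum>t<n. ennreal (w i / n) *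
      (\<integral>\<^sup>+x. \<integral>\<^sup>+y. ennreal (\<phi> i t x) * (ennreal (\<Delta> x y) * ennreal (\<psi> i t y)) \<partial>q \<partial>p))"
    using nu_nn[of "\<lambda>z. \<integral>\<^sup>+x. \<integral>\<^sup>+y. ennreal (\<phi> (fst z) (snd z) x) * (ennreal (\<Delta> x y) * ennreal (\<psi> (fst z) (snd z) y)) \<partial>q \<partial>p"]
    by (simp add: f_def g_def)
  also have "\<dots> = (\<Sum>i\<in>I. \<Sum>t<n. ennreal (1 / (n * kk)) * (\<integral>\<^sup>+x. ennreal (e x (snd i) (fst i)) * L t i x \<partial>?P))"
    by (intro sum.cong refl key) auto
  also have "\<dots> = (\<Sum>t<n. ennreal (1 / (n * kk)) * (\<Sum>i\<in>I. \<integral>\<^sup>+x. ennreal (e x (snd i) (fst i)) * L t i x \<partial>?P))"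
    by (subst sum.swap) (simp add: sum_distrib_left)
  also have "\<dots> = (\<Sum>t<n. code_distortion p \<Delta> n m kk e dec t) / of_nat n"
  proof -
    have "code_distortion p \<Delta> n m kk e dec t = (\<Sum>i\<in>I. \<integral>\<^sup>+x. ennreal (e x (snd i) (fst i)) * L t i x \<partial>?P) / of_nat kk" if t: "t < n" for t
    proof -
      have "(\<integral>\<^sup>+x. (\<Sum>j<m. ennreal (e x k j) * L t (j, k) x) \<partial>?P) = (\<Sum>j<m. \<integral>\<^sup>+x. ennreal (e x k j) * L t (j, k) x \<partial>?P)"
        if "k < kk" for k
        using that em Lm[OF t] by (intro nn_integral_sum) (auto simp: I_def)
      then show ?thesis unfolding code_distortion_def by (simp add: sumI L_def \<mu>Y_def)
    qed
    moreover have "x / of_nat kk / of_nat n = ennreal (1 / (n * kk)) * x" for x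
    proof -
      have "x / of_nat kk / of_nat n = x * (ennreal (1 / kk) * ennreal (1 / n))"
        using kk n by (simp add: divide_ennreal_def ennreal_of_nat_eq_real_of_nat inverse_ennreal inverse_eq_divide mult.assoc)
      then show ?thesis by (simp add: ennreal_mult[symmetric] mult.commute)
    qed
    moreover have "(\<Sum>t<n. F t) / of_nat n = (\<Sum>t<n. F t / of_nat n)" for F :: "nat \<Rightarrow> ennreal"
      by (simp add: divide_ennreal_def sum_distrib_right)
    ultimately show ?thesis by simp
  qed
  finally have "enn2ereal (avg_distortion p q \<nu> f g \<Delta>) \<le> ereal d" using dist by simp
  then show ?thesis using \<nu> fch gch fC gC fR gR by blast
qed

section \<open>Markov chains from pairs of channels\<close>

text \<open>The law of the Markov chain in which \<open>U\<close> has law \<open>\<nu>\<close> and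
  the two ends are drawn independently given \<open>U\<close>.\<close>

definition triple :: "'a measure \<Rightarrow> 'a measure \<Rightarrow> 'u measure \<Rightarrow> ('a \<times> 'u \<Rightarrow> real) \<Rightarrow> ('a \<times> 'u \<Rightarrow> real)
    \<Rightarrow> ('a \<times> 'u \<times> 'a) measure" where
  "triple p q \<nu> f g = density (p \<Otimes>\<^sub>M (\<nu> \<Otimes>\<^sub>M q))
     (\<lambda>z. ennreal (f (fst z, fst (snd z))) * ennreal (g (snd (snd z), fst (snd z))))"

context
  fixes p q :: "'a measure" and \<nu> :: "'u measure" and f g :: "'a \<times> 'u \<Rightarrow> real"
  assumes p: "prob_space p" and q: "prob_space q" and \<nu>: "prob_space \<nu>" and qp: "sets q = sets p"
    and f: "channel p \<nu> f" and g: "channel q \<nu> g"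
begin

interpretation p: prob_space p by (rule p)
interpretation q: prob_space q by (rule q)
interpretation \<nu>: prob_space \<nu> by (rule \<nu>)

lemma sets_triple: "sets (triple p q \<nu> f g) = sets (p \<Otimes>\<^sub>M (\<nu> \<Otimes>\<^sub>M p))"
  unfolding triple_def sets_density by (intro sets_pair_measure_cong qp refl)

text \<open>\<open>U\<close> is moved to the outermost integral, so that with \<open>H\<close> the
  distortion the right-hand side is \<open>avg_distortion\<close>.\<close>

lemma nn_integral_triple_measure:
  assumes H: "H \<in> borel_measurable (p \<Otimes>\<^sub>M (\<nu> \<Otimes>\<^sub>M q))"
  shows "(\<integral>\<^sup>+z. H z \<partial>triple p q \<nu> f g) = (\<integral>\<^sup>+u. \<integral>\<^sup>+x. \<integral>\<^sup>+y. ennreal (f (x, u)) * (H (x, u, y) * ennreal (g (y, u))) \<partial>q \<partial>p \<partial>\<nu>)"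
proof -
  interpret pn: pair_sigma_finite p \<nu> by standard
  note [measurable] = channelD(1)[OF f] channelD(1)[OF g] H
  have "(\<integral>\<^sup>+z. H z \<partial>triple p q \<nu> f g)
    = (\<integral>\<^sup>+z. ennreal (f (fst z, fst (snd z))) * (H z * ennreal (g (snd (snd z), fst (snd z)))) \<partial>(p \<Otimes>\<^sub>M (\<nu> \<Otimes>\<^sub>M q)))"
    unfolding triple_def by (subst nn_integral_density) (auto simp: mult_ac)
  also have "\<dots> = (\<integral>\<^sup>+x. \<integral>\<^sup>+u. \<integral>\<^sup>+y. ennreal (f (x, u)) * (H (x, u, y) * ennreal (g (y, u))) \<partial>q \<partial>\<nu> \<partial>p)"
    by (subst nn_integral_triple[OF \<nu> q, symmetric]) auto
  also have "\<dots> = (\<integral>\<^sup>+u. \<integral>\<^sup>+x. \<integral>\<^sup>+y. ennreal (f (x, u)) * (H (x, u, y) * ennreal (g (y, u))) \<partial>q \<partial>p \<partial>\<nu>)"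
    by (rule pn.Fubini'[symmetric]) measurable
  finally show ?thesis .
qed

text \<open>Conditional independence in integral form: for fixed \<open>u\<close> the two ends
  integrate separately.\<close>

lemma nn_integral_triple_times:
  assumes [measurable]: "A \<in> borel_measurable p" "B \<in> borel_measurable q" "C \<in> borel_measurable \<nu>"
  shows "(\<integral>\<^sup>+z. C (fst (snd z)) * (A (fst z) * B (snd (snd z))) \<partial>triple p q \<nu> f g)
    = (\<integral>\<^sup>+u. C u * ((\<integral>\<^sup>+x. ennreal (f (x, u)) * A x \<partial>p) * (\<integral>\<^sup>+y. ennreal (g (y, u)) * B y \<partial>q)) \<partial>\<nu>)"
proof -
  note [measurable] = channelD(1)[OF f] channelD(1)[OF g]
  have "(\<integral>\<^sup>+z. C (fst (snd z)) * (A (fst z) * B (snd (snd z))) \<partial>triple p q \<nu> f g)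
    = (\<integral>\<^sup>+u. \<integral>\<^sup>+x. \<integral>\<^sup>+y. ennreal (f (x, u)) * (C u * (A x * B y) * ennreal (g (y, u))) \<partial>q \<partial>p \<partial>\<nu>)"
    by (subst nn_integral_triple_measure) auto
  also have "\<dots> = (\<integral>\<^sup>+u. C u * ((\<integral>\<^sup>+x. ennreal (f (x, u)) * A x \<partial>p) * (\<integral>\<^sup>+y. ennreal (g (y, u)) * B y \<partial>q)) \<partial>\<nu>)"
  proof (rule nn_integral_cong)
    fix u assume [measurable]: "u \<in> space \<nu>"
    have "(\<integral>\<^sup>+x. \<integral>\<^sup>+y. ennreal (f (x, u)) * (C u * (A x * B y) * ennreal (g (y, u))) \<partial>q \<partial>p)
      = (\<integral>\<^sup>+x. (C u * (ennreal (f (x, u)) * A x)) * (\<integral>\<^sup>+y. ennreal (g (y, u)) * B y \<partial>q) \<partial>p)"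
      by (intro nn_integral_cong) (subst nn_integral_cmult[symmetric], auto simp: mult_ac)
    also have "\<dots> = (C u * (\<integral>\<^sup>+x. ennreal (f (x, u)) * A x \<partial>p)) * (\<integral>\<^sup>+y. ennreal (g (y, u)) * B y \<partial>q)"
      by (subst nn_integral_multc) (auto simp: nn_integral_cmult)
    finally show "(\<integral>\<^sup>+x. \<integral>\<^sup>+y. ennreal (f (x, u)) * (C u * (A x * B y) * ennreal (g (y, u))) \<partial>q \<partial>p)
      = C u * ((\<integral>\<^sup>+x. ennreal (f (x, u)) * A x \<partial>p) * (\<integral>\<^sup>+y. ennreal (g (y, u)) * B y \<partial>q))" by (simp add: mult.assoc)
  qed
  finally show ?thesis .
qed

lemma prob_space_triple: "prob_space (triple p q \<nu> f g)"
proof (rule prob_spaceI)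
  have "emeasure (triple p q \<nu> f g) (space (triple p q \<nu> f g)) = (\<integral>\<^sup>+z. 1 * (1 * 1) \<partial>triple p q \<nu> f g)" by simp
  also have "\<dots> = (\<integral>\<^sup>+u. 1 * ((\<integral>\<^sup>+x. ennreal (f (x, u)) * 1 \<partial>p) * (\<integral>\<^sup>+y. ennreal (g (y, u)) * 1 \<partial>q)) \<partial>\<nu>)"
    by (rule nn_integral_triple_times[of "\<lambda>_. 1" "\<lambda>_. 1" "\<lambda>_. 1"]) auto
  also have "\<dots> = (\<integral>\<^sup>+u. 1 \<partial>\<nu>)"
    using channelD(3)[OF f] channelD(3)[OF g] by (intro nn_integral_cong) simp
  finally show "emeasure (triple p q \<nu> f g) (space (triple p q \<nu> f g)) = 1" by (simp add: \<nu>.emeasure_space_1)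
qed

text \<open>The other end integrates to 1 at every \<open>u\<close>.\<close>

lemma distr_triple_fst: "distr (triple p q \<nu> f g) (p \<Otimes>\<^sub>M \<nu>) (\<lambda>z. (fst z, fst (snd z))) = density (p \<Otimes>\<^sub>M \<nu>) (\<lambda>z. ennreal (f z))"
proof (rule measure_eqI)
  note [measurable] = channelD(1)[OF f] channelD(1)[OF g]
  interpret pn: pair_sigma_finite p \<nu> by standard
  fix A assume "A \<in> sets (distr (triple p q \<nu> f g) (p \<Otimes>\<^sub>M \<nu>) (\<lambda>z. (fst z, fst (snd z))))"
  then have A[measurable]: "A \<in> sets (p \<Otimes>\<^sub>M \<nu>)" by simp
  have T: "(\<lambda>z. (fst z, fst (snd z))) \<in> measurable (triple p q \<nu> f g) (p \<Otimes>\<^sub>M \<nu>)"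
    unfolding triple_def by measurable
  have "emeasure (distr (triple p q \<nu> f g) (p \<Otimes>\<^sub>M \<nu>) (\<lambda>z. (fst z, fst (snd z)))) A
    = (\<integral>\<^sup>+z. indicator A (fst z, fst (snd z)) \<partial>triple p q \<nu> f g)"
    by (subst nn_integral_distr[OF T, symmetric]) auto
  also have "\<dots> = (\<integral>\<^sup>+u. \<integral>\<^sup>+x. \<integral>\<^sup>+y. ennreal (f (x, u)) * (indicator A (x, u) * ennreal (g (y, u))) \<partial>q \<partial>p \<partial>\<nu>)"
    by (subst nn_integral_triple_measure) auto
  also have "\<dots> = (\<integral>\<^sup>+u. \<integral>\<^sup>+x. ennreal (f (x, u)) * indicator A (x, u) \<partial>p \<partial>\<nu>)"
  proof (intro nn_integral_cong)
    fix u x assume u[measurable]: "u \<in> space \<nu>" and [measurable]: "x \<in> space p"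
    have "(\<integral>\<^sup>+y. ennreal (f (x, u)) * (indicator A (x, u) * ennreal (g (y, u))) \<partial>q)
      = (\<integral>\<^sup>+y. (ennreal (f (x, u)) * indicator A (x, u)) * ennreal (g (y, u)) \<partial>q)" by (simp add: mult.assoc)
    also have "\<dots> = (ennreal (f (x, u)) * indicator A (x, u)) * (\<integral>\<^sup>+y. ennreal (g (y, u)) \<partial>q)"
      by (rule nn_integral_cmult) measurable
    finally show "(\<integral>\<^sup>+y. ennreal (f (x, u)) * (indicator A (x, u) * ennreal (g (y, u))) \<partial>q) = ennreal (f (x, u)) * indicator A (x, u)"
      using channelD(3)[OF g u] by simp
  qed
  also have "\<dots> = (\<integral>\<^sup>+z. ennreal (f z) * indicator A z \<partial>(p \<Otimes>\<^sub>M \<nu>))" by (rule pn.nn_integral_snd) measurable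
  also have "\<dots> = emeasure (density (p \<Otimes>\<^sub>M \<nu>) (\<lambda>z. ennreal (f z))) A" by (simp add: emeasure_density)
  finally show "emeasure (distr (triple p q \<nu> f g) (p \<Otimes>\<^sub>M \<nu>) (\<lambda>z. (fst z, fst (snd z)))) A
    = emeasure (density (p \<Otimes>\<^sub>M \<nu>) (\<lambda>z. ennreal (f z))) A" .
qed simp

lemma distr_triple_snd: "distr (triple p q \<nu> f g) (p \<Otimes>\<^sub>M \<nu>) (\<lambda>z. (snd (snd z), fst (snd z))) = density (q \<Otimes>\<^sub>M \<nu>) (\<lambda>z. ennreal (g z))"
proof (rule measure_eqI)
  have qn: "sets (p \<Otimes>\<^sub>M \<nu>) = sets (q \<Otimes>\<^sub>M \<nu>)" by (intro sets_pair_measure_cong) (simp_all add: qp)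
  note [measurable] = channelD(1)[OF f] channelD(1)[OF g]
  interpret qn: pair_sigma_finite q \<nu> by standard
  fix A assume "A \<in> sets (distr (triple p q \<nu> f g) (p \<Otimes>\<^sub>M \<nu>) (\<lambda>z. (snd (snd z), fst (snd z))))"
  then have A[measurable]: "A \<in> sets (q \<Otimes>\<^sub>M \<nu>)" using qn by simp
  have T: "(\<lambda>z. (snd (snd z), fst (snd z))) \<in> measurable (triple p q \<nu> f g) (p \<Otimes>\<^sub>M \<nu>)"
    unfolding triple_def using qn by (simp cong: measurable_cong_sets)
  have "emeasure (distr (triple p q \<nu> f g) (p \<Otimes>\<^sub>M \<nu>) (\<lambda>z. (snd (snd z), fst (snd z)))) A
    = (\<integral>\<^sup>+z. indicator A (snd (snd z), fst (snd z)) \<partial>triple p q \<nu> f g)"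
  proof -
    have "A \<in> sets (p \<Otimes>\<^sub>M \<nu>)" using A by (simp only: qn)
    then show ?thesis by (subst nn_integral_distr[OF T, symmetric]) auto
  qed
  also have "\<dots> = (\<integral>\<^sup>+u. \<integral>\<^sup>+x. \<integral>\<^sup>+y. ennreal (f (x, u)) * (indicator A (y, u) * ennreal (g (y, u))) \<partial>q \<partial>p \<partial>\<nu>)"
    by (subst nn_integral_triple_measure) auto
  also have "\<dots> = (\<integral>\<^sup>+u. \<integral>\<^sup>+y. ennreal (g (y, u)) * indicator A (y, u) \<partial>q \<partial>\<nu>)"
  proof (intro nn_integral_cong)
    fix u assume u[measurable]: "u \<in> space \<nu>"
    have "(\<integral>\<^sup>+x. \<integral>\<^sup>+y. ennreal (f (x, u)) * (indicator A (y, u) * ennreal (g (y, u))) \<partial>q \<partial>p)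
      = (\<integral>\<^sup>+x. ennreal (f (x, u)) * (\<integral>\<^sup>+y. indicator A (y, u) * ennreal (g (y, u)) \<partial>q) \<partial>p)"
      by (intro nn_integral_cong nn_integral_cmult) measurable
    also have "\<dots> = (\<integral>\<^sup>+x. ennreal (f (x, u)) \<partial>p) * (\<integral>\<^sup>+y. indicator A (y, u) * ennreal (g (y, u)) \<partial>q)"
      by (rule nn_integral_multc) measurable
    finally show "(\<integral>\<^sup>+x. \<integral>\<^sup>+y. ennreal (f (x, u)) * (indicator A (y, u) * ennreal (g (y, u))) \<partial>q \<partial>p)
      = (\<integral>\<^sup>+y. ennreal (g (y, u)) * indicator A (y, u) \<partial>q)"
      using channelD(3)[OF f u] by (simp add: mult.commute)
  qed
  also have "\<dots> = (\<integral>\<^sup>+z. ennreal (g z) * indicator A z \<partial>(q \<Otimes>\<^sub>M \<nu>))" by (rule qn.nn_integral_snd) measurable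
  also have "\<dots> = emeasure (density (q \<Otimes>\<^sub>M \<nu>) (\<lambda>z. ennreal (g z))) A" by (simp add: emeasure_density)
  finally show "emeasure (distr (triple p q \<nu> f g) (p \<Otimes>\<^sub>M \<nu>) (\<lambda>z. (snd (snd z), fst (snd z)))) A
    = emeasure (density (q \<Otimes>\<^sub>M \<nu>) (\<lambda>z. ennreal (g z))) A" .
qed (simp, intro sets_pair_measure_cong, simp_all add: qp)

text \<open>\<open>\<alpha>\<close> and \<open>\<beta>\<close> are the conditional probabilities of
  the two events given \<open>u\<close>, at most 1 by normalisation, so \<open>enn2real\<close>
  loses nothing. The test against \<open>C\<close> is \<open>nn_integral_triple_times\<close> used
  twice, once with the two events and once with \<open>\<alpha> * \<beta>\<close> absorbed into the
  function of \<open>u\<close>.\<close>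

lemma cond_exp_triple:
  assumes A: "A \<in> sets p" and B: "B \<in> sets q"
  defines "\<alpha> \<equiv> (\<lambda>u. enn2real (\<integral>\<^sup>+x. ennreal (f (x, u)) * indicator A x \<partial>p))"
    and "\<beta> \<equiv> (\<lambda>u. enn2real (\<integral>\<^sup>+y. ennreal (g (y, u)) * indicator B y \<partial>q))"
  shows "AE z in triple p q \<nu> f g. real_cond_exp (triple p q \<nu> f g)
      (vimage_algebra (space (triple p q \<nu> f g)) (\<lambda>z. fst (snd z)) \<nu>)
      (\<lambda>z. indicator A (fst z) * indicator B (snd (snd z))) z = \<alpha> (fst (snd z)) * \<beta> (fst (snd z))"
proof -
  let ?P = "triple p q \<nu> f g"
  interpret P: prob_space ?P by (rule prob_space_triple)
  note [measurable] = channelD(1)[OF f] channelD(1)[OF g] A B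
  have sP[measurable_cong]: "sets ?P = sets (p \<Otimes>\<^sub>M (\<nu> \<Otimes>\<^sub>M q))" by (simp add: triple_def)
  have \<alpha>m[measurable]: "\<alpha> \<in> borel_measurable \<nu>" and \<beta>m[measurable]: "\<beta> \<in> borel_measurable \<nu>"
    unfolding \<alpha>_def \<beta>_def by measurable
  have \<alpha>1: "ennreal (\<alpha> u) = (\<integral>\<^sup>+x. ennreal (f (x, u)) * indicator A x \<partial>p)" "\<alpha> u \<le> 1" if u: "u \<in> space \<nu>" for u
  proof -
    have "(\<integral>\<^sup>+x. ennreal (f (x, u)) * indicator A x \<partial>p) \<le> (\<integral>\<^sup>+x. ennreal (f (x, u)) \<partial>p)"
      by (intro nn_integral_mono) (auto simp: indicator_def)
    then have le: "(\<integral>\<^sup>+x. ennreal (f (x, u)) * indicator A x \<partial>p) \<le> 1" using channelD(3)[OF f u] by simp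
    then show "ennreal (\<alpha> u) = (\<integral>\<^sup>+x. ennreal (f (x, u)) * indicator A x \<partial>p)"
      unfolding \<alpha>_def by (intro ennreal_enn2real) (auto intro: le_less_trans)
    then have "ennreal (\<alpha> u) \<le> ennreal 1" using le by simp
    then show "\<alpha> u \<le> 1" by (subst (asm) ennreal_le_iff) auto
  qed
  have \<beta>1: "ennreal (\<beta> u) = (\<integral>\<^sup>+y. ennreal (g (y, u)) * indicator B y \<partial>q)" "\<beta> u \<le> 1" if u: "u \<in> space \<nu>" for u
  proof -
    have "(\<integral>\<^sup>+x. ennreal (g (x, u)) * indicator B x \<partial>q) \<le> (\<integral>\<^sup>+x. ennreal (g (x, u)) \<partial>q)"
      by (intro nn_integral_mono) (auto simp: indicator_def)
    then have le: "(\<integral>\<^sup>+x. ennreal (g (x, u)) * indicator B x \<partial>q) \<le> 1" using channelD(3)[OF g u] by simp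
    then show "ennreal (\<beta> u) = (\<integral>\<^sup>+x. ennreal (g (x, u)) * indicator B x \<partial>q)"
      unfolding \<beta>_def by (intro ennreal_enn2real) (auto intro: le_less_trans)
    then have "ennreal (\<beta> u) \<le> ennreal 1" using le by simp
    then show "\<beta> u \<le> 1" by (subst (asm) ennreal_le_iff) auto
  qed
  have \<alpha>\<beta>0: "0 \<le> \<alpha> u" "0 \<le> \<beta> u" for u by (auto simp: \<alpha>_def \<beta>_def)
  have Um[measurable]: "(\<lambda>z. fst (snd z)) \<in> measurable ?P \<nu>" by measurable
  have Usp: "fst (snd z) \<in> space \<nu>" if "z \<in> space ?P" for z using measurable_space[OF Um that] .
  show ?thesis
  proof (rule real_cond_exp_vimage[OF P.prob_space_axioms Um, of _ "\<lambda>u. \<alpha> u * \<beta> u"])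
    show "integrable ?P (\<lambda>z. indicator A (fst z) * indicator B (snd (snd z)) :: real)"
      by (rule P.integrable_const_bound[of _ 1]) (auto simp: indicator_def)
    show "integrable ?P (\<lambda>z. \<alpha> (fst (snd z)) * \<beta> (fst (snd z)))"
    proof (rule P.integrable_const_bound[of _ 1])
      show "AE z in ?P. norm (\<alpha> (fst (snd z)) * \<beta> (fst (snd z))) \<le> 1"
        using \<alpha>1(2) \<beta>1(2) \<alpha>\<beta>0 Usp by (intro AE_I2) (auto intro!: mult_le_one)
    qed measurable
    fix C assume C[measurable]: "C \<in> sets \<nu>"
    have "(\<integral>\<^sup>+z. ennreal (indicator C (fst (snd z)) * (indicator A (fst z) * indicator B (snd (snd z)))) \<partial>?P)
      = (\<integral>\<^sup>+z. indicator C (fst (snd z)) * (indicator A (fst z) * indicator B (snd (snd z))) \<partial>?P)"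
      by (intro nn_integral_cong) (auto simp: indicator_def)
    also have "\<dots> = (\<integral>\<^sup>+u. indicator C u * ((\<integral>\<^sup>+x. ennreal (f (x, u)) * indicator A x \<partial>p) * (\<integral>\<^sup>+y. ennreal (g (y, u)) * indicator B y \<partial>q)) \<partial>\<nu>)"
      by (rule nn_integral_triple_times) measurable
    also have "\<dots> = (\<integral>\<^sup>+u. (indicator C u * ennreal (\<alpha> u * \<beta> u)) * ((\<integral>\<^sup>+x. ennreal (f (x, u)) * 1 \<partial>p) * (\<integral>\<^sup>+y. ennreal (g (y, u)) * 1 \<partial>q)) \<partial>\<nu>)"
      using channelD(3)[OF f] channelD(3)[OF g] \<alpha>\<beta>0 by (intro nn_integral_cong) (simp add: \<alpha>1(1)[symmetric] \<beta>1(1)[symmetric] ennreal_mult)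
    also have "\<dots> = (\<integral>\<^sup>+z. (indicator C (fst (snd z)) * ennreal (\<alpha> (fst (snd z)) * \<beta> (fst (snd z)))) * (1 * 1) \<partial>?P)"
      by (rule nn_integral_triple_times[symmetric, of "\<lambda>_. 1" "\<lambda>_. 1"]) measurable
    also have "\<dots> = (\<integral>\<^sup>+z. ennreal (indicator C (fst (snd z)) * (\<alpha> (fst (snd z)) * \<beta> (fst (snd z)))) \<partial>?P)"
      by (intro nn_integral_cong) (auto simp: indicator_def)
    finally have eq: "(\<integral>\<^sup>+z. ennreal (indicator C (fst (snd z)) * (indicator A (fst z) * indicator B (snd (snd z)))) \<partial>?P)
      = (\<integral>\<^sup>+z. ennreal (indicator C (fst (snd z)) * (\<alpha> (fst (snd z)) * \<beta> (fst (snd z)))) \<partial>?P)" .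
    show "(\<integral>z. indicator C (fst (snd z)) * (indicator A (fst z) * indicator B (snd (snd z))) \<partial>?P)
      = (\<integral>z. indicator C (fst (snd z)) * (\<alpha> (fst (snd z)) * \<beta> (fst (snd z))) \<partial>?P)"
      using \<alpha>\<beta>0 by (simp add: integral_eq_nn_integral eq)
  qed measurable
qed

text \<open>The conditional probability of one event alone comes from \<open>cond_exp_triple\<close>
  with the whole space as the other event; the Markov property is then the factorised formula
  itself.\<close>

lemma triple_Omega: "triple p q \<nu> f g \<in> Omega p \<nu> p q"
proof -
  let ?P = "triple p q \<nu> f g"
  note [measurable] = channelD(1)[OF f] channelD(1)[OF g]
  have sP[measurable_cong]: "sets ?P = sets (p \<Otimes>\<^sub>M (\<nu> \<Otimes>\<^sub>M q))" by (simp add: triple_def)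
  have T1: "(\<lambda>z. (fst z, fst (snd z))) \<in> measurable ?P (p \<Otimes>\<^sub>M \<nu>)" by measurable
  have T2: "(\<lambda>z. (snd (snd z), fst (snd z))) \<in> measurable ?P (p \<Otimes>\<^sub>M \<nu>)"
  proof -
    have "(\<lambda>z. (snd (snd z), fst (snd z))) \<in> measurable ?P (q \<Otimes>\<^sub>M \<nu>)" by measurable
    moreover have "sets (p \<Otimes>\<^sub>M \<nu>) = sets (q \<Otimes>\<^sub>M \<nu>)" by (intro sets_pair_measure_cong) (simp_all add: qp)
    ultimately show ?thesis by (simp cong: measurable_cong_sets)
  qed
  have "distr ?P p fst = distr (distr ?P (p \<Otimes>\<^sub>M \<nu>) (\<lambda>z. (fst z, fst (snd z)))) p fst"
    using T1 by (subst distr_distr) (auto simp: comp_def)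
  then have d1: "distr ?P p fst = p"
    unfolding distr_triple_fst using channel_marginals(2)[OF p \<nu> f] by simp
  have "distr ?P p (\<lambda>z. snd (snd z)) = distr (distr ?P (p \<Otimes>\<^sub>M \<nu>) (\<lambda>z. (snd (snd z), fst (snd z)))) p fst"
    using T2 by (subst distr_distr) (auto simp: comp_def)
  then have d2: "distr ?P p (\<lambda>z. snd (snd z)) = q"
    unfolding distr_triple_snd using channel_marginals(2)[OF q \<nu> g, of p \<nu>] qp by simp
  have "markov_chain p \<nu> p ?P"
    unfolding markov_chain_def Let_def
  proof (intro ballI)
    fix A B assume AB: "A \<in> sets p" "B \<in> sets p"
    let ?F = "vimage_algebra (space ?P) (\<lambda>z. fst (snd z)) \<nu>"
    let ?\<alpha> = "\<lambda>u. enn2real (\<integral>\<^sup>+x. ennreal (f (x, u)) * indicator A x \<partial>p)"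
    let ?\<beta> = "\<lambda>u. enn2real (\<integral>\<^sup>+y. ennreal (g (y, u)) * indicator B y \<partial>q)"
    have Usp: "fst (snd z) \<in> space \<nu>" "fst z \<in> space p" "snd (snd z) \<in> space q" if "z \<in> space ?P" for z
    proof -
      have "z \<in> space p \<times> (space \<nu> \<times> space q)"
        using that unfolding sets_eq_imp_space_eq[OF sP] space_pair_measure .
      then show "fst (snd z) \<in> space \<nu>" "fst z \<in> space p" "snd (snd z) \<in> space q" by (auto simp: mem_Times_iff)
    qed
    have B': "B \<in> sets q" using AB qp by simp
    have 1: "AE z in ?P. real_cond_exp ?P ?F (\<lambda>z. indicator A (fst z) * indicator B (snd (snd z))) z = ?\<alpha> (fst (snd z)) * ?\<beta> (fst (snd z))"
      by (rule cond_exp_triple[OF AB(1) B'])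
    have U: "(\<lambda>z. fst (snd z)) \<in> measurable ?P \<nu>" by measurable
    interpret sigma_finite_subalgebra ?P ?F
    proof (rule finite_measure_subalgebra_is_sigma_finite)
      interpret P: prob_space ?P by (rule prob_space_triple)
      have "subalgebra ?P ?F"
        unfolding subalgebra_def using sets_vimage_algebra2[of "\<lambda>z. fst (snd z)" "space ?P" \<nu>] Usp measurable_sets[OF U] by auto
      then show "finite_measure_subalgebra ?P ?F" by unfold_locales
    qed
    have m: "(\<lambda>z. indicator A (fst z) :: real) \<in> borel_measurable ?P" "(\<lambda>z. indicator B (snd (snd z)) :: real) \<in> borel_measurable ?P"
      using AB B' by measurable
    have m2: "(\<lambda>z. indicator A (fst z) * indicator (space q) (snd (snd z)) :: real) \<in> borel_measurable ?P"
      "(\<lambda>z. indicator (space p) (fst z) * indicator B (snd (snd z)) :: real) \<in> borel_measurable ?P"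
      using AB B' by measurable
    have 2: "AE z in ?P. real_cond_exp ?P ?F (\<lambda>z. indicator A (fst z)) z = ?\<alpha> (fst (snd z))"
    proof -
      have "AE z in ?P. real_cond_exp ?P ?F (\<lambda>z. indicator A (fst z) * indicator (space q) (snd (snd z))) z = real_cond_exp ?P ?F (\<lambda>z. indicator A (fst z)) z"
        by (rule real_cond_exp_cong[OF AE_I2 m2(1) m(1)]) (simp add: Usp)
      then show ?thesis using cond_exp_triple[OF AB(1) sets.top[of q]] AE_space
        by eventually_elim (simp add: channelD(3)[OF g] Usp)
    qed
    have 3: "AE z in ?P. real_cond_exp ?P ?F (\<lambda>z. indicator B (snd (snd z))) z = ?\<beta> (fst (snd z))"
    proof -
      have "AE z in ?P. real_cond_exp ?P ?F (\<lambda>z. indicator (space p) (fst z) * indicator B (snd (snd z))) z = real_cond_exp ?P ?F (\<lambda>z. indicator B (snd (snd z))) z"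
        by (rule real_cond_exp_cong[OF AE_I2 m2(2) m(2)]) (simp add: Usp)
      then show ?thesis using cond_exp_triple[OF sets.top[of p] B'] AE_space
        by eventually_elim (simp add: channelD(3)[OF f] Usp)
    qed
    show "AE z in ?P. real_cond_exp ?P ?F (\<lambda>z. indicator A (fst z) * indicator B (snd (snd z))) z =
        real_cond_exp ?P ?F (\<lambda>z. indicator A (fst z)) z * real_cond_exp ?P ?F (\<lambda>z. indicator B (snd (snd z))) z"
      using 1 2 3 by eventually_elim simp
  qed
  then show ?thesis using prob_space_triple sets_triple d1 d2 by (simp add: Omega_def)
qed

end

text \<open>Only the joint law of the two end points of the Markov chain is needed here, so the chain
  may be reduced to rectangles \<open>A \<times> B\<close>.\<close>

lemma Omega_distortion:
  fixes p q :: "'a measure" and \<Delta> :: "'a \<Rightarrow> 'a \<Rightarrow> real"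
  assumes P: "P \<in> Omega M SU p q" and sM: "sets p = sets M" "sets q = sets M"
    and \<Delta>m: "(\<lambda>(x, y). \<Delta> x y) \<in> borel_measurable (M \<Otimes>\<^sub>M M)"
    and \<nu>_def: "\<nu> = distr P SU (\<lambda>z. fst (snd z))"
    and f: "channel p \<nu> f" and g: "channel q \<nu> g"
    and Pf: "distr P (M \<Otimes>\<^sub>M SU) (\<lambda>z. (fst z, fst (snd z))) = density (p \<Otimes>\<^sub>M \<nu>) (\<lambda>z. ennreal (f z))"
    and Pg: "distr P (M \<Otimes>\<^sub>M SU) (\<lambda>z. (snd (snd z), fst (snd z))) = density (q \<Otimes>\<^sub>M \<nu>) (\<lambda>z. ennreal (g z))"
  shows "(\<integral>\<^sup>+z. ennreal (\<Delta> (fst z) (snd (snd z))) \<partial>P) = avg_distortion p q \<nu> f g \<Delta>"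
proof -
  have PO: "prob_space P" and sP[measurable_cong]: "sets P = sets (M \<Otimes>\<^sub>M (SU \<Otimes>\<^sub>M M))"
    and dp: "distr P M fst = p" and dq: "distr P M (\<lambda>z. snd (snd z)) = q" and mk: "markov_chain M SU M P"
    using P unfolding Omega_def by blast+
  interpret P: prob_space P by fact
  have p: "prob_space p" unfolding dp[symmetric] by (rule P.prob_space_distr) measurable
  have q: "prob_space q" unfolding dq[symmetric] by (rule P.prob_space_distr) measurable
  have U[measurable]: "(\<lambda>z. fst (snd z)) \<in> measurable P SU" by measurable
  have \<nu>: "prob_space \<nu>" unfolding \<nu>_def by (rule P.prob_space_distr[OF U])
  interpret p: prob_space p by fact
  interpret q: prob_space q by fact
  interpret \<nu>: prob_space \<nu> by fact
  interpret pn: pair_prob_space p \<nu> by standard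
  interpret qn: pair_prob_space q \<nu> by standard
  have s\<nu>: "sets \<nu> = sets SU" by (simp add: \<nu>_def)
  note [measurable] = channelD(1)[OF f] channelD(1)[OF g]
  note [measurable_cong] = sM s\<nu>
  have qp: "sets q = sets p" using sM by simp
  note T = prob_space_triple[OF p q \<nu> qp f g]
  define J where "J = triple p q \<nu> f g"
  have sJ[measurable_cong]: "sets J = sets (p \<Otimes>\<^sub>M (\<nu> \<Otimes>\<^sub>M q))" by (simp add: J_def triple_def)
  interpret J: prob_space J unfolding J_def by (rule T)
  let ?F = "vimage_algebra (space P) (\<lambda>z. fst (snd z)) SU"
  have TF: "(\<lambda>z. (fst z, fst (snd z))) \<in> measurable P (M \<Otimes>\<^sub>M SU)" "(\<lambda>z. (snd (snd z), fst (snd z))) \<in> measurable P (M \<Otimes>\<^sub>M SU)"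
    by measurable
  \<comment> \<open>On rectangles the law of the ends is the \<open>\<nu>\<close>-integral of
    \<open>\<alpha> * \<beta>\<close>: under \<open>P\<close> by the Markov property and the tower
    rule, under the triple by construction.\<close>
  have rect: "emeasure P {z \<in> space P. fst z \<in> A \<and> snd (snd z) \<in> B} = emeasure J {z \<in> space J. fst z \<in> A \<and> snd (snd z) \<in> B}"
    if A[measurable]: "A \<in> sets M" and B[measurable]: "B \<in> sets M" for A B
  proof -
    define \<alpha> where "\<alpha> u = enn2real (\<integral>\<^sup>+x. ennreal (f (x, u)) * indicator A x \<partial>p)" for u
    define \<beta> where "\<beta> u = enn2real (\<integral>\<^sup>+y. ennreal (g (y, u)) * indicator B y \<partial>q)" for u
    have \<alpha>m[measurable]: "\<alpha> \<in> borel_measurable \<nu>" and \<beta>m[measurable]: "\<beta> \<in> borel_measurable \<nu>"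
      unfolding \<alpha>_def \<beta>_def by measurable
    have gen: "ennreal (enn2real (\<integral>\<^sup>+x. ennreal (h (x, u)) * indicator E x \<partial>r)) = (\<integral>\<^sup>+x. ennreal (h (x, u)) * indicator E x \<partial>r)
       \<and> enn2real (\<integral>\<^sup>+x. ennreal (h (x, u)) * indicator E x \<partial>r) \<le> 1"
      if u: "u \<in> space \<nu>" and h: "channel r \<nu> h" for u r E and h :: "'a \<times> 'b \<Rightarrow> real"
    proof -
      have "(\<integral>\<^sup>+x. ennreal (h (x, u)) * indicator E x \<partial>r) \<le> (\<integral>\<^sup>+x. ennreal (h (x, u)) \<partial>r)"
        by (intro nn_integral_mono) (auto simp: indicator_def)
      then have le: "(\<integral>\<^sup>+x. ennreal (h (x, u)) * indicator E x \<partial>r) \<le> 1" using channelD(3)[OF h u] by simp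
      then have e: "ennreal (enn2real (\<integral>\<^sup>+x. ennreal (h (x, u)) * indicator E x \<partial>r)) = (\<integral>\<^sup>+x. ennreal (h (x, u)) * indicator E x \<partial>r)"
        by (intro ennreal_enn2real) (auto intro: le_less_trans)
      then have "ennreal (enn2real (\<integral>\<^sup>+x. ennreal (h (x, u)) * indicator E x \<partial>r)) \<le> ennreal 1" using le by simp
      then show ?thesis using e by (subst (asm) ennreal_le_iff) auto
    qed
    have \<alpha>1: "ennreal (\<alpha> u) = (\<integral>\<^sup>+x. ennreal (f (x, u)) * indicator A x \<partial>p)" "\<alpha> u \<le> 1" if "u \<in> space \<nu>" for u
      using gen[OF that f, of A] by (auto simp: \<alpha>_def)
    have \<beta>1: "ennreal (\<beta> u) = (\<integral>\<^sup>+x. ennreal (g (x, u)) * indicator B x \<partial>q)" "\<beta> u \<le> 1" if "u \<in> space \<nu>" for u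
      using gen[OF that g, of B] by (auto simp: \<beta>_def)
    have \<alpha>\<beta>0: "0 \<le> \<alpha> u" "0 \<le> \<beta> u" for u by (auto simp: \<alpha>_def \<beta>_def)
    have Usp: "fst (snd z) \<in> space \<nu>" if "z \<in> space P" for z
      using measurable_space[OF U that] sets_eq_imp_space_eq[OF s\<nu>] by simp
    \<comment> \<open>Conditional probabilities of a single end depend only on its pair law with
      \<open>U\<close>, which \<open>P\<close> shares with the triple; they are read off the density
      \<open>f\<close>.\<close>
    have cA: "AE z in P. real_cond_exp P ?F (\<lambda>z. indicator A (fst z)) z = \<alpha> (fst (snd z))"
    proof (rule real_cond_exp_vimage[OF PO U])
      show "\<alpha> \<in> borel_measurable SU" by measurable
      show "integrable P (\<lambda>z. indicator A (fst z) :: real)" by (rule P.integrable_const_bound[of _ 1]) auto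
      show "integrable P (\<lambda>z. \<alpha> (fst (snd z)))"
        by (rule P.integrable_const_bound[of _ 1]) (use \<alpha>\<beta>0 \<alpha>1(2) Usp in auto)
      fix C assume C[measurable]: "C \<in> sets SU"
      have "(\<integral>\<^sup>+z. ennreal (indicator C (fst (snd z)) * indicator A (fst z)) \<partial>P)
        = (\<integral>\<^sup>+z. ennreal (indicator C (snd z) * indicator A (fst z)) \<partial>distr P (M \<Otimes>\<^sub>M SU) (\<lambda>z. (fst z, fst (snd z))))"
        by (subst nn_integral_distr[OF TF(1)]) auto
      also have "\<dots> = (\<integral>\<^sup>+z. ennreal (f z) * ennreal (indicator C (snd z) * indicator A (fst z)) \<partial>(p \<Otimes>\<^sub>M \<nu>))"
        unfolding Pf by (rule nn_integral_density) measurable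
      also have "\<dots> = (\<integral>\<^sup>+u. \<integral>\<^sup>+x. ennreal (f (x, u)) * ennreal (indicator C u * indicator A x) \<partial>p \<partial>\<nu>)"
        by (subst pn.nn_integral_snd[symmetric]) auto
      also have "\<dots> = (\<integral>\<^sup>+u. ennreal (indicator C u * \<alpha> u) \<partial>\<nu>)"
      proof (rule nn_integral_cong)
        fix u assume u: "u \<in> space \<nu>"
        show "(\<integral>\<^sup>+x. ennreal (f (x, u)) * ennreal (indicator C u * indicator A x) \<partial>p) = ennreal (indicator C u * \<alpha> u)"
          using \<alpha>1(1)[OF u] by (cases "u \<in> C") (auto simp: ennreal_indicator)
      qed
      also have "\<dots> = (\<integral>\<^sup>+z. ennreal (indicator C (fst (snd z)) * \<alpha> (fst (snd z))) \<partial>P)"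
        unfolding \<nu>_def by (subst nn_integral_distr[OF U]) auto
      finally show "(\<integral>z. indicator C (fst (snd z)) * indicator A (fst z) \<partial>P) = (\<integral>z. indicator C (fst (snd z)) * \<alpha> (fst (snd z)) \<partial>P)"
        using \<alpha>\<beta>0 by (simp add: integral_eq_nn_integral)
    qed
    have cB: "AE z in P. real_cond_exp P ?F (\<lambda>z. indicator B (snd (snd z))) z = \<beta> (fst (snd z))"
    proof (rule real_cond_exp_vimage[OF PO U])
      show "\<beta> \<in> borel_measurable SU" by measurable
      show "integrable P (\<lambda>z. indicator B (snd (snd z)) :: real)" by (rule P.integrable_const_bound[of _ 1]) auto
      show "integrable P (\<lambda>z. \<beta> (fst (snd z)))"
        by (rule P.integrable_const_bound[of _ 1]) (use \<alpha>\<beta>0 \<beta>1(2) Usp in auto)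
      fix C assume C[measurable]: "C \<in> sets SU"
      have "(\<integral>\<^sup>+z. ennreal (indicator C (fst (snd z)) * indicator B (snd (snd z))) \<partial>P)
        = (\<integral>\<^sup>+z. ennreal (indicator C (snd z) * indicator B (fst z)) \<partial>distr P (M \<Otimes>\<^sub>M SU) (\<lambda>z. (snd (snd z), fst (snd z))))"
        by (subst nn_integral_distr[OF TF(2)]) auto
      also have "\<dots> = (\<integral>\<^sup>+z. ennreal (g z) * ennreal (indicator C (snd z) * indicator B (fst z)) \<partial>(q \<Otimes>\<^sub>M \<nu>))"
        unfolding Pg by (rule nn_integral_density) measurable
      also have "\<dots> = (\<integral>\<^sup>+u. \<integral>\<^sup>+x. ennreal (g (x, u)) * ennreal (indicator C u * indicator B x) \<partial>q \<partial>\<nu>)"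
        by (subst qn.nn_integral_snd[symmetric]) auto
      also have "\<dots> = (\<integral>\<^sup>+u. ennreal (indicator C u * \<beta> u) \<partial>\<nu>)"
      proof (rule nn_integral_cong)
        fix u assume u: "u \<in> space \<nu>"
        show "(\<integral>\<^sup>+x. ennreal (g (x, u)) * ennreal (indicator C u * indicator B x) \<partial>q) = ennreal (indicator C u * \<beta> u)"
          using \<beta>1(1)[OF u] by (cases "u \<in> C") (auto simp: ennreal_indicator)
      qed
      also have "\<dots> = (\<integral>\<^sup>+z. ennreal (indicator C (fst (snd z)) * \<beta> (fst (snd z))) \<partial>P)"
        unfolding \<nu>_def by (subst nn_integral_distr[OF U]) auto
      finally show "(\<integral>z. indicator C (fst (snd z)) * indicator B (snd (snd z)) \<partial>P) = (\<integral>z. indicator C (fst (snd z)) * \<beta> (fst (snd z)) \<partial>P)"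
        using \<alpha>\<beta>0 by (simp add: integral_eq_nn_integral)
    qed
    let ?AB = "\<lambda>z. indicator A (fst z) * indicator B (snd (snd z)) :: real"
    have ABi: "integrable P ?AB" by (rule P.integrable_const_bound[of _ 1]) (auto simp: indicator_def)
    interpret sigma_finite_subalgebra P ?F
    proof (rule finite_measure_subalgebra_is_sigma_finite)
      have "subalgebra P ?F"
        unfolding subalgebra_def using sets_vimage_algebra2[of "\<lambda>z. fst (snd z)" "space P" SU] measurable_space[OF U] measurable_sets[OF U] by auto
      then show "finite_measure_subalgebra P ?F" by unfold_locales
    qed
    have "AE z in P. real_cond_exp P ?F ?AB z = \<alpha> (fst (snd z)) * \<beta> (fst (snd z))"
    proof -
      have "AE z in P. real_cond_exp P ?F ?AB z = real_cond_exp P ?F (\<lambda>z. indicator A (fst z)) z * real_cond_exp P ?F (\<lambda>z. indicator B (snd (snd z))) z"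
        using mk A B unfolding markov_chain_def Let_def by blast
      then show ?thesis using cA cB by eventually_elim simp
    qed
    then have "(\<integral>z. real_cond_exp P ?F ?AB z \<partial>P) = (\<integral>z. \<alpha> (fst (snd z)) * \<beta> (fst (snd z)) \<partial>P)"
      by (intro integral_cong_AE) auto
    then have eq: "(\<integral>z. ?AB z \<partial>P) = (\<integral>z. \<alpha> (fst (snd z)) * \<beta> (fst (snd z)) \<partial>P)"
      using real_cond_exp_int(2)[OF ABi] by simp
    have \<alpha>\<beta>i: "integrable P (\<lambda>z. \<alpha> (fst (snd z)) * \<beta> (fst (snd z)))"
    proof (rule P.integrable_const_bound[of _ 1])
      show "AE z in P. norm (\<alpha> (fst (snd z)) * \<beta> (fst (snd z))) \<le> 1"
        using \<alpha>1(2) \<beta>1(2) \<alpha>\<beta>0 Usp by (intro AE_I2) (auto intro!: mult_le_one)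
    qed measurable
    have "emeasure P {z \<in> space P. fst z \<in> A \<and> snd (snd z) \<in> B} = (\<integral>\<^sup>+z. indicator {z \<in> space P. fst z \<in> A \<and> snd (snd z) \<in> B} z \<partial>P)"
      by (rule nn_integral_indicator[symmetric]) measurable
    also have "\<dots> = (\<integral>\<^sup>+z. ennreal (?AB z) \<partial>P)"
      by (intro nn_integral_cong) (auto simp: indicator_def)
    also have "\<dots> = ennreal (\<integral>z. \<alpha> (fst (snd z)) * \<beta> (fst (snd z)) \<partial>P)"
      unfolding eq[symmetric] by (rule nn_integral_eq_integral[OF ABi]) auto
    also have "\<dots> = (\<integral>\<^sup>+z. ennreal (\<alpha> (fst (snd z)) * \<beta> (fst (snd z))) \<partial>P)"
      using \<alpha>\<beta>0 by (intro nn_integral_eq_integral[symmetric] \<alpha>\<beta>i) auto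
    also have "\<dots> = (\<integral>\<^sup>+u. ennreal (\<alpha> u * \<beta> u) \<partial>\<nu>)"
      unfolding \<nu>_def by (subst nn_integral_distr[OF U]) auto
    also have "\<dots> = (\<integral>\<^sup>+u. 1 * ((\<integral>\<^sup>+x. ennreal (f (x, u)) * indicator A x \<partial>p) * (\<integral>\<^sup>+y. ennreal (g (y, u)) * indicator B y \<partial>q)) \<partial>\<nu>)"
      using \<alpha>\<beta>0 by (intro nn_integral_cong) (simp add: \<alpha>1(1)[symmetric] \<beta>1(1)[symmetric] ennreal_mult)
    also have "\<dots> = (\<integral>\<^sup>+z. 1 * (indicator A (fst z) * indicator B (snd (snd z))) \<partial>J)"
      unfolding J_def by (rule nn_integral_triple_times[OF p q \<nu> qp f g, symmetric]) measurable
    also have "\<dots> = (\<integral>\<^sup>+z. indicator {z \<in> space J. fst z \<in> A \<and> snd (snd z) \<in> B} z \<partial>J)"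
      by (intro nn_integral_cong) (auto simp: indicator_def)
    also have "\<dots> = emeasure J {z \<in> space J. fst z \<in> A \<and> snd (snd z) \<in> B}"
      by (rule nn_integral_indicator) measurable
    finally show ?thesis .
  qed
  let ?E = "\<lambda>z. (fst z, snd (snd z))"
  have EP: "?E \<in> measurable P (M \<Otimes>\<^sub>M M)" by measurable
  have EJ: "?E \<in> measurable J (M \<Otimes>\<^sub>M M)" by measurable
  have "distr P (M \<Otimes>\<^sub>M M) ?E = distr J (M \<Otimes>\<^sub>M M) ?E"
  proof (rule measure_eqI_generator_eq[OF Int_stable_pair_measure_generator[of M M] pair_measure_closed, where A="\<lambda>_. space M \<times> space M"])
    fix X assume "X \<in> {a \<times> b |a b. a \<in> sets M \<and> b \<in> sets M}"
    then obtain A B where X: "X = A \<times> B" "A \<in> sets M" "B \<in> sets M" by auto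
    have "emeasure (distr P (M \<Otimes>\<^sub>M M) ?E) X = emeasure P {z \<in> space P. fst z \<in> A \<and> snd (snd z) \<in> B}"
      using X by (subst emeasure_distr[OF EP]) (auto intro!: arg_cong2[where f=emeasure])
    moreover have "emeasure (distr J (M \<Otimes>\<^sub>M M) ?E) X = emeasure J {z \<in> space J. fst z \<in> A \<and> snd (snd z) \<in> B}"
      using X by (subst emeasure_distr[OF EJ]) (auto intro!: arg_cong2[where f=emeasure])
    ultimately show "emeasure (distr P (M \<Otimes>\<^sub>M M) ?E) X = emeasure (distr J (M \<Otimes>\<^sub>M M) ?E) X"
      using rect[OF X(2,3)] by simp
  next
    fix i :: nat
    interpret D: prob_space "distr P (M \<Otimes>\<^sub>M M) ?E" by (rule P.prob_space_distr[OF EP])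
    show "emeasure (distr P (M \<Otimes>\<^sub>M M) ?E) (space M \<times> space M) \<noteq> \<infinity>" by simp
  qed (auto simp: sets_pair_measure)
  then have "(\<integral>\<^sup>+z. ennreal (\<Delta> (fst z) (snd z)) \<partial>distr P (M \<Otimes>\<^sub>M M) ?E) = (\<integral>\<^sup>+z. ennreal (\<Delta> (fst z) (snd z)) \<partial>distr J (M \<Otimes>\<^sub>M M) ?E)"
    by simp
  then have "(\<integral>\<^sup>+z. ennreal (\<Delta> (fst z) (snd (snd z))) \<partial>P) = (\<integral>\<^sup>+z. ennreal (\<Delta> (fst z) (snd (snd z))) \<partial>J)"
    using \<Delta>m by (subst (asm) (1 2) nn_integral_distr) (auto simp: split_beta' EP EJ)
  also have "\<dots> = avg_distortion p q \<nu> f g \<Delta>"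
  proof -
    have "(\<lambda>z. (fst z, snd (snd z))) \<in> measurable (p \<Otimes>\<^sub>M (\<nu> \<Otimes>\<^sub>M q)) (M \<Otimes>\<^sub>M M)" by measurable
    from measurable_compose[OF this \<Delta>m] have "(\<lambda>z. ennreal (\<Delta> (fst z) (snd (snd z)))) \<in> borel_measurable (p \<Otimes>\<^sub>M (\<nu> \<Otimes>\<^sub>M q))"
      by simp
    then show ?thesis unfolding J_def by (subst nn_integral_triple_measure[OF p q \<nu> qp f g]) auto
  qed
  finally show ?thesis .
qed

text \<open>Only the sigma-algebra of the alphabet matters, so \<open>p\<close> itself can play the
  role of \<open>M\<close> and the argument deals with one measure less. The two lemmas that follow
  do the same for the hypothesis and for the chains.\<close>

lemma opt_distortion_cong:
  assumes "sets M = sets M'"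
  shows "opt_distortion M p q \<Delta> R Rc = opt_distortion M' p q \<Delta> R Rc"
proof -
  have s: "sets (PiM {..<n} (\<lambda>_. M)) = sets (PiM {..<n} (\<lambda>_. M'))" for n :: nat
    using assms by (intro sets_PiM_cong) auto
  note sp = sets_eq_imp_space_eq[OF s]
  have "valid_code M n m kk e dec = valid_code M' n m kk e dec" for n m kk e dec
    unfolding valid_code_def s sp measurable_cong_sets[OF s refl] ..
  then have "achievable M p q \<Delta> R Rc = achievable M' p q \<Delta> R Rc"
    unfolding achievable_def s by simp
  then show ?thesis unfolding opt_distortion_def by simp
qed

lemma unif_integrable_cong:
  assumes "sets M = sets M'"
  shows "unif_integrable M p q \<Delta> = unif_integrable M' p q \<Delta>"
proof -
  have s: "sets (M \<Otimes>\<^sub>M M) = sets (M' \<Otimes>\<^sub>M M')" using assms by (intro sets_pair_measure_cong) auto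
  have d: "distr \<pi> M h = distr \<pi> M' h" for \<pi> and h :: "'a \<times> 'a \<Rightarrow> 'a"
    using assms by (intro distr_cong) auto
  have "coupling M p M q \<pi> = coupling M' p M' q \<pi>" for \<pi>
    unfolding coupling_def s d ..
  then show ?thesis unfolding unif_integrable_def by simp
qed

lemma Omega_cong:
  assumes "sets M = sets M'"
  shows "Omega M SU p q = Omega M' SU p q"
proof -
  have s: "sets (M \<Otimes>\<^sub>M (SU \<Otimes>\<^sub>M M)) = sets (M' \<Otimes>\<^sub>M (SU \<Otimes>\<^sub>M M'))"
    using assms by (intro sets_pair_measure_cong) auto
  have d: "distr P M h = distr P M' h" for P and h :: "'a \<times> 'b \<times> 'a \<Rightarrow> 'a"
    using assms by (intro distr_cong) auto
  show ?thesis unfolding Omega_def markov_chain_def s d assms ..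
qed

section \<open>The first formula: optimal distortion over Markov chains\<close>

lemma opt_distortion_Omega_le:
  fixes \<Delta> :: "'a \<Rightarrow> 'a \<Rightarrow> real" and SU :: "'u measure"
  assumes p: "prob_space p" "sets p = sets M" and q: "prob_space q" "sets q = sets M"
    and \<Delta>0: "\<And>x y. 0 \<le> \<Delta> x y" and \<Delta>m: "(\<lambda>(x, y). \<Delta> x y) \<in> borel_measurable (M \<Otimes>\<^sub>M M)"
    and R: "0 \<le> R" "0 \<le> Rc" and UI: "unif_integrable M p q \<Delta>"
    and P: "P \<in> Omega M SU p q"
    and I1: "mutual_info M SU (distr P (M \<Otimes>\<^sub>M SU) (\<lambda>z. (fst z, fst (snd z)))) \<le> ennreal R"
    and I2: "mutual_info M SU (distr P (M \<Otimes>\<^sub>M SU) (\<lambda>z. (snd (snd z), fst (snd z)))) \<le> ennreal (R + Rc)"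
  shows "opt_distortion M p q \<Delta> R Rc \<le> enn2ereal (\<integral>\<^sup>+z. ennreal (\<Delta> (fst z) (snd (snd z))) \<partial>P)"
proof -
  have PO: "prob_space P" and sP[measurable_cong]: "sets P = sets (M \<Otimes>\<^sub>M (SU \<Otimes>\<^sub>M M))"
    and dp: "distr P M fst = p" and dq: "distr P M (\<lambda>z. snd (snd z)) = q"
    using P unfolding Omega_def by blast+
  interpret P: prob_space P by fact
  define \<nu> where "\<nu> = distr P SU (\<lambda>z. fst (snd z))"
  have U: "(\<lambda>z. fst (snd z)) \<in> measurable P SU" by measurable
  have \<nu>: "prob_space \<nu>" unfolding \<nu>_def by (rule P.prob_space_distr[OF U])
  let ?T1 = "\<lambda>z. (fst z, fst (snd z))" and ?T2 = "\<lambda>z. (snd (snd z), fst (snd z))"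
  have T1: "?T1 \<in> measurable P (M \<Otimes>\<^sub>M SU)" and T2: "?T2 \<in> measurable P (M \<Otimes>\<^sub>M SU)" by measurable
  have p1: "distr (distr P (M \<Otimes>\<^sub>M SU) ?T1) M fst = p" "distr (distr P (M \<Otimes>\<^sub>M SU) ?T1) SU snd = \<nu>"
    unfolding dp[symmetric] \<nu>_def using T1 by (auto simp: distr_distr comp_def)
  have p2: "distr (distr P (M \<Otimes>\<^sub>M SU) ?T2) M fst = q" "distr (distr P (M \<Otimes>\<^sub>M SU) ?T2) SU snd = \<nu>"
    unfolding dq[symmetric] \<nu>_def using T2 by (auto simp: distr_distr comp_def)
  obtain f where f: "channel p \<nu> f" and Pf: "distr P (M \<Otimes>\<^sub>M SU) ?T1 = density (p \<Otimes>\<^sub>M \<nu>) (\<lambda>z. ennreal (f z))"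
    and fi: "integrable (p \<Otimes>\<^sub>M \<nu>) (\<lambda>z. f z * ln (f z))" and fR: "(\<integral>z. f z * ln (f z) \<partial>(p \<Otimes>\<^sub>M \<nu>)) \<le> R"
    using mutual_info_finite_channel[OF P.prob_space_distr[OF T1] sets_distr I1 R(1)] unfolding p1 by blast
  obtain g where g: "channel q \<nu> g" and Pg: "distr P (M \<Otimes>\<^sub>M SU) ?T2 = density (q \<Otimes>\<^sub>M \<nu>) (\<lambda>z. ennreal (g z))"
    and gi: "integrable (q \<Otimes>\<^sub>M \<nu>) (\<lambda>z. g z * ln (g z))" and gR: "(\<integral>z. g z * ln (g z) \<partial>(q \<Otimes>\<^sub>M \<nu>)) \<le> R + Rc"
    using mutual_info_finite_channel[OF P.prob_space_distr[OF T2] sets_distr I2] R unfolding p2 by auto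
  have \<Delta>m': "(\<lambda>(x, y). \<Delta> x y) \<in> borel_measurable (p \<Otimes>\<^sub>M p)"
    using \<Delta>m p(2) by (simp cong: measurable_cong_sets sets_pair_measure_cong)
  have UI': "unif_integrable p p q \<Delta>" using UI unif_integrable_cong[OF p(2)] by blast
  have "opt_distortion p p q \<Delta> R Rc \<le> enn2ereal (avg_distortion p q \<nu> f g \<Delta>)"
    using q(2) p(2) by (intro achievability[OF p(1) q(1) _ \<nu> \<Delta>0 \<Delta>m' UI' f g fi gi fR gR R]) simp
  moreover have "(\<integral>\<^sup>+z. ennreal (\<Delta> (fst z) (snd (snd z))) \<partial>P) = avg_distortion p q \<nu> f g \<Delta>"
    by (rule Omega_distortion[OF P p(2) q(2) \<Delta>m \<nu>_def f g Pf Pg])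
  moreover have "opt_distortion M p q \<Delta> R Rc = opt_distortion p p q \<Delta> R Rc"
    by (rule opt_distortion_cong) (simp add: p(2))
  ultimately show ?thesis by simp
qed

text \<open>The bounded densities extracted from a code define a triple in \<open>Omega\<close>; its
  pair laws have these densities, so its mutual informations are the integrals of
  \<open>f * ln f\<close> and \<open>g * ln g\<close>.\<close>

lemma achievable_Omega:
  fixes \<Delta> :: "'a \<Rightarrow> 'a \<Rightarrow> real"
  assumes inf: "infinite (UNIV :: 'u set)" and p: "prob_space p" "sets p = sets M" and q: "prob_space q" "sets q = sets M"
    and \<Delta>m: "(\<lambda>(x, y). \<Delta> x y) \<in> borel_measurable (M \<Otimes>\<^sub>M M)"
    and ach: "achievable p p q \<Delta> R Rc d"
  shows "\<exists>(SU :: 'u measure) P. P \<in> Omega M SU p q \<and>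
    mutual_info M SU (distr P (M \<Otimes>\<^sub>M SU) (\<lambda>z. (fst z, fst (snd z)))) \<le> ennreal R \<and>
    mutual_info M SU (distr P (M \<Otimes>\<^sub>M SU) (\<lambda>z. (snd (snd z), fst (snd z)))) \<le> ennreal (R + Rc) \<and>
    enn2ereal (\<integral>\<^sup>+z. ennreal (\<Delta> (fst z) (snd (snd z))) \<partial>P) \<le> ereal d"
proof -
  have qp: "sets q = sets p" using p q by simp
  have \<Delta>m': "(\<lambda>(x, y). \<Delta> x y) \<in> borel_measurable (p \<Otimes>\<^sub>M p)"
    using \<Delta>m p(2) by (simp cong: measurable_cong_sets sets_pair_measure_cong)
  obtain \<nu> :: "'u measure" and f g C where \<nu>: "prob_space \<nu>" and f: "channel p \<nu> f" and g: "channel q \<nu> g"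
    and fC: "\<And>z. f z \<le> C" and gC: "\<And>z. g z \<le> C"
    and fR: "(\<integral>z. f z * ln (f z) \<partial>(p \<Otimes>\<^sub>M \<nu>)) \<le> R" and gR: "(\<integral>z. g z * ln (g z) \<partial>(q \<Otimes>\<^sub>M \<nu>)) \<le> R + Rc"
    and d: "enn2ereal (avg_distortion p q \<nu> f g \<Delta>) \<le> ereal d"
    using code_converse[OF inf p(1) q(1) qp \<Delta>m' ach] by blast
  let ?P = "triple p q \<nu> f g"
  have sp: "sets (M \<Otimes>\<^sub>M \<nu>) = sets (p \<Otimes>\<^sub>M \<nu>)" using p(2) by (intro sets_pair_measure_cong) auto
  have "?P \<in> Omega M \<nu> p q"
    using triple_Omega[OF p(1) q(1) \<nu> qp f g] Omega_cong[OF p(2)] by blast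
  moreover have "mutual_info M \<nu> (distr ?P (M \<Otimes>\<^sub>M \<nu>) (\<lambda>z. (fst z, fst (snd z)))) \<le> ennreal R"
  proof -
    interpret prob_space "p \<Otimes>\<^sub>M \<nu>" by (intro prob_space_pair p \<nu>)
    have "distr ?P (M \<Otimes>\<^sub>M \<nu>) (\<lambda>z. (fst z, fst (snd z))) = density (p \<Otimes>\<^sub>M \<nu>) (\<lambda>z. ennreal (f z))"
      unfolding distr_triple_fst[OF p(1) q(1) \<nu> qp f g, symmetric] using sp by (intro distr_cong) auto
    then show ?thesis
      using mutual_info_channel[OF p(1) \<nu> f p(2)[symmetric] refl integrable_xlnx[OF channelD(1,2)[OF f] fC]] fR
      by (simp add: ennreal_leI)
  qed
  moreover have "mutual_info M \<nu> (distr ?P (M \<Otimes>\<^sub>M \<nu>) (\<lambda>z. (snd (snd z), fst (snd z)))) \<le> ennreal (R + Rc)"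
  proof -
    interpret prob_space "q \<Otimes>\<^sub>M \<nu>" by (intro prob_space_pair q \<nu>)
    have "distr ?P (M \<Otimes>\<^sub>M \<nu>) (\<lambda>z. (snd (snd z), fst (snd z))) = density (q \<Otimes>\<^sub>M \<nu>) (\<lambda>z. ennreal (g z))"
      unfolding distr_triple_snd[OF p(1) q(1) \<nu> qp f g, symmetric] using sp by (intro distr_cong) auto
    then show ?thesis
      using mutual_info_channel[OF q(1) \<nu> g q(2)[symmetric] refl integrable_xlnx[OF channelD(1,2)[OF g] gC]] gR
      by (simp add: ennreal_leI del: ennreal_plus)
  qed
  moreover have "(\<integral>\<^sup>+z. ennreal (\<Delta> (fst z) (snd (snd z))) \<partial>?P) = avg_distortion p q \<nu> f g \<Delta>"
  proof -
    note [measurable_cong] = qp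
    have "(\<lambda>z. (fst z, snd (snd z))) \<in> measurable (p \<Otimes>\<^sub>M (\<nu> \<Otimes>\<^sub>M q)) (p \<Otimes>\<^sub>M p)" by measurable
    from measurable_compose[OF this \<Delta>m'] have "(\<lambda>z. ennreal (\<Delta> (fst z) (snd (snd z)))) \<in> borel_measurable (p \<Otimes>\<^sub>M (\<nu> \<Otimes>\<^sub>M q))"
      by simp
    then show ?thesis by (subst nn_integral_triple_measure[OF p(1) q(1) \<nu> qp f g]) auto
  qed
  ultimately show ?thesis
    by (intro exI[of _ \<nu>] exI[of _ ?P] conjI) (use d in simp_all)
qed

lemma opt_distortion_Omega:
  fixes \<Delta> :: "'a \<Rightarrow> 'a \<Rightarrow> real"
  assumes inf: "infinite (UNIV :: 'u set)" and p: "prob_space p" "sets p = sets M" and q: "prob_space q" "sets q = sets M"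
    and \<Delta>0: "\<And>x y. 0 \<le> \<Delta> x y" and \<Delta>m: "(\<lambda>(x, y). \<Delta> x y) \<in> borel_measurable (M \<Otimes>\<^sub>M M)"
    and R: "0 \<le> R" "0 \<le> Rc" and UI: "unif_integrable M p q \<Delta>"
  shows "opt_distortion M p q \<Delta> R Rc =
    Inf {enn2ereal (\<integral>\<^sup>+ z. ennreal (\<Delta> (fst z) (snd (snd z))) \<partial>P) | (SU :: 'u measure) P.
      P \<in> Omega M SU p q \<and>
      mutual_info M SU (distr P (M \<Otimes>\<^sub>M SU) (\<lambda>z. (fst z, fst (snd z)))) \<le> ennreal R \<and>
      mutual_info M SU (distr P (M \<Otimes>\<^sub>M SU) (\<lambda>z. (snd (snd z), fst (snd z)))) \<le> ennreal (R + Rc)}"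
    (is "_ = Inf ?S")
proof (rule antisym)
  show "opt_distortion M p q \<Delta> R Rc \<le> Inf ?S"
  proof (rule Inf_greatest)
    fix v assume "v \<in> ?S"
    then show "opt_distortion M p q \<Delta> R Rc \<le> v"
      using opt_distortion_Omega_le[OF p q \<Delta>0 \<Delta>m R UI] by blast
  qed
  have "opt_distortion M p q \<Delta> R Rc = opt_distortion p p q \<Delta> R Rc"
    by (rule opt_distortion_cong) (simp add: p(2))
  moreover have "Inf ?S \<le> opt_distortion p p q \<Delta> R Rc"
    unfolding opt_distortion_def
  proof (rule Inf_greatest, safe)
    fix d assume "achievable p p q \<Delta> R Rc d"
    note ex = achievable_Omega[OF inf p q \<Delta>m this]
    then obtain SU :: "'u measure" and P where
      P: "P \<in> Omega M SU p q"
        "mutual_info M SU (distr P (M \<Otimes>\<^sub>M SU) (\<lambda>z. (fst z, fst (snd z)))) \<le> ennreal R"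
        "mutual_info M SU (distr P (M \<Otimes>\<^sub>M SU) (\<lambda>z. (snd (snd z), fst (snd z)))) \<le> ennreal (R + Rc)"
      and le: "enn2ereal (\<integral>\<^sup>+z. ennreal (\<Delta> (fst z) (snd (snd z))) \<partial>P) \<le> ereal d"
      by blast
    show "Inf ?S \<le> ereal d"
    proof (rule Inf_lower2[OF _ le], rule CollectI)
      show "\<exists>(SU' :: 'u measure) P'. enn2ereal (\<integral>\<^sup>+z. ennreal (\<Delta> (fst z) (snd (snd z))) \<partial>P) = enn2ereal (\<integral>\<^sup>+z. ennreal (\<Delta> (fst z) (snd (snd z))) \<partial>P') \<and>
          P' \<in> Omega M SU' p q \<and>
          mutual_info M SU' (distr P' (M \<Otimes>\<^sub>M SU') (\<lambda>z. (fst z, fst (snd z)))) \<le> ennreal R \<and>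
          mutual_info M SU' (distr P' (M \<Otimes>\<^sub>M SU') (\<lambda>z. (snd (snd z), fst (snd z)))) \<le> ennreal (R + Rc)"
        by (rule exI[of _ SU], rule exI[of _ P], intro conjI refl P)
    qed
  qed
  ultimately show "Inf ?S \<le> opt_distortion M p q \<Delta> R Rc" by simp
qed

section \<open>Squared error\<close>

text \<open>Dominated convergence with majorant \<open>x\<^sup>2\<close>.\<close>

lemma square_tail:
  fixes p :: "real measure"
  assumes p: "prob_space p" and s[measurable_cong]: "sets p = sets borel"
    and fin: "(\<integral>\<^sup>+x. ennreal (x\<^sup>2) \<partial>p) < \<infinity>" and \<epsilon>: "0 < \<epsilon>"
  shows "\<exists>N0. \<forall>N::nat. N \<ge> N0 \<longrightarrow> (\<integral>\<^sup>+x. ennreal (x\<^sup>2) * indicator {x. real N < x\<^sup>2} x \<partial>p) \<le> ennreal \<epsilon>"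
proof -
  interpret prob_space p by fact
  have i: "integrable p (\<lambda>x. x\<^sup>2)" using fin by (intro integrableI_nonneg) auto
  let ?g = "\<lambda>N x. x\<^sup>2 * indicator {x. real N < x\<^sup>2} x :: real"
  have "(\<lambda>N. \<integral>x. ?g N x \<partial>p) \<longlonglongrightarrow> (\<integral>x. 0 \<partial>p)"
  proof (rule integral_dominated_convergence[where w="\<lambda>x. x\<^sup>2"])
    show "AE x in p. (\<lambda>N. ?g N x) \<longlonglongrightarrow> 0"
    proof (rule AE_I2)
      fix x :: real
      have "\<forall>\<^sub>F N in sequentially. x\<^sup>2 \<le> real N"
        by (rule eventually_sequentiallyI[of "nat \<lceil>x\<^sup>2\<rceil>"]) linarith
      then have "\<forall>\<^sub>F N in sequentially. ?g N x = 0" by eventually_elim simp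
      then show "(\<lambda>N. ?g N x) \<longlonglongrightarrow> 0" by (rule tendsto_eventually)
    qed
  qed (use i in \<open>auto simp: indicator_def\<close>)
  then have "\<forall>\<^sub>F N in sequentially. (\<integral>x. ?g N x \<partial>p) < \<epsilon>" using \<epsilon> by (intro order_tendstoD) auto
  then obtain N0 where N0: "\<And>N. N \<ge> N0 \<Longrightarrow> (\<integral>x. ?g N x \<partial>p) < \<epsilon>" by (auto simp: eventually_sequentially)
  have "(\<integral>\<^sup>+x. ennreal (x\<^sup>2) * indicator {x. real N < x\<^sup>2} x \<partial>p) \<le> ennreal \<epsilon>" if "N \<ge> N0" for N
  proof -
    have gi: "integrable p (?g N)"
      by (rule Bochner_Integration.integrable_bound[OF i]) (auto simp: indicator_def)
    have "(\<integral>\<^sup>+x. ennreal (x\<^sup>2) * indicator {x. real N < x\<^sup>2} x \<partial>p) = (\<integral>\<^sup>+x. ennreal (?g N x) \<partial>p)"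
      by (intro nn_integral_cong) (auto simp: indicator_def)
    also have "\<dots> = ennreal (\<integral>x. ?g N x \<partial>p)" by (rule nn_integral_eq_integral[OF gi]) auto
    finally show ?thesis using N0[OF that] by (simp add: ennreal_leI less_imp_le)
  qed
  then show ?thesis by blast
qed

text \<open>By \<open>(x - y)\<^sup>2 \<le> 2 * x\<^sup>2 + 2 * y\<^sup>2\<close> each square can be
  treated alone. On an event a square is at most \<open>N\<close> plus its part above
  \<open>N\<close>, and the integral of that part depends on the marginal alone; this makes the
  estimate uniform over couplings.\<close>

lemma unif_integrable_square:
  fixes p q :: "real measure"
  assumes p: "prob_space p" "sets p = sets borel" and q: "prob_space q" "sets q = sets borel"
    and fin: "(\<integral>\<^sup>+x. ennreal (x\<^sup>2) \<partial>p) < \<infinity>" "(\<integral>\<^sup>+x. ennreal (x\<^sup>2) \<partial>q) < \<infinity>"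
  shows "unif_integrable borel p q (\<lambda>x y. (x - y)\<^sup>2)"
  unfolding unif_integrable_def
proof (intro allI impI)
  fix \<epsilon> :: real assume \<epsilon>: "0 < \<epsilon>"
  then have e8: "0 < \<epsilon> / 8" by simp
  obtain N1 where N1: "\<And>N. N \<ge> N1 \<Longrightarrow> (\<integral>\<^sup>+x. ennreal (x\<^sup>2) * indicator {x. real N < x\<^sup>2} x \<partial>p) \<le> ennreal (\<epsilon> / 8)"
    using square_tail[OF p fin(1) e8] by blast
  obtain N2 where N2: "\<And>N. N \<ge> N2 \<Longrightarrow> (\<integral>\<^sup>+x. ennreal (x\<^sup>2) * indicator {x. real N < x\<^sup>2} x \<partial>q) \<le> ennreal (\<epsilon> / 8)"
    using square_tail[OF q fin(2) e8] by blast
  define N where "N = Suc (max N1 N2)"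
  \<comment> \<open>Each square contributes
    \<open>N * \<delta> + \<epsilon> / 8 = \<epsilon> / 4\<close>, and both enter with the factor
    2.\<close>
  define \<delta> where "\<delta> = \<epsilon> / (8 * N)"
  have N: "0 < real N" by (simp add: N_def)
  then have \<delta>: "0 < \<delta>" "N * \<delta> = \<epsilon> / 8" using \<epsilon> by (simp_all add: \<delta>_def)
  have part: "(\<integral>\<^sup>+z. ennreal ((h z)\<^sup>2) * indicator E z \<partial>\<pi>) \<le> ennreal (\<epsilon> / 4)"
    if \<pi>: "prob_space \<pi>" and E[measurable]: "E \<in> sets \<pi>" and m: "measure \<pi> E \<le> \<delta>" and h[measurable]: "h \<in> borel_measurable \<pi>"
      and d: "distr \<pi> borel h = r" and tail: "(\<integral>\<^sup>+x. ennreal (x\<^sup>2) * indicator {x. real N < x\<^sup>2} x \<partial>r) \<le> ennreal (\<epsilon> / 8)"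
    for \<pi> :: "(real \<times> real) measure" and E h r
  proof -
    interpret prob_space \<pi> by fact
    have "(\<integral>\<^sup>+z. ennreal ((h z)\<^sup>2) * indicator E z \<partial>\<pi>)
      \<le> (\<integral>\<^sup>+z. ennreal (real N) * indicator E z + ennreal ((h z)\<^sup>2) * indicator {x. real N < x\<^sup>2} (h z) \<partial>\<pi>)"
      by (intro nn_integral_mono) (auto simp: indicator_def not_less intro: ennreal_leI)
    also have "\<dots> = ennreal (real N) * emeasure \<pi> E + (\<integral>\<^sup>+z. ennreal ((h z)\<^sup>2) * indicator {x. real N < x\<^sup>2} (h z) \<partial>\<pi>)"
      by (subst nn_integral_add) (auto simp: nn_integral_cmult)
    also have "(\<integral>\<^sup>+z. ennreal ((h z)\<^sup>2) * indicator {x. real N < x\<^sup>2} (h z) \<partial>\<pi>) = (\<integral>\<^sup>+x. ennreal (x\<^sup>2) * indicator {x. real N < x\<^sup>2} x \<partial>r)"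
      unfolding d[symmetric] by (subst nn_integral_distr) auto
    also have "ennreal (real N) * emeasure \<pi> E + \<dots> \<le> ennreal (real N) * ennreal \<delta> + ennreal (\<epsilon> / 8)"
      using m tail by (intro add_mono mult_left_mono) (auto simp: emeasure_eq_measure intro: ennreal_leI)
    also have "\<dots> = ennreal (\<epsilon> / 4)"
      using \<delta> \<epsilon> by (simp add: ennreal_mult[symmetric] ennreal_plus[symmetric] del: ennreal_plus)
    finally show ?thesis .
  qed
  show "\<exists>\<delta>>0. \<forall>\<pi> E. coupling borel p borel q \<pi> \<and> E \<in> sets \<pi> \<and> measure \<pi> E \<le> \<delta> \<longrightarrow>
     (\<integral>\<^sup>+ z. ennreal (indicator E z * (fst z - snd z)\<^sup>2) \<partial>\<pi>) \<le> ennreal \<epsilon>"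
  proof (intro exI[of _ \<delta>] conjI allI impI \<delta>(1), elim conjE)
    fix \<pi> E assume \<pi>: "coupling borel p borel q \<pi>" and E[measurable]: "E \<in> sets \<pi>" and m: "measure \<pi> E \<le> \<delta>"
    note s[measurable_cong] = couplingD(2)[OF \<pi>]
    have 1: "(\<integral>\<^sup>+z. ennreal ((fst z)\<^sup>2) * indicator E z \<partial>\<pi>) \<le> ennreal (\<epsilon> / 4)"
      by (rule part[OF couplingD(1)[OF \<pi>] E m _ couplingD(3)[OF \<pi>] N1]) (auto simp: N_def)
    have 2: "(\<integral>\<^sup>+z. ennreal ((snd z)\<^sup>2) * indicator E z \<partial>\<pi>) \<le> ennreal (\<epsilon> / 4)"
      by (rule part[OF couplingD(1)[OF \<pi>] E m _ couplingD(4)[OF \<pi>] N2]) (auto simp: N_def)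
    have "(\<integral>\<^sup>+ z. ennreal (indicator E z * (fst z - snd z)\<^sup>2) \<partial>\<pi>)
      \<le> (\<integral>\<^sup>+ z. 2 * (ennreal ((fst z)\<^sup>2) * indicator E z) + 2 * (ennreal ((snd z)\<^sup>2) * indicator E z) \<partial>\<pi>)"
    proof (rule nn_integral_mono)
      fix z :: "real \<times> real"
      have "(fst z - snd z)\<^sup>2 \<le> 2 * (fst z)\<^sup>2 + 2 * (snd z)\<^sup>2"
        using zero_le_power2[of "fst z + snd z"] by (simp add: power2_sum power2_diff)
      then have "ennreal ((fst z - snd z)\<^sup>2) \<le> 2 * ennreal ((fst z)\<^sup>2) + 2 * ennreal ((snd z)\<^sup>2)"
        by (subst (asm) ennreal_le_iff[symmetric]) (auto simp: ennreal_plus ennreal_mult)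
      then show "ennreal (indicator E z * (fst z - snd z)\<^sup>2) \<le> 2 * (ennreal ((fst z)\<^sup>2) * indicator E z) + 2 * (ennreal ((snd z)\<^sup>2) * indicator E z)"
        by (simp add: indicator_def)
    qed
    also have "\<dots> = 2 * (\<integral>\<^sup>+z. ennreal ((fst z)\<^sup>2) * indicator E z \<partial>\<pi>) + 2 * (\<integral>\<^sup>+z. ennreal ((snd z)\<^sup>2) * indicator E z \<partial>\<pi>)"
      by (subst nn_integral_add) (auto simp: nn_integral_cmult)
    also have "\<dots> \<le> 2 * ennreal (\<epsilon> / 4) + 2 * ennreal (\<epsilon> / 4)" by (intro add_mono mult_left_mono 1 2) auto
    also have "\<dots> = ennreal \<epsilon>"
    proof -
      have "2 * ennreal (\<epsilon> / 4) = ennreal (\<epsilon> / 2)" using \<epsilon> ennreal_mult[of 2 "\<epsilon> / 4"] by simp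
      then show ?thesis using \<epsilon> by (simp add: ennreal_plus[symmetric] del: ennreal_plus)
    qed
    finally show "(\<integral>\<^sup>+ z. ennreal (indicator E z * (fst z - snd z)\<^sup>2) \<partial>\<pi>) \<le> ennreal \<epsilon>" .
  qed
qed

lemma integrable_of_square:
  fixes p :: "real measure"
  assumes p: "prob_space p" and s[measurable_cong]: "sets p = sets borel" and fin: "(\<integral>\<^sup>+x. ennreal (x\<^sup>2) \<partial>p) < \<infinity>"
  shows "integrable p (\<lambda>x. x\<^sup>2)" "integrable p (\<lambda>x. x)"
proof -
  interpret prob_space p by fact
  show i: "integrable p (\<lambda>x. x\<^sup>2)" using fin by (intro integrableI_nonneg) auto
  show "integrable p (\<lambda>x. x)"
  proof (rule Bochner_Integration.integrable_bound[of p "\<lambda>x. 1 + x\<^sup>2"])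
    show "AE x in p. norm x \<le> norm (1 + x\<^sup>2)"
    proof (rule AE_I2)
      fix x :: real
      have "0 \<le> (\<bar>x\<bar> - 1)\<^sup>2" by simp
      then have "2 * \<bar>x\<bar> \<le> 1 + x\<^sup>2" by (simp add: power2_diff)
      then show "norm x \<le> norm (1 + x\<^sup>2)" by simp
    qed
  qed (use i in auto)
qed

section \<open>Orthogonal splitting of the squared error\<close>

lemma nn_integral_square_shift:
  fixes p :: "real measure"
  assumes p: "prob_space p" and s[measurable_cong]: "sets p = sets borel" and fin: "(\<integral>\<^sup>+x. ennreal (x\<^sup>2) \<partial>p) < \<infinity>"
    and m: "m = (\<integral>x. x \<partial>p)"
  shows "(\<integral>\<^sup>+x. ennreal ((x - c)\<^sup>2) \<partial>p) = (\<integral>\<^sup>+x. ennreal ((x - m)\<^sup>2) \<partial>p) + ennreal ((m - c)\<^sup>2)"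
proof -
  interpret prob_space p by fact
  note i = integrable_of_square[OF p s fin]
  have q: "integrable p (\<lambda>x. (x - b)\<^sup>2)" for b unfolding power2_diff using i by simp
  have "(\<integral>x. (x - c)\<^sup>2 \<partial>p) = (\<integral>x. (x - m)\<^sup>2 + (2 * (m - c) * (x - m) + (m - c)\<^sup>2) \<partial>p)"
    by (intro Bochner_Integration.integral_cong) (auto simp: power2_eq_square algebra_simps)
  also have "\<dots> = (\<integral>x. (x - m)\<^sup>2 \<partial>p) + (m - c)\<^sup>2"
    using q i by (simp add: prob_space m)
  finally have e: "(\<integral>x. (x - c)\<^sup>2 \<partial>p) = (\<integral>x. (x - m)\<^sup>2 \<partial>p) + (m - c)\<^sup>2" .
  show ?thesis
    using q[of c] q[of m] e by (simp add: nn_integral_eq_integral ennreal_plus)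
qed

text \<open>The shift formula is applied first in \<open>y\<close> for fixed \<open>x\<close>, then
  in \<open>x\<close>.\<close>

lemma nn_integral_square_diff:
  fixes p q :: "real measure"
  assumes p: "prob_space p" and sp[measurable_cong]: "sets p = sets borel" and fp: "(\<integral>\<^sup>+x. ennreal (x\<^sup>2) \<partial>p) < \<infinity>"
    and q: "prob_space q" and sq[measurable_cong]: "sets q = sets borel" and fq: "(\<integral>\<^sup>+x. ennreal (x\<^sup>2) \<partial>q) < \<infinity>"
    and m: "m = (\<integral>x. x \<partial>p)" and m': "m' = (\<integral>x. x \<partial>q)"
  shows "(\<integral>\<^sup>+x. \<integral>\<^sup>+y. ennreal ((x - y)\<^sup>2) \<partial>q \<partial>p)
    = (\<integral>\<^sup>+x. ennreal ((x - m)\<^sup>2) \<partial>p) + (\<integral>\<^sup>+y. ennreal ((y - m')\<^sup>2) \<partial>q) + ennreal ((m - m')\<^sup>2)"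
proof -
  interpret p: prob_space p by fact
  interpret q: prob_space q by fact
  have "(\<integral>\<^sup>+x. \<integral>\<^sup>+y. ennreal ((x - y)\<^sup>2) \<partial>q \<partial>p) = (\<integral>\<^sup>+x. (\<integral>\<^sup>+y. ennreal ((y - m')\<^sup>2) \<partial>q) + ennreal ((x - m')\<^sup>2) \<partial>p)"
    using nn_integral_square_shift[OF q sq fq m'] by (simp add: power2_commute[of _ "_ :: real"] power2_commute)
  also have "\<dots> = (\<integral>\<^sup>+y. ennreal ((y - m')\<^sup>2) \<partial>q) + (\<integral>\<^sup>+x. ennreal ((x - m')\<^sup>2) \<partial>p)"
    by (subst nn_integral_add) (auto simp: p.emeasure_space_1)
  also have "(\<integral>\<^sup>+x. ennreal ((x - m')\<^sup>2) \<partial>p) = (\<integral>\<^sup>+x. ennreal ((x - m)\<^sup>2) \<partial>p) + ennreal ((m - m')\<^sup>2)"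
    by (rule nn_integral_square_shift[OF p sp fp m])
  finally show ?thesis by (simp add: add_ac)
qed

lemma channel_letter_measure:
  assumes p: "prob_space p" and f: "channel p \<nu> f" and u[measurable]: "u \<in> space \<nu>"
  shows "prob_space (density p (\<lambda>x. ennreal (f (x, u))))"
  by standard (use channelD(1,3)[OF f] u in \<open>simp add: emeasure_density\<close>)

text \<open>The second moment of \<open>p\<close> is the \<open>\<nu>\<close>-mean of the
  conditional ones, so almost all of these are finite.\<close>

lemma channel_second_moment:
  fixes p :: "real measure"
  assumes p: "prob_space p" and s[measurable_cong]: "sets p = sets borel" and fin: "(\<integral>\<^sup>+x. ennreal (x\<^sup>2) \<partial>p) < \<infinity>"
    and \<nu>: "prob_space \<nu>" and f: "channel p \<nu> f"
  shows "AE u in \<nu>. (\<integral>\<^sup>+x. ennreal (x\<^sup>2) \<partial>density p (\<lambda>x. ennreal (f (x, u)))) < \<infinity>"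
proof -
  interpret p: prob_space p by fact
  interpret \<nu>: prob_space \<nu> by fact
  interpret pair_sigma_finite p \<nu> by standard
  note [measurable] = channelD(1)[OF f]
  have "(\<integral>\<^sup>+u. \<integral>\<^sup>+x. ennreal (f (x, u)) * ennreal (x\<^sup>2) \<partial>p \<partial>\<nu>) \<noteq> \<infinity>"
    using fin by (subst nn_integral_channel[OF p \<nu> f]) auto
  then have "AE u in \<nu>. (\<integral>\<^sup>+x. ennreal (f (x, u)) * ennreal (x\<^sup>2) \<partial>p) \<noteq> \<infinity>"
    by (intro nn_integral_PInf_AE) auto
  then show ?thesis using AE_space
  proof eventually_elim
    case (elim u)
    note [measurable] = elim(2)
    show ?case using elim(1) by (subst nn_integral_density) (auto simp: less_top)
  qed
qed

text \<open>Given \<open>u\<close> the two ends are independent, so the squared error splits into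
  two conditional variances and the squared distance of the conditional means. \<open>m\<close> and
  \<open>m'\<close> are compared with the means only almost everywhere, because in one application
  they are the coordinates of a given pair of estimators.\<close>

lemma avg_distortion_square:
  fixes p q :: "real measure"
  assumes p: "prob_space p" and sp[measurable_cong]: "sets p = sets borel" and fp: "(\<integral>\<^sup>+x. ennreal (x\<^sup>2) \<partial>p) < \<infinity>"
    and q: "prob_space q" and sq[measurable_cong]: "sets q = sets borel" and fq: "(\<integral>\<^sup>+x. ennreal (x\<^sup>2) \<partial>q) < \<infinity>"
    and \<nu>: "prob_space \<nu>" and f: "channel p \<nu> f" and g: "channel q \<nu> g"
    and m[measurable]: "m \<in> borel_measurable \<nu>" and m'[measurable]: "m' \<in> borel_measurable \<nu>"
    and mf: "AE u in \<nu>. m u = (\<integral>x. f (x, u) * x \<partial>p)" and mg: "AE u in \<nu>. m' u = (\<integral>y. g (y, u) * y \<partial>q)"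
  shows "avg_distortion p q \<nu> f g (\<lambda>x y. (x - y)\<^sup>2) =
    (\<integral>\<^sup>+u. \<integral>\<^sup>+x. ennreal (f (x, u)) * ennreal ((x - m u)\<^sup>2) \<partial>p \<partial>\<nu>) +
    (\<integral>\<^sup>+u. \<integral>\<^sup>+y. ennreal (g (y, u)) * ennreal ((y - m' u)\<^sup>2) \<partial>q \<partial>\<nu>) +
    (\<integral>\<^sup>+u. ennreal ((m u - m' u)\<^sup>2) \<partial>\<nu>)"
proof -
  interpret p: prob_space p by fact
  interpret q: prob_space q by fact
  interpret \<nu>: prob_space \<nu> by fact
  note [measurable] = channelD(1)[OF f] channelD(1)[OF g]
  have "avg_distortion p q \<nu> f g (\<lambda>x y. (x - y)\<^sup>2) =
    (\<integral>\<^sup>+u. (\<integral>\<^sup>+x. ennreal (f (x, u)) * ennreal ((x - m u)\<^sup>2) \<partial>p) + (\<integral>\<^sup>+y. ennreal (g (y, u)) * ennreal ((y - m' u)\<^sup>2) \<partial>q)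
      + ennreal ((m u - m' u)\<^sup>2) \<partial>\<nu>)"
  proof (rule nn_integral_cong_AE)
    show "AE u in \<nu>. (\<integral>\<^sup>+x. \<integral>\<^sup>+y. ennreal (f (x, u)) * (ennreal ((x - y)\<^sup>2) * ennreal (g (y, u))) \<partial>q \<partial>p) =
      (\<integral>\<^sup>+x. ennreal (f (x, u)) * ennreal ((x - m u)\<^sup>2) \<partial>p) + (\<integral>\<^sup>+y. ennreal (g (y, u)) * ennreal ((y - m' u)\<^sup>2) \<partial>q)
      + ennreal ((m u - m' u)\<^sup>2)"
      using channel_second_moment[OF p sp fp \<nu> f] channel_second_moment[OF q sq fq \<nu> g] mf mg AE_space
    proof eventually_elim
      case (elim u)
      note u[measurable] = elim(5)
      let ?p = "density p (\<lambda>x. ennreal (f (x, u)))" and ?q = "density q (\<lambda>y. ennreal (g (y, u)))"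
      have M: "m u = (\<integral>x. x \<partial>?p)" using channelD(2)[OF f] by (subst integral_density) (auto simp: elim(3))
      have M': "m' u = (\<integral>x. x \<partial>?q)" using channelD(2)[OF g] by (subst integral_density) (auto simp: elim(4))
      have "(\<integral>\<^sup>+x. \<integral>\<^sup>+y. ennreal (f (x, u)) * (ennreal ((x - y)\<^sup>2) * ennreal (g (y, u))) \<partial>q \<partial>p)
        = (\<integral>\<^sup>+x. ennreal (f (x, u)) * (\<integral>\<^sup>+y. ennreal ((x - y)\<^sup>2) \<partial>?q) \<partial>p)"
      proof (rule nn_integral_cong)
        fix x
        have "(\<integral>\<^sup>+y. ennreal (f (x, u)) * (ennreal ((x - y)\<^sup>2) * ennreal (g (y, u))) \<partial>q)
          = ennreal (f (x, u)) * (\<integral>\<^sup>+y. ennreal ((x - y)\<^sup>2) * ennreal (g (y, u)) \<partial>q)"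
          by (rule nn_integral_cmult) measurable
        then show "(\<integral>\<^sup>+y. ennreal (f (x, u)) * (ennreal ((x - y)\<^sup>2) * ennreal (g (y, u))) \<partial>q)
          = ennreal (f (x, u)) * (\<integral>\<^sup>+y. ennreal ((x - y)\<^sup>2) \<partial>?q)"
          by (subst nn_integral_density) (auto simp: mult.commute)
      qed
      also have "\<dots> = (\<integral>\<^sup>+x. \<integral>\<^sup>+y. ennreal ((x - y)\<^sup>2) \<partial>?q \<partial>?p)"
      proof (rule nn_integral_density[symmetric])
        interpret Q: prob_space ?q by (rule channel_letter_measure[OF q g u])
        show "(\<lambda>x. \<integral>\<^sup>+y. ennreal ((x - y)\<^sup>2) \<partial>?q) \<in> borel_measurable p" by measurable
      qed measurable
      also have "\<dots> = (\<integral>\<^sup>+x. ennreal ((x - m u)\<^sup>2) \<partial>?p) + (\<integral>\<^sup>+y. ennreal ((y - m' u)\<^sup>2) \<partial>?q) + ennreal ((m u - m' u)\<^sup>2)"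
        by (rule nn_integral_square_diff[OF channel_letter_measure[OF p f u] _ elim(1) channel_letter_measure[OF q g u] _ elim(2) M M'])
          (simp_all add: sp sq)
      finally show ?case by (simp add: nn_integral_density)
    qed
  qed
  then show ?thesis by (simp add: nn_integral_add)
qed

lemma channel_mean:
  fixes p :: "real measure" and f :: "real \<times> 'u \<Rightarrow> real"
  assumes p: "prob_space p" and sp[measurable_cong]: "sets p = sets borel" and i: "integrable p (\<lambda>x. x)"
    and \<nu>: "prob_space \<nu>" and f: "channel p \<nu> f"
    and m_def: "m = (\<lambda>u. \<integral>x. f (x, u) * x \<partial>p)"
  shows "m \<in> borel_measurable \<nu>" "integrable \<nu> m" "integrable (p \<Otimes>\<^sub>M \<nu>) (\<lambda>z. f z * fst z)"
    "\<And>C. C \<in> sets \<nu> \<Longrightarrow> (\<integral>z. indicator C (snd z) * (f z * fst z) \<partial>(p \<Otimes>\<^sub>M \<nu>)) = (\<integral>u. indicator C u * m u \<partial>\<nu>)"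
proof -
  interpret p: prob_space p by fact
  interpret \<nu>: prob_space \<nu> by fact
  interpret pn: pair_sigma_finite p \<nu> by standard
  note [measurable] = channelD(1)[OF f]
  show m[measurable]: "m \<in> borel_measurable \<nu>" unfolding m_def by measurable
  show zi: "integrable (p \<Otimes>\<^sub>M \<nu>) (\<lambda>z. f z * fst z)"
  proof (rule integrableI_bounded)
    have "(\<integral>\<^sup>+z. ennreal (norm (f z * fst z)) \<partial>(p \<Otimes>\<^sub>M \<nu>)) = (\<integral>\<^sup>+u. \<integral>\<^sup>+x. ennreal (f (x, u)) * ennreal \<bar>x\<bar> \<partial>p \<partial>\<nu>)"
      using channelD(2)[OF f] by (subst pn.nn_integral_snd[symmetric]) (auto simp: abs_mult ennreal_mult)
    also have "\<dots> = (\<integral>\<^sup>+x. ennreal \<bar>x\<bar> \<partial>p)" by (rule nn_integral_channel[OF p \<nu> f]) measurable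
    also have "\<dots> < \<infinity>" using i by (simp add: integrable_iff_bounded)
    finally show "(\<integral>\<^sup>+z. ennreal (norm (f z * fst z)) \<partial>(p \<Otimes>\<^sub>M \<nu>)) < \<infinity>" .
  qed measurable
  show "integrable \<nu> m"
    unfolding m_def using pn.integrable_snd[of "\<lambda>x u. f (x, u) * x"] zi by (simp add: split_beta')
  fix C assume [measurable]: "C \<in> sets \<nu>"
  have ci: "integrable (p \<Otimes>\<^sub>M \<nu>) (\<lambda>z. indicator C (snd z) * (f z * fst z))"
    by (rule Bochner_Integration.integrable_bound[OF zi]) (auto simp: indicator_def)
  have "(\<integral>z. indicator C (snd z) * (f z * fst z) \<partial>(p \<Otimes>\<^sub>M \<nu>)) = (\<integral>u. \<integral>x. indicator C u * (f (x, u) * x) \<partial>p \<partial>\<nu>)"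
    using pn.integral_snd[of "\<lambda>x u. indicator C u * (f (x, u) * x)"] ci by (simp add: split_beta')
  then show "(\<integral>z. indicator C (snd z) * (f z * fst z) \<partial>(p \<Otimes>\<^sub>M \<nu>)) = (\<integral>u. indicator C u * m u \<partial>\<nu>)"
    by (simp add: m_def)
qed

text \<open>The mean computed from \<open>f\<close> is a version of the conditional expectation, and
  by assumption the identity is another; the two agree almost surely.\<close>

lemma cond_mean_channel:
  fixes p \<nu> :: "real measure" and f :: "real \<times> real \<Rightarrow> real"
  assumes p: "prob_space p" and sp[measurable_cong]: "sets p = sets borel" and i: "integrable p (\<lambda>x. x)"
    and \<nu>: "prob_space \<nu>" and s\<nu>[measurable_cong]: "sets \<nu> = sets borel" and f: "channel p \<nu> f"
    and c: "cond_mean_eq (density (p \<Otimes>\<^sub>M \<nu>) (\<lambda>z. ennreal (f z)))"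
  shows "AE y in \<nu>. y = (\<integral>x. f (x, y) * x \<partial>p)"
proof -
  let ?P = "density (p \<Otimes>\<^sub>M \<nu>) (\<lambda>z. ennreal (f z))"
  interpret p: prob_space p by fact
  interpret \<nu>: prob_space \<nu> by fact
  note [measurable] = channelD(1)[OF f]
  note f0 = channelD(2)[OF f]
  note P = channel_marginals[OF p \<nu> f sp[symmetric] s\<nu>[symmetric]]
  define m where "m = (\<lambda>y. \<integral>x. f (x, y) * x \<partial>p)"
  note m = channel_mean[OF p sp i \<nu> f m_def]
  have m1[measurable]: "m \<in> borel_measurable borel" using m(1) measurable_cong_sets[OF s\<nu> refl] by blast
  note mi = m(2)
  have sm: "snd \<in> measurable ?P borel" by measurable
  have "AE z in ?P. real_cond_exp ?P (vimage_algebra (space ?P) snd borel) fst z = m (snd z)"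
  proof (rule real_cond_exp_vimage[OF P(1) sm])
    show "integrable ?P fst" using c by (simp add: cond_mean_eq_def)
    have "integrable (distr ?P borel snd) m" unfolding P(3) by (rule mi)
    then show "integrable ?P (\<lambda>z. m (snd z))" by (subst (asm) integrable_distr_eq[OF sm]) auto
    fix C :: "real set" assume C[measurable]: "C \<in> sets borel"
    have "(\<integral>z. indicator C (snd z) * fst z \<partial>?P) = (\<integral>z. indicator C (snd z) * (f z * fst z) \<partial>(p \<Otimes>\<^sub>M \<nu>))"
      using f0 by (subst integral_density) (auto simp: mult_ac)
    also have "\<dots> = (\<integral>u. indicator C u * m u \<partial>\<nu>)"
      using s\<nu> by (intro m(4)) simp
    also have "\<dots> = (\<integral>u. indicator C u * m u \<partial>distr ?P borel snd)" unfolding P(3) ..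
    also have "\<dots> = (\<integral>z. indicator C (snd z) * m (snd z) \<partial>?P)"
      by (rule integral_distr[OF sm]) measurable
    finally show "(\<integral>z. indicator C (snd z) * fst z \<partial>?P) = (\<integral>z. indicator C (snd z) * m (snd z) \<partial>?P)" .
  qed measurable
  moreover have "AE z in ?P. real_cond_exp ?P (vimage_algebra (space ?P) snd borel) fst z = snd z"
    using c unfolding cond_mean_eq_def by blast
  ultimately have "AE z in ?P. snd z = m (snd z)" by eventually_elim simp
  then have "AE y in distr ?P borel snd. y = m y" by (subst AE_distr_iff[OF sm]) auto
  then show ?thesis unfolding P(3) m_def .
qed

text \<open>Data processing for a map of the second coordinate, by Gibbs' inequality
  \<open>f ln (G / f) \<le> G - f\<close> with \<open>G\<close> the density of the processed pair.\<close>

lemma data_processing: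
  fixes p :: "'a measure" and \<nu> :: "'u measure" and f :: "'a \<times> 'u \<Rightarrow> real"
  assumes p: "prob_space p" and \<nu>: "prob_space \<nu>" and f: "channel p \<nu> f" and fC: "\<And>z. f z \<le> C"
    and h[measurable]: "h \<in> measurable \<nu> T" and S[measurable_cong]: "sets S = sets p"
    and P_def: "P = distr (density (p \<Otimes>\<^sub>M \<nu>) (\<lambda>z. ennreal (f z))) (S \<Otimes>\<^sub>M T) (\<lambda>z. (fst z, h (snd z)))"
  shows "distr P S fst = p" "distr P T snd = distr \<nu> T h"
    "mutual_info S T P \<le> ennreal (\<integral>z. f z * ln (f z) \<partial>(p \<Otimes>\<^sub>M \<nu>))"
proof -
  interpret p: prob_space p by fact
  interpret \<nu>: prob_space \<nu> by fact
  note fm[measurable] = channelD(1)[OF f]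
  note f0 = channelD(2)[OF f]
  let ?P1 = "density (p \<Otimes>\<^sub>M \<nu>) (\<lambda>z. ennreal (f z))"
  note P1 = channel_marginals[OF p \<nu> f S refl]
  interpret P1: prob_space ?P1 by (rule P1(1))
  interpret pn: prob_space "p \<Otimes>\<^sub>M \<nu>" by (intro prob_space_pair p \<nu>)
  let ?H = "\<lambda>z. (fst z, h (snd z))"
  have H1: "?H \<in> measurable ?P1 (S \<Otimes>\<^sub>M T)" and H2: "?H \<in> measurable (p \<Otimes>\<^sub>M \<nu>) (S \<Otimes>\<^sub>M T)" by measurable
  have P: "prob_space P" unfolding P_def by (rule P1.prob_space_distr[OF H1])
  have "distr P S fst = distr ?P1 S fst" unfolding P_def using H1 by (subst distr_distr) (auto simp: comp_def)
  then show d1: "distr P S fst = p" using P1(2) by simp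
  have "distr P T snd = distr ?P1 T (\<lambda>z. h (snd z))" unfolding P_def using H1 by (subst distr_distr) (auto simp: comp_def)
  also have "\<dots> = distr (distr ?P1 \<nu> snd) T h" by (subst distr_distr) (auto simp: comp_def)
  finally show d2: "distr P T snd = distr \<nu> T h" using P1(3) by simp
  define Q where "Q = p \<Otimes>\<^sub>M distr \<nu> T h"
  have nT: "prob_space (distr \<nu> T h)" by (rule \<nu>.prob_space_distr[OF h])
  have Q: "prob_space Q" unfolding Q_def by (intro prob_space_pair p nT)
  have QH: "Q = distr (p \<Otimes>\<^sub>M \<nu>) (S \<Otimes>\<^sub>M T) ?H"
  proof -
    have "distr p S (\<lambda>x. x) = p" using S by (intro distr_id2) simp
    then have "Q = distr p S (\<lambda>x. x) \<Otimes>\<^sub>M distr \<nu> T h" by (simp add: Q_def)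
    also have "\<dots> = distr (p \<Otimes>\<^sub>M \<nu>) (S \<Otimes>\<^sub>M T) (\<lambda>(x, y). (x, h y))"
      by (rule pair_measure_distr) (auto intro: prob_space_imp_sigma_finite nT)
    finally show ?thesis by (simp add: split_beta')
  qed
  have sPQ: "sets P = sets Q" by (simp add: P_def QH)
  \<comment> \<open>The maximum with 1 makes the bound positive, so that \<open>1 / D\<close> can be
    a domination constant.\<close>
  define D where "D = max C 1"
  have D: "0 < D" "\<And>z. f z \<le> D" using fC by (auto simp: D_def le_max_iff_disj)
  have dom: "ennreal (1 / D) * emeasure P A \<le> emeasure Q A" if "A \<in> sets Q" for A
  proof -
    have A[measurable]: "A \<in> sets (S \<Otimes>\<^sub>M T)" using that by (simp add: QH)
    have "emeasure P A = (\<integral>\<^sup>+z. indicator A (?H z) \<partial>?P1)"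
      unfolding P_def by (subst nn_integral_distr[OF H1, symmetric]) auto
    also have "\<dots> = (\<integral>\<^sup>+z. ennreal (f z) * indicator A (?H z) \<partial>(p \<Otimes>\<^sub>M \<nu>))" by (rule nn_integral_density) measurable
    also have "\<dots> \<le> (\<integral>\<^sup>+z. ennreal D * indicator A (?H z) \<partial>(p \<Otimes>\<^sub>M \<nu>))"
      using D by (intro nn_integral_mono mult_right_mono ennreal_leI) auto
    also have "\<dots> = ennreal D * (\<integral>\<^sup>+z. indicator A (?H z) \<partial>(p \<Otimes>\<^sub>M \<nu>))" by (rule nn_integral_cmult) measurable
    also have "(\<integral>\<^sup>+z. indicator A (?H z) \<partial>(p \<Otimes>\<^sub>M \<nu>)) = emeasure Q A"
      unfolding QH by (subst nn_integral_distr[OF H2, symmetric]) auto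
    finally have "ennreal (1 / D) * emeasure P A \<le> ennreal (1 / D) * (ennreal D * emeasure Q A)" by (rule mult_left_mono) simp
    also have "\<dots> = emeasure Q A" using D by (simp add: mult.assoc[symmetric] ennreal_mult[symmetric])
    finally show ?thesis .
  qed
  \<comment> \<open>Domination passes through the map, so the processed pair has a density with the
    same bound \<open>D\<close>.\<close>
  obtain F where F: "F \<in> borel_measurable Q" "\<And>x. 0 \<le> F x" "\<And>x. F x \<le> D" and PF: "P = density Q (\<lambda>x. ennreal (F x))"
    using dominated_density[OF Q P sPQ _ dom] D by auto
  have F1: "(\<integral>\<^sup>+z. ennreal (F z) \<partial>Q) = 1"
    using prob_space.emeasure_space_1[OF P] F(1) unfolding PF by (simp add: emeasure_density cong: nn_integral_cong_simp)
  interpret Q: prob_space Q by (rule Q)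
  have Fi: "integrable Q (\<lambda>z. F z * ln (F z))" by (rule Q.integrable_xlnx[OF F])
  have MI: "mutual_info S T P = ennreal (\<integral>z. F z * ln (F z) \<partial>Q)"
    unfolding mutual_info_def d1 d2 Q_def[symmetric] unfolding PF by (rule KL_div_density[OF Q F(1,2) F1 Fi])
  have Fm[measurable]: "F \<in> borel_measurable (S \<Otimes>\<^sub>M T)" using F(1) by (simp add: QH)
  define G where "G z = F (?H z)" for z
  have G[measurable]: "G \<in> borel_measurable (p \<Otimes>\<^sub>M \<nu>)" unfolding G_def by measurable
  have lF: "integrable P (\<lambda>z. ln (F z))" "(\<integral>z. F z * ln (F z) \<partial>Q) = (\<integral>z. ln (F z) \<partial>P)"
    unfolding PF using Fi F by (auto simp: integrable_density integral_density)
  have "integrable ?P1 (\<lambda>z. ln (G z))" using lF(1) unfolding P_def G_def by (subst (asm) integrable_distr_eq[OF H1]) auto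
  then have Gi: "integrable (p \<Otimes>\<^sub>M \<nu>) (\<lambda>z. f z * ln (G z))" using f0 by (subst (asm) integrable_density) auto
  have "(\<integral>z. ln (F z) \<partial>P) = (\<integral>z. ln (G z) \<partial>?P1)" unfolding P_def G_def by (rule integral_distr[OF H1]) measurable
  also have "\<dots> = (\<integral>z. f z * ln (G z) \<partial>(p \<Otimes>\<^sub>M \<nu>))" using f0 by (subst integral_density) auto
  finally have e: "(\<integral>z. F z * ln (F z) \<partial>Q) = (\<integral>z. f z * ln (G z) \<partial>(p \<Otimes>\<^sub>M \<nu>))" using lF(2) by simp
  have G0: "0 \<le> G z" "G z \<le> D" for z using F by (auto simp: G_def)
  have Gint: "integrable (p \<Otimes>\<^sub>M \<nu>) G" by (rule pn.integrable_const_bound[of _ D]) (use G0 in auto)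
  have fint: "integrable (p \<Otimes>\<^sub>M \<nu>) f" by (rule pn.integrable_const_bound[of _ D]) (use f0 D in auto)
  have GI: "(\<integral>z. G z \<partial>(p \<Otimes>\<^sub>M \<nu>)) = 1"
  proof -
    have "(\<integral>z. G z \<partial>(p \<Otimes>\<^sub>M \<nu>)) = (\<integral>z. F z \<partial>Q)" unfolding QH G_def by (rule integral_distr[OF H2, symmetric]) measurable
    also have "\<dots> = 1" using F1 F by (subst integral_eq_nn_integral) auto
    finally show ?thesis .
  qed
  have fI: "(\<integral>z. f z \<partial>(p \<Otimes>\<^sub>M \<nu>)) = 1"
    using integral_channel_eq_one[OF p \<nu> f] f0 by (simp add: integral_eq_nn_integral)
  \<comment> \<open>Ensures that \<open>G\<close> is positive wherever \<open>f\<close> is, as the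
    logarithm of the quotient requires.\<close>
  have "AE z in P. 0 < F z" unfolding PF using F by (subst AE_density) auto
  then have "AE z in ?P1. 0 < G z" unfolding P_def G_def by (rule AE_distrD[OF H1])
  then have "AE z in p \<Otimes>\<^sub>M \<nu>. 0 < ennreal (f z) \<longrightarrow> 0 < G z" by (subst (asm) AE_density) auto
  then have "AE z in p \<Otimes>\<^sub>M \<nu>. f z * ln (G z) \<le> f z * ln (f z) + (G z - f z)"
  proof eventually_elim
    case (elim z)
    show ?case
    proof (cases "f z = 0")
      case False
      then have fz: "0 < f z" using f0[of z] by (simp add: less_le)
      then have Gz: "0 < G z" using elim by simp
      have "ln (G z / f z) \<le> G z / f z - 1" using fz Gz by (intro ln_le_minus_one) simp
      then have "f z * ln (G z / f z) \<le> f z * (G z / f z - 1)" using fz by (intro mult_left_mono) auto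
      then show ?thesis using fz Gz by (simp add: ln_div algebra_simps)
    qed (use G0 in simp)
  qed
  then have "(\<integral>z. f z * ln (G z) \<partial>(p \<Otimes>\<^sub>M \<nu>)) \<le> (\<integral>z. f z * ln (f z) + (G z - f z) \<partial>(p \<Otimes>\<^sub>M \<nu>))"
    using Gi Gint fint pn.integrable_xlnx[OF fm f0 fC] by (intro integral_mono_AE) auto
  also have "\<dots> = (\<integral>z. f z * ln (f z) \<partial>(p \<Otimes>\<^sub>M \<nu>))"
    using Gint fint pn.integrable_xlnx[OF fm f0 fC] GI fI by simp
  finally show "mutual_info S T P \<le> ennreal (\<integral>z. f z * ln (f z) \<partial>(p \<Otimes>\<^sub>M \<nu>))"
    unfolding MI e by (rule ennreal_leI)
qed

text \<open>\<open>W2sq\<close> is an infimum standing inside a sum. For finite \<open>c\<close> and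
  nonnegative \<open>x\<close> the constant is moved across by subtraction in
  \<open>ennreal\<close>; a negative \<open>x\<close> or an infinite \<open>c\<close> makes the
  claim trivial.\<close>

lemma le_enn2ereal_add_Inf:
  fixes c :: ennreal
  assumes "\<And>s. s \<in> S \<Longrightarrow> x \<le> enn2ereal (c + s)"
  shows "x \<le> enn2ereal (c + Inf S)"
proof (cases "0 \<le> x \<and> c \<noteq> top")
  case True
  define y where "y = e2ennreal x"
  have x: "x = enn2ereal y" using True by (simp add: y_def enn2ereal_e2ennreal)
  have "y - c \<le> Inf S"
  proof (rule Inf_greatest)
    fix s assume "s \<in> S"
    then have "y \<le> c + s" using assms unfolding x less_eq_ennreal.rep_eq by blast
    then show "y - c \<le> s" using True by (simp add: ennreal_minus_le_iff)
  qed
  then have "y \<le> c + Inf S" using True by (simp add: ennreal_minus_le_iff)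
  then show ?thesis unfolding x less_eq_ennreal.rep_eq .
next
  case False
  show ?thesis
  proof (cases "0 \<le> x")
    case True
    then have "c = top" using False by simp
    then show ?thesis by simp
  next
    case False
    then show ?thesis using enn2ereal_nonneg[of "c + Inf S"] by (meson linear order_trans)
  qed
qed

lemma distr_pair_map_snd:
  assumes p: "prob_space p" and \<nu>: "prob_space \<nu>" and h[measurable]: "h \<in> measurable \<nu> T"
  shows "p \<Otimes>\<^sub>M distr \<nu> T h = distr (p \<Otimes>\<^sub>M \<nu>) (p \<Otimes>\<^sub>M T) (\<lambda>z. (fst z, h (snd z)))"
proof -
  interpret \<nu>: prob_space \<nu> by fact
  have nT: "prob_space (distr \<nu> T h)" by (rule \<nu>.prob_space_distr[OF h])
  have "p \<Otimes>\<^sub>M distr \<nu> T h = distr p p (\<lambda>x. x) \<Otimes>\<^sub>M distr \<nu> T h" by simp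
  also have "\<dots> = distr (p \<Otimes>\<^sub>M \<nu>) (p \<Otimes>\<^sub>M T) (\<lambda>(x, y). (x, h y))"
    by (rule pair_measure_distr) (auto intro: prob_space_imp_sigma_finite nT)
  finally show ?thesis by (simp add: split_beta')
qed

text \<open>\<open>f'\<close> is \<open>f\<close> composed with a map that carries one product
  measure to the other, so a variable that depends on \<open>u\<close> only through
  \<open>h u\<close> has the same information with both.\<close>

lemma channel_lift:
  fixes f :: "'a \<times> 'v \<Rightarrow> real" and \<pi> :: "'u measure"
  assumes p: "prob_space p" and \<pi>: "prob_space \<pi>" and h[measurable]: "h \<in> measurable \<pi> T"
    and f: "channel p (distr \<pi> T h) f" and fi: "integrable (p \<Otimes>\<^sub>M distr \<pi> T h) (\<lambda>z. f z * ln (f z))"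
    and f'_def: "f' = (\<lambda>z. f (fst z, h (snd z)))"
  shows "channel p \<pi> f'" "integrable (p \<Otimes>\<^sub>M \<pi>) (\<lambda>z. f' z * ln (f' z))"
    "(\<integral>z. f' z * ln (f' z) \<partial>(p \<Otimes>\<^sub>M \<pi>)) = (\<integral>z. f z * ln (f z) \<partial>(p \<Otimes>\<^sub>M distr \<pi> T h))"
proof -
  have s: "sets (p \<Otimes>\<^sub>M distr \<pi> T h) = sets (p \<Otimes>\<^sub>M T)" by (intro sets_pair_measure_cong) auto
  have fm[measurable]: "f \<in> borel_measurable (p \<Otimes>\<^sub>M T)"
    using channelD(1)[OF f] measurable_cong_sets[OF s refl] by blast
  have H: "(\<lambda>z. (fst z, h (snd z))) \<in> measurable (p \<Otimes>\<^sub>M \<pi>) (p \<Otimes>\<^sub>M T)" by measurable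
  show "channel p \<pi> f'"
    unfolding channel_def
  proof (intro conjI allI ballI)
    show "f' \<in> borel_measurable (p \<Otimes>\<^sub>M \<pi>)" unfolding f'_def by measurable
    show "0 \<le> f' z" for z unfolding f'_def by (rule channelD(2)[OF f])
    show "(\<integral>\<^sup>+x. ennreal (f' (x, u)) \<partial>p) = 1" if "u \<in> space \<pi>" for u
      unfolding f'_def using channelD(3)[OF f, of "h u"] measurable_space[OF h that] by simp
    show "AE x in p. (\<integral>\<^sup>+u. ennreal (f' (x, u)) \<partial>\<pi>) = 1"
      using channelD(4)[OF f] AE_space
    proof eventually_elim
      case (elim x)
      note [measurable] = elim(2)
      have "(\<integral>\<^sup>+u. ennreal (f (x, u)) \<partial>distr \<pi> T h) = (\<integral>\<^sup>+u. ennreal (f (x, h u)) \<partial>\<pi>)"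
        by (rule nn_integral_distr[OF h]) measurable
      then show ?case using elim(1) by (simp add: f'_def)
    qed
  qed
  show "integrable (p \<Otimes>\<^sub>M \<pi>) (\<lambda>z. f' z * ln (f' z))"
    using fi unfolding distr_pair_map_snd[OF p \<pi> h] f'_def by (subst (asm) integrable_distr_eq[OF H]) auto
  show "(\<integral>z. f' z * ln (f' z) \<partial>(p \<Otimes>\<^sub>M \<pi>)) = (\<integral>z. f z * ln (f z) \<partial>(p \<Otimes>\<^sub>M distr \<pi> T h))"
    unfolding distr_pair_map_snd[OF p \<pi> h] f'_def by (subst integral_distr[OF H]) auto
qed

lemma nn_integral_density_channel:
  assumes p: "prob_space p" and \<nu>: "prob_space \<nu>" and f: "channel p \<nu> f" and H[measurable]: "H \<in> borel_measurable (p \<Otimes>\<^sub>M \<nu>)"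
  shows "(\<integral>\<^sup>+z. H z \<partial>density (p \<Otimes>\<^sub>M \<nu>) (\<lambda>z. ennreal (f z))) = (\<integral>\<^sup>+u. \<integral>\<^sup>+x. ennreal (f (x, u)) * H (x, u) \<partial>p \<partial>\<nu>)"
proof -
  interpret p: prob_space p by fact
  interpret \<nu>: prob_space \<nu> by fact
  interpret pair_sigma_finite p \<nu> by standard
  note [measurable] = channelD(1)[OF f]
  show ?thesis by (subst nn_integral_density, simp, simp, subst nn_integral_snd[symmetric]) simp_all
qed

text \<open>With a coupling \<open>\<pi>\<close> of the two estimators as the law of
  \<open>U\<close>, the source depends on \<open>U\<close> through the first coordinate and the
  output through the second. The informations with \<open>U\<close> are then those of
  \<open>P\<close> and \<open>Q\<close>, however the estimators are coupled, so \<open>\<pi>\<close>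
  can be varied freely and its infimum is \<open>W2sq\<close>.\<close>

lemma opt_distortion_square_le:
  fixes p q :: "real measure"
  assumes p: "prob_space p" "sets p = sets borel" and q: "prob_space q" "sets q = sets borel"
    and fin: "(\<integral>\<^sup>+x. ennreal (x\<^sup>2) \<partial>p) < \<infinity>" "(\<integral>\<^sup>+x. ennreal (x\<^sup>2) \<partial>q) < \<infinity>" and R: "0 \<le> R" "0 \<le> Rc"
    and P: "coupling borel p borel (distr P borel snd) P" and Q: "coupling borel q borel (distr Q borel snd) Q"
    and cP: "cond_mean_eq P" and cQ: "cond_mean_eq Q"
    and IP: "mutual_info borel borel P \<le> ennreal R" and IQ: "mutual_info borel borel Q \<le> ennreal (R + Rc)"
  shows "opt_distortion borel p q (\<lambda>x y. (x - y)\<^sup>2) R Rc \<le>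
    enn2ereal ((\<integral>\<^sup>+z. ennreal ((fst z - snd z)\<^sup>2) \<partial>P) + (\<integral>\<^sup>+z. ennreal ((fst z - snd z)\<^sup>2) \<partial>Q)
      + W2sq (distr P borel snd) (distr Q borel snd))"
  unfolding W2sq_def
proof (rule le_enn2ereal_add_Inf, elim CollectE exE conjE)
  fix s and \<pi> :: "(real \<times> real) measure"
  assume s: "s = (\<integral>\<^sup>+z. ennreal ((fst z - snd z)\<^sup>2) \<partial>\<pi>)" and cpl: "coupling borel (distr P borel snd) borel (distr Q borel snd) \<pi>"
  note sp[measurable_cong] = p(2) and sq[measurable_cong] = q(2)
  note \<pi> = couplingD(1)[OF cpl]
  note s\<pi>[measurable_cong] = couplingD(2)[OF cpl]
  have f1: "fst \<in> measurable \<pi> borel" and s1: "snd \<in> measurable \<pi> borel" by measurable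
  note dP = couplingD(3)[OF cpl, symmetric] and dQ = couplingD(4)[OF cpl, symmetric]
  note R' = add_nonneg_nonneg[OF R]
  obtain f where "channel p (distr P borel snd) f" and "P = density (p \<Otimes>\<^sub>M distr P borel snd) (\<lambda>z. ennreal (f z))"
    and "integrable (p \<Otimes>\<^sub>M distr P borel snd) (\<lambda>z. f z * ln (f z))" and "(\<integral>z. f z * ln (f z) \<partial>(p \<Otimes>\<^sub>M distr P borel snd)) \<le> R"
    using mutual_info_finite_channel[OF couplingD(1,2)[OF P] IP R(1)] unfolding couplingD(3)[OF P] by blast
  note f = this[unfolded dP]
  obtain g where "channel q (distr Q borel snd) g" and "Q = density (q \<Otimes>\<^sub>M distr Q borel snd) (\<lambda>z. ennreal (g z))"
    and "integrable (q \<Otimes>\<^sub>M distr Q borel snd) (\<lambda>z. g z * ln (g z))" and "(\<integral>z. g z * ln (g z) \<partial>(q \<Otimes>\<^sub>M distr Q borel snd)) \<le> R + Rc"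
    using mutual_info_finite_channel[OF couplingD(1,2)[OF Q] IQ R'] unfolding couplingD(3)[OF Q] by blast
  note g = this[unfolded dQ]
  define f' where "f' = (\<lambda>z :: real \<times> real \<times> real. f (fst z, fst (snd z)))"
  define g' where "g' = (\<lambda>z :: real \<times> real \<times> real. g (fst z, snd (snd z)))"
  note F = channel_lift[OF p(1) \<pi> f1 f(1,3) f'_def]
  note G = channel_lift[OF q(1) \<pi> s1 g(1,3) g'_def]
  have pY: "prob_space (distr \<pi> borel fst)" "prob_space (distr \<pi> borel snd)"
    by (rule prob_space.prob_space_distr[OF \<pi> f1], rule prob_space.prob_space_distr[OF \<pi> s1])
  have mf: "AE u in \<pi>. fst u = (\<integral>x. f' (x, u) * x \<partial>p)"
  proof -
    have "AE y in distr \<pi> borel fst. y = (\<integral>x. f (x, y) * x \<partial>p)"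
      using cP f(2) by (intro cond_mean_channel[OF p integrable_of_square(2)[OF p fin(1)] pY(1) _ f(1)]) auto
    then show ?thesis unfolding f'_def fst_conv snd_conv by (rule AE_distrD[OF f1])
  qed
  have mg: "AE u in \<pi>. snd u = (\<integral>y. g' (y, u) * y \<partial>q)"
  proof -
    have "AE y in distr \<pi> borel snd. y = (\<integral>x. g (x, y) * x \<partial>q)"
      using cQ g(2) by (intro cond_mean_channel[OF q integrable_of_square(2)[OF q fin(2)] pY(2) _ g(1)]) auto
    then show ?thesis unfolding g'_def fst_conv snd_conv by (rule AE_distrD[OF s1])
  qed
  have eP: "(\<integral>\<^sup>+u. \<integral>\<^sup>+x. ennreal (f' (x, u)) * ennreal ((x - fst u)\<^sup>2) \<partial>p \<partial>\<pi>) = (\<integral>\<^sup>+z. ennreal ((fst z - snd z)\<^sup>2) \<partial>P)"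
  proof -
    interpret p: prob_space p by (rule p(1))
    note fm = channelD(1)[OF f(1)]
    have [measurable]: "f \<in> borel_measurable (p \<Otimes>\<^sub>M borel)"
      using fm by (simp cong: measurable_cong_sets sets_pair_measure_cong)
    have "(\<integral>\<^sup>+z. ennreal ((fst z - snd z)\<^sup>2) \<partial>P)
      = (\<integral>\<^sup>+u. \<integral>\<^sup>+x. ennreal (f (x, u)) * ennreal ((fst (x, u) - snd (x, u))\<^sup>2) \<partial>p \<partial>distr \<pi> borel fst)"
      by (subst f(2)) (rule nn_integral_density_channel[OF p(1) pY(1) f(1)], measurable)
    also have "\<dots> = (\<integral>\<^sup>+u. \<integral>\<^sup>+x. ennreal (f (x, fst u)) * ennreal ((x - fst u)\<^sup>2) \<partial>p \<partial>\<pi>)"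
      by (subst nn_integral_distr[OF f1]) simp_all
    finally show ?thesis by (simp add: f'_def)
  qed
  have eQ: "(\<integral>\<^sup>+u. \<integral>\<^sup>+y. ennreal (g' (y, u)) * ennreal ((y - snd u)\<^sup>2) \<partial>q \<partial>\<pi>) = (\<integral>\<^sup>+z. ennreal ((fst z - snd z)\<^sup>2) \<partial>Q)"
  proof -
    interpret q: prob_space q by (rule q(1))
    note gm = channelD(1)[OF g(1)]
    have [measurable]: "g \<in> borel_measurable (q \<Otimes>\<^sub>M borel)"
      using gm by (simp cong: measurable_cong_sets sets_pair_measure_cong)
    have "(\<integral>\<^sup>+z. ennreal ((fst z - snd z)\<^sup>2) \<partial>Q)
      = (\<integral>\<^sup>+u. \<integral>\<^sup>+x. ennreal (g (x, u)) * ennreal ((fst (x, u) - snd (x, u))\<^sup>2) \<partial>q \<partial>distr \<pi> borel snd)"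
      by (subst g(2)) (rule nn_integral_density_channel[OF q(1) pY(2) g(1)], measurable)
    also have "\<dots> = (\<integral>\<^sup>+u. \<integral>\<^sup>+x. ennreal (g (x, snd u)) * ennreal ((x - snd u)\<^sup>2) \<partial>q \<partial>\<pi>)"
      by (subst nn_integral_distr[OF s1]) simp_all
    finally show ?thesis by (simp add: g'_def)
  qed
  have \<Delta>m: "(\<lambda>(x, y). (x - y)\<^sup>2 :: real) \<in> borel_measurable (p \<Otimes>\<^sub>M p)" by measurable
  have UI: "unif_integrable p p q (\<lambda>x y. (x - y)\<^sup>2)"
    using unif_integrable_square[OF p q fin] unif_integrable_cong[OF p(2)] by blast
  have qp: "sets q = sets p" using p q by simp
  have "opt_distortion p p q (\<lambda>x y. (x - y)\<^sup>2) R Rc \<le> enn2ereal (avg_distortion p q \<pi> f' g' (\<lambda>x y. (x - y)\<^sup>2))"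
    using f(4) g(4) F(3) G(3) by (intro achievability[OF p(1) q(1) qp \<pi> _ \<Delta>m UI F(1) G(1) F(2) G(2) _ _ R]) auto
  also have "avg_distortion p q \<pi> f' g' (\<lambda>x y. (x - y)\<^sup>2) =
    (\<integral>\<^sup>+z. ennreal ((fst z - snd z)\<^sup>2) \<partial>P) + (\<integral>\<^sup>+z. ennreal ((fst z - snd z)\<^sup>2) \<partial>Q) + s"
    unfolding eP[symmetric] eQ[symmetric] s
    by (rule avg_distortion_square[OF p fin(1) q fin(2) \<pi> F(1) G(1) f1 s1 mf mg])
  finally show "opt_distortion borel p q (\<lambda>x y. (x - y)\<^sup>2) R Rc \<le>
    enn2ereal ((\<integral>\<^sup>+z. ennreal ((fst z - snd z)\<^sup>2) \<partial>P) + (\<integral>\<^sup>+z. ennreal ((fst z - snd z)\<^sup>2) \<partial>Q) + s)"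
    using opt_distortion_cong[of borel p] p(2) by simp
qed

text \<open>By the tower property the conditional mean \<open>m\<close> satisfies
  \<open>E[X | m(U)] = m(U)\<close>, and passing from \<open>U\<close> to \<open>m(U)\<close> cannot
  raise the information.\<close>

lemma channel_estimator:
  fixes p :: "real measure" and f :: "real \<times> 'u \<Rightarrow> real"
  assumes p: "prob_space p" and sp[measurable_cong]: "sets p = sets borel" and i: "integrable p (\<lambda>x. x)"
    and \<nu>: "prob_space \<nu>" and f: "channel p \<nu> f" and fC: "\<And>z. f z \<le> C"
    and m_def: "m = (\<lambda>u. \<integral>x. f (x, u) * x \<partial>p)"
    and P_def: "P = distr (density (p \<Otimes>\<^sub>M \<nu>) (\<lambda>z. ennreal (f z))) (borel \<Otimes>\<^sub>M borel) (\<lambda>z. (fst z, m (snd z)))"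
  shows "distr P borel snd = distr \<nu> borel m" "coupling borel p borel (distr P borel snd) P" "cond_mean_eq P"
    "mutual_info borel borel P \<le> ennreal (\<integral>z. f z * ln (f z) \<partial>(p \<Otimes>\<^sub>M \<nu>))"
    "(\<integral>\<^sup>+z. ennreal ((fst z - snd z)\<^sup>2) \<partial>P) = (\<integral>\<^sup>+u. \<integral>\<^sup>+x. ennreal (f (x, u)) * ennreal ((x - m u)\<^sup>2) \<partial>p \<partial>\<nu>)"
proof -
  note M = channel_mean[OF p sp i \<nu> f m_def]
  note m[measurable] = M(1)
  note [measurable] = channelD(1)[OF f]
  note f0 = channelD(2)[OF f]
  let ?P1 = "density (p \<Otimes>\<^sub>M \<nu>) (\<lambda>z. ennreal (f z))"
  note P1 = channel_marginals[OF p \<nu> f refl refl]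
  interpret P1: prob_space ?P1 by (rule P1(1))
  have H: "(\<lambda>z. (fst z, m (snd z))) \<in> measurable ?P1 (borel \<Otimes>\<^sub>M borel)" by measurable
  note DP = data_processing[OF p \<nu> f fC m sp[symmetric] P_def]
  show d2: "distr P borel snd = distr \<nu> borel m" by (rule DP(2))
  show "mutual_info borel borel P \<le> ennreal (\<integral>z. f z * ln (f z) \<partial>(p \<Otimes>\<^sub>M \<nu>))" by (rule DP(3))
  have PP: "prob_space P" unfolding P_def by (rule P1.prob_space_distr[OF H])
  have sP[measurable_cong]: "sets P = sets (borel \<Otimes>\<^sub>M borel)" by (simp add: P_def)
  show "coupling borel p borel (distr P borel snd) P"
    unfolding coupling_def using PP sP DP(1) by simp
  show "(\<integral>\<^sup>+z. ennreal ((fst z - snd z)\<^sup>2) \<partial>P) = (\<integral>\<^sup>+u. \<integral>\<^sup>+x. ennreal (f (x, u)) * ennreal ((x - m u)\<^sup>2) \<partial>p \<partial>\<nu>)"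
  proof -
    have "(\<integral>\<^sup>+z. ennreal ((fst z - snd z)\<^sup>2) \<partial>P) = (\<integral>\<^sup>+z. ennreal ((fst z - m (snd z))\<^sup>2) \<partial>?P1)"
      unfolding P_def by (subst nn_integral_distr[OF H]) auto
    also have "\<dots> = (\<integral>\<^sup>+u. \<integral>\<^sup>+x. ennreal (f (x, u)) * ennreal ((fst (x, u) - m (snd (x, u)))\<^sup>2) \<partial>p \<partial>\<nu>)"
      by (rule nn_integral_density_channel[OF p \<nu> f]) measurable
    finally show ?thesis by simp
  qed
  have fi1: "integrable ?P1 fst" using M(3) f0 by (subst integrable_density) auto
  then have fP: "integrable P fst" unfolding P_def by (subst integrable_distr_eq[OF H]) auto
  have sm: "snd \<in> measurable P borel" by measurable
  have "AE z in P. real_cond_exp P (vimage_algebra (space P) snd borel) fst z = (\<lambda>y. y) (snd z)"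
  proof (rule real_cond_exp_vimage[OF PP sm fP])
    have "integrable (distr \<nu> borel m) (\<lambda>y. y)" using M(2) by (subst integrable_distr_eq[OF m]) auto
    then show "integrable P (\<lambda>z. snd z)" unfolding d2[symmetric] by (subst (asm) integrable_distr_eq[OF sm]) auto
    fix B :: "real set" assume B[measurable]: "B \<in> sets borel"
    \<comment> \<open>An event about \<open>m u\<close> is an event about \<open>u\<close>, on which
      the integrals of the source and of \<open>m\<close> agree.\<close>
    define C where "C = m -` B \<inter> space \<nu>"
    have C: "C \<in> sets \<nu>" unfolding C_def by measurable
    have "(\<integral>z. indicator B (snd z) * fst z \<partial>P) = (\<integral>z. indicator B (m (snd z)) * fst z \<partial>?P1)"
      unfolding P_def by (subst integral_distr[OF H]) auto
    also have "\<dots> = (\<integral>z. f z * (indicator B (m (snd z)) * fst z) \<partial>(p \<Otimes>\<^sub>M \<nu>))"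
      using f0 by (subst integral_density) auto
    also have "\<dots> = (\<integral>z. indicator C (snd z) * (f z * fst z) \<partial>(p \<Otimes>\<^sub>M \<nu>))"
      by (intro Bochner_Integration.integral_cong) (auto simp: C_def indicator_def space_pair_measure)
    also have "\<dots> = (\<integral>u. indicator C u * m u \<partial>\<nu>)" by (rule M(4)[OF C])
    also have "\<dots> = (\<integral>u. indicator B (m u) * m u \<partial>\<nu>)"
      by (intro Bochner_Integration.integral_cong) (auto simp: C_def indicator_def)
    also have "\<dots> = (\<integral>y. indicator B y * y \<partial>distr \<nu> borel m)" by (subst integral_distr[OF m]) auto
    also have "\<dots> = (\<integral>z. indicator B (snd z) * snd z \<partial>P)" unfolding d2[symmetric] by (subst integral_distr[OF sm]) auto
    finally show "(\<integral>z. indicator B (snd z) * fst z \<partial>P) = (\<integral>z. indicator B (snd z) * snd z \<partial>P)" .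
  qed simp
  then show "cond_mean_eq P" using fP by (simp add: cond_mean_eq_def)
qed

text \<open>The joint law of the two conditional means is one coupling of their marginals, so the
  third term of the split is at least \<open>W2sq\<close>. The auxiliary variable of the converse is
  placed in \<open>nat\<close>.\<close>

lemma achievable_square_estimators:
  fixes p q :: "real measure"
  assumes p: "prob_space p" "sets p = sets borel" and q: "prob_space q" "sets q = sets borel"
    and fin: "(\<integral>\<^sup>+x. ennreal (x\<^sup>2) \<partial>p) < \<infinity>" "(\<integral>\<^sup>+x. ennreal (x\<^sup>2) \<partial>q) < \<infinity>"
    and ach: "achievable p p q (\<lambda>x y. (x - y)\<^sup>2) R Rc d"
  shows "\<exists>P Q. coupling borel p borel (distr P borel snd) P \<and> coupling borel q borel (distr Q borel snd) Q \<and>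
    cond_mean_eq P \<and> cond_mean_eq Q \<and>
    mutual_info borel borel P \<le> ennreal R \<and> mutual_info borel borel Q \<le> ennreal (R + Rc) \<and>
    enn2ereal ((\<integral>\<^sup>+z. ennreal ((fst z - snd z)\<^sup>2) \<partial>P) + (\<integral>\<^sup>+z. ennreal ((fst z - snd z)\<^sup>2) \<partial>Q)
      + W2sq (distr P borel snd) (distr Q borel snd)) \<le> ereal d"
proof -
  note sp[measurable_cong] = p(2) and sq[measurable_cong] = q(2)
  have qp: "sets q = sets p" using p q by simp
  have \<Delta>m: "(\<lambda>(x, y). (x - y)\<^sup>2 :: real) \<in> borel_measurable (p \<Otimes>\<^sub>M p)" by measurable
  obtain \<nu> :: "nat measure" and f g C where \<nu>: "prob_space \<nu>" and f: "channel p \<nu> f" and g: "channel q \<nu> g"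
    and fC: "\<And>z. f z \<le> C" and gC: "\<And>z. g z \<le> C"
    and fR: "(\<integral>z. f z * ln (f z) \<partial>(p \<Otimes>\<^sub>M \<nu>)) \<le> R" and gR: "(\<integral>z. g z * ln (g z) \<partial>(q \<Otimes>\<^sub>M \<nu>)) \<le> R + Rc"
    and d: "enn2ereal (avg_distortion p q \<nu> f g (\<lambda>x y. (x - y)\<^sup>2)) \<le> ereal d"
    using code_converse[OF infinite_UNIV_nat p(1) q(1) qp \<Delta>m ach] by blast
  define m where "m = (\<lambda>u. \<integral>x. f (x, u) * x \<partial>p)"
  define m' where "m' = (\<lambda>u. \<integral>x. g (x, u) * x \<partial>q)"
  define P where "P = distr (density (p \<Otimes>\<^sub>M \<nu>) (\<lambda>z. ennreal (f z))) (borel \<Otimes>\<^sub>M borel) (\<lambda>z. (fst z, m (snd z)))"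
  define Q where "Q = distr (density (q \<Otimes>\<^sub>M \<nu>) (\<lambda>z. ennreal (g z))) (borel \<Otimes>\<^sub>M borel) (\<lambda>z. (fst z, m' (snd z)))"
  note i = integrable_of_square(2)[OF p fin(1)] integrable_of_square(2)[OF q fin(2)]
  note P = channel_estimator[OF p i(1) \<nu> f fC m_def P_def]
  note Q = channel_estimator[OF q i(2) \<nu> g gC m'_def Q_def]
  have m: "m \<in> borel_measurable \<nu>" by (rule channel_mean(1)[OF p i(1) \<nu> f m_def])
  have m': "m' \<in> borel_measurable \<nu>" by (rule channel_mean(1)[OF q i(2) \<nu> g m'_def])
  define \<pi> where "\<pi> = distr \<nu> (borel \<Otimes>\<^sub>M borel) (\<lambda>u. (m u, m' u))"
  have h: "(\<lambda>u. (m u, m' u)) \<in> measurable \<nu> (borel \<Otimes>\<^sub>M borel)" using m m' by measurable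
  have "coupling borel (distr P borel snd) borel (distr Q borel snd) \<pi>"
    unfolding coupling_def P(1) Q(1) \<pi>_def
    using h by (auto simp: distr_distr comp_def intro: prob_space.prob_space_distr[OF \<nu>])
  then have "W2sq (distr P borel snd) (distr Q borel snd) \<le> (\<integral>\<^sup>+z. ennreal ((fst z - snd z)\<^sup>2) \<partial>\<pi>)"
    unfolding W2sq_def by (intro Inf_lower) blast
  also have "\<dots> = (\<integral>\<^sup>+u. ennreal ((m u - m' u)\<^sup>2) \<partial>\<nu>)"
    unfolding \<pi>_def by (subst nn_integral_distr[OF h]) auto
  finally have W: "W2sq (distr P borel snd) (distr Q borel snd) \<le> (\<integral>\<^sup>+u. ennreal ((m u - m' u)\<^sup>2) \<partial>\<nu>)" .
  have "avg_distortion p q \<nu> f g (\<lambda>x y. (x - y)\<^sup>2) =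
    (\<integral>\<^sup>+z. ennreal ((fst z - snd z)\<^sup>2) \<partial>P) + (\<integral>\<^sup>+z. ennreal ((fst z - snd z)\<^sup>2) \<partial>Q) + (\<integral>\<^sup>+u. ennreal ((m u - m' u)\<^sup>2) \<partial>\<nu>)"
    unfolding P(5) Q(5)
    by (rule avg_distortion_square[OF p fin(1) q fin(2) \<nu> f g m m']) (simp_all add: m_def m'_def)
  then have "(\<integral>\<^sup>+z. ennreal ((fst z - snd z)\<^sup>2) \<partial>P) + (\<integral>\<^sup>+z. ennreal ((fst z - snd z)\<^sup>2) \<partial>Q)
      + W2sq (distr P borel snd) (distr Q borel snd) \<le> avg_distortion p q \<nu> f g (\<lambda>x y. (x - y)\<^sup>2)"
    using W by (simp add: add_left_mono)
  then have "enn2ereal ((\<integral>\<^sup>+z. ennreal ((fst z - snd z)\<^sup>2) \<partial>P) + (\<integral>\<^sup>+z. ennreal ((fst z - snd z)\<^sup>2) \<partial>Q)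
      + W2sq (distr P borel snd) (distr Q borel snd)) \<le> ereal d"
    using d unfolding less_eq_ennreal.rep_eq by (rule order_trans)
  moreover have "mutual_info borel borel P \<le> ennreal R" "mutual_info borel borel Q \<le> ennreal (R + Rc)"
    using P(4) Q(4) fR gR by (meson ennreal_leI order_trans)+
  ultimately show ?thesis using P(2,3) Q(2,3) by blast
qed

lemma opt_distortion_square:
  fixes p q :: "real measure"
  assumes p: "prob_space p" "sets p = sets borel" and q: "prob_space q" "sets q = sets borel"
    and fin: "(\<integral>\<^sup>+x. ennreal (x\<^sup>2) \<partial>p) < \<infinity>" "(\<integral>\<^sup>+x. ennreal (x\<^sup>2) \<partial>q) < \<infinity>" and R: "0 \<le> R" "0 \<le> Rc"
  shows "opt_distortion borel p q (\<lambda>x y. (x - y)\<^sup>2) R Rc =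
        Inf {enn2ereal ((\<integral>\<^sup>+ z. ennreal ((fst z - snd z)\<^sup>2) \<partial>P) + (\<integral>\<^sup>+ z. ennreal ((fst z - snd z)\<^sup>2) \<partial>Q)
                         + W2sq (distr P borel snd) (distr Q borel snd)) | P Q.
              coupling borel p borel (distr P borel snd) P \<and>
              coupling borel q borel (distr Q borel snd) Q \<and>
              cond_mean_eq P \<and> cond_mean_eq Q \<and>
              mutual_info borel borel P \<le> ennreal R \<and>
              mutual_info borel borel Q \<le> ennreal (R + Rc)}"
    (is "_ = Inf ?S")
proof (rule antisym)
  show "opt_distortion borel p q (\<lambda>x y. (x - y)\<^sup>2) R Rc \<le> Inf ?S"
  proof (rule Inf_greatest)
    fix v assume "v \<in> ?S"
    then show "opt_distortion borel p q (\<lambda>x y. (x - y)\<^sup>2) R Rc \<le> v"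
      using opt_distortion_square_le[OF p q fin R] by blast
  qed
  have "opt_distortion borel p q (\<lambda>x y. (x - y)\<^sup>2) R Rc = opt_distortion p p q (\<lambda>x y. (x - y)\<^sup>2) R Rc"
    by (rule opt_distortion_cong) (simp add: p(2))
  moreover have "Inf ?S \<le> opt_distortion p p q (\<lambda>x y. (x - y)\<^sup>2) R Rc"
    unfolding opt_distortion_def
  proof (rule Inf_greatest, safe)
    fix d assume "achievable p p q (\<lambda>x y. (x - y)\<^sup>2) R Rc d"
    from achievable_square_estimators[OF p q fin this] obtain P Q where
      PQ: "coupling borel p borel (distr P borel snd) P" "coupling borel q borel (distr Q borel snd) Q"
        "cond_mean_eq P" "cond_mean_eq Q" "mutual_info borel borel P \<le> ennreal R" "mutual_info borel borel Q \<le> ennreal (R + Rc)"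
      and le: "enn2ereal ((\<integral>\<^sup>+z. ennreal ((fst z - snd z)\<^sup>2) \<partial>P) + (\<integral>\<^sup>+z. ennreal ((fst z - snd z)\<^sup>2) \<partial>Q)
        + W2sq (distr P borel snd) (distr Q borel snd)) \<le> ereal d" by blast
    show "Inf ?S \<le> ereal d"
      by (rule Inf_lower2[OF _ le], rule CollectI, rule exI[of _ P], rule exI[of _ Q], intro conjI refl PQ)
  qed
  ultimately show "Inf ?S \<le> opt_distortion borel p q (\<lambda>x y. (x - y)\<^sup>2) R Rc" by simp
qed

theorem theorem1:
  fixes TYPE_U :: "'u itself"
  assumes "infinite (UNIV :: 'u set)"
  shows
  "(\<forall>(M :: 'a measure) pX pXh (\<Delta> :: 'a \<Rightarrow> 'a \<Rightarrow> real) R Rc.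
      prob_space pX \<and> sets pX = sets M \<and> prob_space pXh \<and> sets pXh = sets M \<and>
      (\<forall>x y. 0 \<le> \<Delta> x y) \<and> (\<lambda>(x, y). \<Delta> x y) \<in> borel_measurable (M \<Otimes>\<^sub>M M) \<and>
      0 \<le> R \<and> 0 \<le> Rc \<and> unif_integrable M pX pXh \<Delta> \<longrightarrow>
      opt_distortion M pX pXh \<Delta> R Rc =
        Inf {enn2ereal (\<integral>\<^sup>+ z. ennreal (\<Delta> (fst z) (snd (snd z))) \<partial>P) | (SU :: 'u measure) P.
              P \<in> Omega M SU pX pXh \<and>
              mutual_info M SU (distr P (M \<Otimes>\<^sub>M SU) (\<lambda>z. (fst z, fst (snd z)))) \<le> ennreal R \<and>
              mutual_info M SU (distr P (M \<Otimes>\<^sub>M SU) (\<lambda>z. (snd (snd z), fst (snd z)))) \<le> ennreal (R + Rc)})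
   \<and>
   (\<forall>(pX :: real measure) pXh R Rc.
      prob_space pX \<and> sets pX = sets borel \<and> prob_space pXh \<and> sets pXh = sets borel \<and>
      (\<integral>\<^sup>+ x. ennreal (x\<^sup>2) \<partial>pX) < \<infinity> \<and> (\<integral>\<^sup>+ x. ennreal (x\<^sup>2) \<partial>pXh) < \<infinity> \<and>
      0 \<le> R \<and> 0 \<le> Rc \<longrightarrow>
      opt_distortion borel pX pXh (\<lambda>x xh. (x - xh)\<^sup>2) R Rc =
        Inf {enn2ereal ((\<integral>\<^sup>+ z. ennreal ((fst z - snd z)\<^sup>2) \<partial>P) + (\<integral>\<^sup>+ z. ennreal ((fst z - snd z)\<^sup>2) \<partial>Q)
                         + W2sq (distr P borel snd) (distr Q borel snd)) | P Q.
              coupling borel pX borel (distr P borel snd) P \<and>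
              coupling borel pXh borel (distr Q borel snd) Q \<and>
              cond_mean_eq P \<and> cond_mean_eq Q \<and>
              mutual_info borel borel P \<le> ennreal R \<and>
              mutual_info borel borel Q \<le> ennreal (R + Rc)})"
proof (intro conjI allI impI; elim conjE)
  fix M :: "'a measure" and pX pXh and \<Delta> :: "'a \<Rightarrow> 'a \<Rightarrow> real" and R Rc :: real
  assume "prob_space pX" "sets pX = sets M" "prob_space pXh" "sets pXh = sets M"
    and "\<forall>x y. 0 \<le> \<Delta> x y" and "(\<lambda>(x, y). \<Delta> x y) \<in> borel_measurable (M \<Otimes>\<^sub>M M)"
    and "0 \<le> R" "0 \<le> Rc" and "unif_integrable M pX pXh \<Delta>"
  then show "opt_distortion M pX pXh \<Delta> R Rc =
        Inf {enn2ereal (\<integral>\<^sup>+ z. ennreal (\<Delta> (fst z) (snd (snd z))) \<partial>P) | (SU :: 'u measure) P.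
              P \<in> Omega M SU pX pXh \<and>
              mutual_info M SU (distr P (M \<Otimes>\<^sub>M SU) (\<lambda>z. (fst z, fst (snd z)))) \<le> ennreal R \<and>
              mutual_info M SU (distr P (M \<Otimes>\<^sub>M SU) (\<lambda>z. (snd (snd z), fst (snd z)))) \<le> ennreal (R + Rc)}"
    by (intro opt_distortion_Omega[OF assms]) simp_all
qed (rule opt_distortion_square)

end
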